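(* Let $H$ be a finite-dimensional Hopf algebra over a field $\Bbbk$, $(M,\psi)$ an involutive Hopf bimodule over $H$, and $\Gamma,\Delta$ two Kitaev graphs (in $\mathcal{RK}$) with distinguished cilia $c_\Gamma$, $c_\Delta$. Let $X_c,Y_d\in\mathsf{Mod}_H^H$ for each $c\in C_\Gamma$, $d\in C_\Delta$. Then the canonical maps $\varkappa$ and $\nu$ (see context) induce an embedding and a projection $$\tilde\varkappa:\mathrm{Bit}_{\mathbb H_\Gamma}^{\mathbb H_\Gamma}(\mathbb X_\Gamma,\mathbb M_\Gamma)\otimes\mathrm{Bit}_{\mathbb H_\Delta}^{\mathbb H_\Delta}(\mathbb Y_\Delta,\mathbb M_\Delta)\hookrightarrow\mathrm{Aux},\qquad\tilde\nu:\mathrm{Bit}_{\mathbb H_{\Gamma\#\Delta}}^{\mathbb H_{\Gamma\#\Delta}}(\mathbb X_\Gamma\#\mathbb Y_\Delta,\mathbb M_{\Gamma\#\Delta})\twoheadrightarrow\mathrm{Aux},$$ and for any linear section $\tilde s$ of $\tilde\nu$ the maps $f=\tilde s\tilde\varkappa$ and $g(w)=\big(w-\tilde s\tilde\nu(w),\ [\tilde\nu(w)]\big)$ form a short exact sequence $$0\to\mathrm{Bit}_{\mathbb H_\Gamma}^{\mathbb H_\Gamma}(\mathbb X_\Gamma,\mathbb M_\Gamma)\otimes\mathrm{Bit}_{\mathbb H_\Delta}^{\mathbb H_\Delta}(\mathbb Y_\Delta,\mathbb M_\Delta)\xrightarrow{f}\mathrm{Bit}_{\mathbb H_{\Gamma\#\Delta}}^{\mathbb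 H_{\Gamma\#\Delta}}(\mathbb X_\Gamma\#\mathbb Y_\Delta,\mathbb M_{\Gamma\#\Delta})\xrightarrow{g}\mathrm{CBit}\to0,$$ where $\mathrm{CBit}=\ker\tilde\nu\oplus\mathrm{coker}\,\tilde\varkappa$ and $[\cdot]$ is the class in $\mathrm{coker}\,\tilde\varkappa$; moreover $\tilde\nu f=\tilde\varkappa$, the restriction of $g$ to $\ker\tilde\nu$ is the inclusion of the first summand, and the composite of $g$ with the projection to $\mathrm{coker}\,\tilde\varkappa$ is $\tilde\nu$ followed by the quotient map. In particular, there is an isomorphism of vector spaces $$\mathrm{Bit}_{\mathbb H_{\Gamma\#\Delta}}^{\mathbb H_{\Gamma\#\Delta}}(\mathbb X_\Gamma\#\mathbb Y_\Delta,\mathbb M_{\Gamma\#\Delta})\cong\Big(\mathrm{Bit}_{\mathbb H_\Gamma}^{\mathbb H_\Gamma}(\mathbb X_\Gamma,\mathbb M_\Gamma)\otimes\mathrm{Bit}_{\mathbb H_\Delta}^{\mathbb H_\Delta}(\mathbb Y_\Delta,\mathbb M_\Delta)\Big)\oplus\mathrm{CBit}.$$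
   Context: **Hopf algebra notation.** $\otimes=\otimes_\Bbbk$; $S$ antipode; Sweedler notation $h_{(1)}\otimes h_{(2)}$. **Involutive Hopf bimodules.** An $H$-bimodule and $H$-bicomodule $M$ (coactions $m_{[-1]}\otimes m_{[0]}$, $m_{[0]}\otimes m_{[1]}$) with $$(h\triangleright m\triangleleft g)_{[-1]}\otimes(h\triangleright m\triangleleft g)_{[0]}\otimes(h\triangleright m\triangleleft g)_{[1]}=h_{(1)}m_{[-1]}g_{(1)}\otimes h_{(2)}\triangleright m_{[0]}\triangleleft g_{(2)}\otimes h_{(3)}m_{[1]}S^{-2}(g_{(3)}),$$ together with a linear involution $\psi:M\to M$ with $\psi(h\triangleright m)=\psi(m)\triangleleft S(h)$ and $\psi(m)_{[-1]}\otimes\psi(m)_{[0]}=S(m_{[1]})\otimes\psi(m_{[0]})$. **Kitaev graphs.** A ribbon graph $(\Gamma,\iota,\rho)$ is a finite set $\Gamma$ of half-edges with a fixed-point free involution $\iota$ and a permutation $\rho$. Vertices $V_\Gamma$, edges $E_\Gamma$, faces $F_\Gamma$ are the cycles (including those of length one) of $\rho$, $\iota$, $\rho^{-1}\iota$; $v_h,e_h,f_h$ are the ones containing $h\in\Gamma$. It is connected if $\langle\iota,\rho\rangle$ acts transitively. A Kitaev graph is a connected ribbon graph with a subset $C_\Gamma\subset\Gamma$ of cilia such that $C_\Gamma\to V_\Gamma$, $c\mapsto v_c$, and $C_\Gamma\to F_\Gamma$, $c\mapsto f_{\rho^{-1}(c)}$, are bijective, a distinguished cilium in $C_\Gamma$,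 and a total order on $\Gamma$ such that for $e_h\ne e_k$: $h<k$ iff $\iota(h)<\iota(k)$. The source of an edge $\{h,\iota(h)\}$ is $s=\min\{h,\iota(h)\}$, its target is $\iota(s)$. Edges are ordered by their sources, cilia by the order of $\Gamma$. $\mathcal{RK}$ denotes the set of Kitaev graphs whose half-edges form a finite subset of $\mathbb N=\{1,2,\dots\}$ stable under $\kappa_\infty=(1\,2)(3\,4)\cdots$, with $\iota$ the restriction of $\kappa_\infty$ and order inherited from $\mathbb N$ (every Kitaev graph is isomorphic to one of these). **Extended Hilbert space.** $\mathbb M_\Gamma=\bigotimes_{e\in E_\Gamma}M_e$, $M_e=M$. For a half-edge $h$, $a\in H$, $\alpha\in H^*$, the operators $L_h(a),T_h(\alpha)$ on $\mathbb M_\Gamma$ are the identity on all factors except $M_{e_h}$, where $L_h(a)m=a\triangleright m$ if $h$ is a target, $L_h(a)m=m\triangleleft S(a)$ if $h$ is a source; $T_h(\alpha)m=\alpha(m_{[-1]})m_{[0]}$ if $h$ is a source, $T_h(\alpha)m=\alpha(S(m_{[1]}))m_{[0]}$ if $h$ is a target. For a cilium $c$ let $v_c=[h_1,\dots,h_i]$ with $h_1=c$, $h_{r+1}=\rho(h_r)$, and $f_{\rho^{-1}(c)}=[k_1,\dots,k_j]$ with $k_1=\rho^{-1}(c)$, $k_{r+1}=\rho^{-1}\iota(k_r)$. The vertex action of $H_c=H$ is $a\bullet_cm=L_{h_i}(a_{(i)})\cdots L_{h_1}(a_{(1)})m$; the face coaction $\delta_c$ of $H_c$ is determined by $(\alpha\otimes\mathrm{id})\delta_c(m)=T_{k_j}(\alpha_{(1)})\cdots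 T_{k_1}(\alpha_{(j)})m$ for $\alpha\in H^*$. These (co)actions commute for different cilia and turn $\mathbb M_\Gamma$ into a left-left Yetter--Drinfeld module over $\mathbb H_\Gamma=\bigotimes_{c\in C_\Gamma}H_c$. **Connected sum.** For Kitaev graphs $\Gamma,\Delta$ (with half-edge sets made disjoint) $\Gamma\#\Delta$ has half-edges $\Gamma\sqcup\Delta$ (elements of $\Gamma$ preceding those of $\Delta$), involution $\iota_\Gamma\sqcup\iota_\Delta$, cilia $C_\Gamma\sqcup(C_\Delta\setminus\{c_\Delta\})$, distinguished cilium $c_\Gamma$, and vertex permutation equal to $\rho_\Gamma\sqcup\rho_\Delta$ except that $\rho_\Gamma^{-1}(c_\Gamma)\mapsto c_\Delta$ and $\rho_\Delta^{-1}(c_\Delta)\mapsto c_\Gamma$. We identify $C_{\Gamma\#\Delta}$ with $C_\Gamma\cup C_\Delta$ where $c_\Gamma=c_\Delta=:c_0$. As vector spaces $\mathbb M_{\Gamma\#\Delta}=\mathbb M_\Gamma\otimes\mathbb M_\Delta$. **Bitensor products.** $\mathsf{Mod}_A^C$ (resp. ${}_A^C\mathsf{Mod}$) is the category of right modules over an algebra $A$ that are also right comodules over a coalgebra $C$ (resp. left-left), with no compatibility. For $X\in\mathsf{Mod}_A^C$, $N\in{}_A^C\mathsf{Mod}$ let $\iota_{X,N}:X\square_CN\hookrightarrow X\otimes N$ be the inclusion of the cotensor product and $\pi_{X,N}:X\otimes N\to X\otimes_AN$ the projection; $\mathrm{Bit}_A^C(X,N):=\mathrm{im}(\pi_{X,N}\iota_{X,N})$.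 **Coefficients.** $\mathbb X_\Gamma=\bigotimes_{c\in C_\Gamma}X_c$ and $\mathbb Y_\Delta=\bigotimes_{d\in C_\Delta}Y_d$ are right-right modules-comodules over $\mathbb H_\Gamma$, $\mathbb H_\Delta$ factorwise. $\mathbb X_\Gamma\#\mathbb Y_\Delta$ is $\mathbb X_\Gamma\otimes\mathbb Y_\Delta$ with $H_c$ (co)acting only on $X_c$ for $c\in C_\Gamma\setminus\{c_0\}$, only on $Y_c$ for $c\in C_\Delta\setminus\{c_0\}$, and on $X_{c_0}\otimes Y_{c_0}$ at $c_0$ diagonally (the tensor product of right modules and of right comodules). **$\mathrm{Aux}$, $\varkappa$, $\nu$.** Let $P=\mathrm{Bit}_{\mathbb H'}^{\mathbb H'}(\bigotimes_{c\ne c_\Gamma}X_c,\mathbb M_\Gamma)$ with $\mathbb H'=\bigotimes_{c\in C_\Gamma\setminus\{c_\Gamma\}}H_c$, which inherits a left-left $H$-Yetter--Drinfeld structure from the (co)action at $c_\Gamma$ on $\mathbb M_\Gamma$ ($P=\mathbb M_\Gamma$ if $C_\Gamma=\{c_\Gamma\}$); define $Q$ analogously from $\Delta$ and $(Y_d)_{d\ne c_\Delta}$. Permuting tensor factors yields identifications $$\mathrm{Bit}_{\mathbb H_\Gamma}^{\mathbb H_\Gamma}(\mathbb X_\Gamma,\mathbb M_\Gamma)\cong\mathrm{Bit}_H^H(X_{c_\Gamma},P),\quad\mathrm{Bit}_{\mathbb H_\Delta}^{\mathbb H_\Delta}(\mathbb Y_\Delta,\mathbb M_\Delta)\cong\mathrm{Bit}_H^H(Y_{c_\Delta},Q),$$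 $$\mathrm{Bit}_{\mathbb H_{\Gamma\#\Delta}}^{\mathbb H_{\Gamma\#\Delta}}(\mathbb X_\Gamma\#\mathbb Y_\Delta,\mathbb M_{\Gamma\#\Delta})\cong\mathrm{Bit}_H^H(X_{c_\Gamma}\otimes Y_{c_\Delta},P\otimes Q)$$ (diagonal actions and coactions on tensor products in the last one). Set $\mathrm{Aux}=\mathrm{Aux}_H^H(\mathbb X_\Gamma\#\mathbb Y_\Delta,\mathbb M_{\Gamma\#\Delta}):=\mathrm{Bit}_{H\otimes H}^H(X_{c_\Gamma}\otimes Y_{c_\Delta},P\otimes Q)$, with factorwise $H\otimes H$-actions and codiagonal $H$-coactions. The canonical maps are $$\varkappa:\mathrm{Bit}_H^H(X_{c_\Gamma},P)\otimes\mathrm{Bit}_H^H(Y_{c_\Delta},Q)\to\mathrm{Aux},\ (x\otimes_Hp)\otimes(y\otimes_Hq)\mapsto(x\otimes y)\otimes_{H\otimes H}(p\otimes q),$$ $$\nu:\mathrm{Bit}_H^H(X_{c_\Gamma}\otimes Y_{c_\Delta},P\otimes Q)\to\mathrm{Aux},\ (x\otimes y)\otimes_H(p\otimes q)\mapsto(x\otimes y)\otimes_{H\otimes H}(p\otimes q).$$ The map $\tilde\varkappa$ is the composite of the isomorphism $\mathrm{Bit}_{\mathbb H_\Gamma}^{\mathbb H_\Gamma}(\mathbb X_\Gamma,\mathbb M_\Gamma)\otimes\mathrm{Bit}_{\mathbb H_\Delta}^{\mathbb H_\Delta}(\mathbb Y_\Delta,\mathbb M_\Delta)\cong\mathrm{Bit}_H^H(X_{c_\Gamma},P)\otimes\mathrm{Bit}_H^H(Y_{c_\Delta},Q)$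 given by permuting tensor factors with $\varkappa$, and $\tilde\nu$ is the composite of the isomorphism $\mathrm{Bit}_{\mathbb H_{\Gamma\#\Delta}}^{\mathbb H_{\Gamma\#\Delta}}(\mathbb X_\Gamma\#\mathbb Y_\Delta,\mathbb M_{\Gamma\#\Delta})\cong\mathrm{Bit}_H^H(X_{c_\Gamma}\otimes Y_{c_\Delta},P\otimes Q)$ given by permuting tensor factors with $\nu$; $\mathrm{CBit}=\mathrm{CBit}_H^H(\mathbb X_\Gamma\#\mathbb Y_\Delta,\mathbb M_{\Gamma\#\Delta})$ is the space $\ker\nu\oplus\mathrm{coker}\,\varkappa$ transported via these two isomorphisms, i.e. $\ker\tilde\nu\oplus\mathrm{coker}\,\tilde\varkappa$.
   Formalization: The identifications of the bitensor products with Bit over H given by permuting tensor factors can fail (e.g. over F_2[Z/2]); their existence is assumed for all claims on the tilde maps, the exact sequence and the splitting, while κ injective and ν surjective are proved without it. *)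

theory Defs
  imports
    "Jordan_Normal_Form.Missing_VectorSpace"
    "HOL-Algebra.AbelCoset"
    "HOL-Combinatorics.Orbits"
    "HOL-Combinatorics.Cycles"
begin

section \<open>Linear algebra over a field\<close>

text \<open>Vector spaces are \<^typ>\<open>('k, 'v) module\<close> records over a field record \<open>K\<close>, with the
  predicates \<^term>\<open>vectorspace\<close> and \<^term>\<open>linear_map\<close>. The multiplicative fields of the records
  are meaningful only for algebras.\<close>

definition quot_space :: "('k, 'v) module \<Rightarrow> 'v set \<Rightarrow> ('k, 'v set) module" where
  "quot_space V U =
     \<lparr>carrier = a_rcosets\<^bsub>V\<^esub> U, monoid.mult = (\<lambda>_ _. U), one = U, zero = U, add = set_add V,
      smult = (\<lambda>a C. \<Union>x\<in>C. U +>\<^bsub>V\<^esub> (a \<odot>\<^bsub>V\<^esub> x))\<rparr>"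

definition ker_space :: "('k, 'v) module \<Rightarrow> ('k, 'w) module \<Rightarrow> ('v \<Rightarrow> 'w) \<Rightarrow> ('k, 'v) module" where
  "ker_space V W f = V\<lparr>carrier := {v \<in> carrier V. f v = \<zero>\<^bsub>W\<^esub>}\<rparr>"

definition coker_space :: "('k, 'v) module \<Rightarrow> ('k, 'w) module \<Rightarrow> ('v \<Rightarrow> 'w) \<Rightarrow> ('k, 'w set) module" where
  "coker_space V W f = quot_space W (f ` carrier V)"

definition linear_embedding ::
  "'k ring \<Rightarrow> ('k, 'v) module \<Rightarrow> ('k, 'w) module \<Rightarrow> ('v \<Rightarrow> 'w) \<Rightarrow> bool" where
  "linear_embedding K V W f \<longleftrightarrow> linear_map K V W f \<and> inj_on f (carrier V)"

definition linear_projection ::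
  "'k ring \<Rightarrow> ('k, 'v) module \<Rightarrow> ('k, 'w) module \<Rightarrow> ('v \<Rightarrow> 'w) \<Rightarrow> bool" where
  "linear_projection K V W f \<longleftrightarrow> linear_map K V W f \<and> f ` carrier V = carrier W"

definition linear_iso ::
  "'k ring \<Rightarrow> ('k, 'v) module \<Rightarrow> ('k, 'w) module \<Rightarrow> ('v \<Rightarrow> 'w) \<Rightarrow> bool" where
  "linear_iso K V W f \<longleftrightarrow> linear_map K V W f \<and> bij_betw f (carrier V) (carrier W)"

definition linear_section ::
  "'k ring \<Rightarrow> ('k, 'v) module \<Rightarrow> ('k, 'w) module \<Rightarrow> ('v \<Rightarrow> 'w) \<Rightarrow> ('w \<Rightarrow> 'v) \<Rightarrow> bool" where
  "linear_section K V W f s \<longleftrightarrow> linear_map K W V s \<and> (\<forall>w\<in>carrier W. f (s w) = w)"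

definition short_exact ::
  "'k ring \<Rightarrow> ('k, 'u) module \<Rightarrow> ('k, 'v) module \<Rightarrow> ('k, 'w) module
     \<Rightarrow> ('u \<Rightarrow> 'v) \<Rightarrow> ('v \<Rightarrow> 'w) \<Rightarrow> bool" where
  "short_exact K U V W f g \<longleftrightarrow>
     linear_embedding K U V f \<and> linear_projection K V W g \<and>
     f ` carrier U = {v \<in> carrier V. g v = \<zero>\<^bsub>W\<^esub>}"

definition scalar_space :: "'k ring \<Rightarrow> ('k, 'k) module" where
  "scalar_space K =
     \<lparr>carrier = carrier K, monoid.mult = monoid.mult K, one = one K, zero = zero K, add = add K, smult = monoid.mult K\<rparr>"

section \<open>Tensor products\<close>

subsection \<open>Free vector spaces\<close>

definition free_space :: "'k ring \<Rightarrow> 'z set \<Rightarrow> ('k, 'z \<Rightarrow> 'k) module" where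
  "free_space K S =
     (ring.func_space K S)
       \<lparr>carrier := {f \<in> S \<rightarrow>\<^sub>E carrier K. finite {s \<in> S. f s \<noteq> \<zero>\<^bsub>K\<^esub>}}\<rparr>"

definition free_gen :: "'k ring \<Rightarrow> 'z set \<Rightarrow> 'z \<Rightarrow> ('z \<Rightarrow> 'k)" where
  "free_gen K S s = (\<lambda>t\<in>S. if t = s then \<one>\<^bsub>K\<^esub> else \<zero>\<^bsub>K\<^esub>)"

definition free_extend :: "'k ring \<Rightarrow> 'z set \<Rightarrow> ('k, 'w) module \<Rightarrow> ('z \<Rightarrow> 'w) \<Rightarrow> ('z \<Rightarrow> 'k) \<Rightarrow> 'w" where
  "free_extend K S W \<phi> f = (\<Oplus>\<^bsub>W\<^esub>s\<in>{s \<in> S. f s \<noteq> \<zero>\<^bsub>K\<^esub>}. f s \<odot>\<^bsub>W\<^esub> \<phi> s)"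

subsection \<open>Binary tensor products\<close>

definition tensor_rel :: "'k ring \<Rightarrow> ('k, 'a) module \<Rightarrow> ('k, 'b) module \<Rightarrow> ('a \<times> 'b \<Rightarrow> 'k) set" where
  "tensor_rel K A B =
    (let S = carrier A \<times> carrier B; F = free_space K S; g = (\<lambda>a b. free_gen K S (a, b)) in
     LinearCombinations.module.span K F
      ({g (a \<oplus>\<^bsub>A\<^esub> a') b \<ominus>\<^bsub>F\<^esub> (g a b \<oplus>\<^bsub>F\<^esub> g a' b) | a a' b.
          a \<in> carrier A \<and> a' \<in> carrier A \<and> b \<in> carrier B} \<union>
       {g a (b \<oplus>\<^bsub>B\<^esub> b') \<ominus>\<^bsub>F\<^esub> (g a b \<oplus>\<^bsub>F\<^esub> g a b') | a b b'.
          a \<in> carrier A \<and> b \<in> carrier B \<and> b' \<in> carrier B} \<union>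
       {g (r \<odot>\<^bsub>A\<^esub> a) b \<ominus>\<^bsub>F\<^esub> (r \<odot>\<^bsub>F\<^esub> g a b) | r a b.
          r \<in> carrier K \<and> a \<in> carrier A \<and> b \<in> carrier B} \<union>
       {g a (r \<odot>\<^bsub>B\<^esub> b) \<ominus>\<^bsub>F\<^esub> (r \<odot>\<^bsub>F\<^esub> g a b) | r a b.
          r \<in> carrier K \<and> a \<in> carrier A \<and> b \<in> carrier B}))"

definition tensor_vs ::
  "'k ring \<Rightarrow> ('k, 'a) module \<Rightarrow> ('k, 'b) module \<Rightarrow> ('k, ('a \<times> 'b \<Rightarrow> 'k) set) module" where
  "tensor_vs K A B = quot_space (free_space K (carrier A \<times> carrier B)) (tensor_rel K A B)"

definition tprod ::
  "'k ring \<Rightarrow> ('k, 'a) module \<Rightarrow> ('k, 'b) module \<Rightarrow> 'a \<Rightarrow> 'b \<Rightarrow> ('a \<times> 'b \<Rightarrow> 'k) set" where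
  "tprod K A B a b =
     tensor_rel K A B +>\<^bsub>free_space K (carrier A \<times> carrier B)\<^esub>
       free_gen K (carrier A \<times> carrier B) (a, b)"

text \<open>The linear map with \<open>a \<otimes> b \<mapsto> \<phi> a b\<close> for bilinear \<open>\<phi>\<close>; the free extension of \<open>\<phi>\<close> takes
  a single value on each coset.\<close>

definition tensor_lift ::
  "'k ring \<Rightarrow> ('k, 'a) module \<Rightarrow> ('k, 'b) module \<Rightarrow> ('k, 'w) module
     \<Rightarrow> ('a \<Rightarrow> 'b \<Rightarrow> 'w) \<Rightarrow> ('a \<times> 'b \<Rightarrow> 'k) set \<Rightarrow> 'w" where
  "tensor_lift K A B W \<phi> t =
     the_elem (free_extend K (carrier A \<times> carrier B) W (\<lambda>(a, b). \<phi> a b) ` t)"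

text \<open>The multiplicative fields hold the tensor product of algebras.\<close>

definition tensor ::
  "'k ring \<Rightarrow> ('k, 'a) module \<Rightarrow> ('k, 'b) module \<Rightarrow> ('k, ('a \<times> 'b \<Rightarrow> 'k) set) module" where
  "tensor K A B =
     (tensor_vs K A B)
       \<lparr>monoid.mult := (\<lambda>s t. tensor_lift K A B (tensor_vs K A B) (\<lambda>a b.
                   tensor_lift K A B (tensor_vs K A B) (\<lambda>a' b'.
                     tprod K A B (a \<otimes>\<^bsub>A\<^esub> a') (b \<otimes>\<^bsub>B\<^esub> b')) t) s),
        one := tprod K A B \<one>\<^bsub>A\<^esub> \<one>\<^bsub>B\<^esub>\<rparr>"

definition tensor_map ::
  "'k ring \<Rightarrow> ('k, 'a) module \<Rightarrow> ('k, 'b) module \<Rightarrow> ('k, 'c) module \<Rightarrow> ('k, 'd) module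
     \<Rightarrow> ('a \<Rightarrow> 'c) \<Rightarrow> ('b \<Rightarrow> 'd) \<Rightarrow> ('a \<times> 'b \<Rightarrow> 'k) set \<Rightarrow> ('c \<times> 'd \<Rightarrow> 'k) set" where
  "tensor_map K A B C D f g =
     tensor_lift K A B (tensor K C D) (\<lambda>a b. tprod K C D (f a) (g b))"

definition assoc ::
  "'k ring \<Rightarrow> ('k, 'a) module \<Rightarrow> ('k, 'b) module \<Rightarrow> ('k, 'c) module
     \<Rightarrow> (('a \<times> 'b \<Rightarrow> 'k) set \<times> 'c \<Rightarrow> 'k) set \<Rightarrow> ('a \<times> ('b \<times> 'c \<Rightarrow> 'k) set \<Rightarrow> 'k) set" where
  "assoc K A B C =
    (let W = tensor K A (tensor K B C) in
     tensor_lift K (tensor K A B) C W (\<lambda>u c.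
       tensor_lift K A B W (\<lambda>a b. tprod K A (tensor K B C) a (tprod K B C b c)) u))"

text \<open>The linear map \<open>A \<otimes> (B \<otimes> C) \<rightarrow> W\<close> with \<open>a \<otimes> (b \<otimes> c) \<mapsto> \<phi> a b c\<close>.\<close>

definition tensor_lift3 ::
  "'k ring \<Rightarrow> ('k, 'a) module \<Rightarrow> ('k, 'b) module \<Rightarrow> ('k, 'c) module \<Rightarrow> ('k, 'w) module
     \<Rightarrow> ('a \<Rightarrow> 'b \<Rightarrow> 'c \<Rightarrow> 'w) \<Rightarrow> ('a \<times> ('b \<times> 'c \<Rightarrow> 'k) set \<Rightarrow> 'k) set \<Rightarrow> 'w" where
  "tensor_lift3 K A B C W \<phi> =
     tensor_lift K A (tensor K B C) W (\<lambda>a. tensor_lift K B C W (\<phi> a))"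

text \<open>\<open>(a \<otimes> b) \<otimes> (c \<otimes> d) \<mapsto> (a \<otimes> c) \<otimes> (b \<otimes> d)\<close>, as a map of two arguments.\<close>

definition shuffle ::
  "'k ring \<Rightarrow> ('k, 'a) module \<Rightarrow> ('k, 'b) module \<Rightarrow> ('k, 'c) module \<Rightarrow> ('k, 'd) module
     \<Rightarrow> ('a \<times> 'b \<Rightarrow> 'k) set \<Rightarrow> ('c \<times> 'd \<Rightarrow> 'k) set
     \<Rightarrow> (('a \<times> 'c \<Rightarrow> 'k) set \<times> ('b \<times> 'd \<Rightarrow> 'k) set \<Rightarrow> 'k) set" where
  "shuffle K A B C D s t =
    (let V = tensor K A C; W = tensor K B D in
     tensor_lift K A B (tensor K V W) (\<lambda>a b.
       tensor_lift K C D (tensor K V W) (\<lambda>c d.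
         tprod K V W (tprod K A C a c) (tprod K B D b d)) t) s)"

subsection \<open>Tensor products over finite index sets\<close>

definition itensor_rel ::
  "'k ring \<Rightarrow> 'i set \<Rightarrow> ('i \<Rightarrow> ('k, 'v) module) \<Rightarrow> (('i \<Rightarrow> 'v) \<Rightarrow> 'k) set" where
  "itensor_rel K I V =
    (let S = (\<Pi>\<^sub>E i\<in>I. carrier (V i)); F = free_space K S; g = free_gen K S in
     LinearCombinations.module.span K F
      ({g (v(i := x \<oplus>\<^bsub>V i\<^esub> y)) \<ominus>\<^bsub>F\<^esub> (g (v(i := x)) \<oplus>\<^bsub>F\<^esub> g (v(i := y))) | v i x y.
          v \<in> S \<and> i \<in> I \<and> x \<in> carrier (V i) \<and> y \<in> carrier (V i)} \<union>
       {g (v(i := r \<odot>\<^bsub>V i\<^esub> x)) \<ominus>\<^bsub>F\<^esub> (r \<odot>\<^bsub>F\<^esub> g (v(i := x))) | v i r x.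
          v \<in> S \<and> i \<in> I \<and> r \<in> carrier K \<and> x \<in> carrier (V i)}))"

definition itensor ::
  "'k ring \<Rightarrow> 'i set \<Rightarrow> ('i \<Rightarrow> ('k, 'v) module) \<Rightarrow> ('k, (('i \<Rightarrow> 'v) \<Rightarrow> 'k) set) module" where
  "itensor K I V = quot_space (free_space K (\<Pi>\<^sub>E i\<in>I. carrier (V i))) (itensor_rel K I V)"

definition itprod ::
  "'k ring \<Rightarrow> 'i set \<Rightarrow> ('i \<Rightarrow> ('k, 'v) module) \<Rightarrow> ('i \<Rightarrow> 'v) \<Rightarrow> (('i \<Rightarrow> 'v) \<Rightarrow> 'k) set" where
  "itprod K I V v =
     itensor_rel K I V +>\<^bsub>free_space K (\<Pi>\<^sub>E i\<in>I. carrier (V i))\<^esub>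
       free_gen K (\<Pi>\<^sub>E i\<in>I. carrier (V i)) v"

definition itensor_lift ::
  "'k ring \<Rightarrow> 'i set \<Rightarrow> ('i \<Rightarrow> ('k, 'v) module) \<Rightarrow> ('k, 'w) module
     \<Rightarrow> (('i \<Rightarrow> 'v) \<Rightarrow> 'w) \<Rightarrow> (('i \<Rightarrow> 'v) \<Rightarrow> 'k) set \<Rightarrow> 'w" where
  "itensor_lift K I V W \<phi> t =
     the_elem (free_extend K (\<Pi>\<^sub>E i\<in>I. carrier (V i)) W \<phi> ` t)"

section \<open>Hopf algebras, modules and comodules\<close>

record ('k, 'h) hopf =
  halg :: "('k, 'h) module"
  comult :: "'h \<Rightarrow> ('h \<times> 'h \<Rightarrow> 'k) set"
  counit :: "'h \<Rightarrow> 'k"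
  antipode :: "'h \<Rightarrow> 'h"

definition unital_algebra :: "'k ring \<Rightarrow> ('k, 'a) module \<Rightarrow> bool" where
  "unital_algebra K A \<longleftrightarrow>
     vectorspace K A \<and> ring A \<and>
     (\<forall>r\<in>carrier K. \<forall>a\<in>carrier A. \<forall>b\<in>carrier A.
        (r \<odot>\<^bsub>A\<^esub> a) \<otimes>\<^bsub>A\<^esub> b = r \<odot>\<^bsub>A\<^esub> (a \<otimes>\<^bsub>A\<^esub> b) \<and> a \<otimes>\<^bsub>A\<^esub> (r \<odot>\<^bsub>A\<^esub> b) = r \<odot>\<^bsub>A\<^esub> (a \<otimes>\<^bsub>A\<^esub> b))"

definition hopf_algebra :: "'k ring \<Rightarrow> ('k, 'h) hopf \<Rightarrow> bool" where
  "hopf_algebra K H \<longleftrightarrow>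
    (let A = halg H; \<Delta> = comult H; \<epsilon> = counit H; S = antipode H in
     unital_algebra K A \<and>
     linear_map K A (tensor K A A) \<Delta> \<and> \<Delta> \<in> ring_hom A (tensor K A A) \<and>
     linear_map K A (scalar_space K) \<epsilon> \<and> \<epsilon> \<in> ring_hom A K \<and>
     linear_map K A A S \<and>
     (\<forall>a\<in>carrier A.
        assoc K A A A (tensor_map K A A (tensor K A A) A \<Delta> id (\<Delta> a)) =
          tensor_map K A A A (tensor K A A) id \<Delta> (\<Delta> a) \<and>
        tensor_lift K A A A (\<lambda>b c. \<epsilon> b \<odot>\<^bsub>A\<^esub> c) (\<Delta> a) = a \<and>
        tensor_lift K A A A (\<lambda>b c. \<epsilon> c \<odot>\<^bsub>A\<^esub> b) (\<Delta> a) = a \<and>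
        tensor_lift K A A A (\<lambda>b c. S b \<otimes>\<^bsub>A\<^esub> c) (\<Delta> a) = \<epsilon> a \<odot>\<^bsub>A\<^esub> \<one>\<^bsub>A\<^esub> \<and>
        tensor_lift K A A A (\<lambda>b c. b \<otimes>\<^bsub>A\<^esub> S c) (\<Delta> a) = \<epsilon> a \<odot>\<^bsub>A\<^esub> \<one>\<^bsub>A\<^esub>))"

definition left_module ::
  "'k ring \<Rightarrow> ('k, 'h) hopf \<Rightarrow> ('k, 'n) module \<Rightarrow> ('h \<Rightarrow> 'n \<Rightarrow> 'n) \<Rightarrow> bool" where
  "left_module K H N act \<longleftrightarrow>
     vectorspace K N \<and>
     (\<forall>a\<in>carrier (halg H). linear_map K N N (act a)) \<and>
     (\<forall>n\<in>carrier N. linear_map K (halg H) N (\<lambda>a. act a n) \<and> act \<one>\<^bsub>halg H\<^esub> n = n \<and>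
        (\<forall>a\<in>carrier (halg H). \<forall>b\<in>carrier (halg H). act (a \<otimes>\<^bsub>halg H\<^esub> b) n = act a (act b n)))"

definition right_module ::
  "'k ring \<Rightarrow> ('k, 'h) hopf \<Rightarrow> ('k, 'n) module \<Rightarrow> ('n \<Rightarrow> 'h \<Rightarrow> 'n) \<Rightarrow> bool" where
  "right_module K H N act \<longleftrightarrow>
     vectorspace K N \<and>
     (\<forall>a\<in>carrier (halg H). linear_map K N N (\<lambda>n. act n a)) \<and>
     (\<forall>n\<in>carrier N. linear_map K (halg H) N (act n) \<and> act n \<one>\<^bsub>halg H\<^esub> = n \<and>
        (\<forall>a\<in>carrier (halg H). \<forall>b\<in>carrier (halg H). act n (a \<otimes>\<^bsub>halg H\<^esub> b) = act (act n a) b))"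

definition left_comodule ::
  "'k ring \<Rightarrow> ('k, 'h) hopf \<Rightarrow> ('k, 'n) module \<Rightarrow> ('n \<Rightarrow> ('h \<times> 'n \<Rightarrow> 'k) set) \<Rightarrow> bool" where
  "left_comodule K H N co \<longleftrightarrow>
    (let A = halg H in
     linear_map K N (tensor K A N) co \<and>
     (\<forall>n\<in>carrier N.
        assoc K A A N (tensor_map K A N (tensor K A A) N (comult H) id (co n)) =
          tensor_map K A N A (tensor K A N) id co (co n) \<and>
        tensor_lift K A N N (\<lambda>a m. counit H a \<odot>\<^bsub>N\<^esub> m) (co n) = n))"

definition right_comodule ::
  "'k ring \<Rightarrow> ('k, 'h) hopf \<Rightarrow> ('k, 'n) module \<Rightarrow> ('n \<Rightarrow> ('n \<times> 'h \<Rightarrow> 'k) set) \<Rightarrow> bool" where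
  "right_comodule K H N co \<longleftrightarrow>
    (let A = halg H in
     linear_map K N (tensor K N A) co \<and>
     (\<forall>n\<in>carrier N.
        assoc K N A A (tensor_map K N A (tensor K N A) A co id (co n)) =
          tensor_map K N A N (tensor K A A) id (comult H) (co n) \<and>
        tensor_lift K N A N (\<lambda>m a. counit H a \<odot>\<^bsub>N\<^esub> m) (co n) = n))"

subsection \<open>Involutive Hopf bimodules\<close>

record ('k, 'h, 'm) hopf_bimod =
  bvs :: "('k, 'm) module"
  blact :: "'h \<Rightarrow> 'm \<Rightarrow> 'm"
  bract :: "'m \<Rightarrow> 'h \<Rightarrow> 'm"
  blcoact :: "'m \<Rightarrow> ('h \<times> 'm \<Rightarrow> 'k) set"
  brcoact :: "'m \<Rightarrow> ('m \<times> 'h \<Rightarrow> 'k) set"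
  binvol :: "'m \<Rightarrow> 'm"

definition comult3 :: "'k ring \<Rightarrow> ('k, 'h) hopf \<Rightarrow> 'h \<Rightarrow> ('h \<times> ('h \<times> 'h \<Rightarrow> 'k) set \<Rightarrow> 'k) set" where
  "comult3 K H a =
     tensor_map K (halg H) (halg H) (halg H) (tensor K (halg H) (halg H)) id (comult H) (comult H a)"

text \<open>\<open>m \<mapsto> m\<^sub>[\<^sub>-\<^sub>1\<^sub>] \<otimes> (m\<^sub>[\<^sub>0\<^sub>] \<otimes> m\<^sub>[\<^sub>1\<^sub>])\<close>\<close>

definition bicoact ::
  "'k ring \<Rightarrow> ('k, 'h) hopf \<Rightarrow> ('k, 'h, 'm) hopf_bimod \<Rightarrow> 'm \<Rightarrow> ('h \<times> ('m \<times> 'h \<Rightarrow> 'k) set \<Rightarrow> 'k) set" where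
  "bicoact K H M m =
     tensor_map K (halg H) (bvs M) (halg H) (tensor K (bvs M) (halg H)) id (brcoact M) (blcoact M m)"

definition involutive_hopf_bimodule ::
  "'k ring \<Rightarrow> ('k, 'h) hopf \<Rightarrow> ('k, 'h, 'm) hopf_bimod \<Rightarrow> bool" where
  "involutive_hopf_bimodule K H M \<longleftrightarrow>
    (let A = halg H; V = bvs M; S = antipode H; Sinv = inv_into (carrier A) S;
         T = tensor K V A; W = tensor K A T; \<psi> = binvol M in
     left_module K H V (blact M) \<and> right_module K H V (bract M) \<and>
     left_comodule K H V (blcoact M) \<and> right_comodule K H V (brcoact M) \<and>
     (\<forall>h\<in>carrier A. \<forall>g\<in>carrier A. \<forall>m\<in>carrier V.
        bract M (blact M h m) g = blact M h (bract M m g)) \<and>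
     (\<forall>m\<in>carrier V.
        assoc K A V A (tensor_map K V A (tensor K A V) A (blcoact M) id (brcoact M m)) =
          bicoact K H M m) \<and>
     (\<forall>h\<in>carrier A. \<forall>g\<in>carrier A. \<forall>m\<in>carrier V.
        bicoact K H M (bract M (blact M h m) g) =
          tensor_lift3 K A A A W (\<lambda>h1 h2 h3.
            tensor_lift3 K A V A W (\<lambda>b n c.
              tensor_lift3 K A A A W (\<lambda>g1 g2 g3.
                tprod K A T (h1 \<otimes>\<^bsub>A\<^esub> b \<otimes>\<^bsub>A\<^esub> g1)
                  (tprod K V A (bract M (blact M h2 n) g2) (h3 \<otimes>\<^bsub>A\<^esub> c \<otimes>\<^bsub>A\<^esub> Sinv (Sinv g3))))
                (comult3 K H g))
              (bicoact K H M m))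
            (comult3 K H h)) \<and>
     linear_map K V V \<psi> \<and>
     (\<forall>m\<in>carrier V. \<psi> (\<psi> m) = m \<and>
        (\<forall>h\<in>carrier A. \<psi> (blact M h m) = bract M (\<psi> m) (S h)) \<and>
        blcoact M (\<psi> m) =
          tensor_lift K V A (tensor K A V) (\<lambda>n c. tprod K A V (S c) (\<psi> n)) (brcoact M m)))"

section \<open>Bitensor products\<close>

text \<open>Objects of the categories of right-right and of left-left modules-comodules, over a space
  \<open>A\<close> of operators (elements of \<^typ>\<open>'a\<close>) and a space \<open>C\<close> of coefficients (elements of \<^typ>\<open>'c\<close>).\<close>

record ('k, 'a, 'c, 'x) rmc =
  rvs :: "('k, 'x) module"
  ract :: "'x \<Rightarrow> 'a \<Rightarrow> 'x"
  rcoact :: "'x \<Rightarrow> ('x \<times> 'c \<Rightarrow> 'k) set"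

record ('k, 'a, 'c, 'n) lmc =
  lvs :: "('k, 'n) module"
  lact :: "'a \<Rightarrow> 'n \<Rightarrow> 'n"
  lcoact :: "'n \<Rightarrow> ('c \<times> 'n \<Rightarrow> 'k) set"

definition right_modcomod :: "'k ring \<Rightarrow> ('k, 'h) hopf \<Rightarrow> ('k, 'h, 'h, 'x) rmc \<Rightarrow> bool" where
  "right_modcomod K H X \<longleftrightarrow>
     right_module K H (rvs X) (ract X) \<and> right_comodule K H (rvs X) (rcoact X)"

definition cotensor ::
  "'k ring \<Rightarrow> ('k, 'c) module \<Rightarrow> ('k, 'a, 'c, 'x) rmc \<Rightarrow> ('k, 'a, 'c, 'n) lmc \<Rightarrow> ('x \<times> 'n \<Rightarrow> 'k) set set" where
  "cotensor K C X N =
    {z \<in> carrier (tensor K (rvs X) (lvs N)).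
       assoc K (rvs X) C (lvs N)
         (tensor_map K (rvs X) (lvs N) (tensor K (rvs X) C) (lvs N) (rcoact X) id z) =
       tensor_map K (rvs X) (lvs N) (rvs X) (tensor K C (lvs N)) id (lcoact N) z}"

definition balanced_rel ::
  "'k ring \<Rightarrow> ('k, 'a) module \<Rightarrow> ('k, 'a, 'c, 'x) rmc \<Rightarrow> ('k, 'a, 'c, 'n) lmc \<Rightarrow> ('x \<times> 'n \<Rightarrow> 'k) set set" where
  "balanced_rel K A X N =
    (let T = tensor K (rvs X) (lvs N); t = tprod K (rvs X) (lvs N) in
     LinearCombinations.module.span K T
       {t (ract X x a) n \<ominus>\<^bsub>T\<^esub> t x (lact N a n) | x a n.
          x \<in> carrier (rvs X) \<and> a \<in> carrier A \<and> n \<in> carrier (lvs N)})"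

definition tensor_over ::
  "'k ring \<Rightarrow> ('k, 'a) module \<Rightarrow> ('k, 'a, 'c, 'x) rmc \<Rightarrow> ('k, 'a, 'c, 'n) lmc
     \<Rightarrow> ('k, ('x \<times> 'n \<Rightarrow> 'k) set set) module" where
  "tensor_over K A X N = quot_space (tensor K (rvs X) (lvs N)) (balanced_rel K A X N)"

definition proj_over ::
  "'k ring \<Rightarrow> ('k, 'a) module \<Rightarrow> ('k, 'a, 'c, 'x) rmc \<Rightarrow> ('k, 'a, 'c, 'n) lmc
     \<Rightarrow> ('x \<times> 'n \<Rightarrow> 'k) set \<Rightarrow> ('x \<times> 'n \<Rightarrow> 'k) set set" where
  "proj_over K A X N z = balanced_rel K A X N +>\<^bsub>tensor K (rvs X) (lvs N)\<^esub> z"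

definition Bit ::
  "'k ring \<Rightarrow> ('k, 'a) module \<Rightarrow> ('k, 'c) module \<Rightarrow> ('k, 'a, 'c, 'x) rmc \<Rightarrow> ('k, 'a, 'c, 'n) lmc
     \<Rightarrow> ('k, ('x \<times> 'n \<Rightarrow> 'k) set set) module" where
  "Bit K A C X N =
     (tensor_over K A X N)\<lparr>carrier := proj_over K A X N ` cotensor K C X N\<rparr>"

text \<open>If \<open>N\<close> carries, besides its structure over \<open>(A, C)\<close>, an action and coaction of \<open>H\<close> (given by
  \<open>N0\<close>) which commute with it, these pass to \<open>X \<otimes>\<^sub>A N\<close> and restrict to \<open>Bit X N\<close>. The induced
  coaction takes values in \<open>H \<otimes> (X \<otimes>\<^sub>A N)\<close> and is corestricted along the injection
  \<open>H \<otimes> Bit X N \<rightarrow> H \<otimes> (X \<otimes>\<^sub>A N)\<close>.\<close>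

definition Bit_inherit ::
  "'k ring \<Rightarrow> ('k, 'h) hopf \<Rightarrow> ('k, 'a) module \<Rightarrow> ('k, 'c) module
     \<Rightarrow> ('k, 'a, 'c, 'x) rmc \<Rightarrow> ('k, 'a, 'c, 'n) lmc \<Rightarrow> ('k, 'h, 'h, 'n) lmc
     \<Rightarrow> ('k, 'h, 'h, ('x \<times> 'n \<Rightarrow> 'k) set set) lmc" where
  "Bit_inherit K H A C X N N0 =
    (let V = rvs X; U = lvs N; T = tensor K V U; B = Bit K A C X N; Q = tensor_over K A X N;
         L = halg H; \<pi> = proj_over K A X N;
         coT = tensor_lift K V U (tensor K L T) (\<lambda>x n.
                 tensor_lift K L U (tensor K L T) (\<lambda>h n'. tprod K L T h (tprod K V U x n')) (lcoact N0 n))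
     in \<lparr>lvs = B,
         lact = (\<lambda>h p. the_elem ((\<lambda>z. \<pi> (tensor_map K V U V U id (lact N0 h) z)) ` p)),
         lcoact = (\<lambda>p. the_inv_into (carrier (tensor K L B)) (tensor_map K L B L Q id id)
                    (the_elem ((\<lambda>z. tensor_map K L T L Q id \<pi> (coT z)) ` p)))\<rparr>)"

subsection \<open>Tensor products of modules-comodules\<close>

definition rtensor_act ::
  "'k ring \<Rightarrow> ('k, 'h) hopf \<Rightarrow> ('k, 'h, 'h, 'x) rmc \<Rightarrow> ('k, 'h, 'h, 'y) rmc
     \<Rightarrow> ('x \<times> 'y \<Rightarrow> 'k) set \<Rightarrow> ('h \<times> 'h \<Rightarrow> 'k) set \<Rightarrow> ('x \<times> 'y \<Rightarrow> 'k) set" where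
  "rtensor_act K H X Y z t =
     tensor_lift K (halg H) (halg H) (tensor K (rvs X) (rvs Y)) (\<lambda>a b.
       tensor_map K (rvs X) (rvs Y) (rvs X) (rvs Y) (\<lambda>x. ract X x a) (\<lambda>y. ract Y y b) z) t"

definition ltensor_act ::
  "'k ring \<Rightarrow> ('k, 'h) hopf \<Rightarrow> ('k, 'h, 'h, 'p) lmc \<Rightarrow> ('k, 'h, 'h, 'q) lmc
     \<Rightarrow> ('h \<times> 'h \<Rightarrow> 'k) set \<Rightarrow> ('p \<times> 'q \<Rightarrow> 'k) set \<Rightarrow> ('p \<times> 'q \<Rightarrow> 'k) set" where
  "ltensor_act K H P Q t z =
     tensor_lift K (halg H) (halg H) (tensor K (lvs P) (lvs Q)) (\<lambda>a b.
       tensor_map K (lvs P) (lvs Q) (lvs P) (lvs Q) (lact P a) (lact Q b) z) t"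

text \<open>\<open>x \<otimes> y \<mapsto> (x\<^sub>0 \<otimes> y\<^sub>0) \<otimes> x\<^sub>1 y\<^sub>1\<close> and \<open>p \<otimes> q \<mapsto> p\<^sub>-\<^sub>1 q\<^sub>-\<^sub>1 \<otimes> (p\<^sub>0 \<otimes> q\<^sub>0)\<close>\<close>

definition rtensor_coact ::
  "'k ring \<Rightarrow> ('k, 'h) hopf \<Rightarrow> ('k, 'h, 'h, 'x) rmc \<Rightarrow> ('k, 'h, 'h, 'y) rmc
     \<Rightarrow> ('x \<times> 'y \<Rightarrow> 'k) set \<Rightarrow> (('x \<times> 'y \<Rightarrow> 'k) set \<times> 'h \<Rightarrow> 'k) set" where
  "rtensor_coact K H X Y =
    (let A = halg H; V = rvs X; W = rvs Y; T = tensor K V W; TA = tensor K T A in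
     tensor_lift K V W TA (\<lambda>x y.
       tensor_lift K V A TA (\<lambda>x0 a.
         tensor_lift K W A TA (\<lambda>y0 b. tprod K T A (tprod K V W x0 y0) (a \<otimes>\<^bsub>A\<^esub> b))
           (rcoact Y y)) (rcoact X x)))"

definition ltensor_coact ::
  "'k ring \<Rightarrow> ('k, 'h) hopf \<Rightarrow> ('k, 'h, 'h, 'p) lmc \<Rightarrow> ('k, 'h, 'h, 'q) lmc
     \<Rightarrow> ('p \<times> 'q \<Rightarrow> 'k) set \<Rightarrow> ('h \<times> ('p \<times> 'q \<Rightarrow> 'k) set \<Rightarrow> 'k) set" where
  "ltensor_coact K H P Q =
    (let A = halg H; V = lvs P; W = lvs Q; T = tensor K V W; AT = tensor K A T in
     tensor_lift K V W AT (\<lambda>p q.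
       tensor_lift K A V AT (\<lambda>a p0.
         tensor_lift K A W AT (\<lambda>b q0. tprod K A T (a \<otimes>\<^bsub>A\<^esub> b) (tprod K V W p0 q0))
           (lcoact Q q)) (lcoact P p)))"

text \<open>The diagonal versions (over \<open>H\<close>) and the factorwise versions (over the algebra \<open>H \<otimes> H\<close>);
  the coaction of \<open>H\<close> is codiagonal in both.\<close>

definition rdiag ::
  "'k ring \<Rightarrow> ('k, 'h) hopf \<Rightarrow> ('k, 'h, 'h, 'x) rmc \<Rightarrow> ('k, 'h, 'h, 'y) rmc
     \<Rightarrow> ('k, 'h, 'h, ('x \<times> 'y \<Rightarrow> 'k) set) rmc" where
  "rdiag K H X Y =
     \<lparr>rvs = tensor K (rvs X) (rvs Y), ract = (\<lambda>z a. rtensor_act K H X Y z (comult H a)),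
      rcoact = rtensor_coact K H X Y\<rparr>"

definition ldiag ::
  "'k ring \<Rightarrow> ('k, 'h) hopf \<Rightarrow> ('k, 'h, 'h, 'p) lmc \<Rightarrow> ('k, 'h, 'h, 'q) lmc
     \<Rightarrow> ('k, 'h, 'h, ('p \<times> 'q \<Rightarrow> 'k) set) lmc" where
  "ldiag K H P Q =
     \<lparr>lvs = tensor K (lvs P) (lvs Q), lact = (\<lambda>a. ltensor_act K H P Q (comult H a)),
      lcoact = ltensor_coact K H P Q\<rparr>"

definition rfactor ::
  "'k ring \<Rightarrow> ('k, 'h) hopf \<Rightarrow> ('k, 'h, 'h, 'x) rmc \<Rightarrow> ('k, 'h, 'h, 'y) rmc
     \<Rightarrow> ('k, ('h \<times> 'h \<Rightarrow> 'k) set, 'h, ('x \<times> 'y \<Rightarrow> 'k) set) rmc" where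
  "rfactor K H X Y =
     \<lparr>rvs = tensor K (rvs X) (rvs Y), ract = rtensor_act K H X Y, rcoact = rtensor_coact K H X Y\<rparr>"

definition lfactor ::
  "'k ring \<Rightarrow> ('k, 'h) hopf \<Rightarrow> ('k, 'h, 'h, 'p) lmc \<Rightarrow> ('k, 'h, 'h, 'q) lmc
     \<Rightarrow> ('k, ('h \<times> 'h \<Rightarrow> 'k) set, 'h, ('p \<times> 'q \<Rightarrow> 'k) set) lmc" where
  "lfactor K H P Q =
     \<lparr>lvs = tensor K (lvs P) (lvs Q), lact = ltensor_act K H P Q, lcoact = ltensor_coact K H P Q\<rparr>"

definition Aux ::
  "'k ring \<Rightarrow> ('k, 'h) hopf \<Rightarrow> ('k, 'h, 'h, 'x) rmc \<Rightarrow> ('k, 'h, 'h, 'y) rmc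
     \<Rightarrow> ('k, 'h, 'h, 'p) lmc \<Rightarrow> ('k, 'h, 'h, 'q) lmc
     \<Rightarrow> ('k, (('x \<times> 'y \<Rightarrow> 'k) set \<times> ('p \<times> 'q \<Rightarrow> 'k) set \<Rightarrow> 'k) set set) module" where
  "Aux K H X Y P Q =
     Bit K (tensor K (halg H) (halg H)) (halg H) (rfactor K H X Y) (lfactor K H P Q)"

definition Aux_proj ::
  "'k ring \<Rightarrow> ('k, 'h) hopf \<Rightarrow> ('k, 'h, 'h, 'x) rmc \<Rightarrow> ('k, 'h, 'h, 'y) rmc
     \<Rightarrow> ('k, 'h, 'h, 'p) lmc \<Rightarrow> ('k, 'h, 'h, 'q) lmc
     \<Rightarrow> (('x \<times> 'y \<Rightarrow> 'k) set \<times> ('p \<times> 'q \<Rightarrow> 'k) set \<Rightarrow> 'k) set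
     \<Rightarrow> (('x \<times> 'y \<Rightarrow> 'k) set \<times> ('p \<times> 'q \<Rightarrow> 'k) set \<Rightarrow> 'k) set set" where
  "Aux_proj K H X Y P Q =
     proj_over K (tensor K (halg H) (halg H)) (rfactor K H X Y) (lfactor K H P Q)"

definition kappa ::
  "'k ring \<Rightarrow> ('k, 'h) hopf \<Rightarrow> ('k, 'h, 'h, 'x) rmc \<Rightarrow> ('k, 'h, 'h, 'y) rmc
     \<Rightarrow> ('k, 'h, 'h, 'p) lmc \<Rightarrow> ('k, 'h, 'h, 'q) lmc
     \<Rightarrow> (('x \<times> 'p \<Rightarrow> 'k) set set \<times> ('y \<times> 'q \<Rightarrow> 'k) set set \<Rightarrow> 'k) set
     \<Rightarrow> (('x \<times> 'y \<Rightarrow> 'k) set \<times> ('p \<times> 'q \<Rightarrow> 'k) set \<Rightarrow> 'k) set set" where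
  "kappa K H X Y P Q =
     tensor_lift K (Bit K (halg H) (halg H) X P) (Bit K (halg H) (halg H) Y Q) (Aux K H X Y P Q)
       (\<lambda>b c. the_elem ((\<lambda>(u, v).
          Aux_proj K H X Y P Q (shuffle K (rvs X) (lvs P) (rvs Y) (lvs Q) u v)) ` (b \<times> c)))"

definition nu ::
  "'k ring \<Rightarrow> ('k, 'h) hopf \<Rightarrow> ('k, 'h, 'h, 'x) rmc \<Rightarrow> ('k, 'h, 'h, 'y) rmc
     \<Rightarrow> ('k, 'h, 'h, 'p) lmc \<Rightarrow> ('k, 'h, 'h, 'q) lmc
     \<Rightarrow> (('x \<times> 'y \<Rightarrow> 'k) set \<times> ('p \<times> 'q \<Rightarrow> 'k) set \<Rightarrow> 'k) set set
     \<Rightarrow> (('x \<times> 'y \<Rightarrow> 'k) set \<times> ('p \<times> 'q \<Rightarrow> 'k) set \<Rightarrow> 'k) set set" where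
  "nu K H X Y P Q w = the_elem (Aux_proj K H X Y P Q ` w)"

section \<open>Kitaev graphs\<close>

record 'a kitaev =
  half :: "'a set"
  flip :: "'a \<Rightarrow> 'a"
  rho :: "'a \<Rightarrow> 'a"
  cilia :: "'a set"
  base :: "'a"
  hord :: "'a rel"

definition ribbon_graph :: "('a, 'z) kitaev_scheme \<Rightarrow> bool" where
  "ribbon_graph G \<longleftrightarrow>
     finite (half G) \<and> flip G permutes half G \<and> rho G permutes half G \<and>
     (\<forall>h\<in>half G. flip G h \<noteq> h \<and> flip G (flip G h) = h)"

definition connected_graph :: "('a, 'z) kitaev_scheme \<Rightarrow> bool" where
  "connected_graph G \<longleftrightarrow>
     (\<forall>h\<in>half G. \<forall>k\<in>half G. (h, k) \<in> {(x, y). y = flip G x \<or> y = rho G x \<or> x = rho G y}\<^sup>*)"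

definition face_perm :: "('a, 'z) kitaev_scheme \<Rightarrow> 'a \<Rightarrow> 'a" where
  "face_perm G = Hilbert_Choice.inv (rho G) \<circ> flip G"

text \<open>A cycle of a permutation is represented by its set of elements.\<close>

definition vertex_of :: "('a, 'z) kitaev_scheme \<Rightarrow> 'a \<Rightarrow> 'a set" where
  "vertex_of G h = Orbits.orbit (rho G) h"

definition edge_of :: "('a, 'z) kitaev_scheme \<Rightarrow> 'a \<Rightarrow> 'a set" where
  "edge_of G h = Orbits.orbit (flip G) h"

definition face_of :: "('a, 'z) kitaev_scheme \<Rightarrow> 'a \<Rightarrow> 'a set" where
  "face_of G h = Orbits.orbit (face_perm G) h"

definition edges :: "('a, 'z) kitaev_scheme \<Rightarrow> 'a set set" where
  "edges G = edge_of G ` half G"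

definition kitaev_graph :: "('a, 'z) kitaev_scheme \<Rightarrow> bool" where
  "kitaev_graph G \<longleftrightarrow>
     ribbon_graph G \<and> connected_graph G \<and> cilia G \<subseteq> half G \<and> base G \<in> cilia G \<and>
     bij_betw (vertex_of G) (cilia G) (vertex_of G ` half G) \<and>
     bij_betw (\<lambda>c. face_of G (Hilbert_Choice.inv (rho G) c)) (cilia G) (face_of G ` half G) \<and>
     linear_order_on (half G) (hord G) \<and>
     (\<forall>h\<in>half G. \<forall>k\<in>half G. edge_of G h \<noteq> edge_of G k \<longrightarrow>
        ((h, k) \<in> hord G \<longleftrightarrow> (flip G h, flip G k) \<in> hord G))"

definition is_source :: "('a, 'z) kitaev_scheme \<Rightarrow> 'a \<Rightarrow> bool" where
  "is_source G h \<longleftrightarrow> (h, flip G h) \<in> hord G"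

definition kappa_infty :: "nat \<Rightarrow> nat" where
  "kappa_infty n = (if odd n then n + 1 else n - 1)"

definition RK :: "nat kitaev set" where
  "RK = {G. kitaev_graph G \<and> half G \<subseteq> {1..} \<and> kappa_infty ` half G \<subseteq> half G \<and>
            (\<forall>h\<in>half G. flip G h = kappa_infty h) \<and>
            hord G = {(h, k). h \<in> half G \<and> k \<in> half G \<and> h \<le> k}}"

text \<open>The half-edges of \<open>D\<close> are made disjoint from those of \<open>G\<close> by adding the largest half-edge
  of \<open>G\<close>, an even number for \<open>G\<close> in \<^const>\<open>RK\<close>, so that the result is again in \<^const>\<open>RK\<close>.\<close>

definition shift :: "nat kitaev \<Rightarrow> nat \<Rightarrow> nat" where
  "shift G h = h + Max (half G)"

definition conn_sum :: "nat kitaev \<Rightarrow> nat kitaev \<Rightarrow> nat kitaev" where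
  "conn_sum G D =
    (let sh = shift G; un = (\<lambda>h. h - Max (half G)); D' = sh ` half D in
     \<lparr>half = half G \<union> D',
      flip = (\<lambda>h. if h \<in> half G then flip G h else if h \<in> D' then sh (flip D (un h)) else h),
      rho = (\<lambda>h. if h = Hilbert_Choice.inv (rho G) (base G) then sh (base D)
                 else if h = sh (Hilbert_Choice.inv (rho D) (base D)) then base G
                 else if h \<in> half G then rho G h
                 else if h \<in> D' then sh (rho D (un h)) else h),
      cilia = cilia G \<union> sh ` (cilia D - {base D}),
      base = base G,
      hord = hord G \<union> {(sh h, sh k) | h k. (h, k) \<in> hord D} \<union> half G \<times> D'\<rparr>)"

section \<open>The extended Hilbert space\<close>

definition ext_space ::
  "'k ring \<Rightarrow> ('k, 'h, 'm) hopf_bimod \<Rightarrow> nat kitaev \<Rightarrow> ('k, ((nat set \<Rightarrow> 'm) \<Rightarrow> 'k) set) module" where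
  "ext_space K M G = itensor K (edges G) (\<lambda>_. bvs M)"

definition half_act ::
  "'k ring \<Rightarrow> ('k, 'h) hopf \<Rightarrow> ('k, 'h, 'm) hopf_bimod \<Rightarrow> nat kitaev \<Rightarrow> nat \<Rightarrow> 'h
     \<Rightarrow> ((nat set \<Rightarrow> 'm) \<Rightarrow> 'k) set \<Rightarrow> ((nat set \<Rightarrow> 'm) \<Rightarrow> 'k) set" where
  "half_act K H M G h a =
     itensor_lift K (edges G) (\<lambda>_. bvs M) (ext_space K M G) (\<lambda>v.
       itprod K (edges G) (\<lambda>_. bvs M)
         (v(edge_of G h := (if is_source G h then bract M (v (edge_of G h)) (antipode H a)
                            else blact M a (v (edge_of G h))))))"

text \<open>The coaction \<open>t\<^sub>h\<close> of \<open>H\<close> on the extended space for which \<open>T\<^sub>h(\<alpha>) = (\<alpha> \<otimes> id) t\<^sub>h\<close>.\<close>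

definition half_coact ::
  "'k ring \<Rightarrow> ('k, 'h) hopf \<Rightarrow> ('k, 'h, 'm) hopf_bimod \<Rightarrow> nat kitaev \<Rightarrow> nat
     \<Rightarrow> ((nat set \<Rightarrow> 'm) \<Rightarrow> 'k) set \<Rightarrow> ('h \<times> ((nat set \<Rightarrow> 'm) \<Rightarrow> 'k) set \<Rightarrow> 'k) set" where
  "half_coact K H M G h =
    (let A = halg H; V = bvs M; E = ext_space K M G; e = edge_of G h;
         co = (\<lambda>m. if is_source G h then blcoact M m
                   else tensor_lift K V A (tensor K A V) (\<lambda>n c. tprod K A V (antipode H c) n) (brcoact M m))
     in itensor_lift K (edges G) (\<lambda>_. V) (tensor K A E) (\<lambda>v.
          tensor_lift K A V (tensor K A E) (\<lambda>b n.
            tprod K A E b (itprod K (edges G) (\<lambda>_. V) (v(e := n)))) (co (v e))))"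

text \<open>\<open>word_act [h\<^sub>1, \<dots>, h\<^sub>i] a = L\<^sub>h\<^sub>i(a\<^sub>(\<^sub>i\<^sub>)) \<cdots> L\<^sub>h\<^sub>1(a\<^sub>(\<^sub>1\<^sub>))\<close>\<close>

primrec word_act ::
  "'k ring \<Rightarrow> ('k, 'h) hopf \<Rightarrow> ('k, 'h, 'm) hopf_bimod \<Rightarrow> nat kitaev \<Rightarrow> nat list \<Rightarrow> 'h
     \<Rightarrow> ((nat set \<Rightarrow> 'm) \<Rightarrow> 'k) set \<Rightarrow> ((nat set \<Rightarrow> 'm) \<Rightarrow> 'k) set" where
  "word_act K H M G [] a m = counit H a \<odot>\<^bsub>ext_space K M G\<^esub> m"
| "word_act K H M G (h # hs) a m =
     tensor_lift K (halg H) (halg H) (ext_space K M G) (\<lambda>a1 a2.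
       word_act K H M G hs a2 (half_act K H M G h a1 m)) (comult H a)"

text \<open>\<open>\<delta> = word_coact [k\<^sub>1, \<dots>, k\<^sub>j]\<close> satisfies
  \<open>(\<alpha> \<otimes> id) (\<delta> m) = T\<^sub>k\<^sub>j(\<alpha>\<^sub>(\<^sub>1\<^sub>)) \<cdots> T\<^sub>k\<^sub>1(\<alpha>\<^sub>(\<^sub>j\<^sub>)) m\<close>, where the coproduct of \<open>\<alpha>\<close> in the dual of \<open>H\<close>
  is given by \<open>\<alpha> (b c) = \<alpha>\<^sub>(\<^sub>1\<^sub>) b \<cdot> \<alpha>\<^sub>(\<^sub>2\<^sub>) c\<close>: the coefficient produced by the first half-edge
  becomes the rightmost factor.\<close>

primrec word_coact ::
  "'k ring \<Rightarrow> ('k, 'h) hopf \<Rightarrow> ('k, 'h, 'm) hopf_bimod \<Rightarrow> nat kitaev \<Rightarrow> nat list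
     \<Rightarrow> ((nat set \<Rightarrow> 'm) \<Rightarrow> 'k) set \<Rightarrow> ('h \<times> ((nat set \<Rightarrow> 'm) \<Rightarrow> 'k) set \<Rightarrow> 'k) set" where
  "word_coact K H M G [] m = tprod K (halg H) (ext_space K M G) \<one>\<^bsub>halg H\<^esub> m"
| "word_coact K H M G (k # ks) m =
    (let A = halg H; E = ext_space K M G in
     tensor_lift K A E (tensor K A E) (\<lambda>b n.
       tensor_lift K A E (tensor K A E) (\<lambda>b' n'. tprod K A E (b' \<otimes>\<^bsub>A\<^esub> b) n')
         (word_coact K H M G ks n)) (half_coact K H M G k m))"

definition cilium_lmc ::
  "'k ring \<Rightarrow> ('k, 'h) hopf \<Rightarrow> ('k, 'h, 'm) hopf_bimod \<Rightarrow> nat kitaev \<Rightarrow> nat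
     \<Rightarrow> ('k, 'h, 'h, ((nat set \<Rightarrow> 'm) \<Rightarrow> 'k) set) lmc" where
  "cilium_lmc K H M G c =
     \<lparr>lvs = ext_space K M G,
      lact = word_act K H M G (Cycles.support (rho G) c),
      lcoact = word_coact K H M G (Cycles.support (face_perm G) (Hilbert_Choice.inv (rho G) c))\<rparr>"

subsection \<open>Actions and coactions of several cilia\<close>

definition cilia_hopf ::
  "'k ring \<Rightarrow> ('k, 'h) hopf \<Rightarrow> nat set \<Rightarrow> ('k, ((nat \<Rightarrow> 'h) \<Rightarrow> 'k) set) module" where
  "cilia_hopf K H S = itensor K S (\<lambda>_. halg H)"

primrec multi_coact ::
  "'k ring \<Rightarrow> ('k, 'h) hopf \<Rightarrow> nat set \<Rightarrow> (nat \<Rightarrow> ('k, 'h, 'h, 'n) lmc) \<Rightarrow> ('k, 'n) module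
     \<Rightarrow> nat list \<Rightarrow> (nat \<Rightarrow> 'h) \<Rightarrow> 'n \<Rightarrow> (((nat \<Rightarrow> 'h) \<Rightarrow> 'k) set \<times> 'n \<Rightarrow> 'k) set" where
  "multi_coact K H S N E [] b n = tprod K (cilia_hopf K H S) E (itprod K S (\<lambda>_. halg H) b) n"
| "multi_coact K H S N E (c # cs) b n =
     tensor_lift K (halg H) E (tensor K (cilia_hopf K H S) E) (\<lambda>h n'.
       multi_coact K H S N E cs (b(c := h)) n') (lcoact (N c) n)"

text \<open>The extended space with the joint (co)action of the tensor product of the \<open>H\<^sub>c\<close>, \<open>c \<in> S\<close>. The
  (co)actions of different cilia commute; the order of \<^typ>\<open>nat\<close> is used to write down the
  composites.\<close>

definition graph_lmc ::
  "'k ring \<Rightarrow> ('k, 'h) hopf \<Rightarrow> ('k, 'h, 'm) hopf_bimod \<Rightarrow> nat kitaev \<Rightarrow> nat set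
     \<Rightarrow> ('k, ((nat \<Rightarrow> 'h) \<Rightarrow> 'k) set, ((nat \<Rightarrow> 'h) \<Rightarrow> 'k) set, ((nat set \<Rightarrow> 'm) \<Rightarrow> 'k) set) lmc" where
  "graph_lmc K H M G S =
    (let E = ext_space K M G; N = cilium_lmc K H M G; cs = sorted_list_of_set S in
     \<lparr>lvs = E,
      lact = (\<lambda>t m. itensor_lift K S (\<lambda>_. halg H) E (\<lambda>a. fold (\<lambda>c. lact (N c) (a c)) cs m) t),
      lcoact = multi_coact K H S N E cs (\<lambda>_. undefined)\<rparr>)"

primrec factor_coact ::
  "'k ring \<Rightarrow> ('k, 'h) hopf \<Rightarrow> nat set \<Rightarrow> (nat \<Rightarrow> ('k, 'h, 'h, 'x) rmc) \<Rightarrow> (nat \<Rightarrow> 'x)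
     \<Rightarrow> nat list \<Rightarrow> (nat \<Rightarrow> 'x) \<Rightarrow> (nat \<Rightarrow> 'h)
     \<Rightarrow> (((nat \<Rightarrow> 'x) \<Rightarrow> 'k) set \<times> ((nat \<Rightarrow> 'h) \<Rightarrow> 'k) set \<Rightarrow> 'k) set" where
  "factor_coact K H S X v [] u b =
     tprod K (itensor K S (\<lambda>c. rvs (X c))) (cilia_hopf K H S)
       (itprod K S (\<lambda>c. rvs (X c)) u) (itprod K S (\<lambda>_. halg H) b)"
| "factor_coact K H S X v (c # cs) u b =
     tensor_lift K (rvs (X c)) (halg H)
       (tensor K (itensor K S (\<lambda>c. rvs (X c))) (cilia_hopf K H S)) (\<lambda>x h.
         factor_coact K H S X v cs (u(c := x)) (b(c := h))) (rcoact (X c) (v c))"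

definition coeff_rmc ::
  "'k ring \<Rightarrow> ('k, 'h) hopf \<Rightarrow> nat set \<Rightarrow> (nat \<Rightarrow> ('k, 'h, 'h, 'x) rmc)
     \<Rightarrow> ('k, ((nat \<Rightarrow> 'h) \<Rightarrow> 'k) set, ((nat \<Rightarrow> 'h) \<Rightarrow> 'k) set, ((nat \<Rightarrow> 'x) \<Rightarrow> 'k) set) rmc" where
  "coeff_rmc K H S X =
    (let V = (\<lambda>c. rvs (X c)); T = itensor K S V in
     \<lparr>rvs = T,
      ract = (\<lambda>x t. itensor_lift K S V T (\<lambda>v.
                itensor_lift K S (\<lambda>_. halg H) T (\<lambda>a. itprod K S V (\<lambda>c\<in>S. ract (X c) (v c) (a c))) t) x),
      rcoact = itensor_lift K S V (tensor K T (cilia_hopf K H S)) (\<lambda>v.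
                factor_coact K H S X v (sorted_list_of_set S) (\<lambda>_. undefined) (\<lambda>_. undefined))\<rparr>)"

abbreviation graph_Bit where
  "graph_Bit K H M G X \<equiv>
     Bit K (cilia_hopf K H (cilia G)) (cilia_hopf K H (cilia G))
       (coeff_rmc K H (cilia G) X) (graph_lmc K H M G (cilia G))"

subsection \<open>The coefficients of a connected sum\<close>

text \<open>\<open>sum_split\<close> applies the coproduct of \<open>H\<close>, and \<open>sum_merge\<close> its product, at the common cilium
  \<open>c\<^sub>0 = base G = base D\<close>.\<close>

definition sum_split ::
  "'k ring \<Rightarrow> ('k, 'h) hopf \<Rightarrow> nat kitaev \<Rightarrow> nat kitaev \<Rightarrow> ((nat \<Rightarrow> 'h) \<Rightarrow> 'k) set
     \<Rightarrow> (((nat \<Rightarrow> 'h) \<Rightarrow> 'k) set \<times> ((nat \<Rightarrow> 'h) \<Rightarrow> 'k) set \<Rightarrow> 'k) set" where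
  "sum_split K H G D =
    (let A = halg H; HG = cilia_hopf K H (cilia G); HD = cilia_hopf K H (cilia D);
         W = tensor K HG HD in
     itensor_lift K (cilia (conn_sum G D)) (\<lambda>_. A) W (\<lambda>a.
       tensor_lift K A A W (\<lambda>a1 a2.
         tprod K HG HD
           (itprod K (cilia G) (\<lambda>_. A) (\<lambda>c\<in>cilia G. if c = base G then a1 else a c))
           (itprod K (cilia D) (\<lambda>_. A) (\<lambda>d\<in>cilia D. if d = base D then a2 else a (shift G d))))
         (comult H (a (base G)))))"

definition sum_merge ::
  "'k ring \<Rightarrow> ('k, 'h) hopf \<Rightarrow> nat kitaev \<Rightarrow> nat kitaev
     \<Rightarrow> ((nat \<Rightarrow> 'h) \<Rightarrow> 'k) set \<Rightarrow> ((nat \<Rightarrow> 'h) \<Rightarrow> 'k) set \<Rightarrow> ((nat \<Rightarrow> 'h) \<Rightarrow> 'k) set" where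
  "sum_merge K H G D s t =
    (let A = halg H; C = cilia (conn_sum G D); W = cilia_hopf K H C in
     itensor_lift K (cilia G) (\<lambda>_. A) W (\<lambda>b.
       itensor_lift K (cilia D) (\<lambda>_. A) W (\<lambda>b'.
         itprod K C (\<lambda>_. A) (\<lambda>c\<in>C.
           if c = base G then b c \<otimes>\<^bsub>A\<^esub> b' (base D)
           else if c \<in> cilia G then b c else b' (c - Max (half G)))) t) s)"

definition sum_rmc ::
  "'k ring \<Rightarrow> ('k, 'h) hopf \<Rightarrow> nat kitaev \<Rightarrow> nat kitaev
     \<Rightarrow> (nat \<Rightarrow> ('k, 'h, 'h, 'x) rmc) \<Rightarrow> (nat \<Rightarrow> ('k, 'h, 'h, 'y) rmc)
     \<Rightarrow> ('k, ((nat \<Rightarrow> 'h) \<Rightarrow> 'k) set, ((nat \<Rightarrow> 'h) \<Rightarrow> 'k) set,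
         (((nat \<Rightarrow> 'x) \<Rightarrow> 'k) set \<times> ((nat \<Rightarrow> 'y) \<Rightarrow> 'k) set \<Rightarrow> 'k) set) rmc" where
  "sum_rmc K H G D X Y =
    (let XG = coeff_rmc K H (cilia G) X; YD = coeff_rmc K H (cilia D) Y;
         HG = cilia_hopf K H (cilia G); HD = cilia_hopf K H (cilia D);
         HS = cilia_hopf K H (cilia (conn_sum G D));
         V = rvs XG; W = rvs YD; T = tensor K V W; TH = tensor K T HS in
     \<lparr>rvs = T,
      ract = (\<lambda>z t. tensor_lift K HG HD T (\<lambda>s s'.
                tensor_map K V W V W (\<lambda>x. ract XG x s) (\<lambda>y. ract YD y s') z) (sum_split K H G D t)),
      rcoact = tensor_lift K V W TH (\<lambda>x y.
                tensor_lift K V HG TH (\<lambda>x0 b.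
                  tensor_lift K W HD TH (\<lambda>y0 b'.
                    tprod K T HS (tprod K V W x0 y0) (sum_merge K H G D b b'))
                    (rcoact YD y)) (rcoact XG x))\<rparr>)"

abbreviation sum_Bit where
  "sum_Bit K H M G D X Y \<equiv>
     Bit K (cilia_hopf K H (cilia (conn_sum G D))) (cilia_hopf K H (cilia (conn_sum G D)))
       (sum_rmc K H G D X Y) (graph_lmc K H M (conn_sum G D) (cilia (conn_sum G D)))"

section \<open>Separating the distinguished cilium\<close>

abbreviation rest :: "nat kitaev \<Rightarrow> nat set" where
  "rest G \<equiv> cilia G - {base G}"

text \<open>The Yetter--Drinfeld module \<open>P\<close> (and \<open>Q\<close>). For \<open>rest G = {}\<close> it is the tensor product of the
  extended space with the empty tensor product, which is the ground field.\<close>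

definition base_lmc where
  "base_lmc K H M G X =
     Bit_inherit K H (cilia_hopf K H (rest G)) (cilia_hopf K H (rest G))
       (coeff_rmc K H (rest G) X) (graph_lmc K H M G (rest G)) (cilium_lmc K H M G (base G))"

definition base_over where
  "base_over K H M G X =
     tensor_over K (cilia_hopf K H (rest G)) (coeff_rmc K H (rest G) X) (graph_lmc K H M G (rest G))"

definition base_proj where
  "base_proj K H M G X =
     proj_over K (cilia_hopf K H (rest G)) (coeff_rmc K H (rest G) X) (graph_lmc K H M G (rest G))"

text \<open>\<open>(\<Otimes>\<^sub>c x\<^sub>c) \<otimes> m \<mapsto> x\<^sub>b \<otimes> ((\<Otimes>\<^sub>c\<^sub>\<noteq>\<^sub>b x\<^sub>c) \<otimes> m)\<close> for \<open>b = base G\<close>\<close>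

definition graph_perm ::
  "'k ring \<Rightarrow> ('k, 'h, 'm) hopf_bimod \<Rightarrow> nat kitaev \<Rightarrow> (nat \<Rightarrow> ('k, 'h, 'h, 'x) rmc)
     \<Rightarrow> (((nat \<Rightarrow> 'x) \<Rightarrow> 'k) set \<times> ((nat set \<Rightarrow> 'm) \<Rightarrow> 'k) set \<Rightarrow> 'k) set
     \<Rightarrow> ('x \<times> (((nat \<Rightarrow> 'x) \<Rightarrow> 'k) set \<times> ((nat set \<Rightarrow> 'm) \<Rightarrow> 'k) set \<Rightarrow> 'k) set \<Rightarrow> 'k) set" where
  "graph_perm K M G X =
    (let V = (\<lambda>c. rvs (X c)); R = itensor K (rest G) V; E = ext_space K M G;
         W = tensor K (V (base G)) (tensor K R E) in
     tensor_lift K (itensor K (cilia G) V) E W (\<lambda>x m.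
       itensor_lift K (cilia G) V W (\<lambda>v.
         tprod K (V (base G)) (tensor K R E) (v (base G))
           (tprod K R E (itprod K (rest G) V (restrict v (rest G))) m)) x))"

text \<open>\<open>\<theta>\<close> is an isomorphism \<open>Bit X\<^sub>G M\<^sub>G \<rightarrow> Bit X\<^sub>b P\<close>, \<open>b = base G\<close>, which is given by permuting
  tensor factors: the class of an element \<open>z\<close> of the cotensor product is sent to the class of the
  element of \<open>X\<^sub>b \<otimes> P\<close> whose image in \<open>X\<^sub>b \<otimes> (X' \<otimes>\<^bsub>H'\<^esub> M\<^sub>G)\<close> is the class of the permuted \<open>z\<close>.
  There is at most one such \<open>\<theta>\<close> on the carrier. It always exists if \<open>base G\<close> is the only cilium; in general
  the assignment can fail to be well defined or bijective, because \<open>X\<^sub>b \<box> X' \<box> M\<^sub>G \<rightarrow> X\<^sub>b \<box> P\<close> need not be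
  surjective and \<open>X\<^sub>b \<otimes>\<^sub>H P \<rightarrow> X\<^sub>b \<otimes>\<^sub>H (X' \<otimes>\<^bsub>H'\<^esub> M\<^sub>G)\<close> need not be injective.\<close>

definition graph_identification where
  "graph_identification K H M G X \<theta> \<longleftrightarrow>
    (let b = base G; P = base_lmc K H M G X; V = rvs (X b);
         T = tensor K (rvs (coeff_rmc K H (rest G) X)) (ext_space K M G);
         R = base_over K H M G X in
     linear_iso K (graph_Bit K H M G X) (Bit K (halg H) (halg H) (X b) P) \<theta> \<and>
     (\<forall>z\<in>cotensor K (cilia_hopf K H (cilia G)) (coeff_rmc K H (cilia G) X) (graph_lmc K H M G (cilia G)).
        \<theta> (proj_over K (cilia_hopf K H (cilia G)) (coeff_rmc K H (cilia G) X)
             (graph_lmc K H M G (cilia G)) z) =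
        proj_over K (halg H) (X b) P
          (the_inv_into (carrier (tensor K V (lvs P))) (tensor_map K V (lvs P) V R id id)
            (tensor_map K V T V R id (base_proj K H M G X) (graph_perm K M G X z)))))"

text \<open>\<open>((\<Otimes>\<^sub>c x\<^sub>c) \<otimes> (\<Otimes>\<^sub>d y\<^sub>d)) \<otimes> (m \<otimes> n) \<mapsto>
  (x\<^sub>b \<otimes> y\<^sub>b) \<otimes> (((\<Otimes>\<^sub>c\<^sub>\<noteq>\<^sub>b x\<^sub>c) \<otimes> m) \<otimes> ((\<Otimes>\<^sub>d\<^sub>\<noteq>\<^sub>b y\<^sub>d) \<otimes> n))\<close>, where the tensor product over the edges
  of the connected sum is split into a factor for each of the two graphs\<close>

definition ext_split ::
  "'k ring \<Rightarrow> ('k, 'h, 'm) hopf_bimod \<Rightarrow> nat kitaev \<Rightarrow> nat kitaev \<Rightarrow> ((nat set \<Rightarrow> 'm) \<Rightarrow> 'k) set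
     \<Rightarrow> (((nat set \<Rightarrow> 'm) \<Rightarrow> 'k) set \<times> ((nat set \<Rightarrow> 'm) \<Rightarrow> 'k) set \<Rightarrow> 'k) set" where
  "ext_split K M G D =
    (let EG = ext_space K M G; ED = ext_space K M D in
     itensor_lift K (edges (conn_sum G D)) (\<lambda>_. bvs M) (tensor K EG ED) (\<lambda>v.
       tprod K EG ED
         (itprod K (edges G) (\<lambda>_. bvs M) (restrict v (edges G)))
         (itprod K (edges D) (\<lambda>_. bvs M) (\<lambda>e\<in>edges D. v (shift G ` e)))))"

definition sum_perm where
  "sum_perm K H M G D X Y =
    (let XG = itensor K (cilia G) (\<lambda>c. rvs (X c)); YD = itensor K (cilia D) (\<lambda>d. rvs (Y d));
         XR = itensor K (rest G) (\<lambda>c. rvs (X c)); YR = itensor K (rest D) (\<lambda>d. rvs (Y d));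
         Xb = rvs (X (base G)); Yb = rvs (Y (base D));
         EG = ext_space K M G; ED = ext_space K M D; ES = ext_space K M (conn_sum G D);
         TG = tensor K XR EG; TD = tensor K YR ED;
         W = tensor K (tensor K Xb Yb) (tensor K TG TD) in
     tensor_lift K (tensor K XG YD) ES W (\<lambda>u w.
       tensor_lift K XG YD W (\<lambda>x y.
         tensor_lift K EG ED W (\<lambda>m n.
           shuffle K Xb TG Yb TD
             (graph_perm K M G X (tprod K XG EG x m))
             (graph_perm K M D Y (tprod K YD ED y n)))
           (ext_split K M G D w)) u))"

definition sum_identification where
  "sum_identification K H M G D X Y \<theta> \<longleftrightarrow>
    (let Xb = X (base G); Yb = Y (base D);
         P = base_lmc K H M G X; Q = base_lmc K H M D Y;
         C = cilia_hopf K H (cilia (conn_sum G D));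
         XY = sum_rmc K H G D X Y; N = graph_lmc K H M (conn_sum G D) (cilia (conn_sum G D));
         V = tensor K (rvs Xb) (rvs Yb); PQ = tensor K (lvs P) (lvs Q);
         TG = tensor K (rvs (coeff_rmc K H (rest G) X)) (ext_space K M G);
         TD = tensor K (rvs (coeff_rmc K H (rest D) Y)) (ext_space K M D);
         RG = base_over K H M G X; RD = base_over K H M D Y; R = tensor K RG RD in
     linear_iso K (sum_Bit K H M G D X Y)
       (Bit K (halg H) (halg H) (rdiag K H Xb Yb) (ldiag K H P Q)) \<theta> \<and>
     (\<forall>z\<in>cotensor K C XY N.
        \<theta> (proj_over K C XY N z) =
        proj_over K (halg H) (rdiag K H Xb Yb) (ldiag K H P Q)
          (the_inv_into (carrier (tensor K V PQ))
            (tensor_map K V PQ V R id (tensor_map K (lvs P) (lvs Q) RG RD id id))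
            (tensor_map K V (tensor K TG TD) V R id
              (tensor_map K TG TD RG RD (base_proj K H M G X) (base_proj K H M D Y))
              (sum_perm K H M G D X Y z)))))"

end

theory Submission imports Defs begin

text \<open>The proof uses the graphs only to see that \<open>P\<close> and \<open>Q\<close> inherit a unital action and a linear
  coaction of \<open>H\<close>. This holds because the actions and coactions of different cilia commute: when the
  vertex action of one cilium is moved past the face coaction of another, the action at each half-edge
  leaves a factor in \<open>H\<close>, and the factors left at consecutive half-edges of the vertex cancel, since these
  half-edges are also consecutive in a face. The factor \<open>S\<^sup>-\<^sup>2\<close> in the definition of a Hopf bimodule
  makes sense because the antipode of a finite-dimensional Hopf algebra is bijective.

  The rest is linear algebra over a field. The diagonal and the factorwise structures have the same
  cotensor product, and the relations over \<open>H\<close> of the former hold over \<open>H \<otimes> H\<close>; so \<open>\<nu>\<close> is onto.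
  The map \<open>(x \<otimes> y) \<otimes> (p \<otimes> q) \<mapsto> (x \<otimes>\<^sub>H p) \<otimes> (y \<otimes>\<^sub>H q)\<close> is well defined over \<open>H \<otimes> H\<close>, and after \<open>\<kappa>\<close> it is
  the inclusion of a tensor product of subspaces; so \<open>\<kappa>\<close> is injective. Sections and retractions then
  give the exact sequence and the isomorphism.\<close>

section \<open>Linear maps, subspaces, quotients and tensor products over a field\<close>

section \<open>Vector spaces\<close>

text \<open>\<open>M\<close> and the coefficients may be infinite-dimensional, so no bases are used:
  Zorn's lemma gives complements, and these give for each linear f a map g with f g f = f.
  Retractions, sections, injectivity of a tensor product of injective maps, and the fact that ker
  (id \<otimes> f) comes from H \<otimes> ker f all follow. The last two make the coaction inherited
  by a bitensor product exist, since it is defined by inverting an injection and its values have to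
  lie in the range.

  The half-edge relations are computed for the left action only, with the right action evaluated at
  1, and are carried to the right action by the involution. The bimodule axiom is stated through
  lifts, however, so even at 1 it can be evaluated only once the inverse of the antipode is known to
  be linear.

  In the cancellation at a vertex, the leftover factor travels backwards once round the cyclic
  order. It starts and ends at \<rho>^-1(c), the first half-edge of the face of c itself, hence
  absent from the face of every other cilium, and is absorbed there by the counit.\<close>

locale base_field =
  fixes K :: "'k ring"
  assumes field_K: "field K"
begin

abbreviation vsp :: "('k, 'v) module \<Rightarrow> bool" where "vsp \<equiv> vectorspace K"

text \<open>Unlike \<open>linear_map\<close>, this does not contain that domain and codomain are
  vector spaces. Linearity goals can then be closed by backward chaining with few side conditions,
  and the predicate applies to codomains not yet known to be vector spaces, as in
  \<open>vs_image\<close>.\<close>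

definition lin :: "('k, 'v) module \<Rightarrow> ('k, 'w) module \<Rightarrow> ('v \<Rightarrow> 'w) \<Rightarrow> bool" where
  "lin V W f \<longleftrightarrow> f \<in> carrier V \<rightarrow> carrier W \<and>
     (\<forall>x\<in>carrier V. \<forall>y\<in>carrier V. f (x \<oplus>\<^bsub>V\<^esub> y) = f x \<oplus>\<^bsub>W\<^esub> f y) \<and>
     (\<forall>r\<in>carrier K. \<forall>x\<in>carrier V. f (r \<odot>\<^bsub>V\<^esub> x) = r \<odot>\<^bsub>W\<^esub> f x)"

lemma linI:
  assumes "\<And>x. x \<in> carrier V \<Longrightarrow> f x \<in> carrier W"
    "\<And>x y. x \<in> carrier V \<Longrightarrow> y \<in> carrier V \<Longrightarrow> f (x \<oplus>\<^bsub>V\<^esub> y) = f x \<oplus>\<^bsub>W\<^esub> f y"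
    "\<And>r x. r \<in> carrier K \<Longrightarrow> x \<in> carrier V \<Longrightarrow> f (r \<odot>\<^bsub>V\<^esub> x) = r \<odot>\<^bsub>W\<^esub> f x"
  shows "lin V W f"
  using assms unfolding lin_def by auto

lemma lin_closed: "lin V W f \<Longrightarrow> x \<in> carrier V \<Longrightarrow> f x \<in> carrier W"
  and lin_add: "lin V W f \<Longrightarrow> x \<in> carrier V \<Longrightarrow> y \<in> carrier V \<Longrightarrow> f (x \<oplus>\<^bsub>V\<^esub> y) = f x \<oplus>\<^bsub>W\<^esub> f y"
  and lin_smult: "lin V W f \<Longrightarrow> r \<in> carrier K \<Longrightarrow> x \<in> carrier V \<Longrightarrow> f (r \<odot>\<^bsub>V\<^esub> x) = r \<odot>\<^bsub>W\<^esub> f x"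
  unfolding lin_def by auto

lemma linear_map_iff: "linear_map K V W f \<longleftrightarrow> vsp V \<and> vsp W \<and> lin V W f"
  by (auto simp: linear_map_def mod_hom_def mod_hom_axioms_def module_hom_def lin_def
      vectorspace_def)

lemma vs_closed [simp]:
  assumes "vsp V"
  shows "\<zero>\<^bsub>V\<^esub> \<in> carrier V"
    "\<And>x y. x \<in> carrier V \<Longrightarrow> y \<in> carrier V \<Longrightarrow> x \<oplus>\<^bsub>V\<^esub> y \<in> carrier V"
    "\<And>x y. x \<in> carrier V \<Longrightarrow> y \<in> carrier V \<Longrightarrow> x \<ominus>\<^bsub>V\<^esub> y \<in> carrier V"
    "\<And>x. x \<in> carrier V \<Longrightarrow> \<ominus>\<^bsub>V\<^esub> x \<in> carrier V"
    "\<And>r x. r \<in> carrier K \<Longrightarrow> x \<in> carrier V \<Longrightarrow> r \<odot>\<^bsub>V\<^esub> x \<in> carrier V"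
proof -
  interpret vectorspace K V by fact
  show "\<zero>\<^bsub>V\<^esub> \<in> carrier V"
    "\<And>x y. x \<in> carrier V \<Longrightarrow> y \<in> carrier V \<Longrightarrow> x \<oplus>\<^bsub>V\<^esub> y \<in> carrier V"
    "\<And>x y. x \<in> carrier V \<Longrightarrow> y \<in> carrier V \<Longrightarrow> x \<ominus>\<^bsub>V\<^esub> y \<in> carrier V"
    "\<And>x. x \<in> carrier V \<Longrightarrow> \<ominus>\<^bsub>V\<^esub> x \<in> carrier V"
    "\<And>r x. r \<in> carrier K \<Longrightarrow> x \<in> carrier V \<Longrightarrow> r \<odot>\<^bsub>V\<^esub> x \<in> carrier V"
    by auto
qed

lemma vs_smult_zero: "vsp V \<Longrightarrow> x \<in> carrier V \<Longrightarrow> \<zero>\<^bsub>K\<^esub> \<odot>\<^bsub>V\<^esub> x = \<zero>\<^bsub>V\<^esub>"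
  using module.lmult_0[of K V x] by (auto simp: vectorspace_def)

lemma vs_minus_eq:
  assumes "vsp V" "x \<in> carrier V" "y \<in> carrier V"
  shows "x \<ominus>\<^bsub>V\<^esub> y = x \<oplus>\<^bsub>V\<^esub> ((\<ominus>\<^bsub>K\<^esub> \<one>\<^bsub>K\<^esub>) \<odot>\<^bsub>V\<^esub> y)"
proof -
  interpret vectorspace K V by fact
  show ?thesis using assms by (simp add: a_minus_def smult_minus_1)
qed

lemma lin_zero:
  assumes "vsp V" "vsp W" "lin V W f" shows "f \<zero>\<^bsub>V\<^esub> = \<zero>\<^bsub>W\<^esub>"
  using lin_smult[OF assms(3), of "\<zero>\<^bsub>K\<^esub>" "\<zero>\<^bsub>V\<^esub>"] assms field_K
  by (simp add: vs_smult_zero lin_closed field_def domain_def cring_def ring.ring_simprules)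

lemma K_closed [simp]: "\<zero>\<^bsub>K\<^esub> \<in> carrier K" "\<one>\<^bsub>K\<^esub> \<in> carrier K" "\<ominus>\<^bsub>K\<^esub> \<one>\<^bsub>K\<^esub> \<in> carrier K"
  using field_K by (simp_all add: field_def domain_def cring_def ring.ring_simprules)

lemma lin_minus:
  assumes "vsp V" "vsp W" "lin V W f" "x \<in> carrier V" "y \<in> carrier V"
  shows "f (x \<ominus>\<^bsub>V\<^esub> y) = f x \<ominus>\<^bsub>W\<^esub> f y"
  using assms by (simp add: vs_minus_eq lin_add lin_smult lin_closed)

lemma vs_minus_zero_iff:
  assumes "vsp V" "x \<in> carrier V" "y \<in> carrier V" shows "x \<ominus>\<^bsub>V\<^esub> y = \<zero>\<^bsub>V\<^esub> \<longleftrightarrow> x = y"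
proof -
  interpret vectorspace K V by fact
  show ?thesis using assms M.minus_other_side by blast
qed

lemma vsI:
  assumes "\<And>x y. x \<in> carrier V \<Longrightarrow> y \<in> carrier V \<Longrightarrow> x \<oplus>\<^bsub>V\<^esub> y \<in> carrier V"
    "\<zero>\<^bsub>V\<^esub> \<in> carrier V"
    "\<And>r x. r \<in> carrier K \<Longrightarrow> x \<in> carrier V \<Longrightarrow> r \<odot>\<^bsub>V\<^esub> x \<in> carrier V"
    "\<And>x. x \<in> carrier V \<Longrightarrow> \<exists>y\<in>carrier V. x \<oplus>\<^bsub>V\<^esub> y = \<zero>\<^bsub>V\<^esub>"
    "\<And>x y. x \<in> carrier V \<Longrightarrow> y \<in> carrier V \<Longrightarrow> x \<oplus>\<^bsub>V\<^esub> y = y \<oplus>\<^bsub>V\<^esub> x"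
    "\<And>x y z. x \<in> carrier V \<Longrightarrow> y \<in> carrier V \<Longrightarrow> z \<in> carrier V \<Longrightarrow>
       (x \<oplus>\<^bsub>V\<^esub> y) \<oplus>\<^bsub>V\<^esub> z = x \<oplus>\<^bsub>V\<^esub> (y \<oplus>\<^bsub>V\<^esub> z)"
    "\<And>x. x \<in> carrier V \<Longrightarrow> x \<oplus>\<^bsub>V\<^esub> \<zero>\<^bsub>V\<^esub> = x"
    "\<And>r s x. r \<in> carrier K \<Longrightarrow> s \<in> carrier K \<Longrightarrow> x \<in> carrier V \<Longrightarrow>
       (r \<otimes>\<^bsub>K\<^esub> s) \<odot>\<^bsub>V\<^esub> x = r \<odot>\<^bsub>V\<^esub> (s \<odot>\<^bsub>V\<^esub> x)"
    "\<And>x. x \<in> carrier V \<Longrightarrow> \<one>\<^bsub>K\<^esub> \<odot>\<^bsub>V\<^esub> x = x"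
    "\<And>r s x. r \<in> carrier K \<Longrightarrow> s \<in> carrier K \<Longrightarrow> x \<in> carrier V \<Longrightarrow>
       (r \<oplus>\<^bsub>K\<^esub> s) \<odot>\<^bsub>V\<^esub> x = r \<odot>\<^bsub>V\<^esub> x \<oplus>\<^bsub>V\<^esub> s \<odot>\<^bsub>V\<^esub> x"
    "\<And>r x y. r \<in> carrier K \<Longrightarrow> x \<in> carrier V \<Longrightarrow> y \<in> carrier V \<Longrightarrow>
       r \<odot>\<^bsub>V\<^esub> (x \<oplus>\<^bsub>V\<^esub> y) = r \<odot>\<^bsub>V\<^esub> x \<oplus>\<^bsub>V\<^esub> r \<odot>\<^bsub>V\<^esub> y"
  shows "vsp V"
proof -
  have "module K V"
    by (rule module_criteria) (use assms field_K in \<open>auto simp: field_def domain_def\<close>)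
  then show ?thesis by (simp add: vectorspace_def field_K)
qed

text \<open>The laws pass to a surjective image. The condition on zero is separate because
  \<open>W\<close> is not yet a vector space. Quotients, and tensor products with overwritten
  multiplicative fields, become vector spaces in this way.\<close>

lemma vs_image:
  assumes V: "vsp V" and f: "lin V W f" and im: "carrier W = f ` carrier V" and z: "f \<zero>\<^bsub>V\<^esub> = \<zero>\<^bsub>W\<^esub>"
  shows "vsp W"
proof -
  interpret V: vectorspace K V by fact
  have add: "f x \<oplus>\<^bsub>W\<^esub> f y = f (x \<oplus>\<^bsub>V\<^esub> y)" if "x \<in> carrier V" "y \<in> carrier V" for x y
    using lin_add[OF f] that by simp
  have sm: "r \<odot>\<^bsub>W\<^esub> f x = f (r \<odot>\<^bsub>V\<^esub> x)" if "r \<in> carrier K" "x \<in> carrier V" for r x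
    using lin_smult[OF f] that by simp
  have inv: "\<exists>y\<in>carrier V. f x \<oplus>\<^bsub>W\<^esub> f y = \<zero>\<^bsub>W\<^esub>" if "x \<in> carrier V" for x
    using that z add[of x "\<ominus>\<^bsub>V\<^esub> x"] by (metis V.M.a_inv_closed V.M.r_neg)
  have comm: "f (x \<oplus>\<^bsub>V\<^esub> y) = f (y \<oplus>\<^bsub>V\<^esub> x)" if "x \<in> carrier V" "y \<in> carrier V" for x y
    using that by (simp add: V.M.a_comm)
  show ?thesis
    by (rule vsI)
       (use inv[unfolded z[symmetric]] comm in \<open>auto simp: im add sm V.smult_l_distr V.smult_r_distr
          V.smult_assoc1 V.M.a_assoc z[symmetric]\<close>)
qed

lemma vs_cong:
  assumes "vsp V" "carrier W = carrier V" "add W = add V" "zero W = zero V" "smult W = smult V"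
  shows "vsp W"
  by (rule vs_image[OF assms(1), of W "\<lambda>x. x"]) (auto simp: assms lin_def)

lemma vs_module: "vsp V \<Longrightarrow> module K V"
  by (simp add: vectorspace_def)

lemma submoduleI:
  assumes "vsp V" "U \<subseteq> carrier V" "\<zero>\<^bsub>V\<^esub> \<in> U"
    "\<And>x y. x \<in> U \<Longrightarrow> y \<in> U \<Longrightarrow> x \<oplus>\<^bsub>V\<^esub> y \<in> U"
    "\<And>r x. r \<in> carrier K \<Longrightarrow> x \<in> U \<Longrightarrow> r \<odot>\<^bsub>V\<^esub> x \<in> U"
  shows "submodule K U V"
  using assms by (simp add: submodule_def vs_module)

lemma vs_sub: "vsp V \<Longrightarrow> submodule K U V \<Longrightarrow> vsp (V\<lparr>carrier := U\<rparr>)"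
  by (simp add: vectorspace.subspace_is_vs subspace_def)

lemma submodule_minus:
  assumes "submodule K U V" "x \<in> U" "y \<in> U" shows "x \<ominus>\<^bsub>V\<^esub> y \<in> U"
proof -
  interpret module K V using assms(1) by (simp add: submodule_def)
  have "y \<in> carrier V" using assms by (auto simp: submodule_def)
  then have "x \<ominus>\<^bsub>V\<^esub> y = x \<oplus>\<^bsub>V\<^esub> ((\<ominus>\<^bsub>K\<^esub> \<one>\<^bsub>K\<^esub>) \<odot>\<^bsub>V\<^esub> y)"
    by (simp add: a_minus_def smult_minus_1)
  with assms show ?thesis by (simp add: submodule_def)
qed

lemma submodule_kernel:
  assumes "vsp V" "vsp W" "lin V W f"
  shows "submodule K {x \<in> carrier V. f x = \<zero>\<^bsub>W\<^esub>} V"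
proof -
  interpret W: vectorspace K W by fact
  show ?thesis
    by (rule submoduleI) (use assms in \<open>auto simp: lin_add lin_smult lin_zero\<close>)
qed

lemma submodule_image:
  assumes "vsp V" "vsp W" "lin V W f" "submodule K U V"
  shows "submodule K (f ` U) W"
proof -
  have U: "U \<subseteq> carrier V" "\<zero>\<^bsub>V\<^esub> \<in> U" using assms(4) by (auto simp: submodule_def)
  show ?thesis
  proof (rule submoduleI)
    show "\<zero>\<^bsub>W\<^esub> \<in> f ` U" using lin_zero[OF assms(1-3)] U by (metis image_eqI)
    show "f ` U \<subseteq> carrier W" using lin_closed[OF assms(3)] U by auto
    show "x \<oplus>\<^bsub>W\<^esub> y \<in> f ` U" if xy: "x \<in> f ` U" "y \<in> f ` U" for x y
    proof -
      obtain a b where ab: "a \<in> U" "b \<in> U" "x = f a" "y = f b" using xy by auto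
      then have "x \<oplus>\<^bsub>W\<^esub> y = f (a \<oplus>\<^bsub>V\<^esub> b)" "a \<oplus>\<^bsub>V\<^esub> b \<in> U"
        using U assms(4) lin_add[OF assms(3), of a b, symmetric] by (auto simp: submodule_def)
      then show ?thesis by blast
    qed
    show "r \<odot>\<^bsub>W\<^esub> x \<in> f ` U" if rx: "r \<in> carrier K" "x \<in> f ` U" for r x
    proof -
      obtain a where ab: "a \<in> U" "x = f a" using rx by auto
      then have "r \<odot>\<^bsub>W\<^esub> x = f (r \<odot>\<^bsub>V\<^esub> a)" "r \<odot>\<^bsub>V\<^esub> a \<in> U"
        using U assms(4) rx lin_smult[OF assms(3), of r a, symmetric] by (auto simp: submodule_def)
      then show ?thesis by blast
    qed
  qed fact
qed

lemma submodule_carrier: "vsp V \<Longrightarrow> submodule K (carrier V) V"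
  by (rule submoduleI) auto

subsection \<open>Quotient spaces\<close>

lemma coset_mem: "z \<in> U +>\<^bsub>V\<^esub> x \<longleftrightarrow> (\<exists>u\<in>U. z = u \<oplus>\<^bsub>V\<^esub> x)"
  by (auto simp: a_r_coset_def')

lemma coset_self: "submodule K U V \<Longrightarrow> x \<in> carrier V \<Longrightarrow> x \<in> U +>\<^bsub>V\<^esub> x"
proof -
  assume a: "submodule K U V" "x \<in> carrier V"
  interpret module K V using a(1) by (simp add: submodule_def)
  show ?thesis using a by (auto simp: coset_mem submodule_def intro!: bexI[of _ "\<zero>\<^bsub>V\<^esub>"])
qed

lemma coset_subset: "submodule K U V \<Longrightarrow> x \<in> carrier V \<Longrightarrow> U +>\<^bsub>V\<^esub> x \<subseteq> carrier V"
proof -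
  assume a: "submodule K U V" "x \<in> carrier V"
  interpret module K V using a(1) by (simp add: submodule_def)
  have "U \<subseteq> carrier V" using a(1) by (simp add: submodule_def)
  then show ?thesis using a(2) by (auto simp: coset_mem intro!: a_closed)
qed

lemma coset_eqI:
  assumes U: "submodule K U V" and x: "x \<in> carrier V" and y: "y \<in> carrier V" and d: "x \<ominus>\<^bsub>V\<^esub> y \<in> U"
  shows "U +>\<^bsub>V\<^esub> x = U +>\<^bsub>V\<^esub> y"
proof -
  interpret module K V using U by (simp add: submodule_def)
  have sub: "U \<subseteq> carrier V" using U by (simp add: submodule_def)
  have *: "U +>\<^bsub>V\<^esub> x \<subseteq> U +>\<^bsub>V\<^esub> y" if x: "x \<in> carrier V" and y: "y \<in> carrier V"
    and d: "x \<ominus>\<^bsub>V\<^esub> y \<in> U" for x y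
  proof
    fix z assume "z \<in> U +>\<^bsub>V\<^esub> x"
    then obtain u where u: "u \<in> U" "z = u \<oplus>\<^bsub>V\<^esub> x" by (auto simp: coset_mem)
    have "z = (u \<oplus>\<^bsub>V\<^esub> (x \<ominus>\<^bsub>V\<^esub> y)) \<oplus>\<^bsub>V\<^esub> y"
      using u sub x y by (auto simp: a_minus_def a_assoc l_neg)
    moreover have "u \<oplus>\<^bsub>V\<^esub> (x \<ominus>\<^bsub>V\<^esub> y) \<in> U" using U u d by (simp add: submodule_def)
    ultimately show "z \<in> U +>\<^bsub>V\<^esub> y" by (auto simp: coset_mem)
  qed
  have "y \<ominus>\<^bsub>V\<^esub> x = \<ominus>\<^bsub>V\<^esub> (x \<ominus>\<^bsub>V\<^esub> y)" using x y by (simp add: a_minus_def minus_add a_comm)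
  also have "\<dots> = (\<ominus>\<^bsub>K\<^esub> \<one>\<^bsub>K\<^esub>) \<odot>\<^bsub>V\<^esub> (x \<ominus>\<^bsub>V\<^esub> y)" using x y by (simp add: smult_minus_1)
  finally have "y \<ominus>\<^bsub>V\<^esub> x \<in> U" using U d by (simp add: submodule_def)
  with * x y d show ?thesis by blast
qed

lemma coset_zero: "submodule K U V \<Longrightarrow> U +>\<^bsub>V\<^esub> \<zero>\<^bsub>V\<^esub> = U"
proof -
  assume a: "submodule K U V"
  interpret module K V using a by (simp add: submodule_def)
  have "U \<subseteq> carrier V" using a by (simp add: submodule_def)
  then have "\<And>u. u \<in> U \<Longrightarrow> u \<oplus>\<^bsub>V\<^esub> \<zero>\<^bsub>V\<^esub> = u" by auto
  then show ?thesis unfolding a_r_coset_def' by auto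
qed

lemma coset_eq_U: "vsp V \<Longrightarrow> submodule K U V \<Longrightarrow> x \<in> carrier V \<Longrightarrow> U +>\<^bsub>V\<^esub> x = U \<longleftrightarrow> x \<in> U"
  using coset_self coset_zero coset_eqI[of U V x "\<zero>\<^bsub>V\<^esub>"] submodule_minus[of U V x "\<zero>\<^bsub>V\<^esub>"]
  by (metis submodule.zero_closed vs_closed(1))

lemma carrier_quot: "carrier (quot_space V U) = (\<lambda>x. U +>\<^bsub>V\<^esub> x) ` carrier V"
  by (auto simp: quot_space_def A_RCOSETS_def')

lemma zero_quot [simp]: "\<zero>\<^bsub>quot_space V U\<^esub> = U"
  by (simp add: quot_space_def)

lemma lin_quot:
  assumes V: "vsp V" and U: "submodule K U V"
  shows "lin V (quot_space V U) (\<lambda>x. U +>\<^bsub>V\<^esub> x)"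
proof (rule linI)
  interpret vectorspace K V by fact
  have sub: "U \<subseteq> carrier V" using U by (simp add: submodule_def)
  fix x y assume x: "x \<in> carrier V" and y: "y \<in> carrier V"
  show "U +>\<^bsub>V\<^esub> x \<in> carrier (quot_space V U)" using x by (auto simp: carrier_quot)
  have "(U +>\<^bsub>V\<^esub> x) <+>\<^bsub>V\<^esub> (U +>\<^bsub>V\<^esub> y) = U +>\<^bsub>V\<^esub> (x \<oplus>\<^bsub>V\<^esub> y)"
  proof -
    have 1: "u \<oplus>\<^bsub>V\<^esub> x \<oplus>\<^bsub>V\<^esub> (u' \<oplus>\<^bsub>V\<^esub> y) = (u \<oplus>\<^bsub>V\<^esub> u') \<oplus>\<^bsub>V\<^esub> (x \<oplus>\<^bsub>V\<^esub> y)" if "u \<in> U" "u' \<in> U" for u u'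
    proof -
      have "u \<in> carrier V" "u' \<in> carrier V" using that sub by auto
      then show ?thesis using x y by (simp add: M.a_ac)
    qed
    have 2: "u \<oplus>\<^bsub>V\<^esub> (x \<oplus>\<^bsub>V\<^esub> y) = u \<oplus>\<^bsub>V\<^esub> x \<oplus>\<^bsub>V\<^esub> (\<zero>\<^bsub>V\<^esub> \<oplus>\<^bsub>V\<^esub> y)" if "u \<in> U" for u
      using that sub x y by (auto simp: M.a_assoc subsetD)
    have 3: "\<zero>\<^bsub>V\<^esub> \<in> U" "\<And>u u'. u \<in> U \<Longrightarrow> u' \<in> U \<Longrightarrow> u \<oplus>\<^bsub>V\<^esub> u' \<in> U"
      using U by (auto simp: submodule_def)
    show ?thesis
    proof (intro equalityI subsetI)
      fix z assume "z \<in> (U +>\<^bsub>V\<^esub> x) <+>\<^bsub>V\<^esub> (U +>\<^bsub>V\<^esub> y)"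
      then show "z \<in> U +>\<^bsub>V\<^esub> (x \<oplus>\<^bsub>V\<^esub> y)"
        unfolding set_add_def' a_r_coset_def' using 1 3 by auto
    next
      fix z assume "z \<in> U +>\<^bsub>V\<^esub> (x \<oplus>\<^bsub>V\<^esub> y)"
      then show "z \<in> (U +>\<^bsub>V\<^esub> x) <+>\<^bsub>V\<^esub> (U +>\<^bsub>V\<^esub> y)"
        unfolding set_add_def' a_r_coset_def' using 2 3(1) by fastforce
    qed
  qed
  then show "U +>\<^bsub>V\<^esub> (x \<oplus>\<^bsub>V\<^esub> y) = (U +>\<^bsub>V\<^esub> x) \<oplus>\<^bsub>quot_space V U\<^esub> (U +>\<^bsub>V\<^esub> y)"
    by (simp add: quot_space_def)
next
  interpret vectorspace K V by fact
  have sub: "U \<subseteq> carrier V" using U by (simp add: submodule_def)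
  fix r x assume r: "r \<in> carrier K" and x: "x \<in> carrier V"
  \<comment> \<open>Scalar multiplication of a coset is defined as a union over all its
    representatives; it is again a single coset because all members of the union coincide.\<close>
  have "U +>\<^bsub>V\<^esub> (r \<odot>\<^bsub>V\<^esub> z) = U +>\<^bsub>V\<^esub> (r \<odot>\<^bsub>V\<^esub> x)" if z: "z \<in> U +>\<^bsub>V\<^esub> x" for z
  proof (rule coset_eqI[OF U])
    have "z \<in> carrier V" using z coset_subset[OF U x] by auto
    then show "r \<odot>\<^bsub>V\<^esub> z \<in> carrier V" "r \<odot>\<^bsub>V\<^esub> x \<in> carrier V" using r x by auto
    obtain u where u: "u \<in> U" "z = u \<oplus>\<^bsub>V\<^esub> x" using z by (auto simp: coset_mem)
    have uc: "u \<in> carrier V" using u sub by auto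
    have "r \<odot>\<^bsub>V\<^esub> z = r \<odot>\<^bsub>V\<^esub> u \<oplus>\<^bsub>V\<^esub> r \<odot>\<^bsub>V\<^esub> x"
      unfolding u(2) by (rule smult_r_distr[OF r uc x])
    moreover have "a \<oplus>\<^bsub>V\<^esub> b \<ominus>\<^bsub>V\<^esub> b = a" if "a \<in> carrier V" "b \<in> carrier V" for a b
      using M.minus_other_side M.a_assoc that unfolding a_minus_def by (metis M.a_inv_closed M.r_neg M.r_zero)
    ultimately have "r \<odot>\<^bsub>V\<^esub> z \<ominus>\<^bsub>V\<^esub> r \<odot>\<^bsub>V\<^esub> x = r \<odot>\<^bsub>V\<^esub> u"
      using smult_closed[OF r x] smult_closed[OF r uc] by (simp only:)
    then show "r \<odot>\<^bsub>V\<^esub> z \<ominus>\<^bsub>V\<^esub> r \<odot>\<^bsub>V\<^esub> x \<in> U" using submodule.smult_closed[OF U r u(1)] by (simp only:)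
  qed
  then have "(\<Union>z\<in>U +>\<^bsub>V\<^esub> x. U +>\<^bsub>V\<^esub> (r \<odot>\<^bsub>V\<^esub> z)) = U +>\<^bsub>V\<^esub> (r \<odot>\<^bsub>V\<^esub> x)"
    using coset_self[OF U x] by (intro SUP_eq_const) blast+
  then show "U +>\<^bsub>V\<^esub> (r \<odot>\<^bsub>V\<^esub> x) = r \<odot>\<^bsub>quot_space V U\<^esub> (U +>\<^bsub>V\<^esub> x)"
    by (simp add: quot_space_def)
qed

lemma vs_quot: "vsp V \<Longrightarrow> submodule K U V \<Longrightarrow> vsp (quot_space V U)"
  by (rule vs_image[OF _ lin_quot]) (auto simp: carrier_quot coset_zero)

lemma coset_const:
  assumes V: "vsp V" and W: "vsp W" and U: "submodule K U V" and f: "lin V W f"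
    and z: "\<And>u. u \<in> U \<Longrightarrow> f u = \<zero>\<^bsub>W\<^esub>" and x: "x \<in> carrier V" and y: "y \<in> U +>\<^bsub>V\<^esub> x"
  shows "f y = f x"
proof -
  interpret W: vectorspace K W by fact
  obtain u where "u \<in> U" "y = u \<oplus>\<^bsub>V\<^esub> x" using y by (auto simp: coset_mem)
  moreover then have "u \<in> carrier V" using U by (auto simp: submodule_def)
  ultimately show ?thesis using z x lin_add[OF f] lin_closed[OF f] by simp
qed

text \<open>Maps out of quotients are written with \<open>the_elem\<close> of the image of a coset;
  this evaluates them as soon as the map kills the subspace.\<close>

lemma the_elem_coset:
  assumes "vsp V" "vsp W" "submodule K U V" "lin V W f"
    "\<And>u. u \<in> U \<Longrightarrow> f u = \<zero>\<^bsub>W\<^esub>" "x \<in> carrier V"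
  shows "the_elem (f ` (U +>\<^bsub>V\<^esub> x)) = f x"
proof -
  have "f ` (U +>\<^bsub>V\<^esub> x) = {f x}"
  proof (intro equalityI subsetI)
    fix y assume "y \<in> f ` (U +>\<^bsub>V\<^esub> x)"
    then obtain z where z: "z \<in> U +>\<^bsub>V\<^esub> x" "y = f z" by blast
    show "y \<in> {f x}" unfolding z(2) by (simp only: coset_const[OF assms z(1)] singleton_iff)
  next
    fix y assume "y \<in> {f x}"
    then show "y \<in> f ` (U +>\<^bsub>V\<^esub> x)" using coset_self[OF assms(3,6)] by blast
  qed
  then show ?thesis by simp
qed

lemma lin_quotI:
  assumes V: "vsp V" and U: "submodule K U V" and W: "vsp W" and f: "lin V W f"
    and e: "\<And>x. x \<in> carrier V \<Longrightarrow> g (U +>\<^bsub>V\<^esub> x) = f x"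
  shows "lin (quot_space V U) W g"
proof (rule linI)
  note q = lin_quot[OF V U]
  fix p p' assume "p \<in> carrier (quot_space V U)" "p' \<in> carrier (quot_space V U)"
  then obtain x y where x: "x \<in> carrier V" "p = U +>\<^bsub>V\<^esub> x" "y \<in> carrier V" "p' = U +>\<^bsub>V\<^esub> y"
    by (auto simp: carrier_quot)
  then show "g p \<in> carrier W" using e lin_closed[OF f] by simp
  show "g (p \<oplus>\<^bsub>quot_space V U\<^esub> p') = g p \<oplus>\<^bsub>W\<^esub> g p'"
    using x V lin_add[OF q, of x y, symmetric] lin_add[OF f, of x y] by (simp add: e)
next
  note q = lin_quot[OF V U]
  fix r p assume r: "r \<in> carrier K" and "p \<in> carrier (quot_space V U)"
  then obtain x where x: "x \<in> carrier V" "p = U +>\<^bsub>V\<^esub> x" by (auto simp: carrier_quot)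
  then show "g (r \<odot>\<^bsub>quot_space V U\<^esub> p) = r \<odot>\<^bsub>W\<^esub> g p"
    using r V lin_smult[OF q, of r x, symmetric] lin_smult[OF f, of r x] by (simp add: e)
qed

lemma submodule_span:
  "vsp V \<Longrightarrow> G \<subseteq> carrier V \<Longrightarrow> submodule K (LinearCombinations.module.span K V G) V"
  using module.span_is_submodule[OF vs_module] by blast

lemma span_base: "vsp V \<Longrightarrow> G \<subseteq> carrier V \<Longrightarrow> g \<in> G \<Longrightarrow> g \<in> LinearCombinations.module.span K V G"
  using module.in_own_span[OF vs_module] by blast

lemma span_in: "vsp V \<Longrightarrow> G \<subseteq> U \<Longrightarrow> submodule K U V \<Longrightarrow> u \<in> LinearCombinations.module.span K V G \<Longrightarrow> u \<in> U"
  using module.span_is_subset[OF vs_module] by blast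

lemma span_kernel:
  assumes "vsp V" "vsp W" "lin V W f" "G \<subseteq> carrier V" "\<And>g. g \<in> G \<Longrightarrow> f g = \<zero>\<^bsub>W\<^esub>"
    "u \<in> LinearCombinations.module.span K V G"
  shows "f u = \<zero>\<^bsub>W\<^esub>"
  using span_in[OF assms(1) _ submodule_kernel[OF assms(1-3)] assms(6)] assms(4,5) by auto

end

context base_field begin

subsection \<open>Free vector spaces and presentations\<close>

lemma ring_K: "ring K" "cring K"
  using field_K by (simp_all add: field_def domain_def cring_def)

lemma free_carrier:
  "f \<in> carrier (free_space K S) \<longleftrightarrow> f \<in> S \<rightarrow>\<^sub>E carrier K \<and> finite {s \<in> S. f s \<noteq> \<zero>\<^bsub>K\<^esub>}"
  by (simp add: free_space_def)

lemma free_add: "f \<oplus>\<^bsub>free_space K S\<^esub> g = (\<lambda>s\<in>S. f s \<oplus>\<^bsub>K\<^esub> g s)"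
  and free_smult: "r \<odot>\<^bsub>free_space K S\<^esub> f = (\<lambda>s\<in>S. r \<otimes>\<^bsub>K\<^esub> f s)"
  and free_zero: "\<zero>\<^bsub>free_space K S\<^esub> = (\<lambda>s\<in>S. \<zero>\<^bsub>K\<^esub>)"
  by (simp_all add: free_space_def ring.func_space_def[OF ring_K(1)])

lemma vsp_free [simp]: "vsp (free_space K S)"
proof -
  interpret K: field K by (rule field_K)
  let ?F = "K.func_space S" and ?C = "{f \<in> S \<rightarrow>\<^sub>E carrier K. finite {s \<in> S. f s \<noteq> \<zero>\<^bsub>K\<^esub>}}"
  have F: "vsp ?F" by (simp add: vectorspace_def K.func_space_is_module field_K)
  have "submodule K ?C ?F"
  proof (rule submoduleI[OF F])
    fix f g assume f: "f \<in> ?C" and g: "g \<in> ?C"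
    have "{s \<in> S. (f \<oplus>\<^bsub>?F\<^esub> g) s \<noteq> \<zero>\<^bsub>K\<^esub>} \<subseteq> {s \<in> S. f s \<noteq> \<zero>\<^bsub>K\<^esub>} \<union> {s \<in> S. g s \<noteq> \<zero>\<^bsub>K\<^esub>}"
      by (auto simp: K.func_space_def)
    moreover have "finite \<dots>" using f g by simp
    ultimately have "finite {s \<in> S. (f \<oplus>\<^bsub>?F\<^esub> g) s \<noteq> \<zero>\<^bsub>K\<^esub>}" by (rule finite_subset)
    with f g show "f \<oplus>\<^bsub>?F\<^esub> g \<in> ?C" by (auto simp: K.func_space_def)
  next
    fix r f assume r: "r \<in> carrier K" and f: "f \<in> ?C"
    have "{s \<in> S. (r \<odot>\<^bsub>?F\<^esub> f) s \<noteq> \<zero>\<^bsub>K\<^esub>} \<subseteq> {s \<in> S. f s \<noteq> \<zero>\<^bsub>K\<^esub>}"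
      using r by (auto simp: K.func_space_def)
    moreover have "finite \<dots>" using f by simp
    ultimately have "finite {s \<in> S. (r \<odot>\<^bsub>?F\<^esub> f) s \<noteq> \<zero>\<^bsub>K\<^esub>}" by (rule finite_subset)
    with r f show "r \<odot>\<^bsub>?F\<^esub> f \<in> ?C" by (auto simp: K.func_space_def)
  qed (auto simp: K.func_space_def)
  from vs_sub[OF F this] show ?thesis by (simp add: free_space_def)
qed

lemma free_gen_closed: "s \<in> S \<Longrightarrow> free_gen K S s \<in> carrier (free_space K S)"
proof -
  assume "s \<in> S"
  then have "{t \<in> S. free_gen K S s t \<noteq> \<zero>\<^bsub>K\<^esub>} \<subseteq> {s}" by (auto simp: free_gen_def)
  then show ?thesis unfolding free_carrier by (auto simp: free_gen_def intro: finite_subset)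
qed

text \<open>\<open>free_extend\<close> sums over the support, which changes under addition and
  scaling. Sums over a common finite superset can be compared term by term.\<close>

lemma free_extend_superset:
  assumes W: "vsp W" and \<phi>: "\<phi> \<in> S \<rightarrow> carrier W" and f: "f \<in> carrier (free_space K S)"
    and T: "finite T" "T \<subseteq> S" "{s \<in> S. f s \<noteq> \<zero>\<^bsub>K\<^esub>} \<subseteq> T"
  shows "free_extend K S W \<phi> f = (\<Oplus>\<^bsub>W\<^esub>s\<in>T. f s \<odot>\<^bsub>W\<^esub> \<phi> s)"
proof -
  interpret W: vectorspace K W by fact
  have c: "s \<in> S \<Longrightarrow> f s \<in> carrier K \<and> \<phi> s \<in> carrier W" for s
    using f \<phi> by (auto simp: free_carrier)
  show ?thesis
    unfolding free_extend_def
  proof (rule W.M.add.finprod_mono_neutral_cong_left)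
    show "f i \<odot>\<^bsub>W\<^esub> \<phi> i = \<zero>\<^bsub>W\<^esub>" if "i \<in> T - {s \<in> S. f s \<noteq> \<zero>\<^bsub>K\<^esub>}" for i
      using that c[of i] T W by (auto simp: vs_smult_zero)
  qed (use T c in auto)
qed

lemma lin_free_extend:
  assumes W: "vsp W" and \<phi>: "\<phi> \<in> S \<rightarrow> carrier W"
  shows "lin (free_space K S) W (free_extend K S W \<phi>)"
proof (rule linI)
  interpret W: vectorspace K W by fact
  let ?F = "free_space K S"
  note ext = free_extend_superset[OF W \<phi>]
  have c: "s \<in> S \<Longrightarrow> \<phi> s \<in> carrier W" "s \<in> S \<Longrightarrow> h \<in> carrier ?F \<Longrightarrow> h s \<in> carrier K" for s h
    using \<phi> by (auto simp: free_carrier)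
  fix f g assume f: "f \<in> carrier ?F" and g: "g \<in> carrier ?F"
  let ?T = "{s \<in> S. f s \<noteq> \<zero>\<^bsub>K\<^esub>} \<union> {s \<in> S. g s \<noteq> \<zero>\<^bsub>K\<^esub>}"
  have T: "finite ?T" "?T \<subseteq> S" using f g by (auto simp: free_carrier)
  show "free_extend K S W \<phi> f \<in> carrier W"
    using f T c by (subst ext[OF f T]) (auto intro!: W.M.finsum_closed)
  have fg: "f \<oplus>\<^bsub>?F\<^esub> g \<in> carrier ?F" using f g by simp
  have "free_extend K S W \<phi> (f \<oplus>\<^bsub>?F\<^esub> g) = (\<Oplus>\<^bsub>W\<^esub>s\<in>?T. (f \<oplus>\<^bsub>?F\<^esub> g) s \<odot>\<^bsub>W\<^esub> \<phi> s)"
    using fg T by (intro ext) (auto simp: free_add ring.ring_simprules[OF ring_K(1)])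
  also have "\<dots> = (\<Oplus>\<^bsub>W\<^esub>s\<in>?T. f s \<odot>\<^bsub>W\<^esub> \<phi> s \<oplus>\<^bsub>W\<^esub> g s \<odot>\<^bsub>W\<^esub> \<phi> s)"
    using f g c by (intro W.M.finsum_cong') (auto simp: free_add W.smult_l_distr)
  also have "\<dots> = (\<Oplus>\<^bsub>W\<^esub>s\<in>?T. f s \<odot>\<^bsub>W\<^esub> \<phi> s) \<oplus>\<^bsub>W\<^esub> (\<Oplus>\<^bsub>W\<^esub>s\<in>?T. g s \<odot>\<^bsub>W\<^esub> \<phi> s)"
    using f g c by (intro W.M.finsum_addf) auto
  finally show "free_extend K S W \<phi> (f \<oplus>\<^bsub>?F\<^esub> g) = free_extend K S W \<phi> f \<oplus>\<^bsub>W\<^esub> free_extend K S W \<phi> g"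
    using ext[OF f T] ext[OF g T] by simp
next
  interpret W: vectorspace K W by fact
  let ?F = "free_space K S"
  note ext = free_extend_superset[OF W \<phi>]
  have c: "s \<in> S \<Longrightarrow> \<phi> s \<in> carrier W" "s \<in> S \<Longrightarrow> h \<in> carrier ?F \<Longrightarrow> h s \<in> carrier K" for s h
    using \<phi> by (auto simp: free_carrier)
  fix r f assume r: "r \<in> carrier K" and f: "f \<in> carrier ?F"
  let ?T = "{s \<in> S. f s \<noteq> \<zero>\<^bsub>K\<^esub>}"
  have T: "finite ?T" "?T \<subseteq> S" using f by (auto simp: free_carrier)
  have rf: "r \<odot>\<^bsub>?F\<^esub> f \<in> carrier ?F" using r f by simp
  have "free_extend K S W \<phi> (r \<odot>\<^bsub>?F\<^esub> f) = (\<Oplus>\<^bsub>W\<^esub>s\<in>?T. (r \<odot>\<^bsub>?F\<^esub> f) s \<odot>\<^bsub>W\<^esub> \<phi> s)"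
    using rf T r by (intro ext) (auto simp: free_smult ring.ring_simprules[OF ring_K(1)])
  also have "\<dots> = (\<Oplus>\<^bsub>W\<^esub>s\<in>?T. r \<odot>\<^bsub>W\<^esub> (f s \<odot>\<^bsub>W\<^esub> \<phi> s))"
    using r f c by (intro W.M.finsum_cong') (auto simp: free_smult W.smult_assoc1)
  also have "\<dots> = r \<odot>\<^bsub>W\<^esub> (\<Oplus>\<^bsub>W\<^esub>s\<in>?T. f s \<odot>\<^bsub>W\<^esub> \<phi> s)"
    using r f c by (subst W.finsum_smult) (auto simp: o_def)
  finally show "free_extend K S W \<phi> (r \<odot>\<^bsub>?F\<^esub> f) = r \<odot>\<^bsub>W\<^esub> free_extend K S W \<phi> f"
    using ext[OF f T] by simp
qed

lemma free_extend_gen: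
  assumes W: "vsp W" and \<phi>: "\<phi> \<in> S \<rightarrow> carrier W" and s: "s \<in> S"
  shows "free_extend K S W \<phi> (free_gen K S s) = \<phi> s"
proof -
  interpret W: vectorspace K W by fact
  have "free_extend K S W \<phi> (free_gen K S s) = (\<Oplus>\<^bsub>W\<^esub>t\<in>{s}. free_gen K S s t \<odot>\<^bsub>W\<^esub> \<phi> t)"
    using s free_gen_closed by (intro free_extend_superset[OF W \<phi>]) (auto simp: free_gen_def)
  also have "\<dots> = \<phi> s" using s \<phi> by (auto simp: free_gen_def Pi_def)
  finally show ?thesis .
qed

text \<open>Induction on a finite set containing the support: one coordinate is set to zero at a
  time, and what is removed is a multiple of a generator.\<close>

lemma free_ext:
  assumes W: "vsp W" and f: "lin (free_space K S) W f" and g: "lin (free_space K S) W g"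
    and e: "\<And>s. s \<in> S \<Longrightarrow> f (free_gen K S s) = g (free_gen K S s)"
    and v: "v \<in> carrier (free_space K S)"
  shows "f v = g v"
proof -
  interpret K: field K by (rule field_K)
  let ?F = "free_space K S"
  have "\<forall>v\<in>carrier ?F. {s \<in> S. v s \<noteq> \<zero>\<^bsub>K\<^esub>} \<subseteq> T \<longrightarrow> f v = g v" if "finite T" for T
    using that
  proof induct
    case empty
    have "v = \<zero>\<^bsub>?F\<^esub>" if "v \<in> carrier ?F" "{s \<in> S. v s \<noteq> \<zero>\<^bsub>K\<^esub>} \<subseteq> {}" for v
    proof (rule ext)
      fix s show "v s = \<zero>\<^bsub>?F\<^esub> s"
        using that by (cases "s \<in> S") (auto simp: free_zero free_carrier PiE_def extensional_def)
    qed
    then show ?case using lin_zero[OF vsp_free W f] lin_zero[OF vsp_free W g] by auto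
  next
    case (insert s T)
    show ?case
    proof (intro ballI impI)
      fix v assume v: "v \<in> carrier ?F" and sub: "{t \<in> S. v t \<noteq> \<zero>\<^bsub>K\<^esub>} \<subseteq> insert s T"
      show "f v = g v"
      proof (cases "s \<in> S")
        case False
        then show ?thesis using insert v sub by auto
      next
        case True
        let ?w = "v(s := \<zero>\<^bsub>K\<^esub>)"
        have "finite {t \<in> S. ?w t \<noteq> \<zero>\<^bsub>K\<^esub>}"
          by (rule finite_subset[of _ "{t \<in> S. v t \<noteq> \<zero>\<^bsub>K\<^esub>}"]) (use v in \<open>auto simp: free_carrier\<close>)
        moreover have "?w \<in> S \<rightarrow>\<^sub>E carrier K"
          using v True by (auto simp: free_carrier PiE_def extensional_def)
        ultimately have w: "?w \<in> carrier ?F" by (simp only: free_carrier)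
        have vs: "v s \<in> carrier K" "\<And>t. t \<in> S \<Longrightarrow> v t \<in> carrier K" using v True by (auto simp: free_carrier)
        have eq: "v = ?w \<oplus>\<^bsub>?F\<^esub> v s \<odot>\<^bsub>?F\<^esub> free_gen K S s"
        proof (rule ext)
          fix t show "v t = (?w \<oplus>\<^bsub>?F\<^esub> v s \<odot>\<^bsub>?F\<^esub> free_gen K S s) t"
            using v vs by (auto simp: free_add free_smult free_gen_def free_carrier PiE_def extensional_def)
        qed
        have "f ?w = g ?w" by (rule insert(3)[rule_format, OF w]) (use sub in auto)
        then show ?thesis
          using w vs free_gen_closed[OF True] e[OF True]
          by (subst (1 2) eq) (simp add: lin_add[OF f] lin_add[OF g] lin_smult[OF f] lin_smult[OF g])
      qed
    qed
  qed
  with v show ?thesis by (auto simp: free_carrier)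
qed

text \<open>Tensor products of two factors and tensor products over an index set are both of this
  form, so the universal property is proved once, for generators and relations.\<close>

definition pres :: "'z set \<Rightarrow> ('z \<Rightarrow> 'k) set \<Rightarrow> ('k, ('z \<Rightarrow> 'k) set) module" where
  "pres S R = quot_space (free_space K S) (LinearCombinations.module.span K (free_space K S) R)"

definition pres_gen :: "'z set \<Rightarrow> ('z \<Rightarrow> 'k) set \<Rightarrow> 'z \<Rightarrow> ('z \<Rightarrow> 'k) set" where
  "pres_gen S R s =
     LinearCombinations.module.span K (free_space K S) R +>\<^bsub>free_space K S\<^esub> free_gen K S s"

context
  fixes S :: "'z set" and R
  assumes R: "R \<subseteq> carrier (free_space K S)"
begin

lemma vsp_pres: "vsp (pres S R)"
  unfolding pres_def using vsp_free R by (intro vs_quot submodule_span)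

lemma lin_pres: "lin (free_space K S) (pres S R)
    (\<lambda>x. LinearCombinations.module.span K (free_space K S) R +>\<^bsub>free_space K S\<^esub> x)"
  unfolding pres_def using vsp_free R by (intro lin_quot submodule_span)

lemma pres_gen_closed: "s \<in> S \<Longrightarrow> pres_gen S R s \<in> carrier (pres S R)"
  unfolding pres_gen_def by (rule lin_closed[OF lin_pres free_gen_closed])

lemma pres_ext:
  assumes W: "vsp W" and f: "lin (pres S R) W f" and g: "lin (pres S R) W g"
    and e: "\<And>s. s \<in> S \<Longrightarrow> f (pres_gen S R s) = g (pres_gen S R s)"
    and t: "t \<in> carrier (pres S R)"
  shows "f t = g t"
proof -
  let ?q = "\<lambda>x. LinearCombinations.module.span K (free_space K S) R +>\<^bsub>free_space K S\<^esub> x"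
  have lc: "lin (free_space K S) W (\<lambda>x. h (?q x))" if "lin (pres S R) W h" for h
    using that lin_pres unfolding lin_def by (auto simp: Pi_def)
  obtain x where x: "x \<in> carrier (free_space K S)" "t = ?q x"
    using t by (auto simp: pres_def carrier_quot)
  show ?thesis unfolding x(2)
    by (rule free_ext[OF W lc[OF f] lc[OF g] _ x(1)]) (use e in \<open>simp add: pres_gen_def\<close>)
qed

lemma pres_lift:
  assumes W: "vsp W" and \<phi>: "\<phi> \<in> S \<rightarrow> carrier W"
    and kill: "\<And>r. r \<in> R \<Longrightarrow> free_extend K S W \<phi> r = \<zero>\<^bsub>W\<^esub>"
  shows "lin (pres S R) W (\<lambda>t. the_elem (free_extend K S W \<phi> ` t))"
    and "s \<in> S \<Longrightarrow> the_elem (free_extend K S W \<phi> ` pres_gen S R s) = \<phi> s"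
proof -
  note l = lin_free_extend[OF W \<phi>]
  have e: "the_elem (free_extend K S W \<phi> `
      (LinearCombinations.module.span K (free_space K S) R +>\<^bsub>free_space K S\<^esub> x)) = free_extend K S W \<phi> x"
    if "x \<in> carrier (free_space K S)" for x
    using that by (intro the_elem_coset[OF vsp_free W submodule_span[OF vsp_free R] l]
        span_kernel[OF vsp_free W l R kill])
  show "lin (pres S R) W (\<lambda>t. the_elem (free_extend K S W \<phi> ` t))"
    unfolding pres_def by (rule lin_quotI[OF vsp_free submodule_span[OF vsp_free R] W l e])
  show "s \<in> S \<Longrightarrow> the_elem (free_extend K S W \<phi> ` pres_gen S R s) = \<phi> s"
    unfolding pres_gen_def by (simp add: e free_gen_closed free_extend_gen[OF W \<phi>])
qed

lemma pres_rel:
  assumes "x \<in> carrier (free_space K S)" "y \<in> carrier (free_space K S)" "x \<ominus>\<^bsub>free_space K S\<^esub> y \<in> R"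
  shows "LinearCombinations.module.span K (free_space K S) R +>\<^bsub>free_space K S\<^esub> x =
    LinearCombinations.module.span K (free_space K S) R +>\<^bsub>free_space K S\<^esub> y"
  using assms R by (intro coset_eqI submodule_span vsp_free span_base)

lemma pres_add:
  assumes "x \<in> carrier (free_space K S)" "y \<in> carrier (free_space K S)" "z \<in> carrier (free_space K S)"
    "x \<ominus>\<^bsub>free_space K S\<^esub> (y \<oplus>\<^bsub>free_space K S\<^esub> z) \<in> R"
  shows "LinearCombinations.module.span K (free_space K S) R +>\<^bsub>free_space K S\<^esub> x =
    (LinearCombinations.module.span K (free_space K S) R +>\<^bsub>free_space K S\<^esub> y) \<oplus>\<^bsub>pres S R\<^esub>
    (LinearCombinations.module.span K (free_space K S) R +>\<^bsub>free_space K S\<^esub> z)"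
  using pres_rel[OF assms(1) _ assms(4)] lin_add[OF lin_pres assms(2,3)] assms by simp

lemma pres_smult:
  assumes "x \<in> carrier (free_space K S)" "y \<in> carrier (free_space K S)" "r \<in> carrier K"
    "x \<ominus>\<^bsub>free_space K S\<^esub> (r \<odot>\<^bsub>free_space K S\<^esub> y) \<in> R"
  shows "LinearCombinations.module.span K (free_space K S) R +>\<^bsub>free_space K S\<^esub> x =
    r \<odot>\<^bsub>pres S R\<^esub> (LinearCombinations.module.span K (free_space K S) R +>\<^bsub>free_space K S\<^esub> y)"
  using pres_rel[OF assms(1) _ assms(4)] lin_smult[OF lin_pres assms(3,2)] assms by simp

end

subsection \<open>Binary tensor products\<close>

abbreviation tens (infixr "\<boxtimes>" 72) where "A \<boxtimes> B \<equiv> tensor K A B"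
abbreviation "tp \<equiv> tprod K"
abbreviation "tlf \<equiv> tensor_lift K"
abbreviation "tm \<equiv> tensor_map K"

definition bil :: "('k, 'a) module \<Rightarrow> ('k, 'b) module \<Rightarrow> ('k, 'w) module \<Rightarrow> ('a \<Rightarrow> 'b \<Rightarrow> 'w) \<Rightarrow> bool" where
  "bil A B W \<phi> \<longleftrightarrow> (\<forall>a\<in>carrier A. lin B W (\<lambda>b. \<phi> a b)) \<and> (\<forall>b\<in>carrier B. lin A W (\<lambda>a. \<phi> a b))"

lemma bilI:
  "(\<And>a. a \<in> carrier A \<Longrightarrow> lin B W (\<lambda>b. \<phi> a b)) \<Longrightarrow> (\<And>b. b \<in> carrier B \<Longrightarrow> lin A W (\<lambda>a. \<phi> a b)) \<Longrightarrow>
    bil A B W \<phi>"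
  by (simp add: bil_def)

lemma bilD:
  "bil A B W \<phi> \<Longrightarrow> a \<in> carrier A \<Longrightarrow> lin B W (\<lambda>b. \<phi> a b)"
  "bil A B W \<phi> \<Longrightarrow> b \<in> carrier B \<Longrightarrow> lin A W (\<lambda>a. \<phi> a b)"
  "bil A B W \<phi> \<Longrightarrow> a \<in> carrier A \<Longrightarrow> b \<in> carrier B \<Longrightarrow> \<phi> a b \<in> carrier W"
  unfolding bil_def by (blast intro: lin_closed)+

definition tgens :: "('k, 'a) module \<Rightarrow> ('k, 'b) module \<Rightarrow> ('a \<times> 'b \<Rightarrow> 'k) set" where
  "tgens A B =
    (let S = carrier A \<times> carrier B; F = free_space K S; g = (\<lambda>a b. free_gen K S (a, b)) in
      ({g (a \<oplus>\<^bsub>A\<^esub> a') b \<ominus>\<^bsub>F\<^esub> (g a b \<oplus>\<^bsub>F\<^esub> g a' b) | a a' b.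
          a \<in> carrier A \<and> a' \<in> carrier A \<and> b \<in> carrier B} \<union>
       {g a (b \<oplus>\<^bsub>B\<^esub> b') \<ominus>\<^bsub>F\<^esub> (g a b \<oplus>\<^bsub>F\<^esub> g a b') | a b b'.
          a \<in> carrier A \<and> b \<in> carrier B \<and> b' \<in> carrier B} \<union>
       {g (r \<odot>\<^bsub>A\<^esub> a) b \<ominus>\<^bsub>F\<^esub> (r \<odot>\<^bsub>F\<^esub> g a b) | r a b.
          r \<in> carrier K \<and> a \<in> carrier A \<and> b \<in> carrier B} \<union>
       {g a (r \<odot>\<^bsub>B\<^esub> b) \<ominus>\<^bsub>F\<^esub> (r \<odot>\<^bsub>F\<^esub> g a b) | r a b.
          r \<in> carrier K \<and> a \<in> carrier A \<and> b \<in> carrier B}))"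

lemma tgensI:
  fixes A :: "('k, 'a) module" and B :: "('k, 'b) module"
  defines "S \<equiv> carrier A \<times> carrier B"
  defines "F \<equiv> free_space K S"
  assumes "a \<in> carrier A" "b \<in> carrier B"
  shows "a' \<in> carrier A \<Longrightarrow> free_gen K S (a \<oplus>\<^bsub>A\<^esub> a', b) \<ominus>\<^bsub>F\<^esub>
      (free_gen K S (a, b) \<oplus>\<^bsub>F\<^esub> free_gen K S (a', b)) \<in> tgens A B"
    and "b' \<in> carrier B \<Longrightarrow> free_gen K S (a, b \<oplus>\<^bsub>B\<^esub> b') \<ominus>\<^bsub>F\<^esub>
      (free_gen K S (a, b) \<oplus>\<^bsub>F\<^esub> free_gen K S (a, b')) \<in> tgens A B"
    and "r \<in> carrier K \<Longrightarrow> free_gen K S (r \<odot>\<^bsub>A\<^esub> a, b) \<ominus>\<^bsub>F\<^esub>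
      (r \<odot>\<^bsub>F\<^esub> free_gen K S (a, b)) \<in> tgens A B"
    and "r \<in> carrier K \<Longrightarrow> free_gen K S (a, r \<odot>\<^bsub>B\<^esub> b) \<ominus>\<^bsub>F\<^esub>
      (r \<odot>\<^bsub>F\<^esub> free_gen K S (a, b)) \<in> tgens A B"
  using assms(3,4) unfolding S_def F_def tgens_def Let_def by blast+

lemma tensor_rel_span:
  "tensor_rel K A B = LinearCombinations.module.span K (free_space K (carrier A \<times> carrier B)) (tgens A B)"
  by (simp add: tensor_rel_def tgens_def Let_def)

lemma tensor_vs_pres: "tensor_vs K A B = pres (carrier A \<times> carrier B) (tgens A B)"
  by (simp add: tensor_vs_def pres_def tensor_rel_span)

lemma tprod_pres: "tp A B a b = pres_gen (carrier A \<times> carrier B) (tgens A B) (a, b)"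
  by (simp add: tprod_def pres_gen_def tensor_rel_span)

lemma tensor_fields [simp]:
  "carrier (A \<boxtimes> B) = carrier (tensor_vs K A B)" "add (A \<boxtimes> B) = add (tensor_vs K A B)"
  "zero (A \<boxtimes> B) = zero (tensor_vs K A B)" "smult (A \<boxtimes> B) = smult (tensor_vs K A B)"
  by (simp_all add: tensor_def)

lemma lin_tensor_vs: "lin (A \<boxtimes> B) W f \<longleftrightarrow> lin (tensor_vs K A B) W f"
  by (simp add: lin_def)

context
  fixes A :: "('k, 'a) module" and B :: "('k, 'b) module"
  assumes A: "vsp A" and B: "vsp B"
begin

lemma tgens_closed: "tgens A B \<subseteq> carrier (free_space K (carrier A \<times> carrier B))"
  using A B by (auto simp: tgens_def Let_def intro!: vs_closed free_gen_closed)

lemma vsp_tensor: "vsp (A \<boxtimes> B)"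
  by (rule vs_cong[OF vsp_pres[OF tgens_closed]]) (simp_all add: tensor_vs_pres)

lemma tp_closed: "a \<in> carrier A \<Longrightarrow> b \<in> carrier B \<Longrightarrow> tp A B a b \<in> carrier (A \<boxtimes> B)"
  by (simp add: tprod_pres tensor_vs_pres pres_gen_closed[OF tgens_closed])

lemma tp_linear:
  assumes "a \<in> carrier A" "b \<in> carrier B"
  shows "a' \<in> carrier A \<Longrightarrow> tp A B (a \<oplus>\<^bsub>A\<^esub> a') b = tp A B a b \<oplus>\<^bsub>A \<boxtimes> B\<^esub> tp A B a' b"
    and "b' \<in> carrier B \<Longrightarrow> tp A B a (b \<oplus>\<^bsub>B\<^esub> b') = tp A B a b \<oplus>\<^bsub>A \<boxtimes> B\<^esub> tp A B a b'"
    and "r \<in> carrier K \<Longrightarrow> tp A B (r \<odot>\<^bsub>A\<^esub> a) b = r \<odot>\<^bsub>A \<boxtimes> B\<^esub> tp A B a b"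
    and "r \<in> carrier K \<Longrightarrow> tp A B a (r \<odot>\<^bsub>B\<^esub> b) = r \<odot>\<^bsub>A \<boxtimes> B\<^esub> tp A B a b"
proof -
  let ?S = "carrier A \<times> carrier B"
  let ?F = "free_space K ?S"
  note rel_add = pres_add[OF tgens_closed] and rel_smult = pres_smult[OF tgens_closed]
  note simps = tprod_pres tensor_vs_pres pres_gen_def
  note gc = free_gen_closed[of _ ?S]
  show "tp A B (a \<oplus>\<^bsub>A\<^esub> a') b = tp A B a b \<oplus>\<^bsub>A \<boxtimes> B\<^esub> tp A B a' b" if "a' \<in> carrier A"
    unfolding simps tensor_fields
    by (rule rel_add) (use that assms A B in \<open>simp_all add: gc tgensI\<close>)
  show "tp A B a (b \<oplus>\<^bsub>B\<^esub> b') = tp A B a b \<oplus>\<^bsub>A \<boxtimes> B\<^esub> tp A B a b'" if "b' \<in> carrier B"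
    unfolding simps tensor_fields
    by (rule rel_add) (use that assms A B in \<open>simp_all add: gc tgensI\<close>)
  show "tp A B (r \<odot>\<^bsub>A\<^esub> a) b = r \<odot>\<^bsub>A \<boxtimes> B\<^esub> tp A B a b" if "r \<in> carrier K"
    unfolding simps tensor_fields
    by (rule rel_smult) (use that assms A B in \<open>simp_all add: gc tgensI\<close>)
  show "tp A B a (r \<odot>\<^bsub>B\<^esub> b) = r \<odot>\<^bsub>A \<boxtimes> B\<^esub> tp A B a b" if "r \<in> carrier K"
    unfolding simps tensor_fields
    by (rule rel_smult) (use that assms A B in \<open>simp_all add: gc tgensI\<close>)
qed

lemma tens_ext_elem:
  assumes W: "vsp W" and f: "lin (A \<boxtimes> B) W f" and g: "lin (A \<boxtimes> B) W g"
    and e: "\<And>a b. a \<in> carrier A \<Longrightarrow> b \<in> carrier B \<Longrightarrow> f (tp A B a b) = g (tp A B a b)"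
    and t: "t \<in> carrier (A \<boxtimes> B)"
  shows "f t = g t"
  by (rule pres_ext[OF tgens_closed W])
     (use f g t e in \<open>auto simp: lin_tensor_vs tensor_vs_pres tprod_pres\<close>)

context
  fixes W :: "('k, 'w) module" and \<phi>
  assumes W: "vsp W" and \<phi>: "bil A B W \<phi>"
begin

lemma tensor_lift_kill:
  assumes "r \<in> tgens A B"
  shows "free_extend K (carrier A \<times> carrier B) W (\<lambda>(a, b). \<phi> a b) r = \<zero>\<^bsub>W\<^esub>"
proof -
  let ?S = "carrier A \<times> carrier B"
  have p: "(\<lambda>(a, b). \<phi> a b) \<in> ?S \<rightarrow> carrier W" using bilD(3)[OF \<phi>] by auto
  note l = lin_free_extend[OF W p]
  note s = lin_minus[OF vsp_free W l] lin_add[OF l] lin_smult[OF l] free_extend_gen[OF W p]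
    free_gen_closed[of _ ?S] vsp_free lin_add[OF bilD(1)[OF \<phi>]] lin_add[OF bilD(2)[OF \<phi>]]
    lin_smult[OF bilD(1)[OF \<phi>]] lin_smult[OF bilD(2)[OF \<phi>]] vs_minus_zero_iff[OF W] bilD(3)[OF \<phi>]
  from assms show ?thesis
    unfolding tgens_def Let_def using A B W
    by (elim UnE CollectE exE conjE) (simp_all add: s del: tensor_fields)
qed

lemma lin_tl_self: "lin (A \<boxtimes> B) W (tlf A B W \<phi>)"
proof -
  have p: "(\<lambda>(a, b). \<phi> a b) \<in> carrier A \<times> carrier B \<rightarrow> carrier W" using bilD(3)[OF \<phi>] by auto
  show ?thesis
    using pres_lift(1)[OF tgens_closed W p tensor_lift_kill]
    by (simp add: lin_tensor_vs tensor_vs_pres tensor_lift_def[abs_def])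
qed

lemma tl_tp: "a \<in> carrier A \<Longrightarrow> b \<in> carrier B \<Longrightarrow> tlf A B W \<phi> (tp A B a b) = \<phi> a b"
proof -
  assume ab: "a \<in> carrier A" "b \<in> carrier B"
  have p: "(\<lambda>(a, b). \<phi> a b) \<in> carrier A \<times> carrier B \<rightarrow> carrier W" using bilD(3)[OF \<phi>] by auto
  show ?thesis
    using pres_lift(2)[OF tgens_closed W p tensor_lift_kill, of "(a, b)"] ab
    by (simp add: tensor_lift_def tprod_pres)
qed

end

end

text \<open>Simplification would otherwise replace the carrier and operations of
  \<open>A \<boxtimes> B\<close> by those of \<open>tensor_vs\<close>, where the rules about
  \<open>\<boxtimes>\<close> no longer match.\<close>

declare tensor_fields [simp del]

subsection \<open>Tensor products over index sets\<close>

definition mlin :: "'i set \<Rightarrow> ('i \<Rightarrow> ('k, 'v) module) \<Rightarrow> ('k, 'w) module \<Rightarrow> (('i \<Rightarrow> 'v) \<Rightarrow> 'w) \<Rightarrow> bool" where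
  "mlin I V W \<phi> \<longleftrightarrow> (\<forall>v\<in>\<Pi>\<^sub>E i\<in>I. carrier (V i). \<phi> v \<in> carrier W) \<and>
     (\<forall>v\<in>\<Pi>\<^sub>E i\<in>I. carrier (V i). \<forall>i\<in>I. lin (V i) W (\<lambda>x. \<phi> (v(i := x))))"

lemma mlinI:
  "(\<And>v. v \<in> (\<Pi>\<^sub>E i\<in>I. carrier (V i)) \<Longrightarrow> \<phi> v \<in> carrier W) \<Longrightarrow>
   (\<And>v i. v \<in> (\<Pi>\<^sub>E i\<in>I. carrier (V i)) \<Longrightarrow> i \<in> I \<Longrightarrow> lin (V i) W (\<lambda>x. \<phi> (v(i := x)))) \<Longrightarrow> mlin I V W \<phi>"
  by (simp add: mlin_def)

lemma mlinD:
  "mlin I V W \<phi> \<Longrightarrow> v \<in> (\<Pi>\<^sub>E i\<in>I. carrier (V i)) \<Longrightarrow> \<phi> v \<in> carrier W"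
  "mlin I V W \<phi> \<Longrightarrow> v \<in> (\<Pi>\<^sub>E i\<in>I. carrier (V i)) \<Longrightarrow> i \<in> I \<Longrightarrow> lin (V i) W (\<lambda>x. \<phi> (v(i := x)))"
  by (simp_all add: mlin_def)

definition itgens :: "'i set \<Rightarrow> ('i \<Rightarrow> ('k, 'v) module) \<Rightarrow> (('i \<Rightarrow> 'v) \<Rightarrow> 'k) set" where
  "itgens I V =
    (let S = (\<Pi>\<^sub>E i\<in>I. carrier (V i)); F = free_space K S; g = free_gen K S in
      ({g (v(i := x \<oplus>\<^bsub>V i\<^esub> y)) \<ominus>\<^bsub>F\<^esub> (g (v(i := x)) \<oplus>\<^bsub>F\<^esub> g (v(i := y))) | v i x y.
          v \<in> S \<and> i \<in> I \<and> x \<in> carrier (V i) \<and> y \<in> carrier (V i)} \<union>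
       {g (v(i := r \<odot>\<^bsub>V i\<^esub> x)) \<ominus>\<^bsub>F\<^esub> (r \<odot>\<^bsub>F\<^esub> g (v(i := x))) | v i r x.
          v \<in> S \<and> i \<in> I \<and> r \<in> carrier K \<and> x \<in> carrier (V i)}))"

lemma itgensI:
  fixes I :: "'i set" and V :: "'i \<Rightarrow> ('k, 'v) module"
  defines "S \<equiv> \<Pi>\<^sub>E i\<in>I. carrier (V i)"
  defines "F \<equiv> free_space K S"
  assumes "v \<in> S" "i \<in> I" "x \<in> carrier (V i)"
  shows "y \<in> carrier (V i) \<Longrightarrow> free_gen K S (v(i := x \<oplus>\<^bsub>V i\<^esub> y)) \<ominus>\<^bsub>F\<^esub>
      (free_gen K S (v(i := x)) \<oplus>\<^bsub>F\<^esub> free_gen K S (v(i := y))) \<in> itgens I V"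
    and "r \<in> carrier K \<Longrightarrow> free_gen K S (v(i := r \<odot>\<^bsub>V i\<^esub> x)) \<ominus>\<^bsub>F\<^esub>
      (r \<odot>\<^bsub>F\<^esub> free_gen K S (v(i := x))) \<in> itgens I V"
  using assms(3-5) unfolding S_def F_def itgens_def Let_def by blast+

lemma itensor_pres: "itensor K I V = pres (\<Pi>\<^sub>E i\<in>I. carrier (V i)) (itgens I V)"
  by (simp add: itensor_def pres_def itensor_rel_def itgens_def Let_def)

lemma itprod_pres: "itprod K I V v = pres_gen (\<Pi>\<^sub>E i\<in>I. carrier (V i)) (itgens I V) v"
  by (simp add: itprod_def pres_gen_def itensor_rel_def itgens_def Let_def)

lemma PiE_upd: "v \<in> (\<Pi>\<^sub>E i\<in>I. C i) \<Longrightarrow> i \<in> I \<Longrightarrow> x \<in> C i \<Longrightarrow> v(i := x) \<in> (\<Pi>\<^sub>E i\<in>I. C i)"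
  by (auto simp: PiE_def extensional_def Pi_def)

context
  fixes I :: "'i set" and V :: "'i \<Rightarrow> ('k, 'v) module"
  assumes V: "\<And>i. i \<in> I \<Longrightarrow> vsp (V i)"
begin

lemma itgens_closed: "itgens I V \<subseteq> carrier (free_space K (\<Pi>\<^sub>E i\<in>I. carrier (V i)))"
  unfolding itgens_def Let_def
  by (auto intro!: vs_closed vsp_free free_gen_closed PiE_upd simp: V)

lemma vsp_itensor: "vsp (itensor K I V)"
  unfolding itensor_pres by (rule vsp_pres[OF itgens_closed])

lemma itprod_closed: "v \<in> (\<Pi>\<^sub>E i\<in>I. carrier (V i)) \<Longrightarrow> itprod K I V v \<in> carrier (itensor K I V)"
  unfolding itensor_pres itprod_pres by (rule pres_gen_closed[OF itgens_closed])

lemma mlin_itprod: "mlin I V (itensor K I V) (itprod K I V)"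
proof (rule mlinI)
  let ?S = "\<Pi>\<^sub>E i\<in>I. carrier (V i)"
  fix v i assume v: "v \<in> ?S" and i: "i \<in> I"
  note rel_add = pres_add[OF itgens_closed] and rel_smult = pres_smult[OF itgens_closed]
  note simps = itprod_pres itensor_pres pres_gen_def
  note gc = free_gen_closed[of _ ?S]
  show "lin (V i) (itensor K I V) (\<lambda>x. itprod K I V (v(i := x)))"
  proof (rule linI)
    fix x y assume x: "x \<in> carrier (V i)" and y: "y \<in> carrier (V i)"
    then have m: "v(i := x) \<in> ?S" "v(i := y) \<in> ?S" "v(i := x \<oplus>\<^bsub>V i\<^esub> y) \<in> ?S"
      using v i V by (auto intro!: PiE_upd)
    show "itprod K I V (v(i := x)) \<in> carrier (itensor K I V)" by (rule itprod_closed[OF m(1)])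
    show "itprod K I V (v(i := x \<oplus>\<^bsub>V i\<^esub> y)) =
        itprod K I V (v(i := x)) \<oplus>\<^bsub>itensor K I V\<^esub> itprod K I V (v(i := y))"
      unfolding simps
      by (rule rel_add) (use m v i x y in \<open>simp_all add: gc itgensI\<close>)
  next
    fix r x assume r: "r \<in> carrier K" and x: "x \<in> carrier (V i)"
    then have m: "v(i := x) \<in> ?S" "v(i := r \<odot>\<^bsub>V i\<^esub> x) \<in> ?S"
      using v i V by (auto intro!: PiE_upd)
    show "itprod K I V (v(i := r \<odot>\<^bsub>V i\<^esub> x)) = r \<odot>\<^bsub>itensor K I V\<^esub> itprod K I V (v(i := x))"
      unfolding simps
      by (rule rel_smult) (use m v i x r in \<open>simp_all add: gc itgensI\<close>)
  qed
qed (rule itprod_closed)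

lemma itens_ext_elem:
  assumes W: "vsp W" and f: "lin (itensor K I V) W f" and g: "lin (itensor K I V) W g"
    and e: "\<And>v. v \<in> (\<Pi>\<^sub>E i\<in>I. carrier (V i)) \<Longrightarrow> f (itprod K I V v) = g (itprod K I V v)"
    and t: "t \<in> carrier (itensor K I V)"
  shows "f t = g t"
  by (rule pres_ext[OF itgens_closed W])
     (use f g t e in \<open>simp_all add: itensor_pres itprod_pres\<close>)

context
  fixes W :: "('k, 'w) module" and \<phi>
  assumes W: "vsp W" and \<phi>: "mlin I V W \<phi>"
begin

lemma itensor_lift_kill:
  assumes "r \<in> itgens I V"
  shows "free_extend K (\<Pi>\<^sub>E i\<in>I. carrier (V i)) W \<phi> r = \<zero>\<^bsub>W\<^esub>"
proof -
  let ?S = "\<Pi>\<^sub>E i\<in>I. carrier (V i)"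
  have p: "\<phi> \<in> ?S \<rightarrow> carrier W" using mlinD(1)[OF \<phi>] by auto
  note l = lin_free_extend[OF W p]
  have upd: "v(i := x) \<in> ?S" if "v \<in> ?S" "i \<in> I" "x \<in> carrier (V i)" for v i x
    using that by (auto intro!: PiE_upd)
  note s = lin_minus[OF vsp_free W l] lin_add[OF l] lin_smult[OF l] free_extend_gen[OF W p]
    free_gen_closed[of _ ?S] vsp_free lin_add[OF mlinD(2)[OF \<phi>]]
    lin_smult[OF mlinD(2)[OF \<phi>]] vs_minus_zero_iff[OF W] mlinD(1)[OF \<phi>] upd V W
  from assms show ?thesis
    unfolding itgens_def Let_def
    by (elim UnE CollectE exE conjE) (simp_all add: s)
qed

lemma lin_itl_self: "lin (itensor K I V) W (itensor_lift K I V W \<phi>)"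
proof -
  have p: "\<phi> \<in> (\<Pi>\<^sub>E i\<in>I. carrier (V i)) \<rightarrow> carrier W" using mlinD(1)[OF \<phi>] by auto
  show ?thesis
    using pres_lift(1)[OF itgens_closed W p itensor_lift_kill]
    by (simp add: itensor_pres itensor_lift_def[abs_def])
qed

lemma itl_itprod: "v \<in> (\<Pi>\<^sub>E i\<in>I. carrier (V i)) \<Longrightarrow> itensor_lift K I V W \<phi> (itprod K I V v) = \<phi> v"
proof -
  assume v: "v \<in> (\<Pi>\<^sub>E i\<in>I. carrier (V i))"
  have p: "\<phi> \<in> (\<Pi>\<^sub>E i\<in>I. carrier (V i)) \<rightarrow> carrier W" using mlinD(1)[OF \<phi>] by auto
  show ?thesis
    using pres_lift(2)[OF itgens_closed W p itensor_lift_kill] v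
    by (simp add: itensor_lift_def itprod_pres)
qed

end

end

subsection \<open>Generalised inverses\<close>

text \<open>Zorn's lemma on the subspaces that meet \<open>U\<close> only in zero. If a maximal one,
  \<open>C\<close>, left some v outside U + C, then C + Kv would still meet \<open>U\<close>
  trivially: in an element c + r v of \<open>U\<close> with r nonzero, dividing by r would put v
  into U + C.\<close>

lemma complement_exists:
  assumes V: "vsp V" and U: "submodule K U V"
  shows "\<exists>C. submodule K C V \<and> U \<inter> C = {\<zero>\<^bsub>V\<^esub>} \<and>
    (\<forall>v\<in>carrier V. \<exists>u\<in>U. \<exists>c\<in>C. v = u \<oplus>\<^bsub>V\<^esub> c)"
proof -
  interpret K: field K by (rule field_K)
  interpret V: vectorspace K V by fact
  note sm = submodule_def[of K _ V]
  have Uc: "U \<subseteq> carrier V" using U by (simp add: sm)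
  let ?A = "{C. submodule K C V \<and> U \<inter> C = {\<zero>\<^bsub>V\<^esub>}}"
  have zero: "submodule K {\<zero>\<^bsub>V\<^esub>} V" by (rule submoduleI[OF V]) auto
  have "\<exists>M\<in>?A. \<forall>X\<in>?A. M \<subseteq> X \<longrightarrow> X = M"
  proof (rule subset_Zorn_nonempty)
    have "{\<zero>\<^bsub>V\<^esub>} \<in> ?A" using zero U by (auto simp: sm)
    then show "?A \<noteq> {}" by blast
  next
    fix \<C> assume ne: "\<C> \<noteq> {}" and ch: "subset.chain ?A \<C>"
    have el: "submodule K C V" "U \<inter> C = {\<zero>\<^bsub>V\<^esub>}" if "C \<in> \<C>" for C
      using ch that by (auto simp: subset.chain_def)
    have tot: "C \<subseteq> C' \<or> C' \<subseteq> C" if "C \<in> \<C>" "C' \<in> \<C>" for C C'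
      using ch that by (meson subset_chain_def)
    note sub = submodule.subset[OF el(1)] submodule.zero_closed[OF el(1)]
      submodule.m_closed[OF el(1)] submodule.smult_closed[OF el(1)]
    have "submodule K (\<Union>\<C>) V"
    proof (rule submoduleI[OF V])
      show "\<Union>\<C> \<subseteq> carrier V" using sub(1) by blast
      show "\<zero>\<^bsub>V\<^esub> \<in> \<Union>\<C>" using ne sub(2) by blast
      show "r \<odot>\<^bsub>V\<^esub> x \<in> \<Union>\<C>" if "r \<in> carrier K" "x \<in> \<Union>\<C>" for r x
        using sub(4) that by blast
      fix x y assume "x \<in> \<Union>\<C>" "y \<in> \<Union>\<C>"
      then obtain C C' where c: "C \<in> \<C>" "C' \<in> \<C>" "x \<in> C" "y \<in> C'" by blast
      from tot[OF c(1,2)] show "x \<oplus>\<^bsub>V\<^esub> y \<in> \<Union>\<C>"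
        using c sub(3)[OF c(1), of x y] sub(3)[OF c(2), of x y] by blast
    qed
    moreover have "U \<inter> \<Union>\<C> = {\<zero>\<^bsub>V\<^esub>}" using ne el(2) by blast
    ultimately show "\<Union>\<C> \<in> ?A" by simp
  qed
  then obtain C where C': "C \<in> ?A" and max': "\<forall>X\<in>?A. C \<subseteq> X \<longrightarrow> X = C" by (elim bexE)
  have C: "submodule K C V" "U \<inter> C = {\<zero>\<^bsub>V\<^esub>}" using C' by simp_all
  have max: "X = C" if "submodule K X V" "U \<inter> X = {\<zero>\<^bsub>V\<^esub>}" "C \<subseteq> X" for X
    using max' that by simp
  have Cc: "C \<subseteq> carrier V" using C by (simp add: sm)
  have "\<exists>u\<in>U. \<exists>c\<in>C. v = u \<oplus>\<^bsub>V\<^esub> c" if v: "v \<in> carrier V" for v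
  proof (rule ccontr)
    assume no: "\<not> (\<exists>u\<in>U. \<exists>c\<in>C. v = u \<oplus>\<^bsub>V\<^esub> c)"
    let ?X = "{c \<oplus>\<^bsub>V\<^esub> r \<odot>\<^bsub>V\<^esub> v | c r. c \<in> C \<and> r \<in> carrier K}"
    have X: "submodule K ?X V"
    proof (rule submoduleI[OF V])
      show "?X \<subseteq> carrier V" using Cc v by auto
      have "\<zero>\<^bsub>V\<^esub> = \<zero>\<^bsub>V\<^esub> \<oplus>\<^bsub>V\<^esub> \<zero>\<^bsub>K\<^esub> \<odot>\<^bsub>V\<^esub> v" using v by simp
      moreover have "\<zero>\<^bsub>V\<^esub> \<in> C" using C by (simp add: sm)
      ultimately show "\<zero>\<^bsub>V\<^esub> \<in> ?X" by blast
    next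
      fix x y assume "x \<in> ?X" "y \<in> ?X"
      then obtain c r c' r' where x: "x = c \<oplus>\<^bsub>V\<^esub> r \<odot>\<^bsub>V\<^esub> v" "y = c' \<oplus>\<^bsub>V\<^esub> r' \<odot>\<^bsub>V\<^esub> v" "c \<in> C" "c' \<in> C"
        "r \<in> carrier K" "r' \<in> carrier K" by blast
      have "c \<in> carrier V" "c' \<in> carrier V" using x Cc by auto
      then have "x \<oplus>\<^bsub>V\<^esub> y = (c \<oplus>\<^bsub>V\<^esub> c') \<oplus>\<^bsub>V\<^esub> (r \<oplus>\<^bsub>K\<^esub> r') \<odot>\<^bsub>V\<^esub> v"
        using x v by (simp add: V.smult_l_distr V.M.a_ac)
      moreover have "c \<oplus>\<^bsub>V\<^esub> c' \<in> C" using C x by (simp add: sm)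
      ultimately show "x \<oplus>\<^bsub>V\<^esub> y \<in> ?X" using x by blast
    next
      fix s x assume s: "s \<in> carrier K" and "x \<in> ?X"
      then obtain c r where x: "x = c \<oplus>\<^bsub>V\<^esub> r \<odot>\<^bsub>V\<^esub> v" "c \<in> C" "r \<in> carrier K" by blast
      have "c \<in> carrier V" using x Cc by auto
      then have "s \<odot>\<^bsub>V\<^esub> x = s \<odot>\<^bsub>V\<^esub> c \<oplus>\<^bsub>V\<^esub> (s \<otimes>\<^bsub>K\<^esub> r) \<odot>\<^bsub>V\<^esub> v"
        using x v s by (simp add: V.smult_r_distr V.smult_assoc1)
      moreover have "s \<odot>\<^bsub>V\<^esub> c \<in> C" using C x s by (simp add: sm)
      ultimately show "s \<odot>\<^bsub>V\<^esub> x \<in> ?X" using x s by blast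
    qed
    have "U \<inter> ?X = {\<zero>\<^bsub>V\<^esub>}"
    proof (intro equalityI subsetI)
      fix u assume "u \<in> U \<inter> ?X"
      then obtain c r where u: "u \<in> U" "u = c \<oplus>\<^bsub>V\<^esub> r \<odot>\<^bsub>V\<^esub> v" "c \<in> C" "r \<in> carrier K" by blast
      have cu: "c \<in> carrier V" "u \<in> carrier V" using u Cc Uc by auto
      show "u \<in> {\<zero>\<^bsub>V\<^esub>}"
      proof (cases "r = \<zero>\<^bsub>K\<^esub>")
        case True
        then have "u = c" using u cu v by simp
        then show ?thesis using u C by blast
      next
        case False
        then have ri: "inv\<^bsub>K\<^esub> r \<in> carrier K" "inv\<^bsub>K\<^esub> r \<otimes>\<^bsub>K\<^esub> r = \<one>\<^bsub>K\<^esub>"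
          using u K.field_Units by auto
        let ?s = "inv\<^bsub>K\<^esub> r"
        have "r \<odot>\<^bsub>V\<^esub> v = u \<oplus>\<^bsub>V\<^esub> (\<ominus>\<^bsub>K\<^esub> \<one>\<^bsub>K\<^esub>) \<odot>\<^bsub>V\<^esub> c"
          using u cu v by (simp add: V.smult_minus_1 V.M.a_ac V.M.r_neg1 V.M.r_neg2)
        then have "?s \<odot>\<^bsub>V\<^esub> (r \<odot>\<^bsub>V\<^esub> v) = ?s \<odot>\<^bsub>V\<^esub> u \<oplus>\<^bsub>V\<^esub> ?s \<odot>\<^bsub>V\<^esub> ((\<ominus>\<^bsub>K\<^esub> \<one>\<^bsub>K\<^esub>) \<odot>\<^bsub>V\<^esub> c)"
          using ri cu V by (simp add: V.smult_r_distr)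
        moreover have "?s \<odot>\<^bsub>V\<^esub> (r \<odot>\<^bsub>V\<^esub> v) = v"
          using ri u v by (simp add: V.smult_assoc1[symmetric])
        moreover have "?s \<odot>\<^bsub>V\<^esub> u \<in> U" "?s \<odot>\<^bsub>V\<^esub> ((\<ominus>\<^bsub>K\<^esub> \<one>\<^bsub>K\<^esub>) \<odot>\<^bsub>V\<^esub> c) \<in> C"
          using U C u ri by (simp_all add: sm)
        ultimately show ?thesis using no by metis
      qed
    next
      fix u assume "u \<in> {\<zero>\<^bsub>V\<^esub>}"
      then show "u \<in> U \<inter> ?X" using U X by (simp add: sm)
    qed
    moreover have "C \<subseteq> ?X"
    proof
      fix c assume c: "c \<in> C"
      then have "c = c \<oplus>\<^bsub>V\<^esub> \<zero>\<^bsub>K\<^esub> \<odot>\<^bsub>V\<^esub> v" using Cc v by (auto simp: vs_smult_zero[OF V])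
      with c show "c \<in> ?X" by blast
    qed
    ultimately have "?X = C" using max[OF X] by blast
    moreover have "v = \<zero>\<^bsub>V\<^esub> \<oplus>\<^bsub>V\<^esub> \<one>\<^bsub>K\<^esub> \<odot>\<^bsub>V\<^esub> v" using v by simp
    moreover have "\<zero>\<^bsub>V\<^esub> \<in> C" "\<zero>\<^bsub>V\<^esub> \<in> U" using C U by (simp_all add: sm)
    ultimately have "v \<in> C" by blast
    then have "v = \<zero>\<^bsub>V\<^esub> \<oplus>\<^bsub>V\<^esub> v" using v by simp
    then show False using no \<open>v \<in> C\<close> \<open>\<zero>\<^bsub>V\<^esub> \<in> U\<close> by blast
  qed
  with C show ?thesis by blast
qed

text \<open>With complements \<open>C\<close> of the kernel and \<open>D\<close> of the image, f
  maps \<open>C\<close> bijectively onto its image; g inverts this bijection and vanishes on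
  \<open>D\<close>. For injective f the map g is a retraction, for surjective f a section.\<close>

lemma generalised_inverse:
  assumes V: "vsp V" and W: "vsp W" and f: "lin V W f"
  obtains g where "lin W V g" "\<And>v. v \<in> carrier V \<Longrightarrow> f (g (f v)) = f v"
proof -
  interpret V: vectorspace K V by fact
  interpret W: vectorspace K W by fact
  let ?N = "{v \<in> carrier V. f v = \<zero>\<^bsub>W\<^esub>}"
  obtain C where "submodule K C V \<and> ?N \<inter> C = {\<zero>\<^bsub>V\<^esub>} \<and>
      (\<forall>v\<in>carrier V. \<exists>u\<in>?N. \<exists>c\<in>C. v = u \<oplus>\<^bsub>V\<^esub> c)"
    using complement_exists[OF V submodule_kernel[OF V W f]] by (elim exE)
  then have C: "submodule K C V" "?N \<inter> C = {\<zero>\<^bsub>V\<^esub>}"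
    "\<And>v. v \<in> carrier V \<Longrightarrow> \<exists>u\<in>?N. \<exists>c\<in>C. v = u \<oplus>\<^bsub>V\<^esub> c" by simp_all
  obtain D where "submodule K D W \<and> f ` carrier V \<inter> D = {\<zero>\<^bsub>W\<^esub>} \<and>
      (\<forall>w\<in>carrier W. \<exists>u\<in>f ` carrier V. \<exists>d\<in>D. w = u \<oplus>\<^bsub>W\<^esub> d)"
    using complement_exists[OF W submodule_image[OF V W f submodule_carrier[OF V]]] by (elim exE)
  then have D: "submodule K D W" "f ` carrier V \<inter> D = {\<zero>\<^bsub>W\<^esub>}"
    "\<And>w. w \<in> carrier W \<Longrightarrow> \<exists>u\<in>f ` carrier V. \<exists>d\<in>D. w = u \<oplus>\<^bsub>W\<^esub> d" by simp_all
  have Cc: "C \<subseteq> carrier V" "D \<subseteq> carrier W" using C(1) D(1) by (simp_all add: submodule_def)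
  have fC: "\<exists>c\<in>C. f c = f v" if v: "v \<in> carrier V" for v
  proof -
    obtain u c where uc: "u \<in> ?N" "c \<in> C" "v = u \<oplus>\<^bsub>V\<^esub> c" using C(3)[OF v] by blast
    then have "f v = f c" using Cc lin_add[OF f, of u c] lin_closed[OF f, of c] by auto
    with uc show ?thesis by auto
  qed
  have ex: "\<exists>c\<in>C. \<exists>d\<in>D. w = f c \<oplus>\<^bsub>W\<^esub> d" if w: "w \<in> carrier W" for w
  proof -
    obtain v d where d: "v \<in> carrier V" "d \<in> D" "w = f v \<oplus>\<^bsub>W\<^esub> d" using D(3)[OF w] by blast
    obtain c where "c \<in> C" "f c = f v" using fC[OF d(1)] by blast
    with d show ?thesis by (intro bexI[of _ c] bexI[of _ d]) simp_all
  qed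
  have uniq: "c = c'" if "c \<in> C" "c' \<in> C" "d \<in> D" "d' \<in> D" "f c \<oplus>\<^bsub>W\<^esub> d = f c' \<oplus>\<^bsub>W\<^esub> d'" for c c' d d'
  proof -
    have c: "c \<in> carrier V" "c' \<in> carrier V" "d \<in> carrier W" "d' \<in> carrier W" using that Cc by auto
    then have fc: "f c \<in> carrier W" "f c' \<in> carrier W" using lin_closed[OF f] by auto
    have "f c \<ominus>\<^bsub>W\<^esub> f c' = d' \<ominus>\<^bsub>W\<^esub> d"
    proof -
      note e = that(5)
      have "f c = (f c \<oplus>\<^bsub>W\<^esub> d) \<ominus>\<^bsub>W\<^esub> d"
        using fc c by (simp add: a_minus_def W.M.a_assoc W.M.r_neg)
      also have "\<dots> = f c' \<oplus>\<^bsub>W\<^esub> d' \<ominus>\<^bsub>W\<^esub> d" by (simp only: e)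
      also have "\<dots> = (d' \<ominus>\<^bsub>W\<^esub> d) \<oplus>\<^bsub>W\<^esub> f c'" using fc c by (simp add: a_minus_def W.M.a_ac)
      finally show ?thesis
        using fc c by (simp add: a_minus_def W.M.a_assoc W.M.r_neg)
    qed
    moreover have "d' \<ominus>\<^bsub>W\<^esub> d \<in> D" by (rule submodule_minus[OF D(1) that(4,3)])
    moreover have "f c \<ominus>\<^bsub>W\<^esub> f c' = f (c \<ominus>\<^bsub>V\<^esub> c')" using lin_minus[OF V W f] c by simp
    moreover have cc: "c \<ominus>\<^bsub>V\<^esub> c' \<in> carrier V" using c by simp
    ultimately have "f (c \<ominus>\<^bsub>V\<^esub> c') = \<zero>\<^bsub>W\<^esub>" using D(2) by (metis IntI imageI singletonD)
    moreover have "c \<ominus>\<^bsub>V\<^esub> c' \<in> C" by (rule submodule_minus[OF C(1) that(1,2)])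
    ultimately have "c \<ominus>\<^bsub>V\<^esub> c' = \<zero>\<^bsub>V\<^esub>" using C(2) cc by blast
    then show ?thesis using vs_minus_zero_iff[OF V] c by blast
  qed
  define g where "g w = (THE c. c \<in> C \<and> (\<exists>d\<in>D. w = f c \<oplus>\<^bsub>W\<^esub> d))" for w
  have gI: "g w = c" if "c \<in> C" "d \<in> D" "w = f c \<oplus>\<^bsub>W\<^esub> d" for w c d
    unfolding g_def by (rule the_equality) (use that uniq in blast)+
  have gE: "\<exists>d\<in>D. g w \<in> C \<and> w = f (g w) \<oplus>\<^bsub>W\<^esub> d" if "w \<in> carrier W" for w
    using ex[OF that] gI by metis
  have "lin W V g"
  proof (rule linI)
    show "g w \<in> carrier V" if "w \<in> carrier W" for w using gE[OF that] Cc by blast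
    show "g (x \<oplus>\<^bsub>W\<^esub> y) = g x \<oplus>\<^bsub>V\<^esub> g y" if x: "x \<in> carrier W" and y: "y \<in> carrier W" for x y
    proof -
      obtain d d' where d: "d \<in> D" "g x \<in> C" "x = f (g x) \<oplus>\<^bsub>W\<^esub> d" "d' \<in> D" "g y \<in> C" "y = f (g y) \<oplus>\<^bsub>W\<^esub> d'"
        using gE[OF x] gE[OF y] by blast
      have c: "g x \<in> carrier V" "g y \<in> carrier V" "d \<in> carrier W" "d' \<in> carrier W" using d Cc by auto
      have "x \<oplus>\<^bsub>W\<^esub> y = (f (g x) \<oplus>\<^bsub>W\<^esub> d) \<oplus>\<^bsub>W\<^esub> (f (g y) \<oplus>\<^bsub>W\<^esub> d')" using d by simp
      also have "\<dots> = (f (g x) \<oplus>\<^bsub>W\<^esub> f (g y)) \<oplus>\<^bsub>W\<^esub> (d \<oplus>\<^bsub>W\<^esub> d')"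
        using c lin_closed[OF f] by (simp add: W.M.a_ac)
      also have "f (g x) \<oplus>\<^bsub>W\<^esub> f (g y) = f (g x \<oplus>\<^bsub>V\<^esub> g y)" using c lin_add[OF f] by simp
      finally show ?thesis
        using d C(1) D(1) by (intro gI[of _ "d \<oplus>\<^bsub>W\<^esub> d'"]) (auto simp: submodule_def)
    qed
    show "g (r \<odot>\<^bsub>W\<^esub> x) = r \<odot>\<^bsub>V\<^esub> g x" if r: "r \<in> carrier K" and x: "x \<in> carrier W" for r x
    proof -
      obtain d where d: "d \<in> D" "g x \<in> C" "x = f (g x) \<oplus>\<^bsub>W\<^esub> d" using gE[OF x] by blast
      have c: "g x \<in> carrier V" "d \<in> carrier W" using d Cc by auto
      have "r \<odot>\<^bsub>W\<^esub> x = r \<odot>\<^bsub>W\<^esub> (f (g x) \<oplus>\<^bsub>W\<^esub> d)" using d by simp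
      also have "\<dots> = f (r \<odot>\<^bsub>V\<^esub> g x) \<oplus>\<^bsub>W\<^esub> r \<odot>\<^bsub>W\<^esub> d"
        using c r lin_closed[OF f] by (simp add: W.smult_r_distr lin_smult[OF f])
      finally show ?thesis
        using d r C(1) D(1) by (intro gI[of _ "r \<odot>\<^bsub>W\<^esub> d"]) (auto simp: submodule_def)
    qed
  qed
  moreover have "f (g (f v)) = f v" if v: "v \<in> carrier V" for v
  proof -
    obtain c where c: "c \<in> C" "f c = f v" using fC[OF v] by blast
    have "\<zero>\<^bsub>W\<^esub> \<in> D" using D(1) by (simp add: submodule_def)
    moreover have "f v = f c \<oplus>\<^bsub>W\<^esub> \<zero>\<^bsub>W\<^esub>" using c lin_closed[OF f v] by simp
    ultimately have "g (f v) = c" using gI c by blast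
    with c show ?thesis by simp
  qed
  ultimately show ?thesis using that by blast
qed

end

text \<open>Closure and linearity rules for repeated backward application. A goal about a nested
  lift breaks up along its structure, which replaces the usual tacit remark that an expression in
  Sweedler notation is multilinear.\<close>

named_theorems lin_intros

context base_field begin

subsection \<open>Calculus of multilinear maps\<close>

lemma lin_id [lin_intros]: "lin V V (\<lambda>x. x)"
  by (simp add: lin_def)

lemma lin_id' [lin_intros]: "lin V V id"
  by (simp add: lin_def)

lemma lin_comp: "lin V W g \<Longrightarrow> lin U V f \<Longrightarrow> lin U W (\<lambda>x. g (f x))"
  by (auto simp: lin_def Pi_def)

lemma lin_cong: "vsp V \<Longrightarrow> lin V W f \<Longrightarrow> (\<And>x. x \<in> carrier V \<Longrightarrow> f x = g x) \<Longrightarrow> lin V W g"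
  by (auto simp: lin_def Pi_def)

lemma lin_plus:
  assumes "vsp W" "lin V W f" "lin V W g" shows "lin V W (\<lambda>x. f x \<oplus>\<^bsub>W\<^esub> g x)"
proof -
  interpret W: vectorspace K W by fact
  note c = lin_closed[OF assms(2)] lin_closed[OF assms(3)]
  note e = lin_add[OF assms(2)] lin_add[OF assms(3)] lin_smult[OF assms(2)] lin_smult[OF assms(3)]
  show ?thesis by (rule linI) (simp_all add: c e W.M.a_ac W.smult_r_distr)
qed

lemma lin_zero_fun:
  assumes "vsp W" shows "lin V W (\<lambda>x. \<zero>\<^bsub>W\<^esub>)"
proof -
  interpret W: vectorspace K W by fact
  show ?thesis by (rule linI) simp_all
qed

lemma lin_scale:
  assumes "vsp W" "lin V W f" "r \<in> carrier K" shows "lin V W (\<lambda>x. r \<odot>\<^bsub>W\<^esub> f x)"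
proof -
  interpret W: vectorspace K W by fact
  note c = lin_closed[OF assms(2)] assms(3)
  note e = lin_add[OF assms(2)] lin_smult[OF assms(2)]
  have "r \<odot>\<^bsub>W\<^esub> (s \<odot>\<^bsub>W\<^esub> f x) = s \<odot>\<^bsub>W\<^esub> (r \<odot>\<^bsub>W\<^esub> f x)" if "s \<in> carrier K" "x \<in> carrier V" for s x
    using c that by (simp add: W.smult_assoc1[symmetric] W.R.m_comm)
  then show ?thesis by (intro linI) (simp_all add: c e W.smult_r_distr)
qed

lemma lin_diff:
  assumes "vsp V" "vsp W" "lin V W f" "lin V W g" shows "lin V W (\<lambda>x. f x \<ominus>\<^bsub>W\<^esub> g x)"
proof (rule lin_cong[OF assms(1)])
  show "lin V W (\<lambda>x. f x \<oplus>\<^bsub>W\<^esub> (\<ominus>\<^bsub>K\<^esub> \<one>\<^bsub>K\<^esub>) \<odot>\<^bsub>W\<^esub> g x)"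
    by (intro lin_plus lin_scale assms) simp
  show "f x \<oplus>\<^bsub>W\<^esub> (\<ominus>\<^bsub>K\<^esub> \<one>\<^bsub>K\<^esub>) \<odot>\<^bsub>W\<^esub> g x = f x \<ominus>\<^bsub>W\<^esub> g x" if "x \<in> carrier V" for x
    using that assms by (simp add: vs_minus_eq lin_closed)
qed

lemma vs_minus_zero:
  assumes "vsp V" "x \<in> carrier V" shows "x \<ominus>\<^bsub>V\<^esub> \<zero>\<^bsub>V\<^esub> = x"
proof -
  interpret V: vectorspace K V by fact
  show ?thesis using assms(2) by (simp add: a_minus_def)
qed

lemma bil_arg1: "bil A B W \<phi> \<Longrightarrow> lin V A f \<Longrightarrow> b \<in> carrier B \<Longrightarrow> lin V W (\<lambda>x. \<phi> (f x) b)"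
  by (rule lin_comp[OF bilD(2)])

lemma bil_arg2: "bil A B W \<phi> \<Longrightarrow> lin V B f \<Longrightarrow> a \<in> carrier A \<Longrightarrow> lin V W (\<lambda>x. \<phi> a (f x))"
  by (rule lin_comp[OF bilD(1)])

lemmas [lin_intros] = bilI vsp_tensor vsp_itensor tp_closed

lemma bil_tp: "vsp A \<Longrightarrow> vsp B \<Longrightarrow> bil A B (A \<boxtimes> B) (tp A B)"
  by (intro bilI linI) (simp_all add: tp_linear tp_closed)

lemma lin_tpl [lin_intros]:
  "vsp A \<Longrightarrow> vsp B \<Longrightarrow> lin V A f \<Longrightarrow> b \<in> carrier B \<Longrightarrow> lin V (A \<boxtimes> B) (\<lambda>x. tp A B (f x) b)"
  by (rule bil_arg1[OF bil_tp])

lemma lin_tpr [lin_intros]: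
  "vsp A \<Longrightarrow> vsp B \<Longrightarrow> lin V B f \<Longrightarrow> a \<in> carrier A \<Longrightarrow> lin V (A \<boxtimes> B) (\<lambda>x. tp A B a (f x))"
  by (rule bil_arg2[OF bil_tp])

lemma tens_ext:
  assumes "vsp A" "vsp B" "vsp W" "lin (A \<boxtimes> B) W f" "lin (A \<boxtimes> B) W g"
    "\<And>a b. a \<in> carrier A \<Longrightarrow> b \<in> carrier B \<Longrightarrow> f (tp A B a b) = g (tp A B a b)"
  shows "\<forall>t\<in>carrier (A \<boxtimes> B). f t = g t"
  using tens_ext_elem[OF assms(1-5)] assms(6) by blast

lemma itens_ext:
  assumes "\<And>i. i \<in> I \<Longrightarrow> vsp (V i)" "vsp W" "lin (itensor K I V) W f" "lin (itensor K I V) W g"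
    "\<And>v. v \<in> (\<Pi>\<^sub>E i\<in>I. carrier (V i)) \<Longrightarrow> f (itprod K I V v) = g (itprod K I V v)"
  shows "\<forall>t\<in>carrier (itensor K I V). f t = g t"
  using itens_ext_elem[OF assms(1-4)] assms(5) by blast

lemma tl_closed [lin_intros]:
  "vsp A \<Longrightarrow> vsp B \<Longrightarrow> vsp W \<Longrightarrow> bil A B W \<phi> \<Longrightarrow> t \<in> carrier (A \<boxtimes> B) \<Longrightarrow> tlf A B W \<phi> t \<in> carrier W"
  by (rule lin_closed[OF lin_tl_self])

lemma lin_tl_arg [lin_intros]:
  "vsp A \<Longrightarrow> vsp B \<Longrightarrow> vsp W \<Longrightarrow> bil A B W \<phi> \<Longrightarrow> lin V (A \<boxtimes> B) f \<Longrightarrow> lin V W (\<lambda>x. tlf A B W \<phi> (f x))"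
  by (rule lin_comp[OF lin_tl_self])

text \<open>Here the parameter sits in the map that is lifted and not in the tensor. The dependence
  is linear because it is so on pure tensors.\<close>

lemma lin_tl_fun [lin_intros]:
  assumes A: "vsp A" and B: "vsp B" and W: "vsp W" and V: "vsp V"
    and l: "\<And>a b. a \<in> carrier A \<Longrightarrow> b \<in> carrier B \<Longrightarrow> lin V W (\<lambda>x. \<phi> x a b)"
    and b: "\<And>x. x \<in> carrier V \<Longrightarrow> bil A B W (\<lambda>a b. \<phi> x a b)"
    and t: "t \<in> carrier (A \<boxtimes> B)"
  shows "lin V W (\<lambda>x. tlf A B W (\<lambda>a b. \<phi> x a b) t)"
proof (rule linI)
  note s = lin_tl_self[OF A B W b] and e = tl_tp[OF A B W b]
  fix x y assume x: "x \<in> carrier V" and y: "y \<in> carrier V"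
  show "tlf A B W (\<phi> x) t \<in> carrier W" by (rule lin_closed[OF s[OF x] t])
  have xy: "x \<oplus>\<^bsub>V\<^esub> y \<in> carrier V" using V x y by simp
  have "\<forall>t\<in>carrier (A \<boxtimes> B). tlf A B W (\<phi> (x \<oplus>\<^bsub>V\<^esub> y)) t = tlf A B W (\<phi> x) t \<oplus>\<^bsub>W\<^esub> tlf A B W (\<phi> y) t"
    by (rule tens_ext[OF A B W s[OF xy] lin_plus[OF W s[OF x] s[OF y]]])
       (simp add: e x y xy lin_add[OF l])
  with t show "tlf A B W (\<phi> (x \<oplus>\<^bsub>V\<^esub> y)) t = tlf A B W (\<phi> x) t \<oplus>\<^bsub>W\<^esub> tlf A B W (\<phi> y) t" by simp
next
  note s = lin_tl_self[OF A B W b] and e = tl_tp[OF A B W b]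
  fix r x assume r: "r \<in> carrier K" and x: "x \<in> carrier V"
  have rx: "r \<odot>\<^bsub>V\<^esub> x \<in> carrier V" using V x r by simp
  have "\<forall>t\<in>carrier (A \<boxtimes> B). tlf A B W (\<phi> (r \<odot>\<^bsub>V\<^esub> x)) t = r \<odot>\<^bsub>W\<^esub> tlf A B W (\<phi> x) t"
    by (rule tens_ext[OF A B W s[OF rx] lin_scale[OF W s[OF x] r]])
       (simp add: e x r rx lin_smult[OF l])
  with t show "tlf A B W (\<phi> (r \<odot>\<^bsub>V\<^esub> x)) t = r \<odot>\<^bsub>W\<^esub> tlf A B W (\<phi> x) t" by simp
qed

lemma itl_closed [lin_intros]:
  "(\<And>i. i \<in> I \<Longrightarrow> vsp (V i)) \<Longrightarrow> vsp W \<Longrightarrow> mlin I V W \<phi> \<Longrightarrow> t \<in> carrier (itensor K I V) \<Longrightarrow>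
    itensor_lift K I V W \<phi> t \<in> carrier W"
  by (rule lin_closed[OF lin_itl_self])

lemma lin_itl_arg [lin_intros]:
  "(\<And>i. i \<in> I \<Longrightarrow> vsp (V i)) \<Longrightarrow> vsp W \<Longrightarrow> mlin I V W \<phi> \<Longrightarrow> lin U (itensor K I V) f \<Longrightarrow>
    lin U W (\<lambda>x. itensor_lift K I V W \<phi> (f x))"
  by (rule lin_comp[OF lin_itl_self])

lemma lin_itl_fun [lin_intros]:
  assumes V: "\<And>i. i \<in> I \<Longrightarrow> vsp (V i)" and W: "vsp W" and U: "vsp U"
    and l: "\<And>v. v \<in> (\<Pi>\<^sub>E i\<in>I. carrier (V i)) \<Longrightarrow> lin U W (\<lambda>x. \<phi> x v)"
    and b: "\<And>x. x \<in> carrier U \<Longrightarrow> mlin I V W (\<lambda>v. \<phi> x v)"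
    and t: "t \<in> carrier (itensor K I V)"
  shows "lin U W (\<lambda>x. itensor_lift K I V W (\<lambda>v. \<phi> x v) t)"
proof (rule linI)
  note s = lin_itl_self[OF V W b] and e = itl_itprod[OF V W b]
  fix x y assume x: "x \<in> carrier U" and y: "y \<in> carrier U"
  show "itensor_lift K I V W (\<phi> x) t \<in> carrier W" by (rule lin_closed[OF s[OF _ x] t])
  have xy: "x \<oplus>\<^bsub>U\<^esub> y \<in> carrier U" using U x y by simp
  have "\<forall>t\<in>carrier (itensor K I V). itensor_lift K I V W (\<phi> (x \<oplus>\<^bsub>U\<^esub> y)) t =
      itensor_lift K I V W (\<phi> x) t \<oplus>\<^bsub>W\<^esub> itensor_lift K I V W (\<phi> y) t"
    by (rule itens_ext[OF V W s[OF _ xy] lin_plus[OF W s[OF _ x] s[OF _ y]]])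
       (simp_all add: e x y xy lin_add[OF l])
  with t show "itensor_lift K I V W (\<phi> (x \<oplus>\<^bsub>U\<^esub> y)) t =
      itensor_lift K I V W (\<phi> x) t \<oplus>\<^bsub>W\<^esub> itensor_lift K I V W (\<phi> y) t" by simp
next
  note s = lin_itl_self[OF V W b] and e = itl_itprod[OF V W b]
  fix r x assume r: "r \<in> carrier K" and x: "x \<in> carrier U"
  have rx: "r \<odot>\<^bsub>U\<^esub> x \<in> carrier U" using U x r by simp
  have "\<forall>t\<in>carrier (itensor K I V). itensor_lift K I V W (\<phi> (r \<odot>\<^bsub>U\<^esub> x)) t =
      r \<odot>\<^bsub>W\<^esub> itensor_lift K I V W (\<phi> x) t"
    by (rule itens_ext[OF V W s[OF _ rx] lin_scale[OF W s[OF _ x] r]])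
       (simp_all add: e x r rx lin_smult[OF l])
  with t show "itensor_lift K I V W (\<phi> (r \<odot>\<^bsub>U\<^esub> x)) t = r \<odot>\<^bsub>W\<^esub> itensor_lift K I V W (\<phi> x) t" by simp
qed

lemma bil_cong:
  assumes "vsp A" "vsp B" "bil A B W \<phi>" "\<And>a b. a \<in> carrier A \<Longrightarrow> b \<in> carrier B \<Longrightarrow> \<phi> a b = \<psi> a b"
  shows "bil A B W \<psi>"
proof (rule bilI)
  show "lin B W (\<lambda>b. \<psi> a b)" if "a \<in> carrier A" for a
    by (rule lin_cong[OF assms(2) bilD(1)[OF assms(3) that]]) (simp add: assms that)
  show "lin A W (\<lambda>a. \<psi> a b)" if "b \<in> carrier B" for b
    by (rule lin_cong[OF assms(1) bilD(2)[OF assms(3) that]]) (simp add: assms that)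
qed

lemma tl_cong:
  assumes A: "vsp A" and B: "vsp B" and W: "vsp W" and b: "bil A B W (\<lambda>a b. \<phi> a b)"
    and t: "t \<in> carrier (A \<boxtimes> B)"
    and e: "\<And>a b. a \<in> carrier A \<Longrightarrow> b \<in> carrier B \<Longrightarrow> \<phi> a b = \<psi> a b"
  shows "tlf A B W (\<lambda>a b. \<phi> a b) t = tlf A B W (\<lambda>a b. \<psi> a b) t"
proof -
  note b' = bil_cong[OF A B b e]
  have "\<forall>t\<in>carrier (A \<boxtimes> B). tlf A B W \<phi> t = tlf A B W \<psi> t"
    by (rule tens_ext[OF A B W lin_tl_self[OF A B W b] lin_tl_self[OF A B W b']])
       (simp_all add: tl_tp[OF A B W b] tl_tp[OF A B W b'] e)
  with t show ?thesis by simp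
qed

text \<open>With \<open>tl_cong\<close> and \<open>tl_swap\<close> this is the calculus behind
  Sweedler notation: \<open>tlf A B W \<phi> t\<close> stands for the sum of
  \<open>\<phi> a b\<close> over any expression of t as a sum of tensors a \<otimes> b, and a linear
  map may be moved under the summation sign.\<close>

lemma tl_push:
  assumes A: "vsp A" and B: "vsp B" and W: "vsp W" and W': "vsp W'" and g: "lin W W' g"
    and b: "bil A B W (\<lambda>a b. \<phi> a b)" and t: "t \<in> carrier (A \<boxtimes> B)"
  shows "g (tlf A B W (\<lambda>a b. \<phi> a b) t) = tlf A B W' (\<lambda>a b. g (\<phi> a b)) t"
proof -
  have b': "bil A B W' (\<lambda>a b. g (\<phi> a b))"
    by (rule bilI) (rule lin_comp[OF g bilD(1)[OF b]] lin_comp[OF g bilD(2)[OF b]], assumption)+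
  have "\<forall>t\<in>carrier (A \<boxtimes> B). g (tlf A B W \<phi> t) = tlf A B W' (\<lambda>a b. g (\<phi> a b)) t"
    by (rule tens_ext[OF A B W' lin_comp[OF g lin_tl_self[OF A B W b]] lin_tl_self[OF A B W' b']])
       (simp add: tl_tp[OF A B W b] tl_tp[OF A B W' b'])
  with t show ?thesis by simp
qed

lemma tl_swap:
  assumes A: "vsp A" and B: "vsp B" and C: "vsp C" and D: "vsp D" and W: "vsp W"
    and t: "t \<in> carrier (A \<boxtimes> B)" and s: "s \<in> carrier (C \<boxtimes> D)"
    and b1: "\<And>c d. c \<in> carrier C \<Longrightarrow> d \<in> carrier D \<Longrightarrow> bil A B W (\<lambda>a b. \<phi> a b c d)"
    and b2: "\<And>a b. a \<in> carrier A \<Longrightarrow> b \<in> carrier B \<Longrightarrow> bil C D W (\<lambda>c d. \<phi> a b c d)"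
  shows "tlf A B W (\<lambda>a b. tlf C D W (\<lambda>c d. \<phi> a b c d) s) t =
    tlf C D W (\<lambda>c d. tlf A B W (\<lambda>a b. \<phi> a b c d) t) s"
proof -
  note d1 = bilD(1)[OF b1] bilD(2)[OF b1]
  note d2 = bilD(1)[OF b2] bilD(2)[OF b2]
  have m: "bil A B W (\<lambda>a b. tlf C D W (\<lambda>c d. \<phi> a b c d) s)"
    by (rule bilI) ((rule lin_tl_fun d1 b2 assms | assumption)+)
  have m': "bil C D W (\<lambda>c d. tlf A B W (\<lambda>a b. \<phi> a b c d) t)" if "t \<in> carrier (A \<boxtimes> B)" for t
    by (rule bilI) ((rule lin_tl_fun d2 b1 A B C D W that | assumption)+)
  have "\<forall>t\<in>carrier (A \<boxtimes> B). tlf A B W (\<lambda>a b. tlf C D W (\<lambda>c d. \<phi> a b c d) s) t =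
    tlf C D W (\<lambda>c d. tlf A B W (\<lambda>a b. \<phi> a b c d) t) s"
  proof (rule tens_ext[OF A B W])
    show "lin (A \<boxtimes> B) W (tlf A B W (\<lambda>a b. tlf C D W (\<lambda>c d. \<phi> a b c d) s))"
      by (rule lin_tl_self[OF A B W m])
    show "lin (A \<boxtimes> B) W (\<lambda>t. tlf C D W (\<lambda>c d. tlf A B W (\<lambda>a b. \<phi> a b c d) t) s)"
      by (rule lin_tl_fun[OF C D W vsp_tensor[OF A B] _ m' s]) (rule lin_tl_self[OF A B W b1])
    fix a b assume ab: "a \<in> carrier A" "b \<in> carrier B"
    have "tlf C D W (\<lambda>c d. \<phi> a b c d) s = tlf C D W (\<lambda>c d. tlf A B W (\<lambda>a b. \<phi> a b c d) (tp A B a b)) s"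
      by (rule tl_cong[OF C D W b2[OF ab] s]) (simp add: tl_tp[OF A B W b1] ab)
    then show "tlf A B W (\<lambda>a b. tlf C D W (\<lambda>c d. \<phi> a b c d) s) (tp A B a b) =
      tlf C D W (\<lambda>c d. tlf A B W (\<lambda>a b. \<phi> a b c d) (tp A B a b)) s"
      by (simp add: tl_tp[OF A B W m] ab)
  qed
  with t show ?thesis by simp
qed

lemma tl_id: "vsp A \<Longrightarrow> vsp B \<Longrightarrow> t \<in> carrier (A \<boxtimes> B) \<Longrightarrow> tlf A B (A \<boxtimes> B) (\<lambda>a b. tp A B a b) t = t"
  using tens_ext[of A B "A \<boxtimes> B" "tlf A B (A \<boxtimes> B) (\<lambda>a b. tp A B a b)" "\<lambda>t. t"]
  by (simp add: vsp_tensor bil_tp lin_tl_self tl_tp lin_id)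

lemma lin_tm [lin_intros]:
  "vsp A \<Longrightarrow> vsp B \<Longrightarrow> vsp C \<Longrightarrow> vsp D \<Longrightarrow> lin A C f \<Longrightarrow> lin B D g \<Longrightarrow> lin V (A \<boxtimes> B) h \<Longrightarrow>
    lin V (C \<boxtimes> D) (\<lambda>x. tm A B C D f g (h x))"
  unfolding tensor_map_def
  by (rule lin_tl_arg) ((rule lin_intros | assumption | erule lin_closed)+)

lemma tm_tp:
  "vsp A \<Longrightarrow> vsp B \<Longrightarrow> vsp C \<Longrightarrow> vsp D \<Longrightarrow> lin A C f \<Longrightarrow> lin B D g \<Longrightarrow> a \<in> carrier A \<Longrightarrow> b \<in> carrier B \<Longrightarrow>
    tm A B C D f g (tp A B a b) = tp C D (f a) (g b)"
  unfolding tensor_map_def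
  by (rule tl_tp) ((rule lin_intros | assumption | erule lin_closed)+)

lemma tm_closed [lin_intros]:
  "vsp A \<Longrightarrow> vsp B \<Longrightarrow> vsp C \<Longrightarrow> vsp D \<Longrightarrow> lin A C f \<Longrightarrow> lin B D g \<Longrightarrow> t \<in> carrier (A \<boxtimes> B) \<Longrightarrow>
    tm A B C D f g t \<in> carrier (C \<boxtimes> D)"
  by (rule lin_closed[OF lin_tm[OF _ _ _ _ _ _ lin_id]])

lemma bil_tl_tm:
  "vsp A \<Longrightarrow> vsp B \<Longrightarrow> vsp C \<Longrightarrow> vsp D \<Longrightarrow> lin A C f \<Longrightarrow> lin B D g \<Longrightarrow> bil A B (C \<boxtimes> D) (\<lambda>a b. tp C D (f a) (g b))"
  by ((rule lin_intros | assumption | erule lin_closed)+)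

lemma tl_tm:
  assumes v: "vsp A" "vsp B" "vsp C" "vsp D" "vsp W" and f: "lin A C f" and g: "lin B D g"
    and b: "bil C D W (\<lambda>c d. \<phi> c d)" and t: "t \<in> carrier (A \<boxtimes> B)"
  shows "tlf C D W (\<lambda>c d. \<phi> c d) (tm A B C D f g t) = tlf A B W (\<lambda>a b. \<phi> (f a) (g b)) t"
proof -
  have "tlf C D W (\<lambda>c d. \<phi> c d) (tm A B C D f g t) = tlf A B W (\<lambda>a b. tlf C D W \<phi> (tp C D (f a) (g b))) t"
    unfolding tensor_map_def
    by (rule tl_push) ((rule v t b lin_tl_self[OF v(3,4,5) b] bil_tl_tm[OF v(1-4) f g] vsp_tensor | assumption)+)
  also have "\<dots> = tlf A B W (\<lambda>a b. \<phi> (f a) (g b)) t"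
    by (rule tl_cong)
       ((rule v t b bilI lin_tl_arg lin_tpl lin_tpr f g tl_tp lin_closed[OF f] lin_closed[OF g] | assumption)+)
  finally show ?thesis .
qed

lemma tm_tm:
  assumes v: "vsp A" "vsp B" "vsp C" "vsp D" "vsp E" "vsp F"
    and f: "lin A C f" and g: "lin B D g" and f': "lin C E f'" and g': "lin D F g'"
    and t: "t \<in> carrier (A \<boxtimes> B)"
  shows "tm C D E F f' g' (tm A B C D f g t) = tm A B E F (\<lambda>x. f' (f x)) (\<lambda>x. g' (g x)) t"
  unfolding tensor_map_def[of K C D E F] tensor_map_def[of K A B E F]
  by (rule tl_tm)
     ((rule v vsp_tensor f g t bil_tl_tm f' g' | assumption)+)

lemma tm_cong:
  assumes v: "vsp A" "vsp B" "vsp C" "vsp D" and f: "lin A C f" and g: "lin B D g"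
    and t: "t \<in> carrier (A \<boxtimes> B)"
    and e: "\<And>x. x \<in> carrier A \<Longrightarrow> f x = f' x" "\<And>x. x \<in> carrier B \<Longrightarrow> g x = g' x"
  shows "tm A B C D f g t = tm A B C D f' g' t"
  unfolding tensor_map_def
  by (rule tl_cong[OF v(1,2) vsp_tensor[OF v(3,4)] bil_tl_tm[OF v f g] t]) (simp add: e)

lemma tm_id:
  assumes v: "vsp A" "vsp B" and t: "t \<in> carrier (A \<boxtimes> B)"
    and e: "\<And>x. x \<in> carrier A \<Longrightarrow> f x = x" "\<And>x. x \<in> carrier B \<Longrightarrow> g x = x"
  shows "tm A B A B f g t = t"
proof -
  have "tm A B A B (\<lambda>x. x) (\<lambda>x. x) t = tm A B A B f g t"
    by (rule tm_cong[OF v v lin_id lin_id t]) (simp_all add: e)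
  then show ?thesis using tl_id[OF v t] by (simp add: tensor_map_def)
qed

text \<open>Over a field both maps have retractions, and the tensor product of these is a
  retraction.\<close>

lemma tm_inj:
  assumes v: "vsp A" "vsp B" "vsp C" "vsp D" and f: "lin A C f" and g: "lin B D g"
    and i: "inj_on f (carrier A)" "inj_on g (carrier B)"
  shows "inj_on (tm A B C D f g) (carrier (A \<boxtimes> B))"
proof -
  obtain f' where f': "lin C A f'" "\<And>x. x \<in> carrier A \<Longrightarrow> f (f' (f x)) = f x"
    by (rule generalised_inverse[OF v(1,3) f]) (rule that)
  obtain g' where g': "lin D B g'" "\<And>x. x \<in> carrier B \<Longrightarrow> g (g' (g x)) = g x"
    by (rule generalised_inverse[OF v(2,4) g]) (rule that)
  have e: "f' (f x) = x" if "x \<in> carrier A" for x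
    by (rule inj_onD[OF i(1) f'(2)[OF that] lin_closed[OF f'(1) lin_closed[OF f that]] that])
  have e': "g' (g x) = x" if "x \<in> carrier B" for x
    by (rule inj_onD[OF i(2) g'(2)[OF that] lin_closed[OF g'(1) lin_closed[OF g that]] that])
  show ?thesis
  proof (rule inj_on_inverseI)
    fix t assume t: "t \<in> carrier (A \<boxtimes> B)"
    show "tm C D A B f' g' (tm A B C D f g t) = t"
      by (simp add: tm_tm[OF v v(1,2) f g f'(1) g'(1) t] tm_id[OF v(1,2) t] e e')
  qed
qed

lemma lin_sub: "vsp V \<Longrightarrow> submodule K U V \<Longrightarrow> lin (V\<lparr>carrier := U\<rparr>) V (\<lambda>x. x)"
  by (auto simp: lin_def submodule_def)

text \<open>Exactness of tensoring with \<open>H\<close>. If f g f = f, then 1 - g f maps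
  \<open>T\<close> into the kernel of f, and an element killed by id \<otimes> f is fixed by id
  \<otimes> (1 - g f).\<close>

lemma tensor_kernel:
  assumes H: "vsp H" and T: "vsp T" and W: "vsp W" and f: "lin T W f"
    and t: "t \<in> carrier (H \<boxtimes> T)" and k: "tm H T H W (\<lambda>x. x) f t = \<zero>\<^bsub>H \<boxtimes> W\<^esub>"
  defines "Z \<equiv> T\<lparr>carrier := {z \<in> carrier T. f z = \<zero>\<^bsub>W\<^esub>}\<rparr>"
  shows "\<exists>s\<in>carrier (H \<boxtimes> Z). t = tm H Z H T (\<lambda>x. x) (\<lambda>x. x) s"
proof -
  note sub = submodule_kernel[OF T W f]
  have Z: "vsp Z" unfolding Z_def by (rule vs_sub[OF T sub])
  have ZT: "lin Z T (\<lambda>x. x)" unfolding Z_def by (rule lin_sub[OF T sub])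
  obtain g where g: "lin W T g" "\<And>v. v \<in> carrier T \<Longrightarrow> f (g (f v)) = f v"
    by (rule generalised_inverse[OF T W f]) (rule that)
  have gf: "lin T T (\<lambda>x. g (f x))" by (rule lin_comp[OF g(1) f])
  let ?q = "\<lambda>x. x \<ominus>\<^bsub>T\<^esub> g (f x)"
  have q: "lin T T ?q" by (rule lin_diff[OF T T lin_id gf])
  have qZ: "lin T Z ?q"
  proof -
    have "f (?q x) = \<zero>\<^bsub>W\<^esub>" if "x \<in> carrier T" for x
      using that lin_minus[OF T W f] lin_closed[OF gf] g(2) vs_minus_zero_iff[OF W] lin_closed[OF f]
      by simp
    then show ?thesis using q unfolding lin_def Z_def by (auto simp: Pi_def)
  qed
  let ?s = "tm H T H Z (\<lambda>x. x) ?q t"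
  have "?s \<in> carrier (H \<boxtimes> Z)" by (rule tm_closed[OF H T H Z lin_id qZ t])
  moreover have "tm H Z H T (\<lambda>x. x) (\<lambda>x. x) ?s = tm H T H T (\<lambda>x. x) ?q t"
    by (rule tm_tm[OF H T H Z H T lin_id qZ lin_id ZT t])
  moreover have "tm H T H T (\<lambda>x. x) ?q t = t"
  proof -
    note HT = vsp_tensor[OF H T]
    note l1 = lin_tm[OF H T H T lin_id q lin_id] and l2 = lin_tm[OF H T H T lin_id gf lin_id]
    have "\<forall>t\<in>carrier (H \<boxtimes> T). tm H T H T (\<lambda>x. x) ?q t = t \<ominus>\<^bsub>H \<boxtimes> T\<^esub> tm H T H T (\<lambda>x. x) (\<lambda>x. g (f x)) t"
      by (rule tens_ext[OF H T HT l1 lin_diff[OF HT HT lin_id l2]])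
         (simp add: tm_tp[OF H T H T lin_id q] tm_tp[OF H T H T lin_id gf]
            lin_minus[OF T HT lin_tpr[OF H T lin_id]] lin_closed[OF gf])
    then have 1: "tm H T H T (\<lambda>x. x) ?q t = t \<ominus>\<^bsub>H \<boxtimes> T\<^esub> tm H T H T (\<lambda>x. x) (\<lambda>x. g (f x)) t"
      using t by blast
    have 2: "tm H T H T (\<lambda>x. x) (\<lambda>x. g (f x)) t = tm H W H T (\<lambda>x. x) g (tm H T H W (\<lambda>x. x) f t)"
      by (rule tm_tm[OF H T H W H T lin_id f lin_id g(1) t, symmetric])
    have 3: "\<dots> = \<zero>\<^bsub>H \<boxtimes> T\<^esub>"
      unfolding k by (rule lin_zero[OF vsp_tensor[OF H W] HT lin_tm[OF H W H T lin_id g(1) lin_id]])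
    show ?thesis unfolding 1 2 3 by (rule vs_minus_zero[OF HT t])
  qed
  ultimately show ?thesis by metis
qed

lemma lin_assoc [lin_intros]:
  "vsp A \<Longrightarrow> vsp B \<Longrightarrow> vsp C \<Longrightarrow> lin V ((A \<boxtimes> B) \<boxtimes> C) f \<Longrightarrow> lin V (A \<boxtimes> B \<boxtimes> C) (\<lambda>x. assoc K A B C (f x))"
  unfolding assoc_def Let_def
  by (rule lin_tl_arg) ((rule lin_intros | assumption)+)

lemma assoc_tp':
  "vsp A \<Longrightarrow> vsp B \<Longrightarrow> vsp C \<Longrightarrow> u \<in> carrier (A \<boxtimes> B) \<Longrightarrow> c \<in> carrier C \<Longrightarrow>
    assoc K A B C (tp (A \<boxtimes> B) C u c) =
    tlf A B (A \<boxtimes> B \<boxtimes> C) (\<lambda>a b. tp A (B \<boxtimes> C) a (tp B C b c)) u"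
  unfolding assoc_def Let_def
  by (subst tl_tp) ((rule lin_intros refl | assumption)+)

text \<open>The associativity isomorphism is invisible to trilinear maps. This turns
  coassociativity, which is stated with \<open>assoc\<close>, into an equation between nested
  sums.\<close>

lemma tl_assoc:
  assumes v: "vsp A" "vsp B" "vsp C" "vsp W" and t: "t \<in> carrier ((A \<boxtimes> B) \<boxtimes> C)"
    and f: "\<And>b c. b \<in> carrier B \<Longrightarrow> c \<in> carrier C \<Longrightarrow> lin A W (\<lambda>a. \<phi> a b c)"
      "\<And>a c. a \<in> carrier A \<Longrightarrow> c \<in> carrier C \<Longrightarrow> lin B W (\<lambda>b. \<phi> a b c)"
      "\<And>a b. a \<in> carrier A \<Longrightarrow> b \<in> carrier B \<Longrightarrow> lin C W (\<lambda>c. \<phi> a b c)"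
  shows "tlf A (B \<boxtimes> C) W (\<lambda>a u. tlf B C W (\<lambda>b c. \<phi> a b c) u) (assoc K A B C t) =
    tlf (A \<boxtimes> B) C W (\<lambda>u c. tlf A B W (\<lambda>a b. \<phi> a b c) u) t"
proof -
  have 1: "bil A (B \<boxtimes> C) W (\<lambda>a u. tlf B C W (\<lambda>b c. \<phi> a b c) u)"
    by (rule bilI) ((rule lin_tl_fun lin_tl_arg lin_id f bilI vsp_tensor v | assumption)+)
  have 2: "bil (A \<boxtimes> B) C W (\<lambda>u c. tlf A B W (\<lambda>a b. \<phi> a b c) u)"
    by (rule bilI) ((rule lin_tl_fun lin_tl_arg lin_id f bilI vsp_tensor v | assumption)+)
  have "\<forall>t\<in>carrier ((A \<boxtimes> B) \<boxtimes> C). tlf A (B \<boxtimes> C) W (\<lambda>a u. tlf B C W (\<lambda>b c. \<phi> a b c) u) (assoc K A B C t) =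
    tlf (A \<boxtimes> B) C W (\<lambda>u c. tlf A B W (\<lambda>a b. \<phi> a b c) u) t"
  proof (rule tens_ext)
    fix u c assume u: "u \<in> carrier (A \<boxtimes> B)" and c: "c \<in> carrier C"
    have "tlf A (B \<boxtimes> C) W (\<lambda>a u. tlf B C W (\<lambda>b c. \<phi> a b c) u)
        (tlf A B (A \<boxtimes> B \<boxtimes> C) (\<lambda>a b. tp A (B \<boxtimes> C) a (tp B C b c)) u) =
      tlf A B W (\<lambda>a b. tlf A (B \<boxtimes> C) W (\<lambda>a u. tlf B C W (\<lambda>b c. \<phi> a b c) u) (tp A (B \<boxtimes> C) a (tp B C b c))) u"
      by (rule tl_push[OF v(1,2) _ v(4) lin_tl_self[OF v(1) _ v(4) 1]])
         ((rule lin_intros v u c | assumption)+)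
    also have "\<dots> = tlf A B W (\<lambda>a b. \<phi> a b c) u"
    proof (rule tl_cong[symmetric, OF v(1,2,4) _ u])
      show "bil A B W (\<lambda>a b. \<phi> a b c)" by ((rule f bilI c | assumption)+)
      fix a b assume ab: "a \<in> carrier A" "b \<in> carrier B"
      have "tlf A (B \<boxtimes> C) W (\<lambda>a u. tlf B C W (\<lambda>b c. \<phi> a b c) u) (tp A (B \<boxtimes> C) a (tp B C b c)) =
        tlf B C W (\<lambda>b c. \<phi> a b c) (tp B C b c)"
        by (rule tl_tp[OF v(1) _ v(4) 1]) ((rule lin_intros v ab c)+)
      also have "\<dots> = \<phi> a b c" by (rule tl_tp) ((rule f bilI v ab c | assumption)+)
      finally show "\<phi> a b c = tlf A (B \<boxtimes> C) W (\<lambda>a u. tlf B C W (\<lambda>b c. \<phi> a b c) u) (tp A (B \<boxtimes> C) a (tp B C b c))" ..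
    qed
    finally show "tlf A (B \<boxtimes> C) W (\<lambda>a u. tlf B C W (\<lambda>b c. \<phi> a b c) u) (assoc K A B C (tp (A \<boxtimes> B) C u c)) =
      tlf (A \<boxtimes> B) C W (\<lambda>u c. tlf A B W (\<lambda>a b. \<phi> a b c) u) (tp (A \<boxtimes> B) C u c)"
      by (simp add: assoc_tp' v u c tl_tp[OF vsp_tensor[OF v(1,2)] v(3,4) 2])
  qed ((rule lin_intros 1 2 v | assumption)+)
  with t show ?thesis by blast
qed

end

section \<open>Sweedler calculus in a Hopf algebra and the antipode\<close>

section \<open>Hopf algebras\<close>

locale hopf = base_field K for K :: "'k ring" +
  fixes H :: "('k, 'h) hopf"
  assumes hopf_H: "hopf_algebra K H"
begin

abbreviation "A \<equiv> halg H"
abbreviation mul (infixl "\<star>" 70) where "a \<star> b \<equiv> a \<otimes>\<^bsub>halg H\<^esub> b"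
abbreviation "uA \<equiv> \<one>\<^bsub>halg H\<^esub>"
abbreviation "\<Delta> \<equiv> comult H"
abbreviation "\<epsilon> \<equiv> counit H"
abbreviation "S \<equiv> antipode H"

text \<open>The Sweedler sum of \<phi> over the two legs of the coproduct of a.\<close>

abbreviation sw :: "('k, 'w) module \<Rightarrow> ('h \<Rightarrow> 'h \<Rightarrow> 'w) \<Rightarrow> 'h \<Rightarrow> 'w" where
  "sw W \<phi> a \<equiv> tlf A A W \<phi> (\<Delta> a)"

lemma hopf_facts:
  "unital_algebra K A" "linear_map K A (A \<boxtimes> A) \<Delta>" "\<Delta> \<in> ring_hom A (A \<boxtimes> A)"
  "linear_map K A (scalar_space K) \<epsilon>" "\<epsilon> \<in> ring_hom A K" "linear_map K A A S"
  "a \<in> carrier A \<Longrightarrow> assoc K A A A (tm A A (A \<boxtimes> A) A \<Delta> id (\<Delta> a)) = tm A A A (A \<boxtimes> A) id \<Delta> (\<Delta> a)"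
  "a \<in> carrier A \<Longrightarrow> sw A (\<lambda>b c. \<epsilon> b \<odot>\<^bsub>A\<^esub> c) a = a"
  "a \<in> carrier A \<Longrightarrow> sw A (\<lambda>b c. \<epsilon> c \<odot>\<^bsub>A\<^esub> b) a = a"
  "a \<in> carrier A \<Longrightarrow> sw A (\<lambda>b c. S b \<star> c) a = \<epsilon> a \<odot>\<^bsub>A\<^esub> uA"
  "a \<in> carrier A \<Longrightarrow> sw A (\<lambda>b c. b \<star> S c) a = \<epsilon> a \<odot>\<^bsub>A\<^esub> uA"
  using hopf_H unfolding hopf_algebra_def Let_def by blast+

lemma vA [lin_intros, simp]: "vsp A"
  using hopf_facts(1) by (simp add: unital_algebra_def)

lemma ring_A: "ring A"
  using hopf_facts(1) by (simp add: unital_algebra_def)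

lemma mul_closed [lin_intros, simp]: "a \<in> carrier A \<Longrightarrow> b \<in> carrier A \<Longrightarrow> a \<star> b \<in> carrier A"
  using ring_A by (simp add: ring.ring_simprules)

lemma uA_closed [lin_intros, simp]: "uA \<in> carrier A"
  using ring_A by (simp add: ring.ring_simprules)

lemma mul_assoc: "a \<in> carrier A \<Longrightarrow> b \<in> carrier A \<Longrightarrow> c \<in> carrier A \<Longrightarrow> a \<star> b \<star> c = a \<star> (b \<star> c)"
  using ring_A by (simp add: ring.ring_simprules)

lemma mul_one [simp]: "a \<in> carrier A \<Longrightarrow> uA \<star> a = a" "a \<in> carrier A \<Longrightarrow> a \<star> uA = a"
  using ring_A by (simp_all add: ring.is_monoid monoid.l_one monoid.r_one)

lemma mul_smult:
  "r \<in> carrier K \<Longrightarrow> a \<in> carrier A \<Longrightarrow> b \<in> carrier A \<Longrightarrow> (r \<odot>\<^bsub>A\<^esub> a) \<star> b = r \<odot>\<^bsub>A\<^esub> (a \<star> b)"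
  "r \<in> carrier K \<Longrightarrow> a \<in> carrier A \<Longrightarrow> b \<in> carrier A \<Longrightarrow> a \<star> (r \<odot>\<^bsub>A\<^esub> b) = r \<odot>\<^bsub>A\<^esub> (a \<star> b)"
  using hopf_facts(1) by (simp_all add: unital_algebra_def)

lemma bil_mul: "bil A A A (\<lambda>a b. a \<star> b)"
  using ring_A by (intro bilI linI) (simp_all add: mul_smult ring.ring_simprules)

lemmas [lin_intros] = bil_arg1[OF bil_mul] bil_arg2[OF bil_mul]

lemma lin_\<Delta>: "lin A (A \<boxtimes> A) \<Delta>" and lin_S: "lin A A S" and lin_\<epsilon>: "lin A (scalar_space K) \<epsilon>"
  and vsp_scalar: "vsp (scalar_space K)"
  using hopf_facts(2,4,6) by (simp_all add: linear_map_iff)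

lemmas [lin_intros] = lin_comp[OF lin_\<Delta>] lin_closed[OF lin_\<Delta>] lin_comp[OF lin_S] lin_closed[OF lin_S]

lemma \<Delta>_closed [simp]: "a \<in> carrier A \<Longrightarrow> \<Delta> a \<in> carrier (A \<boxtimes> A)"
  and S_closed [simp]: "a \<in> carrier A \<Longrightarrow> S a \<in> carrier A"
  by (rule lin_closed[OF lin_\<Delta>] lin_closed[OF lin_S], assumption)+

lemma \<epsilon>_closed [simp, lin_intros]: "a \<in> carrier A \<Longrightarrow> \<epsilon> a \<in> carrier K"
  using lin_closed[OF lin_\<epsilon>] by (simp add: scalar_space_def)

lemma smult_closed [lin_intros]: "vsp W \<Longrightarrow> r \<in> carrier K \<Longrightarrow> w \<in> carrier W \<Longrightarrow> r \<odot>\<^bsub>W\<^esub> w \<in> carrier W"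
  by simp

lemma bil_\<epsilon>: "vsp W \<Longrightarrow> bil A W W (\<lambda>a w. \<epsilon> a \<odot>\<^bsub>W\<^esub> w)"
proof (rule bilI)
  assume W: "vsp W"
  then interpret W: vectorspace K W .
  show "lin W W (\<lambda>w. \<epsilon> a \<odot>\<^bsub>W\<^esub> w)" if "a \<in> carrier A" for a
    by (rule lin_scale[OF W lin_id]) (use that in simp)
  show "lin A W (\<lambda>a. \<epsilon> a \<odot>\<^bsub>W\<^esub> w)" if "w \<in> carrier W" for w
    using that lin_add[OF lin_\<epsilon>] lin_smult[OF lin_\<epsilon>]
    by (intro linI) (simp_all add: scalar_space_def W.smult_l_distr W.smult_assoc1)
qed

lemma lin_\<epsilon>1 [lin_intros]: "vsp W \<Longrightarrow> lin V A f \<Longrightarrow> w \<in> carrier W \<Longrightarrow> lin V W (\<lambda>x. \<epsilon> (f x) \<odot>\<^bsub>W\<^esub> w)"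
  by (rule bil_arg1[OF bil_\<epsilon>])

lemma lin_\<epsilon>2 [lin_intros]: "vsp W \<Longrightarrow> lin V W f \<Longrightarrow> a \<in> carrier A \<Longrightarrow> lin V W (\<lambda>x. \<epsilon> a \<odot>\<^bsub>W\<^esub> f x)"
  by (rule bil_arg2[OF bil_\<epsilon>])

lemma \<epsilon>_one [simp]: "\<epsilon> uA = \<one>\<^bsub>K\<^esub>" and \<epsilon>_mul: "a \<in> carrier A \<Longrightarrow> b \<in> carrier A \<Longrightarrow> \<epsilon> (a \<star> b) = \<epsilon> a \<otimes>\<^bsub>K\<^esub> \<epsilon> b"
  using hopf_facts(5) by (simp_all add: ring_hom_def)

lemma smult_one: "vsp W \<Longrightarrow> w \<in> carrier W \<Longrightarrow> \<one>\<^bsub>K\<^esub> \<odot>\<^bsub>W\<^esub> w = w"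
  by (simp add: vectorspace_def module.smult_one)

lemma smult_smult: "vsp W \<Longrightarrow> r \<in> carrier K \<Longrightarrow> s \<in> carrier K \<Longrightarrow> w \<in> carrier W \<Longrightarrow>
    (r \<otimes>\<^bsub>K\<^esub> s) \<odot>\<^bsub>W\<^esub> w = r \<odot>\<^bsub>W\<^esub> (s \<odot>\<^bsub>W\<^esub> w)"
  by (simp add: vectorspace_def module.smult_assoc1)

lemma sw_cong:
  assumes "vsp W" "a \<in> carrier A" "bil A A W (\<lambda>b c. \<phi> b c)"
    "\<And>b c. b \<in> carrier A \<Longrightarrow> c \<in> carrier A \<Longrightarrow> \<phi> b c = \<psi> b c"
  shows "sw W (\<lambda>b c. \<phi> b c) a = sw W (\<lambda>b c. \<psi> b c) a"
  using assms by (intro tl_cong) simp_all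

lemma sw_push:
  assumes "vsp W" "vsp W'" "lin W W' g" "a \<in> carrier A" "bil A A W (\<lambda>b c. \<phi> b c)"
  shows "g (sw W (\<lambda>b c. \<phi> b c) a) = sw W' (\<lambda>b c. g (\<phi> b c)) a"
  using assms by (intro tl_push) simp_all

lemma coassoc:
  assumes W: "vsp W" and a: "a \<in> carrier A"
    and f: "\<And>y z. y \<in> carrier A \<Longrightarrow> z \<in> carrier A \<Longrightarrow> lin A W (\<lambda>x. \<phi> x y z)"
      "\<And>x z. x \<in> carrier A \<Longrightarrow> z \<in> carrier A \<Longrightarrow> lin A W (\<lambda>y. \<phi> x y z)"
      "\<And>x y. x \<in> carrier A \<Longrightarrow> y \<in> carrier A \<Longrightarrow> lin A W (\<lambda>z. \<phi> x y z)"
  shows "sw W (\<lambda>b z. sw W (\<lambda>x y. \<phi> x y z) b) a = sw W (\<lambda>x c. sw W (\<lambda>y z. \<phi> x y z) c) a"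
proof -
  note i = lin_tl_fun lin_tl_arg lin_id f bilI vsp_tensor vA W a
    lin_comp[OF lin_\<Delta>] lin_closed[OF lin_\<Delta>]
  have b1: "bil (A \<boxtimes> A) A W (\<lambda>u c. tlf A A W (\<lambda>a b. \<phi> a b c) u)"
    by ((rule i | assumption)+)
  have b2: "bil A (A \<boxtimes> A) W (\<lambda>a u. tlf A A W (\<lambda>b c. \<phi> a b c) u)"
    by ((rule i | assumption)+)
  have "sw W (\<lambda>b z. sw W (\<lambda>x y. \<phi> x y z) b) a =
    tlf (A \<boxtimes> A) A W (\<lambda>u c. tlf A A W (\<lambda>a b. \<phi> a b c) u) (tm A A (A \<boxtimes> A) A \<Delta> id (\<Delta> a))"
    using b1 a lin_\<Delta> lin_id' by (subst tl_tm) (simp_all add: vsp_tensor W)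
  also have "\<dots> = tlf A (A \<boxtimes> A) W (\<lambda>a u. tlf A A W (\<lambda>b c. \<phi> a b c) u) (assoc K A A A (tm A A (A \<boxtimes> A) A \<Delta> id (\<Delta> a)))"
    by (rule tl_assoc[symmetric])
       ((rule f W vA lin_\<Delta> tm_closed lin_id' vsp_tensor lin_closed[OF lin_\<Delta>] a | assumption)+)
  also have "\<dots> = tlf A (A \<boxtimes> A) W (\<lambda>a u. tlf A A W (\<lambda>b c. \<phi> a b c) u) (tm A A A (A \<boxtimes> A) id \<Delta> (\<Delta> a))"
    by (simp add: hopf_facts(7) a)
  also have "\<dots> = sw W (\<lambda>x c. sw W (\<lambda>y z. \<phi> x y z) c) a"
    using b2 a lin_\<Delta> lin_id' by (subst tl_tm) (simp_all add: vsp_tensor W)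
  finally show ?thesis .
qed

lemma counit_l:
  assumes W: "vsp W" and g: "lin A W g" and a: "a \<in> carrier A"
  shows "sw W (\<lambda>b c. \<epsilon> b \<odot>\<^bsub>W\<^esub> g c) a = g a"
proof -
  have "g (sw A (\<lambda>b c. \<epsilon> b \<odot>\<^bsub>A\<^esub> c) a) = sw W (\<lambda>b c. g (\<epsilon> b \<odot>\<^bsub>A\<^esub> c)) a"
    by (rule sw_push[OF vA W g a]) (rule bil_\<epsilon>[OF vA])
  also have "\<dots> = sw W (\<lambda>b c. \<epsilon> b \<odot>\<^bsub>W\<^esub> g c) a"
    by (rule sw_cong[OF W a]) ((rule lin_intros lin_comp[OF g] | assumption)+, simp add: lin_smult[OF g])
  finally show ?thesis by (simp add: hopf_facts(8) a)
qed

lemma counit_r: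
  assumes W: "vsp W" and g: "lin A W g" and a: "a \<in> carrier A"
  shows "sw W (\<lambda>b c. \<epsilon> c \<odot>\<^bsub>W\<^esub> g b) a = g a"
proof -
  have "g (sw A (\<lambda>b c. \<epsilon> c \<odot>\<^bsub>A\<^esub> b) a) = sw W (\<lambda>b c. g (\<epsilon> c \<odot>\<^bsub>A\<^esub> b)) a"
    by (rule sw_push[OF vA W g a]) ((rule lin_intros | assumption)+)
  also have "\<dots> = sw W (\<lambda>b c. \<epsilon> c \<odot>\<^bsub>W\<^esub> g b) a"
    by (rule sw_cong[OF W a]) ((rule lin_intros lin_comp[OF g] | assumption)+, simp add: lin_smult[OF g])
  finally show ?thesis by (simp add: hopf_facts(9) a)
qed

lemma antipode_l:
  assumes W: "vsp W" and g: "lin A W g" and a: "a \<in> carrier A"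
  shows "sw W (\<lambda>b c. g (S b \<star> c)) a = \<epsilon> a \<odot>\<^bsub>W\<^esub> g uA"
proof -
  have "g (sw A (\<lambda>b c. S b \<star> c) a) = sw W (\<lambda>b c. g (S b \<star> c)) a"
    by (rule sw_push[OF vA W g a]) ((rule lin_intros | assumption)+)
  then show ?thesis by (simp add: hopf_facts(10) a lin_smult[OF g])
qed

lemma antipode_r:
  assumes W: "vsp W" and g: "lin A W g" and a: "a \<in> carrier A"
  shows "sw W (\<lambda>b c. g (b \<star> S c)) a = \<epsilon> a \<odot>\<^bsub>W\<^esub> g uA"
proof -
  have "g (sw A (\<lambda>b c. b \<star> S c) a) = sw W (\<lambda>b c. g (b \<star> S c)) a"
    by (rule sw_push[OF vA W g a]) ((rule lin_intros | assumption)+)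
  then show ?thesis by (simp add: hopf_facts(11) a lin_smult[OF g])
qed

lemma sw_mul:
  assumes W: "vsp W" and \<phi>: "bil A A W (\<lambda>x y. \<phi> x y)" and a: "a \<in> carrier A" and b: "b \<in> carrier A"
  shows "sw W (\<lambda>x y. \<phi> x y) (a \<star> b) = sw W (\<lambda>a1 a2. sw W (\<lambda>b1 b2. \<phi> (a1 \<star> b1) (a2 \<star> b2)) b) a"
proof -
  note AA = vsp_tensor[OF vA vA]
  \<comment> \<open>The product of \<open>tensor\<close> is defined by lifts into
    \<open>tensor_vs\<close>. A lift depends only on the additive structure and the scalars, which
    the two records share.\<close>
  have te: "tlf A A (tensor_vs K A A) \<psi> t = tlf A A (A \<boxtimes> A) \<psi> t" for \<psi> t
    unfolding tensor_lift_def free_extend_def finsum_def tensor_fields ..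
  have "\<Delta> (a \<star> b) = \<Delta> a \<otimes>\<^bsub>A \<boxtimes> A\<^esub> \<Delta> b" using hopf_facts(3) a b by (simp add: ring_hom_def)
  also have "\<dots> = sw (A \<boxtimes> A) (\<lambda>a1 a2. sw (A \<boxtimes> A) (\<lambda>b1 b2. tp A A (a1 \<star> b1) (a2 \<star> b2)) b) a"
    unfolding te[symmetric] by (simp add: tensor_def)
  finally have "sw W (\<lambda>x y. \<phi> x y) (a \<star> b) =
    tlf A A W (\<lambda>x y. \<phi> x y) (sw (A \<boxtimes> A) (\<lambda>a1 a2. sw (A \<boxtimes> A) (\<lambda>b1 b2. tp A A (a1 \<star> b1) (a2 \<star> b2)) b) a)"
    by simp
  also have "\<dots> = sw W (\<lambda>a1 a2. tlf A A W (\<lambda>x y. \<phi> x y) (sw (A \<boxtimes> A) (\<lambda>b1 b2. tp A A (a1 \<star> b1) (a2 \<star> b2)) b)) a"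
    by (rule sw_push[OF AA W lin_tl_self[OF vA vA W \<phi>] a]) ((rule lin_intros b | assumption)+)
  also have "\<dots> = sw W (\<lambda>a1 a2. sw W (\<lambda>b1 b2. \<phi> (a1 \<star> b1) (a2 \<star> b2)) b) a"
  proof (rule sw_cong[OF W a])
    show "bil A A W (\<lambda>a1 a2. tlf A A W (\<lambda>x y. \<phi> x y) (sw (A \<boxtimes> A) (\<lambda>b1 b2. tp A A (a1 \<star> b1) (a2 \<star> b2)) b))"
      by ((rule \<phi> lin_intros b W | assumption)+)
    fix x y assume xy: "x \<in> carrier A" "y \<in> carrier A"
    have "tlf A A W (\<lambda>x y. \<phi> x y) (sw (A \<boxtimes> A) (\<lambda>b1 b2. tp A A (x \<star> b1) (y \<star> b2)) b) =
      sw W (\<lambda>b1 b2. tlf A A W (\<lambda>x y. \<phi> x y) (tp A A (x \<star> b1) (y \<star> b2))) b"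
      by (rule sw_push[OF AA W lin_tl_self[OF vA vA W \<phi>] b]) ((rule lin_intros xy | assumption)+)
    also have "\<dots> = sw W (\<lambda>b1 b2. \<phi> (x \<star> b1) (y \<star> b2)) b"
      by (rule sw_cong[OF W b]) ((rule \<phi> lin_intros xy W | assumption)+, simp add: tl_tp[OF vA vA W \<phi>] xy)
    finally show "tlf A A W (\<lambda>x y. \<phi> x y) (sw (A \<boxtimes> A) (\<lambda>b1 b2. tp A A (x \<star> b1) (y \<star> b2)) b) =
      sw W (\<lambda>b1 b2. \<phi> (x \<star> b1) (y \<star> b2)) b" .
  qed
  finally show ?thesis .
qed

lemma sw_one:
  assumes W: "vsp W" and \<phi>: "bil A A W (\<lambda>x y. \<phi> x y)"
  shows "sw W (\<lambda>x y. \<phi> x y) uA = \<phi> uA uA"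
proof -
  have "\<Delta> uA = \<one>\<^bsub>A \<boxtimes> A\<^esub>" using hopf_facts(3) by (simp add: ring_hom_def)
  then have "\<Delta> uA = tp A A uA uA" by (simp add: tensor_def)
  then show ?thesis by (simp add: tl_tp[OF vA vA W \<phi>])
qed

lemma S_one [simp]: "S uA = uA"
  using hopf_facts(10)[OF uA_closed] sw_one[OF vA, of "\<lambda>b c. S b \<star> c"]
  by (simp add: smult_one bilI lin_intros bil_arg1[OF bil_mul] bil_arg2[OF bil_mul] lin_S lin_id)

text \<open>Uniqueness of convolution inverses: in the sum of S(a1 b1) a2 b2 S(b3) S(a3), cancelling
  the first factors leaves S(b) S(a), and cancelling the last ones leaves S(a b).\<close>

lemma S_mul:
  assumes a: "a \<in> carrier A" and b: "b \<in> carrier A"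
  shows "S (a \<star> b) = S b \<star> S a"
proof -
  note I = lin_intros a b
  have 1: "sw A (\<lambda>p q. sw A (\<lambda>r s. S (p \<star> r) \<star> (q \<star> s) \<star> z) y) x = \<epsilon> x \<odot>\<^bsub>A\<^esub> (\<epsilon> y \<odot>\<^bsub>A\<^esub> z)"
    if "x \<in> carrier A" "y \<in> carrier A" "z \<in> carrier A" for x y z
  proof -
    have "sw A (\<lambda>p q. sw A (\<lambda>r s. S (p \<star> r) \<star> (q \<star> s) \<star> z) y) x = sw A (\<lambda>u v. S u \<star> v \<star> z) (x \<star> y)"
      by (rule sw_mul[symmetric]) ((rule lin_intros that | assumption)+)
    also have "\<dots> = \<epsilon> (x \<star> y) \<odot>\<^bsub>A\<^esub> (uA \<star> z)"
      by (rule antipode_l[of A "\<lambda>u. u \<star> z"]) ((rule lin_intros that | assumption)+)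
    finally show ?thesis using that by (simp add: \<epsilon>_mul smult_smult)
  qed
  have "S b \<star> S a = sw A (\<lambda>x x'. \<epsilon> x \<odot>\<^bsub>A\<^esub> (S b \<star> S x')) a"
    by (rule counit_l[symmetric, of A "\<lambda>x. S b \<star> S x"]) ((rule I | assumption)+)
  also have "\<dots> = sw A (\<lambda>x x'. sw A (\<lambda>y y'. \<epsilon> x \<odot>\<^bsub>A\<^esub> (\<epsilon> y \<odot>\<^bsub>A\<^esub> (S y' \<star> S x'))) b) a"
  proof (rule sw_cong)
    fix x x' assume x: "x \<in> carrier A" "x' \<in> carrier A"
    have "\<epsilon> x \<odot>\<^bsub>A\<^esub> (S b \<star> S x') = \<epsilon> x \<odot>\<^bsub>A\<^esub> sw A (\<lambda>y y'. \<epsilon> y \<odot>\<^bsub>A\<^esub> (S y' \<star> S x')) b"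
      by (rule arg_cong[of _ _ "\<lambda>w. \<epsilon> x \<odot>\<^bsub>A\<^esub> w"], rule counit_l[symmetric, of A "\<lambda>y. S y \<star> S x'"])
         ((rule I x | assumption)+)
    also have "\<dots> = sw A (\<lambda>y y'. \<epsilon> x \<odot>\<^bsub>A\<^esub> (\<epsilon> y \<odot>\<^bsub>A\<^esub> (S y' \<star> S x'))) b"
      by (rule sw_push) ((rule I x | assumption)+)
    finally show "\<epsilon> x \<odot>\<^bsub>A\<^esub> (S b \<star> S x') = sw A (\<lambda>y y'. \<epsilon> x \<odot>\<^bsub>A\<^esub> (\<epsilon> y \<odot>\<^bsub>A\<^esub> (S y' \<star> S x'))) b" .
  qed ((rule I | assumption)+)
  also have "\<dots> = sw A (\<lambda>x x'. sw A (\<lambda>y y'. sw A (\<lambda>p q. sw A (\<lambda>r s. S (p \<star> r) \<star> (q \<star> s) \<star> (S y' \<star> S x')) y) x) b) a"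
    by (rule sw_cong, (rule I | assumption)+, rule sw_cong, (rule I | assumption)+, rule 1[symmetric]) (rule I | assumption)+
  also have "\<dots> = sw A (\<lambda>x x'. sw A (\<lambda>p q. sw A (\<lambda>y y'. sw A (\<lambda>r s. S (p \<star> r) \<star> (q \<star> s) \<star> (S y' \<star> S x')) y) b) x) a"
    by (rule sw_cong, (rule I | assumption)+, rule tl_swap) (rule I | assumption)+
  also have "\<dots> = sw A (\<lambda>x x'. sw A (\<lambda>p q. S (p \<star> b) \<star> q \<star> S x') x) a"
  proof (rule sw_cong, (rule I | assumption)+, rule sw_cong, (rule I | assumption)+)
    fix x x' p q assume c: "x' \<in> carrier A" "p \<in> carrier A" "q \<in> carrier A"
    have "sw A (\<lambda>y y'. sw A (\<lambda>r s. S (p \<star> r) \<star> (q \<star> s) \<star> (S y' \<star> S x')) y) b =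
      sw A (\<lambda>r v. sw A (\<lambda>s y'. S (p \<star> r) \<star> (q \<star> s) \<star> (S y' \<star> S x')) v) b"
      by (rule coassoc) (rule I c | assumption)+
    also have "\<dots> = sw A (\<lambda>r v. sw A (\<lambda>s y'. S (p \<star> r) \<star> (q \<star> ((s \<star> S y') \<star> S x'))) v) b"
      by (rule sw_cong, (rule I c | assumption)+, rule sw_cong, (rule I c | assumption)+) (simp add: mul_assoc c)
    also have "\<dots> = sw A (\<lambda>r v. \<epsilon> v \<odot>\<^bsub>A\<^esub> (S (p \<star> r) \<star> (q \<star> (uA \<star> S x')))) b"
    proof (rule sw_cong)
      fix r v assume r: "r \<in> carrier A" "v \<in> carrier A"
      show "sw A (\<lambda>s y'. S (p \<star> r) \<star> (q \<star> ((s \<star> S y') \<star> S x'))) v = \<epsilon> v \<odot>\<^bsub>A\<^esub> (S (p \<star> r) \<star> (q \<star> (uA \<star> S x')))"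
        by (rule antipode_r[of A "\<lambda>z. S (p \<star> r) \<star> (q \<star> (z \<star> S x'))"]) (rule I c r | assumption)+
    qed (rule I c | assumption)+
    also have "\<dots> = S (p \<star> b) \<star> (q \<star> (uA \<star> S x'))"
      by (rule counit_r) (rule I c | assumption)+
    also have "\<dots> = S (p \<star> b) \<star> q \<star> S x'" using c b by (simp add: mul_assoc)
    finally show "sw A (\<lambda>y y'. sw A (\<lambda>r s. S (p \<star> r) \<star> (q \<star> s) \<star> (S y' \<star> S x')) y) b = S (p \<star> b) \<star> q \<star> S x'" .
  qed
  also have "\<dots> = sw A (\<lambda>p u. sw A (\<lambda>q x'. S (p \<star> b) \<star> q \<star> S x') u) a"
    by (rule coassoc) (rule I | assumption)+
  also have "\<dots> = sw A (\<lambda>p u. \<epsilon> u \<odot>\<^bsub>A\<^esub> (S (p \<star> b) \<star> uA)) a"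
  proof (rule sw_cong)
    fix p u assume c: "p \<in> carrier A" "u \<in> carrier A"
    have "sw A (\<lambda>q x'. S (p \<star> b) \<star> q \<star> S x') u = sw A (\<lambda>q x'. S (p \<star> b) \<star> (q \<star> S x')) u"
      by (rule sw_cong, (rule I c | assumption)+) (simp add: mul_assoc c b)
    also have "\<dots> = \<epsilon> u \<odot>\<^bsub>A\<^esub> (S (p \<star> b) \<star> uA)"
      by (rule antipode_r) (rule I c | assumption)+
    finally show "sw A (\<lambda>q x'. S (p \<star> b) \<star> q \<star> S x') u = \<epsilon> u \<odot>\<^bsub>A\<^esub> (S (p \<star> b) \<star> uA)" .
  qed (rule I | assumption)+
  also have "\<dots> = S (a \<star> b) \<star> uA" by (rule counit_r) (rule I | assumption)+
  finally show ?thesis using a b by simp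
qed

end

context base_field begin

subsection \<open>Chains of subspaces\<close>

text \<open>The rank is the largest size of an independent subset. It is strictly monotone on
  subspaces because a vector outside a subspace enlarges any independent subset of it. Chains of
  subspaces are thus controlled by bounded natural numbers.\<close>

lemma subspace_rank:
  assumes V: "vsp V" and fd: "vectorspace.fin_dim K V"
  obtains r :: "'v set \<Rightarrow> nat" where "\<And>U. r U \<le> vectorspace.dim K V"
    "\<And>U U'. submodule K U V \<Longrightarrow> submodule K U' V \<Longrightarrow> U \<subset> U' \<Longrightarrow> r U < r U'"
proof -
  interpret V: vectorspace K V by fact
  define P where "P U = {B. B \<subseteq> U \<inter> carrier V \<and> V.lin_indpt B}" for U
  define r where "r U = Max (card ` P U)" for U
  have bd: "finite B \<and> card B \<le> V.dim" if "B \<in> P U" for B U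
    using V.li_le_dim[OF fd, of B] that by (auto simp: P_def)
  have em: "{} \<in> P U" for U by (auto simp: P_def V.lin_dep_def)
  have fin: "finite (card ` P U)" for U
    by (rule finite_subset[of _ "{..V.dim}"]) (use bd in auto)
  have le: "r U \<le> V.dim" for U
    unfolding r_def by (rule Max.boundedI[OF fin]) (use em[of U] bd in blast)+
  have st: "r U < r U'" if U: "submodule K U V" and U': "submodule K U' V" and lt: "U \<subset> U'" for U U'
  proof -
    have Uc: "U \<subseteq> carrier V" "U' \<subseteq> carrier V" using U U' by (auto simp: submodule_def)
    have "r U \<in> card ` P U" unfolding r_def by (rule Max_in[OF fin]) (use em[of U] in blast)
    then obtain B where B: "B \<in> P U" "card B = r U" by (elim imageE) simp
    then have Bc: "B \<subseteq> carrier V" "B \<subseteq> U" "V.lin_indpt B" "finite B" using bd by (auto simp: P_def)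
    obtain u where u: "u \<in> U'" "u \<notin> U" using lt by auto
    have "V.span B \<subseteq> U" using V.span_is_subset[OF Bc(2) U] .
    then have "u \<notin> V.span B" using u by auto
    then have "V.lin_indpt (B \<union> {u})"
      using V.lin_dep_iff_in_span[OF Bc(1,3), of u] u Uc Bc by auto
    then have "B \<union> {u} \<in> P U'" using u Bc Uc lt by (auto simp: P_def)
    then have "card (B \<union> {u}) \<le> r U'" unfolding r_def by (intro Max_ge[OF fin]) blast
    moreover have "card (B \<union> {u}) = Suc (r U)" using B Bc u by (simp add: subsetD card_insert_if) blast
    ultimately show ?thesis by simp
  qed
  show ?thesis by (rule that[OF le st])
qed

text \<open>An increasing chain stops where the rank is largest, a decreasing one where it is
  smallest.\<close>

lemma chain_stationary:
  assumes V: "vsp V" and fd: "vectorspace.fin_dim K V" and U: "\<And>n. submodule K (U n) V"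
    and ch: "(\<forall>n. U n \<subseteq> U (Suc n)) \<or> (\<forall>n. U (Suc n) \<subseteq> U n)"
  shows "\<exists>N. \<forall>m\<ge>N. U m = U N"
proof -
  obtain r where r: "\<And>U. r U \<le> vectorspace.dim K V"
    "\<And>U U'. submodule K U V \<Longrightarrow> submodule K U' V \<Longrightarrow> U \<subset> U' \<Longrightarrow> r U < r U'"
    by (rule subspace_rank[OF V fd]) (rule that)
  from ch show ?thesis
  proof
    assume inc: "\<forall>n. U n \<subseteq> U (Suc n)"
    have fin: "finite (range (\<lambda>n. r (U n)))"
      by (rule finite_subset[of _ "{..vectorspace.dim K V}"]) (use r(1) in auto)
    have "Max (range (\<lambda>n. r (U n))) \<in> range (\<lambda>n. r (U n))" by (rule Max_in[OF fin]) simp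
    then obtain N where N: "r (U N) = Max (range (\<lambda>n. r (U n)))" by (elim imageE) simp
    have "U m = U N" if "m \<ge> N" for m
    proof (rule ccontr)
      assume "U m \<noteq> U N"
      moreover have "U N \<subseteq> U m" using that inc by (metis lift_Suc_mono_le)
      ultimately have "r (U N) < r (U m)" using r(2)[OF U U] by blast
      moreover have "r (U m) \<le> r (U N)" unfolding N by (rule Max_ge[OF fin]) blast
      ultimately show False by simp
    qed
    then show ?thesis by blast
  next
    assume dec: "\<forall>n. U (Suc n) \<subseteq> U n"
    obtain N where N: "\<And>m. r (U N) \<le> r (U m)"
      using ex_has_least_nat[of "\<lambda>_. True" 0 "\<lambda>n. r (U n)"] by auto
    have "U m = U N" if "m \<ge> N" for m
    proof (rule ccontr)
      assume "U m \<noteq> U N"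
      moreover have "U m \<subseteq> U N" using that dec by (metis lift_Suc_antimono_le)
      ultimately have "r (U m) < r (U N)" using r(2)[OF U U] by blast
      then show False using N[of m] by simp
    qed
    then show ?thesis by blast
  qed
qed

lemma lin_funpow: "lin V V f \<Longrightarrow> lin V V (f ^^ n)"
  by (induct n) (auto simp: lin_def Pi_def)

text \<open>The kernels of the powers of f increase and the images decrease, so both are constant
  from a common exponent N on. Stability of both is what makes ker f^N and im f^N
  complementary.\<close>

lemma fitting:
  assumes V: "vsp V" and fd: "vectorspace.fin_dim K V" and f: "lin V V f"
  obtains N where
    "\<And>m v. m \<ge> N \<Longrightarrow> v \<in> carrier V \<Longrightarrow> (f ^^ m) v = \<zero>\<^bsub>V\<^esub> \<Longrightarrow> (f ^^ N) v = \<zero>\<^bsub>V\<^esub>"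
    "\<And>m v. m \<ge> N \<Longrightarrow> v \<in> carrier V \<Longrightarrow> \<exists>w\<in>carrier V. (f ^^ N) v = (f ^^ m) w"
proof -
  note l = lin_funpow[OF f]
  have "\<exists>N. \<forall>m\<ge>N. {v \<in> carrier V. (f ^^ m) v = \<zero>\<^bsub>V\<^esub>} = {v \<in> carrier V. (f ^^ N) v = \<zero>\<^bsub>V\<^esub>}"
    by (rule chain_stationary[OF V fd submodule_kernel[OF V V l]]) (use lin_zero[OF V V f] in auto)
  then obtain N1 where N1: "\<And>m. m \<ge> N1 \<Longrightarrow>
    {v \<in> carrier V. (f ^^ m) v = \<zero>\<^bsub>V\<^esub>} = {v \<in> carrier V. (f ^^ N1) v = \<zero>\<^bsub>V\<^esub>}" by blast
  have "\<exists>N. \<forall>m\<ge>N. (f ^^ m) ` carrier V = (f ^^ N) ` carrier V"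
  proof (rule chain_stationary[OF V fd submodule_image[OF V V l submodule_carrier[OF V]]], intro disjI2 allI)
    fix n
    have "(f ^^ Suc n) ` carrier V = (f ^^ n) ` f ` carrier V" by (simp add: funpow_Suc_right image_comp del: funpow.simps)
    then show "(f ^^ Suc n) ` carrier V \<subseteq> (f ^^ n) ` carrier V" using lin_closed[OF f] by auto
  qed
  then obtain N2 where N2: "\<And>m. m \<ge> N2 \<Longrightarrow> (f ^^ m) ` carrier V = (f ^^ N2) ` carrier V" by blast
  show ?thesis
  proof (rule that[of "max N1 N2"])
    fix m v assume m: "max N1 N2 \<le> m" and v: "v \<in> carrier V"
    have m': "m \<ge> N1" "m \<ge> N2" "max N1 N2 \<ge> N1" "max N1 N2 \<ge> N2" using m by auto
    show "(f ^^ m) v = \<zero>\<^bsub>V\<^esub> \<Longrightarrow> (f ^^ max N1 N2) v = \<zero>\<^bsub>V\<^esub>"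
      using N1[OF m'(1)] N1[OF m'(3)] v by blast
    show "\<exists>w\<in>carrier V. (f ^^ max N1 N2) v = (f ^^ m) w"
      using N2[OF m'(2)] N2[OF m'(4)] v by blast
  qed
qed

end

context hopf begin

subsection \<open>The antipode\<close>

text \<open>Uniqueness of convolution inverses for maps from H to H \<otimes> H. In the product of
  \<Delta>(S a1), \<Delta>(a2) and S a4 \<otimes> S a3 the first two factors cancel, leaving the
  right-hand side, and so do the last two, leaving the left-hand side.\<close>

lemma sw_S:
  assumes W: "vsp W" and \<phi>: "bil A A W (\<lambda>x y. \<phi> x y)" and a: "a \<in> carrier A"
  shows "sw W (\<lambda>x y. \<phi> x y) (S a) = sw W (\<lambda>x y. \<phi> (S y) (S x)) a"
proof -
  note I = bil_arg1[OF \<phi>] bil_arg2[OF \<phi>] \<phi> bilD(3)[OF \<phi>] lin_intros a W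
  let ?Y = "\<lambda>z. sw W (\<lambda>u v. \<phi> (S v) (S u)) z"
  let ?\<psi> = "\<lambda>z x y. sw W (\<lambda>u v. \<phi> (x \<star> S v) (y \<star> S u)) z"
  have 1: "sw W (\<lambda>p q. sw W (\<lambda>s1 s2. sw W (\<lambda>q1 q2. ?\<psi> z (s1 \<star> q1) (s2 \<star> q2)) q) (S p)) x = \<epsilon> x \<odot>\<^bsub>W\<^esub> ?Y z"
    if x: "x \<in> carrier A" and z: "z \<in> carrier A" for x z
  proof -
    have "sw W (\<lambda>p q. sw W (\<lambda>s1 s2. sw W (\<lambda>q1 q2. ?\<psi> z (s1 \<star> q1) (s2 \<star> q2)) q) (S p)) x =
      sw W (\<lambda>p q. sw W (\<lambda>u v. ?\<psi> z u v) (S p \<star> q)) x"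
      by (rule sw_cong, (rule I x z | assumption)+, rule sw_mul[symmetric]) (rule I x z | assumption)+
    also have "\<dots> = \<epsilon> x \<odot>\<^bsub>W\<^esub> sw W (\<lambda>u v. ?\<psi> z u v) uA"
      by (rule antipode_l) (rule I x z | assumption)+
    also have "sw W (\<lambda>u v. ?\<psi> z u v) uA = ?\<psi> z uA uA"
      by (rule sw_one) (rule I x z | assumption)+
    also have "\<dots> = ?Y z"
      by (rule sw_cong, (rule I z | assumption)+) simp
    finally show ?thesis .
  qed
  have 2: "sw W (\<lambda>q z. sw W (\<lambda>q1 q2. ?\<psi> z (s1 \<star> q1) (s2 \<star> q2)) q) w = \<epsilon> w \<odot>\<^bsub>W\<^esub> \<phi> s1 s2"
    if s: "s1 \<in> carrier A" "s2 \<in> carrier A" and w: "w \<in> carrier A" for s1 s2 w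
  proof -
    have "sw W (\<lambda>q z. sw W (\<lambda>q1 q2. ?\<psi> z (s1 \<star> q1) (s2 \<star> q2)) q) w =
      sw W (\<lambda>q1 r. sw W (\<lambda>q2 z. ?\<psi> z (s1 \<star> q1) (s2 \<star> q2)) r) w"
      by (rule coassoc) (rule I s w | assumption)+
    also have "\<dots> = sw W (\<lambda>q1 r. \<phi> (s1 \<star> q1 \<star> S r) s2) w"
    proof (rule sw_cong, (rule I s w | assumption)+)
      fix q1 r assume c: "q1 \<in> carrier A" "r \<in> carrier A"
      have "sw W (\<lambda>q2 z. ?\<psi> z (s1 \<star> q1) (s2 \<star> q2)) r =
        sw W (\<lambda>t v. sw W (\<lambda>q2 u. \<phi> (s1 \<star> q1 \<star> S v) (s2 \<star> q2 \<star> S u)) t) r"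
        by (rule coassoc[symmetric]) (rule I s c | assumption)+
      also have "\<dots> = sw W (\<lambda>t v. \<epsilon> t \<odot>\<^bsub>W\<^esub> \<phi> (s1 \<star> q1 \<star> S v) s2) r"
      proof (rule sw_cong, (rule I s c | assumption)+)
        fix t v assume d: "t \<in> carrier A" "v \<in> carrier A"
        have "sw W (\<lambda>q2 u. \<phi> (s1 \<star> q1 \<star> S v) (s2 \<star> q2 \<star> S u)) t =
          sw W (\<lambda>q2 u. \<phi> (s1 \<star> q1 \<star> S v) (s2 \<star> (q2 \<star> S u))) t"
          by (rule sw_cong, (rule I s c d | assumption)+) (simp add: mul_assoc s)
        also have "\<dots> = \<epsilon> t \<odot>\<^bsub>W\<^esub> \<phi> (s1 \<star> q1 \<star> S v) (s2 \<star> uA)"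
          by (rule antipode_r) (rule I s c d | assumption)+
        finally show "sw W (\<lambda>q2 u. \<phi> (s1 \<star> q1 \<star> S v) (s2 \<star> q2 \<star> S u)) t = \<epsilon> t \<odot>\<^bsub>W\<^esub> \<phi> (s1 \<star> q1 \<star> S v) s2"
          using s by simp
      qed
      also have "\<dots> = \<phi> (s1 \<star> q1 \<star> S r) s2"
        by (rule counit_l) (rule I s c | assumption)+
      finally show "sw W (\<lambda>q2 z. ?\<psi> z (s1 \<star> q1) (s2 \<star> q2)) r = \<phi> (s1 \<star> q1 \<star> S r) s2" .
    qed
    also have "\<dots> = sw W (\<lambda>q1 r. \<phi> (s1 \<star> (q1 \<star> S r)) s2) w"
      by (rule sw_cong, (rule I s w | assumption)+) (simp add: mul_assoc s)
    also have "\<dots> = \<epsilon> w \<odot>\<^bsub>W\<^esub> \<phi> (s1 \<star> uA) s2"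
      by (rule antipode_r) (rule I s w | assumption)+
    finally show ?thesis using s by simp
  qed
  have "?Y a = sw W (\<lambda>x z. \<epsilon> x \<odot>\<^bsub>W\<^esub> ?Y z) a"
    by (rule counit_l[symmetric]) (rule I | assumption)+
  also have "\<dots> = sw W (\<lambda>x z. sw W (\<lambda>p q. sw W (\<lambda>s1 s2. sw W (\<lambda>q1 q2. ?\<psi> z (s1 \<star> q1) (s2 \<star> q2)) q) (S p)) x) a"
    by (rule sw_cong, (rule I | assumption)+, rule 1[symmetric])
  also have "\<dots> = sw W (\<lambda>p w. sw W (\<lambda>q z. sw W (\<lambda>s1 s2. sw W (\<lambda>q1 q2. ?\<psi> z (s1 \<star> q1) (s2 \<star> q2)) q) (S p)) w) a"
    by (rule coassoc) (rule I | assumption)+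
  also have "\<dots> = sw W (\<lambda>p w. sw W (\<lambda>s1 s2. sw W (\<lambda>q z. sw W (\<lambda>q1 q2. ?\<psi> z (s1 \<star> q1) (s2 \<star> q2)) q) w) (S p)) a"
    by (rule sw_cong, (rule I | assumption)+, rule tl_swap) (rule I | assumption)+
  also have "\<dots> = sw W (\<lambda>p w. sw W (\<lambda>s1 s2. \<epsilon> w \<odot>\<^bsub>W\<^esub> \<phi> s1 s2) (S p)) a"
    by (rule sw_cong, (rule I | assumption)+, rule sw_cong, (rule I | assumption)+, rule 2)
  also have "\<dots> = sw W (\<lambda>p w. \<epsilon> w \<odot>\<^bsub>W\<^esub> sw W (\<lambda>s1 s2. \<phi> s1 s2) (S p)) a"
    by (rule sw_cong, (rule I | assumption)+, rule sw_push[symmetric]) (rule I | assumption)+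
  also have "\<dots> = sw W (\<lambda>s1 s2. \<phi> s1 s2) (S a)"
    by (rule counit_r) (rule I | assumption)+
  finally show ?thesis ..
qed

lemma \<epsilon>_S [simp]: "a \<in> carrier A \<Longrightarrow> \<epsilon> (S a) = \<epsilon> a"
proof -
  assume a: "a \<in> carrier A"
  interpret K: field K by (rule field_K)
  note sc = vsp_scalar lin_comp[OF lin_\<epsilon>]
  have "\<epsilon> (S a) = sw (scalar_space K) (\<lambda>x y. \<epsilon> y \<odot>\<^bsub>scalar_space K\<^esub> \<epsilon> (S x)) a"
    by (rule counit_r[symmetric]) (rule lin_intros sc a | assumption)+
  also have "\<dots> = sw (scalar_space K) (\<lambda>x y. \<epsilon> (S x \<star> y)) a"
    by (rule sw_cong, (rule lin_intros sc a lin_closed[OF lin_\<epsilon>] | assumption)+)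
       (simp add: \<epsilon>_mul scalar_space_def K.m_comm)
  also have "\<dots> = \<epsilon> a \<odot>\<^bsub>scalar_space K\<^esub> \<epsilon> uA"
    by (rule antipode_l) (rule lin_intros sc a lin_\<epsilon> | assumption)+
  finally show ?thesis using a by (simp add: scalar_space_def)
qed

lemma Spow_one: "(S ^^ n) uA = uA" by (induct n) simp_all

lemma Spow_closed [lin_intros]: "a \<in> carrier A \<Longrightarrow> (S ^^ n) a \<in> carrier A"
  by (rule lin_closed[OF lin_funpow[OF lin_S]])

lemmas [lin_intros] = lin_comp[OF lin_funpow[OF lin_S]]

lemma Spow_mul: "a \<in> carrier A \<Longrightarrow> b \<in> carrier A \<Longrightarrow>
    (S ^^ n) (a \<star> b) = (if even n then (S ^^ n) a \<star> (S ^^ n) b else (S ^^ n) b \<star> (S ^^ n) a)"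
  by (induct n) (simp_all add: S_mul Spow_closed)

lemma Spow_\<epsilon>: "a \<in> carrier A \<Longrightarrow> \<epsilon> ((S ^^ n) a) = \<epsilon> a"
  by (induct n) (simp_all add: Spow_closed)

text \<open>Only even powers: S reverses the legs of the coproduct, and a second application
  restores their order.\<close>

lemma sw_Spow:
  assumes W: "vsp W" and a: "a \<in> carrier A"
  shows "bil A A W (\<lambda>x y. \<phi> x y) \<Longrightarrow>
    sw W (\<lambda>x y. \<phi> x y) ((S ^^ (2 * n)) a) = sw W (\<lambda>x y. \<phi> ((S ^^ (2 * n)) x) ((S ^^ (2 * n)) y)) a"
proof (induct n arbitrary: \<phi>)
  case (Suc n)
  note \<phi> = Suc(2)
  note I = bil_arg1[OF \<phi>] bil_arg2[OF \<phi>] \<phi> bilD(3)[OF \<phi>] lin_intros a W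
  have "sw W (\<lambda>x y. \<phi> x y) (S (S ((S ^^ (2 * n)) a))) = sw W (\<lambda>x y. \<phi> (S y) (S x)) (S ((S ^^ (2 * n)) a))"
    by (rule sw_S) (rule I | assumption)+
  also have "\<dots> = sw W (\<lambda>x y. \<phi> (S (S x)) (S (S y))) ((S ^^ (2 * n)) a)"
    by (rule sw_S) (rule I | assumption)+
  also have "\<dots> = sw W (\<lambda>x y. \<phi> (S (S ((S ^^ (2 * n)) x))) (S (S ((S ^^ (2 * n)) y)))) a"
    by (rule Suc(1)) (rule I | assumption)+
  finally show ?case by simp
qed simp

text \<open>Let \<open>f = S\<^sup>2\<^sup>N\<close> be such that \<open>H = ker f \<oplus> im f\<close>, and let \<open>p\<close> be the projection onto \<open>im f\<close>. For
  \<open>e h = h\<^sub>1 S (p h\<^sub>2)\<close> one has \<open>f (e h) = \<epsilon> h 1\<close>, and since \<open>e h\<^sub>2\<close> is the second leg of \<open>\<Delta> (e h)\<close>, the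
  antipode axiom lets one lower the exponent of \<open>S\<close> step by step until \<open>e h = \<epsilon> h 1\<close>. Then \<open>p = id\<close>.\<close>

theorem antipode_bij:
  assumes fd: "vectorspace.fin_dim K A"
  shows "bij_betw S (carrier A) (carrier A)"
proof -
  obtain N where
    ker: "\<And>m v. m \<ge> N \<Longrightarrow> v \<in> carrier A \<Longrightarrow> (S ^^ m) v = \<zero>\<^bsub>A\<^esub> \<Longrightarrow> (S ^^ N) v = \<zero>\<^bsub>A\<^esub>" and
    im: "\<And>m v. m \<ge> N \<Longrightarrow> v \<in> carrier A \<Longrightarrow> \<exists>w\<in>carrier A. (S ^^ N) v = (S ^^ m) w"
    by (rule fitting[OF vA fd lin_S]) (rule that)
  \<comment> \<open>This exponent is at least N, so kernels and images are stable; it is even, so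
    that f respects products and coproducts without reversing them; and it is positive, so that one
    S can be split off f on either side at the end.\<close>
  define M where "M = 2 * Suc N"
  define f where "f = S ^^ M"
  have f: "lin A A f" unfolding f_def by (rule lin_funpow[OF lin_S])
  have fc: "a \<in> carrier A \<Longrightarrow> f a \<in> carrier A" for a by (rule lin_closed[OF f])
  have N_le: "N \<le> M" by (simp add: M_def)
  have pw: "(S ^^ (i + j)) v = (S ^^ i) ((S ^^ j) v)" for i j v
    by (simp add: funpow_add)
  have fSe: "(S ^^ M) v = (S ^^ (M - N)) ((S ^^ N) v)" "f (f v) = (S ^^ (2 * M)) v"
    "f (S v) = S (f v)" for v
  proof -
    show "(S ^^ M) v = (S ^^ (M - N)) ((S ^^ N) v)" using pw[of "M - N" N v] N_le by simp
    show "f (f v) = (S ^^ (2 * M)) v" unfolding f_def mult_2 by (rule pw[symmetric])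
    show "f (S v) = S (f v)" by (simp add: f_def funpow_swap1)
  qed
  have ff_ker: "f v = \<zero>\<^bsub>A\<^esub>" if "v \<in> carrier A" "f (f v) = \<zero>\<^bsub>A\<^esub>" for v
  proof -
    have "(S ^^ N) v = \<zero>\<^bsub>A\<^esub>" using ker[of "2 * M" v] that fSe by (simp add: M_def)
    then show ?thesis unfolding f_def fSe(1) using lin_zero[OF vA vA lin_funpow[OF lin_S]] by simp
  qed
  have ff_im: "\<exists>w\<in>carrier A. f v = f (f w)" if v: "v \<in> carrier A" for v
  proof -
    have "\<exists>w\<in>carrier A. (S ^^ N) ((S ^^ (M - N)) v) = (S ^^ (2 * M)) w"
      by (rule im) (simp_all add: M_def Spow_closed v)
    moreover have "(S ^^ N) ((S ^^ (M - N)) v) = f v"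
      unfolding f_def using pw[of N "M - N" v, symmetric] N_le by simp
    ultimately show ?thesis using fSe(2) by metis
  qed
  have ffl: "lin A A (\<lambda>x. f (f x))" by (rule lin_comp[OF f f])
  obtain t where t: "lin A A t" "\<And>v. v \<in> carrier A \<Longrightarrow> f (f (t (f (f v)))) = f (f v)"
    by (rule generalised_inverse[OF vA vA ffl]) (rule that)
  \<comment> \<open>As f p = f and f t f f = f, which are shown next, p fixes the image of f and has
    the kernel of f as its kernel. Enclosing t between two copies of f makes p compatible with
    coproducts although t is merely linear.\<close>
  define p where "p h = f (t (f h))" for h
  have p: "lin A A p" unfolding p_def by (rule lin_comp[OF f lin_comp[OF t(1) f]])
  have pc: "h \<in> carrier A \<Longrightarrow> p h \<in> carrier A" for h by (rule lin_closed[OF p])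
  have fp: "f (p h) = f h" if h: "h \<in> carrier A" for h
  proof -
    obtain w where w: "w \<in> carrier A" "f h = f (f w)" using ff_im[OF h] by blast
    show ?thesis unfolding p_def w(2) by (rule t(2)[OF w(1)])
  qed
  have tff: "f (t (f (f v))) = f v" if v: "v \<in> carrier A" for v
  proof -
    have c: "f (t (f (f v))) \<in> carrier A" "f v \<in> carrier A" "t (f (f v)) \<in> carrier A"
      using v lin_closed[OF t(1)] fc by auto
    have 1: "f (t (f (f v)) \<ominus>\<^bsub>A\<^esub> v) = f (t (f (f v))) \<ominus>\<^bsub>A\<^esub> f v"
      by (rule lin_minus[OF vA vA f c(3) v])
    have "f (f (t (f (f v)) \<ominus>\<^bsub>A\<^esub> v)) = f (f v) \<ominus>\<^bsub>A\<^esub> f (f v)"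
      unfolding 1 lin_minus[OF vA vA f c(1,2)] t(2)[OF v] ..
    also have "\<dots> = \<zero>\<^bsub>A\<^esub>" using vs_minus_zero_iff[OF vA] fc[OF c(2)] by blast
    finally have "f (t (f (f v)) \<ominus>\<^bsub>A\<^esub> v) = \<zero>\<^bsub>A\<^esub>"
      by (rule ff_ker[OF vs_closed(3)[OF vA c(3) v]])
    then show ?thesis unfolding 1 using vs_minus_zero_iff[OF vA c(1,2)] by blast
  qed
  note P = lin_intros lin_comp[OF f] fc lin_comp[OF p] pc lin_comp[OF t(1)] lin_closed[OF t(1)]
  have swf: "sw W (\<lambda>x y. \<phi> x y) (f a) = sw W (\<lambda>x y. \<phi> (f x) (f y)) a"
    if "vsp W" "bil A A W (\<lambda>x y. \<phi> x y)" "a \<in> carrier A" for W :: "('k, 'w) module" and \<phi> a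
    unfolding f_def M_def by (rule sw_Spow[OF that(1,3,2)])
  \<comment> \<open>Put x = t (f h), so that p h = f x. On each leg of f x one inserts f = f t f f,
    which moves the coproduct from x to f f x = f h; there the coproduct passes through f once
    more.\<close>
  have swp: "sw W (\<lambda>x y. \<phi> x y) (p h) = sw W (\<lambda>x y. \<phi> (p x) (p y)) h"
    if W: "vsp W" and \<phi>: "bil A A W (\<lambda>x y. \<phi> x y)" and h: "h \<in> carrier A" for W :: "('k, 'w) module" and \<phi> h
  proof -
    note I = bil_arg1[OF \<phi>] bil_arg2[OF \<phi>] \<phi> bilD(3)[OF \<phi>] P h W
    let ?x = "t (f h)"
    have x: "?x \<in> carrier A" using h P by simp
    have "sw W (\<lambda>x y. \<phi> x y) (p h) = sw W (\<lambda>x y. \<phi> (f x) (f y)) ?x"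
      unfolding p_def by (rule swf) (rule I x | assumption)+
    also have "\<dots> = sw W (\<lambda>x y. \<phi> (f (t (f (f x)))) (f (t (f (f y))))) ?x"
      by (rule sw_cong, (rule I x | assumption)+) (simp add: tff)
    also have "\<dots> = sw W (\<lambda>x y. \<phi> (f (t x)) (f (t y))) (f (f ?x))"
      by (subst swf, (rule I x | assumption)+, subst swf) (rule I x refl | assumption)+
    also have "f (f ?x) = f h" using fp[OF h] by (simp add: p_def)
    also have "sw W (\<lambda>x y. \<phi> (f (t x)) (f (t y))) (f h) = sw W (\<lambda>x y. \<phi> (p x) (p y)) h"
      unfolding p_def by (rule swf) (rule I | assumption)+
    finally show ?thesis .
  qed
  define e where "e h = sw A (\<lambda>x y. x \<star> S (p y)) h" for h
  have e: "lin A A e" unfolding e_def by (rule P | assumption)+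
  have ec: "h \<in> carrier A \<Longrightarrow> e h \<in> carrier A" for h by (rule lin_closed[OF e])
  note P = P lin_comp[OF e] ec
  \<comment> \<open>f is multiplicative, commutes with S and satisfies f p = f, so p disappears and
    the antipode axiom remains.\<close>
  have fe: "(S ^^ M) (e h) = \<epsilon> h \<odot>\<^bsub>A\<^esub> uA" if h: "h \<in> carrier A" for h
  proof -
    have "f (e h) = sw A (\<lambda>x y. f (x \<star> S (p y))) h"
      unfolding e_def by (rule sw_push) (rule P f h | assumption)+
    also have "\<dots> = sw A (\<lambda>x y. f (x \<star> S y)) h"
    proof (rule sw_cong, (rule P h | assumption)+)
      fix b c assume bc: "b \<in> carrier A" "c \<in> carrier A"
      have hom: "f (x \<star> y) = f x \<star> f y" if "x \<in> carrier A" "y \<in> carrier A" for x y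
        using Spow_mul[OF that, of M] by (simp add: f_def M_def)
      show "f (b \<star> S (p c)) = f (b \<star> S c)" using bc by (simp add: hom fSe(3) fp pc)
    qed
    also have "\<dots> = \<epsilon> h \<odot>\<^bsub>A\<^esub> f uA" by (rule antipode_r[OF vA f h])
    finally show ?thesis by (simp add: f_def Spow_one)
  qed
  \<comment> \<open>In other words \<Delta>(e h) = h1 S(p h3) \<otimes> e h2: since S reverses the
    legs, the two inner factors h2 and S(p h3) of the fourfold coproduct combine to a value of
    e.\<close>
  have comult_e: "sw A (\<lambda>x y. \<phi> x y) (e h) = sw A (\<lambda>x r. sw A (\<lambda>m v. \<phi> (x \<star> S (p v)) (e m)) r) h"
    if \<phi>: "bil A A A (\<lambda>x y. \<phi> x y)" and h: "h \<in> carrier A" for \<phi> h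
  proof -
    note I = bil_arg1[OF \<phi>] bil_arg2[OF \<phi>] \<phi> bilD(3)[OF \<phi>] P h
    have "sw A (\<lambda>x y. \<phi> x y) (e h) = sw A (\<lambda>a b. sw A (\<lambda>x y. \<phi> x y) (a \<star> S (p b))) h"
      unfolding e_def by (rule sw_push) (rule I | assumption)+
    also have "\<dots> = sw A (\<lambda>a b. sw A (\<lambda>x y. sw A (\<lambda>u v. \<phi> (x \<star> S (p v)) (y \<star> S (p u))) b) a) h"
    proof (rule sw_cong, (rule I | assumption)+)
      fix a b assume ab: "a \<in> carrier A" "b \<in> carrier A"
      have "sw A (\<lambda>x y. \<phi> x y) (a \<star> S (p b)) = sw A (\<lambda>x y. sw A (\<lambda>s t. \<phi> (x \<star> s) (y \<star> t)) (S (p b))) a"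
        by (rule sw_mul) (rule I ab | assumption)+
      also have "\<dots> = sw A (\<lambda>x y. sw A (\<lambda>u v. \<phi> (x \<star> S v) (y \<star> S u)) (p b)) a"
        by (rule sw_cong, (rule I ab | assumption)+, rule sw_S) (rule I ab | assumption)+
      also have "\<dots> = sw A (\<lambda>x y. sw A (\<lambda>u v. \<phi> (x \<star> S (p v)) (y \<star> S (p u))) b) a"
        by (rule sw_cong, (rule I ab | assumption)+, rule swp) (rule I ab | assumption)+
      finally show "sw A (\<lambda>x y. \<phi> x y) (a \<star> S (p b)) =
        sw A (\<lambda>x y. sw A (\<lambda>u v. \<phi> (x \<star> S (p v)) (y \<star> S (p u))) b) a" .
    qed
    also have "\<dots> = sw A (\<lambda>x c. sw A (\<lambda>y b. sw A (\<lambda>u v. \<phi> (x \<star> S (p v)) (y \<star> S (p u))) b) c) h"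
      by (rule coassoc) (rule I | assumption)+
    also have "\<dots> = sw A (\<lambda>x c. sw A (\<lambda>m v. sw A (\<lambda>y u. \<phi> (x \<star> S (p v)) (y \<star> S (p u))) m) c) h"
      by (rule sw_cong, (rule I | assumption)+, rule coassoc[symmetric]) (rule I | assumption)+
    also have "\<dots> = sw A (\<lambda>x c. sw A (\<lambda>m v. \<phi> (x \<star> S (p v)) (e m)) c) h"
    proof (rule sw_cong, (rule I | assumption)+, rule sw_cong, (rule I | assumption)+)
      fix x c m v assume x: "x \<in> carrier A" "m \<in> carrier A" "v \<in> carrier A"
      show "sw A (\<lambda>y u. \<phi> (x \<star> S (p v)) (y \<star> S (p u))) m = \<phi> (x \<star> S (p v)) (e m)"
        unfolding e_def by (rule sw_push[symmetric]) (rule I x | assumption)+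
    qed
    finally show ?thesis .
  qed
  \<comment> \<open>S^n is applied to the antipode axiom at e h. By the formula for \<Delta>(e h)
    the argument is h1 S(p h3) S(e h2). In whichever order S^n puts the factors, S^(n+1)(e h2) is
    the scalar \<epsilon>(h2), and S^n(e h) is left.\<close>
  have down: "(S ^^ n) (e h) = \<epsilon> h \<odot>\<^bsub>A\<^esub> uA"
    if IH: "\<And>h. h \<in> carrier A \<Longrightarrow> (S ^^ Suc n) (e h) = \<epsilon> h \<odot>\<^bsub>A\<^esub> uA" and h: "h \<in> carrier A" for n h
  proof -
    let ?g = "S ^^ n"
    note I = P h
    have eps: "\<epsilon> (e h) = \<epsilon> h"
    proof -
      have "\<epsilon> (e h) = \<epsilon> ((S ^^ Suc n) (e h))" by (simp only: Spow_\<epsilon> ec h)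
      also have "\<dots> = \<epsilon> h"
        using h lin_smult[OF lin_\<epsilon>, of "\<epsilon> h" uA] monoid.r_one[of K "\<epsilon> h"] ring_K(1)
        unfolding IH[OF h] by (simp add: scalar_space_def ring.is_monoid)
      finally show ?thesis .
    qed
    have Se: "(S ^^ n) (S (e m)) = \<epsilon> m \<odot>\<^bsub>A\<^esub> uA" if "m \<in> carrier A" for m
      using IH[OF that] by (simp add: funpow_swap1)
    have "\<epsilon> h \<odot>\<^bsub>A\<^esub> uA = sw A (\<lambda>x y. ?g (x \<star> S y)) (e h)"
      using antipode_r[OF vA lin_funpow[OF lin_S] ec[OF h], of n] by (simp add: eps Spow_one)
    also have "\<dots> = sw A (\<lambda>x r. sw A (\<lambda>m v. ?g (x \<star> S (p v) \<star> S (e m))) r) h"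
      by (rule comult_e) (rule I | assumption)+
    also have "\<dots> = sw A (\<lambda>x r. sw A (\<lambda>m v. \<epsilon> m \<odot>\<^bsub>A\<^esub> ?g (x \<star> S (p v))) r) h"
    proof (rule sw_cong, (rule I | assumption)+, rule sw_cong, (rule I | assumption)+)
      fix x r m v assume c: "x \<in> carrier A" "m \<in> carrier A" "v \<in> carrier A"
      then have d: "x \<star> S (p v) \<in> carrier A" "S (e m) \<in> carrier A" "?g (x \<star> S (p v)) \<in> carrier A"
        using pc ec Spow_closed by simp_all
      show "?g (x \<star> S (p v) \<star> S (e m)) = \<epsilon> m \<odot>\<^bsub>A\<^esub> ?g (x \<star> S (p v))"
        unfolding Spow_mul[OF d(1,2)] using c d by (simp add: Se mul_smult)
    qed
    also have "\<dots> = sw A (\<lambda>x r. ?g (x \<star> S (p r))) h"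
      by (rule sw_cong, (rule I | assumption)+, rule counit_l) (rule I | assumption)+
    also have "\<dots> = ?g (e h)"
      unfolding e_def by (rule sw_push[symmetric]) (rule I lin_funpow[OF lin_S] | assumption)+
    finally show ?thesis ..
  qed
  \<comment> \<open>Descent from M to 0. Truncated subtraction makes the steps beyond M
    trivial.\<close>
  have "\<forall>h\<in>carrier A. (S ^^ (M - k)) (e h) = \<epsilon> h \<odot>\<^bsub>A\<^esub> uA" for k
  proof (induct k)
    case (Suc k)
    show ?case
    proof (cases "M - k")
      case 0 then show ?thesis using Suc by simp
    next
      case n: (Suc n)
      then have "M - Suc k = n" by simp
      moreover have "(S ^^ n) (e h) = \<epsilon> h \<odot>\<^bsub>A\<^esub> uA" if "h \<in> carrier A" for h
        by (rule down[OF _ that]) (use Suc[unfolded n] in blast)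
      ultimately show ?thesis by simp
    qed
  qed (use fe in simp)
  from this[of M] have e_triv: "e h = \<epsilon> h \<odot>\<^bsub>A\<^esub> uA" if "h \<in> carrier A" for h using that by simp
  \<comment> \<open>p h = e(h1) p(h2) = h1 S(p h2) p(h3), and the last two factors cancel because p
    respects coproducts.\<close>
  have pid: "p h = h" if h: "h \<in> carrier A" for h
  proof -
    note I = P h
    have "p h = sw A (\<lambda>x y. \<epsilon> x \<odot>\<^bsub>A\<^esub> p y) h" by (rule counit_l[OF vA p h, symmetric])
    also have "\<dots> = sw A (\<lambda>x y. e x \<star> p y) h"
      by (rule sw_cong, (rule I | assumption)+) (simp add: e_triv mul_smult pc)
    also have "\<dots> = sw A (\<lambda>x y. sw A (\<lambda>u v. u \<star> S (p v) \<star> p y) x) h"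
      unfolding e_def by (rule sw_cong, (rule I | assumption)+, rule sw_push) (rule I | assumption)+
    also have "\<dots> = sw A (\<lambda>u c. sw A (\<lambda>v y. u \<star> S (p v) \<star> p y) c) h"
      by (rule coassoc) (rule I | assumption)+
    also have "\<dots> = sw A (\<lambda>u c. \<epsilon> c \<odot>\<^bsub>A\<^esub> u) h"
    proof (rule sw_cong, (rule I | assumption)+)
      fix u c assume u: "u \<in> carrier A" "c \<in> carrier A"
      have "sw A (\<lambda>v y. u \<star> S (p v) \<star> p y) c = sw A (\<lambda>v y. u \<star> (S (p v) \<star> p y)) c"
        by (rule sw_cong, (rule I u | assumption)+) (simp add: mul_assoc u pc)
      also have "\<dots> = sw A (\<lambda>v y. u \<star> (S v \<star> y)) (p c)"
        by (rule swp[symmetric]) (rule I u | assumption)+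
      also have "\<dots> = \<epsilon> (p c) \<odot>\<^bsub>A\<^esub> (u \<star> uA)"
        by (rule antipode_l) (rule I u | assumption)+
      also have "\<epsilon> (p c) = \<epsilon> c"
        using Spow_\<epsilon>[OF pc[OF u(2)], of M] Spow_\<epsilon>[OF u(2), of M] fp[OF u(2)] by (simp add: f_def)
      finally show "sw A (\<lambda>v y. u \<star> S (p v) \<star> p y) c = \<epsilon> c \<odot>\<^bsub>A\<^esub> u" using u by simp
    qed
    also have "\<dots> = h" by (rule counit_r[OF vA lin_id h])
    finally show ?thesis .
  qed
  \<comment> \<open>Since f t f is now the identity, f is injective and surjective, and S is both
    its first and its last factor.\<close>
  have "f x = (S ^^ Suc (2 * N + 1)) x" for x by (simp add: f_def M_def)
  then have M: "f x = S ((S ^^ (2 * N + 1)) x)" "f x = (S ^^ (2 * N + 1)) (S x)" for x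
    by (simp_all add: funpow_swap1)
  show ?thesis
  proof (intro bij_betw_imageI inj_onI)
    fix x y assume xy: "x \<in> carrier A" "y \<in> carrier A" "S x = S y"
    then have "f x = f y" by (simp only: M(2))
    then have "p x = p y" by (simp only: p_def)
    then show "x = y" using pid xy by simp
  next
    show "S ` carrier A = carrier A"
    proof (intro equalityI subsetI)
      fix h assume h: "h \<in> carrier A"
      have "h = S ((S ^^ (2 * N + 1)) (t (f h)))"
        by (rule trans[OF pid[OF h, unfolded p_def, symmetric] M(1)])
      moreover have "(S ^^ (2 * N + 1)) (t (f h)) \<in> carrier A" by (rule P h)+
      ultimately show "h \<in> S ` carrier A" by blast
    qed auto
  qed
qed

end

section \<open>Relations between the actions and coactions of an involutive Hopf bimodule\<close>

section \<open>Involutive Hopf bimodules\<close>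

context base_field begin

lemma PiE_const: "v \<in> (\<Pi>\<^sub>E i\<in>I. carrier V) \<Longrightarrow> i \<in> I \<Longrightarrow> v i \<in> carrier V"
  by (rule PiE_mem)

lemma tensor_lift3_cong:
  assumes v: "vsp A" "vsp B" "vsp C" "vsp W" and t: "t \<in> carrier (A \<boxtimes> B \<boxtimes> C)"
    and f: "\<And>b c. b \<in> carrier B \<Longrightarrow> c \<in> carrier C \<Longrightarrow> lin A W (\<lambda>a. \<phi> a b c)"
      "\<And>a c. a \<in> carrier A \<Longrightarrow> c \<in> carrier C \<Longrightarrow> lin B W (\<lambda>b. \<phi> a b c)"
      "\<And>a b. a \<in> carrier A \<Longrightarrow> b \<in> carrier B \<Longrightarrow> lin C W (\<lambda>c. \<phi> a b c)"
    and e: "\<And>a b c. a \<in> carrier A \<Longrightarrow> b \<in> carrier B \<Longrightarrow> c \<in> carrier C \<Longrightarrow> \<phi> a b c = \<chi> a b c"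
  shows "tensor_lift3 K A B C W \<phi> t = tensor_lift3 K A B C W \<chi> t"
proof -
  note J = lin_tl_fun lin_tl_arg lin_id f bilI vsp_tensor v t
  show ?thesis
    unfolding tensor_lift3_def
  proof (rule tl_cong)
    fix a u assume au: "a \<in> carrier A" "u \<in> carrier (B \<boxtimes> C)"
    show "tlf B C W (\<phi> a) u = tlf B C W (\<chi> a) u"
      by (rule tl_cong) ((rule J au | assumption)+, simp add: e au)
  qed ((rule J | assumption)+)
qed

end

locale bimod = hopf K H for K :: "'k ring" and H :: "('k, 'h) hopf" +
  fixes M :: "('k, 'h, 'm) hopf_bimod"
  assumes fin_dim_H: "vectorspace.fin_dim K (halg H)"
    and bimod_M: "involutive_hopf_bimodule K H M"
begin

abbreviation "V \<equiv> bvs M"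
abbreviation "bl \<equiv> blact M"
abbreviation "br \<equiv> bract M"
abbreviation "cl \<equiv> blcoact M"
abbreviation "cr \<equiv> brcoact M"
abbreviation "\<psi> \<equiv> binvol M"

lemma bimod_facts:
  "left_module K H V bl" "right_module K H V br" "left_comodule K H V cl" "right_comodule K H V cr"
  "h \<in> carrier A \<Longrightarrow> g \<in> carrier A \<Longrightarrow> m \<in> carrier V \<Longrightarrow> br (bl h m) g = bl h (br m g)"
  "m \<in> carrier V \<Longrightarrow> assoc K A V A (tm V A (A \<boxtimes> V) A cl id (cr m)) = bicoact K H M m"
  "h \<in> carrier A \<Longrightarrow> g \<in> carrier A \<Longrightarrow> m \<in> carrier V \<Longrightarrow>
    bicoact K H M (br (bl h m) g) =
      tensor_lift3 K A A A (A \<boxtimes> V \<boxtimes> A) (\<lambda>h1 h2 h3.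
        tensor_lift3 K A V A (A \<boxtimes> V \<boxtimes> A) (\<lambda>b n c.
          tensor_lift3 K A A A (A \<boxtimes> V \<boxtimes> A) (\<lambda>g1 g2 g3.
            tp A (V \<boxtimes> A) (h1 \<star> b \<star> g1)
              (tp V A (br (bl h2 n) g2) (h3 \<star> c \<star> inv_into (carrier A) S (inv_into (carrier A) S g3))))
            (comult3 K H g))
          (bicoact K H M m))
        (comult3 K H h)"
  "linear_map K V V \<psi>"
  "m \<in> carrier V \<Longrightarrow> \<psi> (\<psi> m) = m"
  "m \<in> carrier V \<Longrightarrow> h \<in> carrier A \<Longrightarrow> \<psi> (bl h m) = br (\<psi> m) (S h)"
  "m \<in> carrier V \<Longrightarrow> cl (\<psi> m) = tlf V A (A \<boxtimes> V) (\<lambda>n c. tp A V (S c) (\<psi> n)) (cr m)"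
  using bimod_M unfolding involutive_hopf_bimodule_def Let_def by blast+

lemma bil_bl: "bil A V V bl" and bil_br: "bil V A V br" and vV [lin_intros, simp]: "vsp V"
  and lin_cl: "lin V (A \<boxtimes> V) cl" and lin_cr: "lin V (V \<boxtimes> A) cr" and lin_\<psi>: "lin V V \<psi>"
  using bimod_facts(1-4,8)
  by (simp_all add: left_module_def right_module_def left_comodule_def right_comodule_def Let_def
      linear_map_iff bil_def)

lemma bl_one: "m \<in> carrier V \<Longrightarrow> bl uA m = m" and br_one: "m \<in> carrier V \<Longrightarrow> br m uA = m"
  using bimod_facts(1,2) by (simp_all add: left_module_def right_module_def)

lemma cl_counit: "m \<in> carrier V \<Longrightarrow> tlf A V V (\<lambda>a m. \<epsilon> a \<odot>\<^bsub>V\<^esub> m) (cl m) = m"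
  and cr_counit: "m \<in> carrier V \<Longrightarrow> tlf V A V (\<lambda>m a. \<epsilon> a \<odot>\<^bsub>V\<^esub> m) (cr m) = m"
  using bimod_facts(3,4) by (simp_all add: left_comodule_def right_comodule_def Let_def)

lemmas [lin_intros] = bil_arg1[OF bil_bl] bil_arg2[OF bil_bl] bilD(3)[OF bil_bl]
  bil_arg1[OF bil_br] bil_arg2[OF bil_br] bilD(3)[OF bil_br]
  lin_comp[OF lin_cl] lin_comp[OF lin_cr] lin_comp[OF lin_\<psi>]
  lin_closed[OF lin_cl] lin_closed[OF lin_cr] lin_closed[OF lin_\<psi>]

lemma tl_bicoact:
  assumes W: "vsp W" and m: "m \<in> carrier V"
    and f: "\<And>n c. n \<in> carrier V \<Longrightarrow> c \<in> carrier A \<Longrightarrow> lin A W (\<lambda>b. \<phi> b n c)"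
      "\<And>b c. b \<in> carrier A \<Longrightarrow> c \<in> carrier A \<Longrightarrow> lin V W (\<lambda>n. \<phi> b n c)"
      "\<And>b n. b \<in> carrier A \<Longrightarrow> n \<in> carrier V \<Longrightarrow> lin A W (\<lambda>c. \<phi> b n c)"
  shows "tlf A (V \<boxtimes> A) W (\<lambda>b. tlf V A W (\<phi> b)) (bicoact K H M m) =
    tlf A V W (\<lambda>b v. tlf V A W (\<lambda>n c. \<phi> b n c) (cr v)) (cl m)"
proof -
  note I = lin_tl_fun lin_tl_arg lin_id f bilI vsp_tensor vA vV W lin_closed[OF lin_cl] m
  have "bil A (V \<boxtimes> A) W (\<lambda>b t. tlf V A W (\<phi> b) t)" by ((rule I | assumption)+)
  then show ?thesis
    unfolding bicoact_def by (subst tl_tm) ((rule I lin_id' lin_cr | assumption | simp)+)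
qed

text \<open>The bimodule axiom at g = 1, where the factor with the inverse antipode is 1. The lift
  over the legs of \<Delta>(1) still contains that inverse as a function; its linearity, and with it
  the bijectivity of the antipode, is needed for the evaluation. The map \<Phi> will be the counit
  on one of the outer legs.\<close>

lemma bicoact_bl:
  assumes U: "vsp U" and h: "h \<in> carrier A" and m: "m \<in> carrier V"
    and \<Phi>: "lin (A \<boxtimes> V \<boxtimes> A) U \<Phi>"
  shows "\<Phi> (bicoact K H M (bl h m)) =
    sw U (\<lambda>h1 u. sw U (\<lambda>h2 h3. tlf A V U (\<lambda>b v. tlf V A U (\<lambda>n c.
      \<Phi> (tp A (V \<boxtimes> A) (h1 \<star> b) (tp V A (bl h2 n) (h3 \<star> c)))) (cr v)) (cl m)) u) h"
proof -
  let ?W = "A \<boxtimes> V \<boxtimes> A" and ?Si = "inv_into (carrier A) S"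
  note S_bij = antipode_bij[OF fin_dim_H]
  have Si: "lin A A ?Si"
  proof (rule linI)
    have Sim: "?Si x \<in> carrier A" "S (?Si x) = x" if "x \<in> carrier A" for x
      using that S_bij by (auto simp: bij_betw_def inv_into_into f_inv_into_f)
    have inj: "x = y" if "x \<in> carrier A" "y \<in> carrier A" "S x = S y" for x y
      using that S_bij by (auto simp: bij_betw_def inj_on_def)
    fix x assume x: "x \<in> carrier A"
    show "?Si x \<in> carrier A" using Sim x by simp
    show "?Si (x \<oplus>\<^bsub>A\<^esub> y) = ?Si x \<oplus>\<^bsub>A\<^esub> ?Si y" if y: "y \<in> carrier A" for y
      by (rule inj) (simp_all add: Sim x y lin_add[OF lin_S])
    show "?Si (r \<odot>\<^bsub>A\<^esub> x) = r \<odot>\<^bsub>A\<^esub> ?Si x" if r: "r \<in> carrier K" for r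
      by (rule inj) (simp_all add: Sim x r lin_smult[OF lin_S])
  qed
  have Si1: "?Si uA = uA" using S_bij inv_into_f_f[of S "carrier A" uA] by (simp add: bij_betw_def)
  note I = lin_intros lin_comp[OF Si] lin_closed[OF Si] h m
  have c3: "tensor_lift3 K A A A ?W \<phi> (comult3 K H uA) = \<phi> uA uA uA"
    if \<phi>: "\<And>n c. n \<in> carrier A \<Longrightarrow> c \<in> carrier A \<Longrightarrow> lin A ?W (\<lambda>b. \<phi> b n c)"
      "\<And>b c. b \<in> carrier A \<Longrightarrow> c \<in> carrier A \<Longrightarrow> lin A ?W (\<lambda>n. \<phi> b n c)"
      "\<And>b n. b \<in> carrier A \<Longrightarrow> n \<in> carrier A \<Longrightarrow> lin A ?W (\<lambda>c. \<phi> b n c)" for \<phi>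
  proof -
    note J = lin_tl_fun lin_tl_arg lin_id \<phi> bilI vsp_tensor vA vV
    have 1: "bil A (A \<boxtimes> A) ?W (\<lambda>b t. tlf A A ?W (\<phi> b) t)" by ((rule J | assumption)+)
    have "tensor_lift3 K A A A ?W \<phi> (comult3 K H uA) =
      sw ?W (\<lambda>b u. sw ?W (\<phi> b) u) uA"
      unfolding tensor_lift3_def comult3_def using 1 by (subst tl_tm) ((rule J lin_id' lin_\<Delta> | assumption | simp)+)
    also have "\<dots> = sw ?W (\<phi> uA) uA"
      by (rule sw_one) ((rule J lin_comp[OF lin_\<Delta>] lin_closed[OF lin_\<Delta>] | assumption)+)
    also have "\<dots> = \<phi> uA uA uA" by (rule sw_one) ((rule J uA_closed | assumption)+)
    finally show ?thesis .
  qed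
  have c3h: "tensor_lift3 K A A A ?W \<phi> (comult3 K H h) = sw ?W (\<lambda>b u. sw ?W (\<lambda>x y. \<phi> b x y) u) h"
    if \<phi>: "\<And>n c. n \<in> carrier A \<Longrightarrow> c \<in> carrier A \<Longrightarrow> lin A ?W (\<lambda>b. \<phi> b n c)"
      "\<And>b c. b \<in> carrier A \<Longrightarrow> c \<in> carrier A \<Longrightarrow> lin A ?W (\<lambda>n. \<phi> b n c)"
      "\<And>b n. b \<in> carrier A \<Longrightarrow> n \<in> carrier A \<Longrightarrow> lin A ?W (\<lambda>c. \<phi> b n c)" for \<phi>
  proof -
    note J = lin_tl_fun lin_tl_arg lin_id \<phi> bilI vsp_tensor vA vV
    have 1: "bil A (A \<boxtimes> A) ?W (\<lambda>b t. tlf A A ?W (\<phi> b) t)" by ((rule J | assumption)+)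
    show ?thesis
      unfolding tensor_lift3_def comult3_def using 1
      by (subst tl_tm) ((rule J lin_id' lin_\<Delta> h \<Delta>_closed | assumption | simp)+)
  qed
  have comult3_closed: "comult3 K H h \<in> carrier (A \<boxtimes> A \<boxtimes> A)"
    unfolding comult3_def by ((rule I tm_closed lin_id' lin_\<Delta>)+)
  let ?\<phi> = "\<lambda>h1 h2 h3 b n c. tp A (V \<boxtimes> A) (h1 \<star> b) (tp V A (bl h2 n) (h3 \<star> c))"
  let ?inner = "\<lambda>h1 h2 h3. tlf A V ?W (\<lambda>b v. tlf V A ?W (\<lambda>n c. ?\<phi> h1 h2 h3 b n c) (cr v)) (cl m)"
  have inner: "tensor_lift3 K A V A ?W (\<lambda>b n c. tensor_lift3 K A A A ?W (\<lambda>g1 g2 g3.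
      tp A (V \<boxtimes> A) (h1 \<star> b \<star> g1) (tp V A (br (bl h2 n) g2) (h3 \<star> c \<star> ?Si (?Si g3)))) (comult3 K H uA))
      (bicoact K H M m) = ?inner h1 h2 h3"
    if hs: "h1 \<in> carrier A" "h2 \<in> carrier A" "h3 \<in> carrier A" for h1 h2 h3
  proof -
    have "tensor_lift3 K A A A ?W (\<lambda>g1 g2 g3.
        tp A (V \<boxtimes> A) (h1 \<star> b \<star> g1) (tp V A (br (bl h2 n) g2) (h3 \<star> c \<star> ?Si (?Si g3)))) (comult3 K H uA) =
      ?\<phi> h1 h2 h3 b n c" if "b \<in> carrier A" "n \<in> carrier V" "c \<in> carrier A" for b n c
      by (subst c3) ((rule I hs that | assumption)+, simp add: Si1 hs that br_one bilD(3)[OF bil_bl])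
    note e = this
    have "tlf A (V \<boxtimes> A) ?W (\<lambda>b. tlf V A ?W (\<lambda>n c. tensor_lift3 K A A A ?W (\<lambda>g1 g2 g3.
        tp A (V \<boxtimes> A) (h1 \<star> b \<star> g1) (tp V A (br (bl h2 n) g2) (h3 \<star> c \<star> ?Si (?Si g3)))) (comult3 K H uA)))
        (bicoact K H M m) =
      tlf A (V \<boxtimes> A) ?W (\<lambda>b. tlf V A ?W (\<lambda>n c. ?\<phi> h1 h2 h3 b n c)) (bicoact K H M m)"
    proof (rule sym, rule tl_cong)
      fix b t assume bt: "b \<in> carrier A" "t \<in> carrier (V \<boxtimes> A)"
      show "tlf V A ?W (\<lambda>n c. ?\<phi> h1 h2 h3 b n c) t = tlf V A ?W (\<lambda>n c. tensor_lift3 K A A A ?W (\<lambda>g1 g2 g3.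
        tp A (V \<boxtimes> A) (h1 \<star> b \<star> g1) (tp V A (br (bl h2 n) g2) (h3 \<star> c \<star> ?Si (?Si g3)))) (comult3 K H uA)) t"
        by (rule tl_cong) ((rule I hs bt | assumption)+, simp add: e bt)
    qed ((rule I hs lin_closed[OF lin_cr] tm_closed lin_id' lin_cr | assumption | simp only: bicoact_def)+)
    also have "\<dots> = ?inner h1 h2 h3"
      by (rule tl_bicoact) ((rule I hs | assumption)+)
    finally show ?thesis by (simp add: tensor_lift3_def)
  qed
  have blhm: "bl h m \<in> carrier V" using h m bilD(3)[OF bil_bl] by simp
  have "bicoact K H M (bl h m) = bicoact K H M (br (bl h m) uA)" by (simp add: br_one blhm)
  also have "\<dots> = tensor_lift3 K A A A ?W (\<lambda>h1 h2 h3. tensor_lift3 K A V A ?W (\<lambda>b n c. tensor_lift3 K A A A ?W (\<lambda>g1 g2 g3.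
      tp A (V \<boxtimes> A) (h1 \<star> b \<star> g1) (tp V A (br (bl h2 n) g2) (h3 \<star> c \<star> ?Si (?Si g3)))) (comult3 K H uA))
      (bicoact K H M m)) (comult3 K H h)"
    by (rule bimod_facts(7)[OF h uA_closed m])
  also have "\<dots> = tensor_lift3 K A A A ?W ?inner (comult3 K H h)"
    by (rule tensor_lift3_cong[symmetric])
       ((rule I tm_closed lin_id' lin_\<Delta> inner[symmetric] comult3_closed | assumption)+)
  also have "\<dots> = sw ?W (\<lambda>h1 u. sw ?W (\<lambda>h2 h3. ?inner h1 h2 h3) u) h"
    by (rule c3h) ((rule I | assumption)+)
  finally have "\<Phi> (bicoact K H M (bl h m)) = \<Phi> (sw ?W (\<lambda>h1 u. sw ?W (\<lambda>h2 h3. ?inner h1 h2 h3) u) h)"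
    by simp
  also have "\<dots> = sw U (\<lambda>h1 u. \<Phi> (sw ?W (\<lambda>h2 h3. ?inner h1 h2 h3) u)) h"
    by (rule sw_push) ((rule I U \<Phi> | assumption)+)
  also have "\<dots> = sw U (\<lambda>h1 u. sw U (\<lambda>h2 h3. \<Phi> (?inner h1 h2 h3)) u) h"
    by (rule sw_cong, (rule I U lin_comp[OF \<Phi>] | assumption)+, rule sw_push) ((rule I U \<Phi> | assumption)+)
  also have "\<dots> = sw U (\<lambda>h1 u. sw U (\<lambda>h2 h3. tlf A V U (\<lambda>b v. \<Phi> (tlf V A ?W (\<lambda>n c. ?\<phi> h1 h2 h3 b n c) (cr v))) (cl m)) u) h"
    by (rule sw_cong, (rule I U lin_comp[OF \<Phi>] | assumption)+, rule sw_cong, (rule I U lin_comp[OF \<Phi>] | assumption)+, rule tl_push)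
       ((rule I U \<Phi> | assumption)+)
  also have "\<dots> = sw U (\<lambda>h1 u. sw U (\<lambda>h2 h3. tlf A V U (\<lambda>b v. tlf V A U (\<lambda>n c. \<Phi> (?\<phi> h1 h2 h3 b n c)) (cr v)) (cl m)) u) h"
    by (rule sw_cong, (rule I U lin_comp[OF \<Phi>] | assumption)+, rule sw_cong, (rule I U lin_comp[OF \<Phi>] | assumption)+,
        rule tl_cong, (rule I U lin_comp[OF \<Phi>] | assumption)+, rule tl_push)
       ((rule I U \<Phi> | assumption)+)
  finally show ?thesis .
qed

text \<open>The counit on the last leg turns the two-sided coaction into the left one; on the
  right-hand side \<epsilon>(h3 c) then removes both h3 and the right coaction of m.\<close>

lemma cl_bl:
  assumes h: "h \<in> carrier A" and m: "m \<in> carrier V"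
  shows "cl (bl h m) = sw (A \<boxtimes> V) (\<lambda>x y. tlf A V (A \<boxtimes> V) (\<lambda>b n. tp A V (x \<star> b) (bl y n)) (cl m)) h"
proof -
  let ?Z = "A \<boxtimes> V" and ?W = "A \<boxtimes> V \<boxtimes> A"
  let ?f = "\<lambda>b n c. \<epsilon> c \<odot>\<^bsub>?Z\<^esub> tp A V b n"
  let ?\<Phi> = "tlf A (V \<boxtimes> A) ?Z (\<lambda>b t. tlf V A ?Z (?f b) t)"
  note I = lin_intros
  have bil: "bil A (V \<boxtimes> A) ?Z (\<lambda>b t. tlf V A ?Z (?f b) t)" by ((rule I | assumption)+)
  have \<Phi>: "lin ?W ?Z ?\<Phi>" by (rule lin_tl_self[OF _ _ _ bil]) ((rule I)+)
  have ptp: "?\<Phi> (tp A (V \<boxtimes> A) b (tp V A n c)) = ?f b n c"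
    if "b \<in> carrier A" "n \<in> carrier V" "c \<in> carrier A" for b n c
    by (subst tl_tp[OF _ _ _ bil], (rule I that)+, subst tl_tp) ((rule I that refl | assumption)+)
  have pb: "?\<Phi> (bicoact K H M n) = cl n" if n: "n \<in> carrier V" for n
  proof -
    have "?\<Phi> (bicoact K H M n) = tlf A V ?Z (\<lambda>b v. tlf V A ?Z (\<lambda>n c. ?f b n c) (cr v)) (cl n)"
      by (rule tl_bicoact) ((rule I n | assumption)+)
    also have "\<dots> = tlf A V ?Z (\<lambda>b v. tp A V b v) (cl n)"
    proof (rule tl_cong)
      fix b v assume bv: "b \<in> carrier A" "v \<in> carrier V"
      have "tp A V b (tlf V A V (\<lambda>m a. \<epsilon> a \<odot>\<^bsub>V\<^esub> m) (cr v)) = tlf V A ?Z (\<lambda>m a. tp A V b (\<epsilon> a \<odot>\<^bsub>V\<^esub> m)) (cr v)"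
        by (rule tl_push) ((rule I bv | assumption)+)
      also have "\<dots> = tlf V A ?Z (\<lambda>n c. ?f b n c) (cr v)"
        by (rule tl_cong) ((rule I bv | assumption)+, simp add: tp_linear[OF vA vV] bv)
      finally show "tlf V A ?Z (\<lambda>n c. ?f b n c) (cr v) = tp A V b v" by (simp add: cr_counit bv)
    qed ((rule I n | assumption)+)
    also have "\<dots> = cl n" by (rule tl_id) ((rule I n)+)
    finally show ?thesis .
  qed
  have "cl (bl h m) = ?\<Phi> (bicoact K H M (bl h m))"
    by (rule pb[symmetric]) ((rule I h m)+)
  also have "\<dots> = sw ?Z (\<lambda>h1 u. sw ?Z (\<lambda>h2 h3. tlf A V ?Z (\<lambda>b v. tlf V A ?Z (\<lambda>n c.
      ?\<Phi> (tp A (V \<boxtimes> A) (h1 \<star> b) (tp V A (bl h2 n) (h3 \<star> c)))) (cr v)) (cl m)) u) h"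
    by (rule bicoact_bl[OF _ h m \<Phi>]) ((rule I)+)
  also have "\<dots> = sw ?Z (\<lambda>h1 u. sw ?Z (\<lambda>h2 h3. \<epsilon> h3 \<odot>\<^bsub>?Z\<^esub> tlf A V ?Z (\<lambda>b v. tp A V (h1 \<star> b) (bl h2 v)) (cl m)) u) h"
  proof (rule sw_cong, (rule I \<Phi>[THEN lin_comp] h m | assumption)+, rule sw_cong, (rule I \<Phi>[THEN lin_comp] h m | assumption)+)
    fix h1 h2 h3 assume hs: "h1 \<in> carrier A" "h2 \<in> carrier A" "h3 \<in> carrier A"
    have "tlf A V ?Z (\<lambda>b v. tlf V A ?Z (\<lambda>n c. ?\<Phi> (tp A (V \<boxtimes> A) (h1 \<star> b) (tp V A (bl h2 n) (h3 \<star> c)))) (cr v)) (cl m) =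
      tlf A V ?Z (\<lambda>b v. \<epsilon> h3 \<odot>\<^bsub>?Z\<^esub> tp A V (h1 \<star> b) (bl h2 v)) (cl m)"
    proof (rule tl_cong)
      fix b v assume bv: "b \<in> carrier A" "v \<in> carrier V"
      let ?g = "\<lambda>v. \<epsilon> h3 \<odot>\<^bsub>?Z\<^esub> tp A V (h1 \<star> b) (bl h2 v)"
      have "?g (tlf V A V (\<lambda>m a. \<epsilon> a \<odot>\<^bsub>V\<^esub> m) (cr v)) = tlf V A ?Z (\<lambda>m a. ?g (\<epsilon> a \<odot>\<^bsub>V\<^esub> m)) (cr v)"
        by (rule tl_push) ((rule I bv hs | assumption)+)
      also have "\<dots> = tlf V A ?Z (\<lambda>n c. ?\<Phi> (tp A (V \<boxtimes> A) (h1 \<star> b) (tp V A (bl h2 n) (h3 \<star> c)))) (cr v)"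
      proof (rule tl_cong)
        fix n c assume nc: "n \<in> carrier V" "c \<in> carrier A"
        have hn: "bl h2 n \<in> carrier V" by ((rule I hs nc)+)
        have tc: "tp A V (h1 \<star> b) (bl h2 n) \<in> carrier ?Z" by ((rule I hs nc bv)+)
        have "bl h2 (\<epsilon> c \<odot>\<^bsub>V\<^esub> n) = \<epsilon> c \<odot>\<^bsub>V\<^esub> bl h2 n"
          by (rule lin_smult[OF bilD(1)[OF bil_bl]]) (simp_all add: hs nc)
        then have "?g (\<epsilon> c \<odot>\<^bsub>V\<^esub> n) = \<epsilon> h3 \<odot>\<^bsub>?Z\<^esub> (\<epsilon> c \<odot>\<^bsub>?Z\<^esub> tp A V (h1 \<star> b) (bl h2 n))"
          by (simp add: tp_linear[OF vA vV] hs nc bv hn)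
        also have "\<dots> = ?f (h1 \<star> b) (bl h2 n) (h3 \<star> c)"
          by (simp add: \<epsilon>_mul hs nc smult_smult[OF vsp_tensor[OF vA vV] _ _ tc])
        also have "\<dots> = ?\<Phi> (tp A (V \<boxtimes> A) (h1 \<star> b) (tp V A (bl h2 n) (h3 \<star> c)))"
          by (rule ptp[symmetric]) (simp_all add: hs nc bv hn)
        finally show "?g (\<epsilon> c \<odot>\<^bsub>V\<^esub> n) = ?\<Phi> (tp A (V \<boxtimes> A) (h1 \<star> b) (tp V A (bl h2 n) (h3 \<star> c)))" .
      qed ((rule I bv hs | assumption)+)
      finally show "tlf V A ?Z (\<lambda>n c. ?\<Phi> (tp A (V \<boxtimes> A) (h1 \<star> b) (tp V A (bl h2 n) (h3 \<star> c)))) (cr v) = ?g v"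
        by (simp add: cr_counit bv)
    qed ((rule I \<Phi>[THEN lin_comp] h m hs | assumption)+)
    also have "\<dots> = \<epsilon> h3 \<odot>\<^bsub>?Z\<^esub> tlf A V ?Z (\<lambda>b v. tp A V (h1 \<star> b) (bl h2 v)) (cl m)"
      by (rule tl_push[symmetric]) ((rule I hs m | assumption)+)
    finally show "tlf A V ?Z (\<lambda>b v. tlf V A ?Z (\<lambda>n c. ?\<Phi> (tp A (V \<boxtimes> A) (h1 \<star> b) (tp V A (bl h2 n) (h3 \<star> c)))) (cr v)) (cl m) =
      \<epsilon> h3 \<odot>\<^bsub>?Z\<^esub> tlf A V ?Z (\<lambda>b v. tp A V (h1 \<star> b) (bl h2 v)) (cl m)" .
  qed
  also have "\<dots> = sw ?Z (\<lambda>h1 u. tlf A V ?Z (\<lambda>b v. tp A V (h1 \<star> b) (bl u v)) (cl m)) h"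
    by (rule sw_cong, (rule I h m | assumption)+, rule counit_r) ((rule I m | assumption)+)
  finally show ?thesis .
qed

text \<open>The mirror image of \<open>cl_bl\<close>, with the counit on the first leg.\<close>

lemma cr_bl:
  assumes h: "h \<in> carrier A" and m: "m \<in> carrier V"
  shows "cr (bl h m) = sw (V \<boxtimes> A) (\<lambda>x y. tlf V A (V \<boxtimes> A) (\<lambda>n c. tp V A (bl x n) (y \<star> c)) (cr m)) h"
proof -
  let ?Z = "V \<boxtimes> A" and ?W = "A \<boxtimes> V \<boxtimes> A"
  let ?f = "\<lambda>b n c. \<epsilon> b \<odot>\<^bsub>?Z\<^esub> tp V A n c"
  let ?\<Phi> = "tlf A (V \<boxtimes> A) ?Z (\<lambda>b t. tlf V A ?Z (?f b) t)"
  note I = lin_intros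
  have bil: "bil A (V \<boxtimes> A) ?Z (\<lambda>b t. tlf V A ?Z (?f b) t)" by ((rule I | assumption)+)
  have \<Phi>: "lin ?W ?Z ?\<Phi>" by (rule lin_tl_self[OF _ _ _ bil]) ((rule I)+)
  have ptp: "?\<Phi> (tp A (V \<boxtimes> A) b (tp V A n c)) = ?f b n c"
    if "b \<in> carrier A" "n \<in> carrier V" "c \<in> carrier A" for b n c
    by (subst tl_tp[OF _ _ _ bil], (rule I that)+, subst tl_tp) ((rule I that refl | assumption)+)
  have ctl: "tlf A V U (\<lambda>b v. \<epsilon> b \<odot>\<^bsub>U\<^esub> g v) (cl n) = g n"
    if U: "vsp U" and n: "n \<in> carrier V" and g: "lin V U g" for n g and U :: "('k, ('m \<times> 'h \<Rightarrow> 'k) set) module"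
  proof -
    have "g (tlf A V V (\<lambda>a m. \<epsilon> a \<odot>\<^bsub>V\<^esub> m) (cl n)) = tlf A V U (\<lambda>a m. g (\<epsilon> a \<odot>\<^bsub>V\<^esub> m)) (cl n)"
      by (rule tl_push) ((rule I n U g | assumption)+)
    also have "\<dots> = tlf A V U (\<lambda>b v. \<epsilon> b \<odot>\<^bsub>U\<^esub> g v) (cl n)"
      by (rule tl_cong) ((rule I lin_comp[OF g] n U | assumption)+, simp add: lin_smult[OF g])
    finally show ?thesis by (simp add: cl_counit n)
  qed
  have pb: "?\<Phi> (bicoact K H M n) = cr n" if n: "n \<in> carrier V" for n
  proof -
    have "?\<Phi> (bicoact K H M n) = tlf A V ?Z (\<lambda>b v. tlf V A ?Z (\<lambda>n c. ?f b n c) (cr v)) (cl n)"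
      by (rule tl_bicoact) ((rule I n | assumption)+)
    also have "\<dots> = tlf A V ?Z (\<lambda>b v. \<epsilon> b \<odot>\<^bsub>?Z\<^esub> cr v) (cl n)"
    proof (rule tl_cong)
      fix b v assume bv: "b \<in> carrier A" "v \<in> carrier V"
      have "\<epsilon> b \<odot>\<^bsub>?Z\<^esub> tlf V A ?Z (\<lambda>n c. tp V A n c) (cr v) = tlf V A ?Z (\<lambda>n c. ?f b n c) (cr v)"
        by (rule tl_push) ((rule I bv | assumption)+)
      moreover have "tlf V A ?Z (\<lambda>n c. tp V A n c) (cr v) = cr v" by (rule tl_id) ((rule I bv)+)
      ultimately show "tlf V A ?Z (\<lambda>n c. ?f b n c) (cr v) = \<epsilon> b \<odot>\<^bsub>?Z\<^esub> cr v" by simp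
    qed ((rule I n | assumption)+)
    also have "\<dots> = cr n" by (rule ctl[OF _ n lin_cr]) ((rule I)+)
    finally show ?thesis .
  qed
  have "cr (bl h m) = ?\<Phi> (bicoact K H M (bl h m))"
    by (rule pb[symmetric]) ((rule I h m)+)
  also have "\<dots> = sw ?Z (\<lambda>h1 u. sw ?Z (\<lambda>h2 h3. tlf A V ?Z (\<lambda>b v. tlf V A ?Z (\<lambda>n c.
      ?\<Phi> (tp A (V \<boxtimes> A) (h1 \<star> b) (tp V A (bl h2 n) (h3 \<star> c)))) (cr v)) (cl m)) u) h"
    by (rule bicoact_bl[OF _ h m \<Phi>]) ((rule I)+)
  also have "\<dots> = sw ?Z (\<lambda>h1 u. \<epsilon> h1 \<odot>\<^bsub>?Z\<^esub> sw ?Z (\<lambda>h2 h3. tlf V A ?Z (\<lambda>n c. tp V A (bl h2 n) (h3 \<star> c)) (cr m)) u) h"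
  proof (rule sw_cong, (rule I \<Phi>[THEN lin_comp] h m | assumption)+)
    fix h1 u assume hu: "h1 \<in> carrier A" "u \<in> carrier A"
    have "sw ?Z (\<lambda>h2 h3. tlf A V ?Z (\<lambda>b v. tlf V A ?Z (\<lambda>n c.
      ?\<Phi> (tp A (V \<boxtimes> A) (h1 \<star> b) (tp V A (bl h2 n) (h3 \<star> c)))) (cr v)) (cl m)) u =
      sw ?Z (\<lambda>h2 h3. \<epsilon> h1 \<odot>\<^bsub>?Z\<^esub> tlf V A ?Z (\<lambda>n c. tp V A (bl h2 n) (h3 \<star> c)) (cr m)) u"
    proof (rule sw_cong, (rule I \<Phi>[THEN lin_comp] hu m | assumption)+)
      fix h2 h3 assume hs: "h2 \<in> carrier A" "h3 \<in> carrier A"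
      let ?g = "\<lambda>v. \<epsilon> h1 \<odot>\<^bsub>?Z\<^esub> tlf V A ?Z (\<lambda>n c. tp V A (bl h2 n) (h3 \<star> c)) (cr v)"
      have "tlf A V ?Z (\<lambda>b v. tlf V A ?Z (\<lambda>n c. ?\<Phi> (tp A (V \<boxtimes> A) (h1 \<star> b) (tp V A (bl h2 n) (h3 \<star> c)))) (cr v)) (cl m) =
        tlf A V ?Z (\<lambda>b v. \<epsilon> b \<odot>\<^bsub>?Z\<^esub> ?g v) (cl m)"
      proof (rule tl_cong)
        fix b v assume bv: "b \<in> carrier A" "v \<in> carrier V"
        have "tlf V A ?Z (\<lambda>n c. ?\<Phi> (tp A (V \<boxtimes> A) (h1 \<star> b) (tp V A (bl h2 n) (h3 \<star> c)))) (cr v) =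
          tlf V A ?Z (\<lambda>n c. \<epsilon> b \<odot>\<^bsub>?Z\<^esub> (\<epsilon> h1 \<odot>\<^bsub>?Z\<^esub> tp V A (bl h2 n) (h3 \<star> c))) (cr v)"
        proof (rule tl_cong)
          fix n c assume nc: "n \<in> carrier V" "c \<in> carrier A"
          have hn: "bl h2 n \<in> carrier V" by ((rule I hs nc)+)
          have tc: "tp V A (bl h2 n) (h3 \<star> c) \<in> carrier ?Z" by ((rule I hs nc bv)+)
          have "\<epsilon> (h1 \<star> b) = \<epsilon> b \<otimes>\<^bsub>K\<^esub> \<epsilon> h1"
            using hu bv cring.cring_simprules(14)[OF ring_K(2)] by (simp add: \<epsilon>_mul)
          then show "?\<Phi> (tp A (V \<boxtimes> A) (h1 \<star> b) (tp V A (bl h2 n) (h3 \<star> c))) =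
            \<epsilon> b \<odot>\<^bsub>?Z\<^esub> (\<epsilon> h1 \<odot>\<^bsub>?Z\<^esub> tp V A (bl h2 n) (h3 \<star> c))"
            using smult_smult[OF vsp_tensor[OF vV vA] _ _ tc, of "\<epsilon> b" "\<epsilon> h1"]
            by (subst ptp) (simp_all add: hu hs nc bv hn)
        qed ((rule I \<Phi>[THEN lin_comp] bv hu hs | assumption)+)
        also have "\<dots> = \<epsilon> b \<odot>\<^bsub>?Z\<^esub> tlf V A ?Z (\<lambda>n c. \<epsilon> h1 \<odot>\<^bsub>?Z\<^esub> tp V A (bl h2 n) (h3 \<star> c)) (cr v)"
          by (rule tl_push[symmetric]) ((rule I hs hu bv | assumption)+)
        also have "tlf V A ?Z (\<lambda>n c. \<epsilon> h1 \<odot>\<^bsub>?Z\<^esub> tp V A (bl h2 n) (h3 \<star> c)) (cr v) = ?g v"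
          by (rule tl_push[symmetric]) ((rule I hs hu bv | assumption)+)
        finally show "tlf V A ?Z (\<lambda>n c. ?\<Phi> (tp A (V \<boxtimes> A) (h1 \<star> b) (tp V A (bl h2 n) (h3 \<star> c)))) (cr v) =
          \<epsilon> b \<odot>\<^bsub>?Z\<^esub> ?g v" .
      qed ((rule I \<Phi>[THEN lin_comp] hu hs m | assumption)+)
      also have "\<dots> = ?g m" by (rule ctl) ((rule I hs hu m | assumption)+)
      finally show "tlf A V ?Z (\<lambda>b v. tlf V A ?Z (\<lambda>n c. ?\<Phi> (tp A (V \<boxtimes> A) (h1 \<star> b) (tp V A (bl h2 n) (h3 \<star> c)))) (cr v)) (cl m) = ?g m" .
    qed
    also have "\<dots> = \<epsilon> h1 \<odot>\<^bsub>?Z\<^esub> sw ?Z (\<lambda>h2 h3. tlf V A ?Z (\<lambda>n c. tp V A (bl h2 n) (h3 \<star> c)) (cr m)) u"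
      by (rule sw_push[symmetric]) ((rule I hu m | assumption)+)
    finally show "sw ?Z (\<lambda>h2 h3. tlf A V ?Z (\<lambda>b v. tlf V A ?Z (\<lambda>n c.
      ?\<Phi> (tp A (V \<boxtimes> A) (h1 \<star> b) (tp V A (bl h2 n) (h3 \<star> c)))) (cr v)) (cl m)) u =
      \<epsilon> h1 \<odot>\<^bsub>?Z\<^esub> sw ?Z (\<lambda>h2 h3. tlf V A ?Z (\<lambda>n c. tp V A (bl h2 n) (h3 \<star> c)) (cr m)) u" .
  qed
  also have "\<dots> = sw ?Z (\<lambda>h2 h3. tlf V A ?Z (\<lambda>n c. tp V A (bl h2 n) (h3 \<star> c)) (cr m)) h"
    by (rule counit_l) ((rule I h m | assumption)+)
  finally show ?thesis .
qed

end

section \<open>Commuting coactions\<close>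

context hopf begin

text \<open>The coefficients of both iterated coactions are brought into the same order, so the
  equation expresses that t and t' commute although their coefficients arise in opposite
  orders.\<close>

definition cocomm :: "('k, 'c) module \<Rightarrow> ('k, 'd) module \<Rightarrow> ('k, 'e) module \<Rightarrow>
    ('e \<Rightarrow> ('c \<times> 'e \<Rightarrow> 'k) set) \<Rightarrow> ('e \<Rightarrow> ('d \<times> 'e \<Rightarrow> 'k) set) \<Rightarrow> 'e \<Rightarrow> bool" where
  "cocomm C D E t t' w \<longleftrightarrow>
    tlf C E (C \<boxtimes> D \<boxtimes> E) (\<lambda>b n. tlf D E (C \<boxtimes> D \<boxtimes> E) (\<lambda>b' n'. tp C (D \<boxtimes> E) b (tp D E b' n')) (t' n)) (t w) =
    tlf D E (C \<boxtimes> D \<boxtimes> E) (\<lambda>b' n. tlf C E (C \<boxtimes> D \<boxtimes> E) (\<lambda>b n'. tp C (D \<boxtimes> E) b (tp D E b' n')) (t n)) (t' w)"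

text \<open>Commutation is used inside larger sums. The defining equation is the universal case, and
  any trilinear \<phi> factors through it.\<close>

lemma cocomm_lift:
  assumes v: "vsp C" "vsp D" "vsp E" "vsp W"
    and t: "lin E (C \<boxtimes> E) t" and t': "lin E (D \<boxtimes> E) t'" and w: "w \<in> carrier E"
    and c: "cocomm C D E t t' w"
    and f: "\<And>b' n. b' \<in> carrier D \<Longrightarrow> n \<in> carrier E \<Longrightarrow> lin C W (\<lambda>b. \<phi> b b' n)"
      "\<And>b n. b \<in> carrier C \<Longrightarrow> n \<in> carrier E \<Longrightarrow> lin D W (\<lambda>b'. \<phi> b b' n)"
      "\<And>b b'. b \<in> carrier C \<Longrightarrow> b' \<in> carrier D \<Longrightarrow> lin E W (\<lambda>n. \<phi> b b' n)"
  shows "tlf C E W (\<lambda>b n. tlf D E W (\<lambda>b' n'. \<phi> b b' n') (t' n)) (t w) =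
    tlf D E W (\<lambda>b' n. tlf C E W (\<lambda>b n'. \<phi> b b' n') (t n)) (t' w)"
proof -
  let ?Y = "C \<boxtimes> D \<boxtimes> E"
  let ?\<Psi> = "tlf C (D \<boxtimes> E) W (\<lambda>b t. tlf D E W (\<lambda>b' n. \<phi> b b' n) t)"
  note J = lin_tl_fun lin_tl_arg lin_id f bilI lin_tpl lin_tpr vsp_tensor v
    lin_comp[OF t] lin_closed[OF t] lin_comp[OF t'] lin_closed[OF t'] w tp_closed
  have bil: "bil C (D \<boxtimes> E) W (\<lambda>b t. tlf D E W (\<lambda>b' n. \<phi> b b' n) t)" by ((rule J | assumption)+)
  have \<Psi>: "lin ?Y W ?\<Psi>" by (rule lin_tl_self[OF _ _ _ bil]) ((rule J)+)
  have e: "?\<Psi> (tp C (D \<boxtimes> E) b (tp D E b' n)) = \<phi> b b' n"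
    if "b \<in> carrier C" "b' \<in> carrier D" "n \<in> carrier E" for b b' n
    by (subst tl_tp[OF _ _ _ bil], (rule J that)+, subst tl_tp) ((rule J that refl | assumption)+)
  have 1: "?\<Psi> (tlf C E ?Y (\<lambda>b n. tlf D E ?Y (\<lambda>b' n'. tp C (D \<boxtimes> E) b (tp D E b' n')) (t' n)) (t w)) =
    tlf C E W (\<lambda>b n. tlf D E W (\<lambda>b' n'. \<phi> b b' n') (t' n)) (t w)"
  proof -
    have "?\<Psi> (tlf C E ?Y (\<lambda>b n. tlf D E ?Y (\<lambda>b' n'. tp C (D \<boxtimes> E) b (tp D E b' n')) (t' n)) (t w)) =
      tlf C E W (\<lambda>b n. ?\<Psi> (tlf D E ?Y (\<lambda>b' n'. tp C (D \<boxtimes> E) b (tp D E b' n')) (t' n))) (t w)"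
      by (rule tl_push) ((rule J \<Psi> | assumption)+)
    also have "\<dots> = tlf C E W (\<lambda>b n. tlf D E W (\<lambda>b' n'. \<phi> b b' n') (t' n)) (t w)"
    proof (rule tl_cong, (rule J lin_comp[OF \<Psi>] | assumption)+)
      fix b n assume bn: "b \<in> carrier C" "n \<in> carrier E"
      have "?\<Psi> (tlf D E ?Y (\<lambda>b' n'. tp C (D \<boxtimes> E) b (tp D E b' n')) (t' n)) =
        tlf D E W (\<lambda>b' n'. ?\<Psi> (tp C (D \<boxtimes> E) b (tp D E b' n'))) (t' n)"
        by (rule tl_push) ((rule J \<Psi> bn | assumption)+)
      also have "\<dots> = tlf D E W (\<lambda>b' n'. \<phi> b b' n') (t' n)"
        by (rule tl_cong, (rule J lin_comp[OF \<Psi>] bn | assumption)+, rule e) ((rule bn | assumption)+)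
      finally show "?\<Psi> (tlf D E ?Y (\<lambda>b' n'. tp C (D \<boxtimes> E) b (tp D E b' n')) (t' n)) = \<dots>" .
    qed
    finally show ?thesis .
  qed
  have 2: "?\<Psi> (tlf D E ?Y (\<lambda>b' n. tlf C E ?Y (\<lambda>b n'. tp C (D \<boxtimes> E) b (tp D E b' n')) (t n)) (t' w)) =
    tlf D E W (\<lambda>b' n. tlf C E W (\<lambda>b n'. \<phi> b b' n') (t n)) (t' w)"
  proof -
    have "?\<Psi> (tlf D E ?Y (\<lambda>b' n. tlf C E ?Y (\<lambda>b n'. tp C (D \<boxtimes> E) b (tp D E b' n')) (t n)) (t' w)) =
      tlf D E W (\<lambda>b' n. ?\<Psi> (tlf C E ?Y (\<lambda>b n'. tp C (D \<boxtimes> E) b (tp D E b' n')) (t n))) (t' w)"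
      by (rule tl_push) ((rule J \<Psi> | assumption)+)
    also have "\<dots> = tlf D E W (\<lambda>b' n. tlf C E W (\<lambda>b n'. \<phi> b b' n') (t n)) (t' w)"
    proof (rule tl_cong, (rule J lin_comp[OF \<Psi>] | assumption)+)
      fix b' n assume bn: "b' \<in> carrier D" "n \<in> carrier E"
      have "?\<Psi> (tlf C E ?Y (\<lambda>b n'. tp C (D \<boxtimes> E) b (tp D E b' n')) (t n)) =
        tlf C E W (\<lambda>b n'. ?\<Psi> (tp C (D \<boxtimes> E) b (tp D E b' n'))) (t n)"
        by (rule tl_push) ((rule J \<Psi> bn | assumption)+)
      also have "\<dots> = tlf C E W (\<lambda>b n'. \<phi> b b' n') (t n)"
        by (rule tl_cong, (rule J lin_comp[OF \<Psi>] bn | assumption)+, rule e) ((rule bn | assumption)+)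
      finally show "?\<Psi> (tlf C E ?Y (\<lambda>b n'. tp C (D \<boxtimes> E) b (tp D E b' n')) (t n)) = \<dots>" .
    qed
    finally show ?thesis .
  qed
  show ?thesis using 1 2 c by (simp add: cocomm_def)
qed

lemma cocomm_sym:
  assumes v: "vsp C" "vsp D" "vsp E"
    and t: "lin E (C \<boxtimes> E) t" and t': "lin E (D \<boxtimes> E) t'" and w: "w \<in> carrier E"
    and c: "cocomm C D E t t' w"
  shows "cocomm D C E t' t w"
  unfolding cocomm_def
  by (rule cocomm_lift[symmetric, OF v _ t t' w c]) ((rule lin_intros v | assumption)+)

end

context bimod begin

subsection \<open>Half-edge operators\<close>

text \<open>\<open>act\<close> and \<open>coa\<close> are the operators L_h and T_h on the factor of
  the edge of h. The flag \<open>s\<close> is true if h is the source of its edge.\<close>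

definition act :: "bool \<Rightarrow> 'h \<Rightarrow> 'm \<Rightarrow> 'm" where
  "act s a m = (if s then br m (S a) else bl a m)"

definition coa :: "bool \<Rightarrow> 'm \<Rightarrow> ('h \<times> 'm \<Rightarrow> 'k) set" where
  "coa s m = (if s then cl m else tlf V A (A \<boxtimes> V) (\<lambda>n c. tp A V (S c) n) (cr m))"

lemma bil_act: "bil A V V (\<lambda>a m. act s a m)"
  by (cases s) (simp_all add: act_def, (rule lin_intros | assumption)+)

lemma lin_act: "a \<in> carrier A \<Longrightarrow> lin V V (act s a)"
  by (rule bilD(1)[OF bil_act])

lemma lin_coa: "lin V (A \<boxtimes> V) (coa s)"
  unfolding coa_def[abs_def] by (cases s) (simp_all add: lin_cl, (rule lin_intros | assumption)+)

lemma act_one: "m \<in> carrier V \<Longrightarrow> act s uA m = m"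
  by (simp add: act_def bl_one br_one)

lemmas [lin_intros] = bil_arg1[OF bil_act] bil_arg2[OF bil_act] bilD(3)[OF bil_act]
  lin_comp[OF lin_coa] lin_closed[OF lin_coa]

text \<open>The involution exchanges source and target, here for actions and in
  \<open>coa_\<psi>\<close> for coactions. Hence each relation has to be computed for one end of the
  edge only.\<close>

lemma act_\<psi>:
  assumes "a \<in> carrier A" "m \<in> carrier V" shows "act s a (\<psi> m) = \<psi> (act (\<not> s) a m)"
proof (cases s)
  case False
  have c: "\<psi> m \<in> carrier V" "bl a (\<psi> m) \<in> carrier V" by ((rule lin_intros assms)+)
  have "\<psi> (bl a (\<psi> m)) = br m (S a)" using bimod_facts(10)[OF c(1) assms(1)] assms by (simp add: bimod_facts(9))
  then have "\<psi> (br m (S a)) = bl a (\<psi> m)" using bimod_facts(9)[OF c(2)] by simp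
  with False show ?thesis by (simp add: act_def)
qed (simp add: act_def bimod_facts(10) assms)

lemma coa_\<psi>:
  assumes m: "m \<in> carrier V" shows "coa s (\<psi> m) = tm A V A V (\<lambda>x. x) \<psi> (coa (\<not> s) m)"
proof -
  have 1: "cl (\<psi> m) = tm A V A V (\<lambda>x. x) \<psi> (coa False m)" if m: "m \<in> carrier V" for m
  proof -
    have "tm A V A V (\<lambda>x. x) \<psi> (coa False m) = tlf V A (A \<boxtimes> V) (\<lambda>n c. tm A V A V (\<lambda>x. x) \<psi> (tp A V (S c) n)) (cr m)"
      unfolding coa_def if_False by (rule tl_push) ((rule lin_intros m lin_\<psi> | assumption)+)
    also have "\<dots> = tlf V A (A \<boxtimes> V) (\<lambda>n c. tp A V (S c) (\<psi> n)) (cr m)"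
      by (rule tl_cong, (rule lin_intros m lin_\<psi> | assumption)+, rule tm_tp) ((rule lin_intros m lin_\<psi> | assumption)+)
    finally show ?thesis by (simp add: bimod_facts(11) m)
  qed
  show ?thesis
  proof (cases s)
    case True then show ?thesis using 1[OF m] by (simp add: coa_def)
  next
    case False
    have c: "\<psi> m \<in> carrier V" by ((rule lin_intros m)+)
    have cc: "coa False (\<psi> m) \<in> carrier (A \<boxtimes> V)" by (rule lin_closed[OF lin_coa c])
    have "cl m = tm A V A V (\<lambda>x. x) \<psi> (coa False (\<psi> m))" using 1[OF c] by (simp add: bimod_facts(9) m)
    then have "tm A V A V (\<lambda>x. x) \<psi> (cl m) = tm A V A V (\<lambda>x. x) (\<lambda>x. \<psi> (\<psi> x)) (coa False (\<psi> m))"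
      using tm_tm[OF vA vV vA vV vA vV lin_id lin_\<psi> lin_id lin_\<psi> cc] by simp
    also have "\<dots> = coa False (\<psi> m)" by (rule tm_id[OF vA vV cc]) (simp_all add: bimod_facts(9))
    finally show ?thesis using False by (simp add: coa_def)
  qed
qed

context
begin

private lemmas I = lin_intros lin_\<psi>

text \<open>The opposite coproduct. With it the relations for the same and for opposite ends of an
  edge both become sums over an element of H \<otimes> H, and \<open>coa_act_conj\<close> and
  \<open>cosite_site_edge\<close> treat them together.\<close>

definition "cop a = tlf A A (A \<boxtimes> A) (\<lambda>x y. tp A A y x) (\<Delta> a)"

lemma cop_closed: "a \<in> carrier A \<Longrightarrow> cop a \<in> carrier (A \<boxtimes> A)"
  unfolding cop_def by ((rule I | assumption)+)

lemma tl_cop: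
  assumes W: "vsp W" and \<phi>: "bil A A W (\<lambda>x y. \<phi> x y)" and a: "a \<in> carrier A"
  shows "tlf A A W (\<lambda>x y. \<phi> x y) (cop a) = sw W (\<lambda>x y. \<phi> y x) a"
proof -
  note I = I W a bil_arg1[OF \<phi>] bil_arg2[OF \<phi>]
  have "tlf A A W (\<lambda>x y. \<phi> x y) (cop a) = sw W (\<lambda>x y. tlf A A W (\<lambda>x y. \<phi> x y) (tp A A y x)) a"
    unfolding cop_def by (rule tl_push) ((rule I \<phi> lin_tl_self | assumption)+)
  also have "\<dots> = sw W (\<lambda>x y. \<phi> y x) a"
    by (rule tl_cong, (rule I \<phi> lin_tl_self | assumption)+, rule tl_tp) ((rule I \<phi> | assumption)+)
  finally show ?thesis .
qed

text \<open>Conjugation with \<psi> exchanges the ends of the edge in the action and in the coaction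
  at once, and leaves the coefficients in H alone.\<close>

lemma coa_act_conj:
  assumes \<mu>: "bil A A A (\<lambda>x c. \<mu> x c)" and d: "d \<in> carrier (A \<boxtimes> A)"
    and R: "\<And>m. m \<in> carrier V \<Longrightarrow> coa t (act s a m) =
      tlf A A (A \<boxtimes> V) (\<lambda>x y. tlf A V (A \<boxtimes> V) (\<lambda>c n. tp A V (\<mu> x c) (act s y n)) (coa t m)) d"
    and a: "a \<in> carrier A" and m: "m \<in> carrier V"
  shows "coa (\<not> t) (act (\<not> s) a m) =
    tlf A A (A \<boxtimes> V) (\<lambda>x y. tlf A V (A \<boxtimes> V) (\<lambda>c n. tp A V (\<mu> x c) (act (\<not> s) y n)) (coa (\<not> t) m)) d"
proof -
  let ?Z = "A \<boxtimes> V"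
  note I = I bil_arg1[OF \<mu>] bil_arg2[OF \<mu>] bilD(3)[OF \<mu>] d
  have pm: "\<psi> m \<in> carrier V" by (rule lin_closed[OF lin_\<psi> m])
  have "act (\<not> s) a m = \<psi> (act s a (\<psi> m))"
    using act_\<psi>[of a "act (\<not> s) a m" s] act_\<psi>[OF a m, of s] bilD(3)[OF bil_act a m, of "\<not> s"]
    by (simp add: bimod_facts(9))
  then have "coa (\<not> t) (act (\<not> s) a m) = tm A V A V (\<lambda>x. x) \<psi> (coa t (act s a (\<psi> m)))"
    using coa_\<psi>[of "act s a (\<psi> m)" "\<not> t"] bilD(3)[OF bil_act a pm] by simp
  also have "\<dots> = tm A V A V (\<lambda>x. x) \<psi> (tlf A A ?Z (\<lambda>x y. tlf A V ?Z (\<lambda>c n. tp A V (\<mu> x c) (act s y n)) (coa t (\<psi> m))) d)"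
    by (simp add: R pm)
  also have "\<dots> = tlf A A ?Z (\<lambda>x y. tm A V A V (\<lambda>x. x) \<psi> (tlf A V ?Z (\<lambda>c n. tp A V (\<mu> x c) (act s y n)) (coa t (\<psi> m)))) d"
    by (rule tl_push) ((rule I a m pm | assumption)+)
  also have "\<dots> = tlf A A ?Z (\<lambda>x y. tlf A V ?Z (\<lambda>c n. tp A V (\<mu> x c) (act (\<not> s) y n)) (coa (\<not> t) m)) d"
  proof (rule tl_cong, (rule I a m pm | assumption)+)
    fix x y assume xy: "x \<in> carrier A" "y \<in> carrier A"
    have "tm A V A V (\<lambda>x. x) \<psi> (tlf A V ?Z (\<lambda>c n. tp A V (\<mu> x c) (act s y n)) (coa t (\<psi> m))) =
      tlf A V ?Z (\<lambda>c n. tm A V A V (\<lambda>x. x) \<psi> (tp A V (\<mu> x c) (act s y n))) (coa t (\<psi> m))"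
      by (rule tl_push) ((rule I a m pm xy | assumption)+)
    also have "\<dots> = tlf A V ?Z (\<lambda>c n. tp A V (\<mu> x c) (\<psi> (act s y n))) (coa t (\<psi> m))"
      by (rule tl_cong, (rule I a m pm xy | assumption)+, rule tm_tp) ((rule I a m pm xy | assumption)+)
    also have "\<dots> = tlf A V ?Z (\<lambda>c n. tp A V (\<mu> x c) (\<psi> (act s y n))) (tm A V A V (\<lambda>x. x) \<psi> (coa (\<not> t) m))"
      using coa_\<psi>[OF m, of t] by simp
    also have "\<dots> = tlf A V ?Z (\<lambda>c n. tp A V (\<mu> x c) (\<psi> (act s y (\<psi> n)))) (coa (\<not> t) m)"
      by (rule tl_tm) ((rule I a m xy | assumption)+)
    also have "\<dots> = tlf A V ?Z (\<lambda>c n. tp A V (\<mu> x c) (act (\<not> s) y n)) (coa (\<not> t) m)"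
      by (rule tl_cong, (rule I a m xy | assumption)+) (simp add: act_\<psi> xy bimod_facts(9) bilD(3)[OF bil_act])
    finally show "tm A V A V (\<lambda>x. x) \<psi> (tlf A V ?Z (\<lambda>c n. tp A V (\<mu> x c) (act s y n)) (coa t (\<psi> m))) =
      tlf A V ?Z (\<lambda>c n. tp A V (\<mu> x c) (act (\<not> s) y n)) (coa (\<not> t) m)" .
  qed
  finally show ?thesis .
qed

lemma bil_opp: "bil A A A (\<lambda>x c. x \<star> c)" and bil_same: "bil A A A (\<lambda>x c. c \<star> S x)"
  by ((rule I | assumption)+)

text \<open>For the action at the target this is \<open>cl_bl\<close>; conjugation with \<psi> gives
  the other case.\<close>

lemma coa_act_opp:
  assumes a: "a \<in> carrier A" and m: "m \<in> carrier V"
  shows "coa (\<not> s) (act s a m) =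
    sw (A \<boxtimes> V) (\<lambda>x y. tlf A V (A \<boxtimes> V) (\<lambda>c n. tp A V (x \<star> c) (act s y n)) (coa (\<not> s) m)) a"
proof -
  have 1: "coa (\<not> False) (act False a m) =
    sw (A \<boxtimes> V) (\<lambda>x y. tlf A V (A \<boxtimes> V) (\<lambda>c n. tp A V (x \<star> c) (act False y n)) (coa (\<not> False) m)) a"
    if "a \<in> carrier A" "m \<in> carrier V" for a m
    using cl_bl[OF that] by (simp add: act_def coa_def)
  show ?thesis
  proof (cases s)
    case True then show ?thesis using coa_act_conj[OF bil_opp lin_closed[OF lin_\<Delta> a] 1[OF a] a m] by simp
  next
    case False then show ?thesis using 1[OF a m] by simp
  qed
qed

text \<open>At the target, the coefficient is S of a right coefficient. Hence the factor on the left
  in \<open>cr_bl\<close> reappears as its antipode on the right.\<close>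

lemma coa_act_same:
  assumes a: "a \<in> carrier A" and m: "m \<in> carrier V"
  shows "coa s (act s a m) =
    tlf A A (A \<boxtimes> V) (\<lambda>x y. tlf A V (A \<boxtimes> V) (\<lambda>c n. tp A V (c \<star> S x) (act s y n)) (coa s m)) (cop a)"
proof -
  let ?Z = "A \<boxtimes> V"
  have 1: "coa False (act False a m) =
    tlf A A ?Z (\<lambda>x y. tlf A V ?Z (\<lambda>c n. tp A V (c \<star> S x) (act False y n)) (coa False m)) (cop a)"
    if a: "a \<in> carrier A" and m: "m \<in> carrier V" for a m
  proof -
    let ?s = "tlf V A ?Z (\<lambda>n c. tp A V (S c) n)"
    have "coa False (act False a m) = ?s (sw (V \<boxtimes> A) (\<lambda>x y. tlf V A (V \<boxtimes> A) (\<lambda>n c. tp V A (bl x n) (y \<star> c)) (cr m)) a)"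
      by (simp add: act_def coa_def cr_bl a m)
    also have "\<dots> = sw ?Z (\<lambda>x y. ?s (tlf V A (V \<boxtimes> A) (\<lambda>n c. tp V A (bl x n) (y \<star> c)) (cr m))) a"
      by (rule sw_push) ((rule I a m | assumption)+)
    also have "\<dots> = sw ?Z (\<lambda>x y. tlf A V ?Z (\<lambda>c n. tp A V (c \<star> S y) (act False x n)) (coa False m)) a"
    proof (rule sw_cong, (rule I a m | assumption)+)
      fix x y assume xy: "x \<in> carrier A" "y \<in> carrier A"
      have "?s (tlf V A (V \<boxtimes> A) (\<lambda>n c. tp V A (bl x n) (y \<star> c)) (cr m)) =
        tlf V A ?Z (\<lambda>n c. ?s (tp V A (bl x n) (y \<star> c))) (cr m)"
        by (rule tl_push) ((rule I m xy | assumption)+)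
      also have "\<dots> = tlf V A ?Z (\<lambda>n c. tp A V (S (y \<star> c)) (bl x n)) (cr m)"
        by (rule tl_cong, (rule I m xy | assumption)+, rule tl_tp) ((rule I m xy | assumption)+)
      also have "\<dots> = tlf V A ?Z (\<lambda>n c. tp A V (S c \<star> S y) (bl x n)) (cr m)"
        by (rule tl_cong, (rule I m xy | assumption)+) (simp add: S_mul xy)
      finally have e: "?s (tlf V A (V \<boxtimes> A) (\<lambda>n c. tp V A (bl x n) (y \<star> c)) (cr m)) = \<dots>" .
      have "tlf A V ?Z (\<lambda>c n. tp A V (c \<star> S y) (bl x n)) (?s (cr m)) =
        tlf V A ?Z (\<lambda>n c. tlf A V ?Z (\<lambda>c n. tp A V (c \<star> S y) (bl x n)) (tp A V (S c) n)) (cr m)"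
        by (rule tl_push) ((rule I m xy | assumption)+)
      also have "\<dots> = tlf V A ?Z (\<lambda>n c. tp A V (S c \<star> S y) (bl x n)) (cr m)"
        by (rule tl_cong, (rule I m xy | assumption)+, rule tl_tp) ((rule I m xy | assumption)+)
      finally show "?s (tlf V A (V \<boxtimes> A) (\<lambda>n c. tp V A (bl x n) (y \<star> c)) (cr m)) =
        tlf A V ?Z (\<lambda>c n. tp A V (c \<star> S y) (act False x n)) (coa False m)"
        using e by (simp add: act_def coa_def)
    qed
    also have "\<dots> = tlf A A ?Z (\<lambda>x y. tlf A V ?Z (\<lambda>c n. tp A V (c \<star> S x) (act False y n)) (coa False m)) (cop a)"
      by (rule tl_cop[symmetric]) ((rule I a m | assumption)+)
    finally show ?thesis .
  qed
  show ?thesis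
  proof (cases s)
    case True then show ?thesis using coa_act_conj[OF bil_same cop_closed[OF a] 1[OF a] a m] by simp
  next
    case False then show ?thesis using 1[OF a m] by simp
  qed
qed

lemma act_act:
  assumes "a \<in> carrier A" "b \<in> carrier A" "m \<in> carrier V"
  shows "act s a (act (\<not> s) b m) = act (\<not> s) b (act s a m)"
  by (cases s) (simp_all add: act_def bimod_facts(5) assms)

text \<open>The compatibility of left and right coaction, with S applied to the right
  coefficient.\<close>

lemma coa_coa:
  assumes m: "m \<in> carrier V"
  shows "tlf A V (A \<boxtimes> A \<boxtimes> V) (\<lambda>b n. tlf A V (A \<boxtimes> A \<boxtimes> V) (\<lambda>b' n'. tp A (A \<boxtimes> V) b (tp A V b' n')) (coa False n)) (coa True m) =
    tlf A V (A \<boxtimes> A \<boxtimes> V) (\<lambda>b' n. tlf A V (A \<boxtimes> A \<boxtimes> V) (\<lambda>b n'. tp A (A \<boxtimes> V) b (tp A V b' n')) (coa True n)) (coa False m)"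
proof -
  let ?Y = "A \<boxtimes> A \<boxtimes> V" and ?Z = "A \<boxtimes> V"
  let ?f = "\<lambda>b n c. tp A ?Z b (tp A V (S c) n)"
  let ?\<Psi> = "tlf A (V \<boxtimes> A) ?Y (\<lambda>b t. tlf V A ?Y (\<lambda>n c. ?f b n c) t)"
  note I = I m
  have tlS: "tlf A V W \<phi> (coa False n) = tlf V A W (\<lambda>k c. \<phi> (S c) k) (cr n)"
    if W: "vsp W" and n: "n \<in> carrier V" and \<phi>: "bil A V W (\<lambda>b k. \<phi> b k)" for n \<phi> and W :: "('k, ('h \<times> ('h \<times> 'm \<Rightarrow> 'k) set \<Rightarrow> 'k) set) module"
  proof -
    note I = I bil_arg1[OF \<phi>] bil_arg2[OF \<phi>] \<phi> bilD(3)[OF \<phi>] W n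
    have "tlf A V W \<phi> (tlf V A ?Z (\<lambda>n c. tp A V (S c) n) (cr n)) = tlf V A W (\<lambda>k c. tlf A V W \<phi> (tp A V (S c) k)) (cr n)"
      by (rule tl_push) ((rule lin_tl_self I | assumption)+)
    also have "\<dots> = tlf V A W (\<lambda>k c. \<phi> (S c) k) (cr n)"
      by (rule tl_cong, (rule lin_tl_self I | assumption)+, rule tl_tp) ((rule I | assumption)+)
    finally show ?thesis by (simp add: coa_def)
  qed
  have "?\<Psi> (bicoact K H M m) = tlf A V ?Y (\<lambda>b v. tlf V A ?Y (\<lambda>n c. ?f b n c) (cr v)) (cl m)"
    by (rule tl_bicoact) ((rule I | assumption)+)
  also have "\<dots> = tlf A V ?Y (\<lambda>b n. tlf A V ?Y (\<lambda>b' n'. tp A ?Z b (tp A V b' n')) (coa False n)) (cl m)"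
    by (rule tl_cong, (rule I | assumption)+, rule tlS[symmetric]) ((rule I | assumption)+)
  finally have 1: "?\<Psi> (bicoact K H M m) = \<dots>" .
  have "?\<Psi> (bicoact K H M m) = ?\<Psi> (assoc K A V A (tm V A ?Z A cl id (cr m)))"
    by (simp add: bimod_facts(6) m)
  also have "\<dots> = tlf ?Z A ?Y (\<lambda>u c. tlf A V ?Y (\<lambda>b n. ?f b n c) u) (tm V A ?Z A cl id (cr m))"
    by (rule tl_assoc) ((rule I lin_cl lin_id' tm_closed | assumption)+)
  also have "\<dots> = tlf V A ?Y (\<lambda>v c. tlf A V ?Y (\<lambda>b n. ?f b n (id c)) (cl v)) (cr m)"
    by (rule tl_tm) ((rule I lin_cl lin_id' | assumption)+)
  also have "\<dots> = tlf A V ?Y (\<lambda>b' n. tlf A V ?Y (\<lambda>b n'. tp A ?Z b (tp A V b' n')) (cl n)) (coa False m)"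
    by (simp only: id_def, rule tlS[symmetric]) ((rule I | assumption)+)
  finally show ?thesis using 1 by (simp add: coa_def)
qed

end

subsection \<open>Operators on a single tensor factor\<close>

text \<open>\<open>site\<close> and \<open>cosite\<close> separate the algebra of one factor from
  the graph: \<open>half_act\<close> and \<open>half_coact\<close> are the instances where I is the
  set of edges.\<close>

definition site :: "'i set \<Rightarrow> 'i \<Rightarrow> ('m \<Rightarrow> 'm) \<Rightarrow> (('i \<Rightarrow> 'm) \<Rightarrow> 'k) set \<Rightarrow> (('i \<Rightarrow> 'm) \<Rightarrow> 'k) set" where
  "site I e f = itensor_lift K I (\<lambda>_. V) (itensor K I (\<lambda>_. V)) (\<lambda>v. itprod K I (\<lambda>_. V) (v(e := f (v e))))"

definition cosite :: "'i set \<Rightarrow> 'i \<Rightarrow> ('m \<Rightarrow> ('h \<times> 'm \<Rightarrow> 'k) set) \<Rightarrow> (('i \<Rightarrow> 'm) \<Rightarrow> 'k) set \<Rightarrow>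
    ('h \<times> (('i \<Rightarrow> 'm) \<Rightarrow> 'k) set \<Rightarrow> 'k) set" where
  "cosite I e g = itensor_lift K I (\<lambda>_. V) (A \<boxtimes> itensor K I (\<lambda>_. V)) (\<lambda>v.
     tlf A V (A \<boxtimes> itensor K I (\<lambda>_. V)) (\<lambda>b n. tp A (itensor K I (\<lambda>_. V)) b (itprod K I (\<lambda>_. V) (v(e := n)))) (g (v e)))"

context
  fixes I :: "'i set" and E
  defines "E \<equiv> itensor K I (\<lambda>_. V)"
begin

lemma vE: "vsp E"
  unfolding E_def by (rule vsp_itensor) simp

lemma lin_ip: "v \<in> (\<Pi>\<^sub>E i\<in>I. carrier V) \<Longrightarrow> e \<in> I \<Longrightarrow> lin V E (\<lambda>n. itprod K I (\<lambda>_. V) (v(e := n)))"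
  unfolding E_def by (rule mlinD(2)[OF mlin_itprod]) simp_all

lemma mlin_site:
  assumes f: "lin V V f" and e: "e \<in> I"
  shows "mlin I (\<lambda>_. V) E (\<lambda>v. itprod K I (\<lambda>_. V) (v(e := f (v e))))"
proof (rule mlinI)
  fix v assume v: "v \<in> (\<Pi>\<^sub>E i\<in>I. carrier V)"
  note ve = PiE_const[OF v e]
  show "itprod K I (\<lambda>_. V) (v(e := f (v e))) \<in> carrier E"
    by (rule lin_closed[OF lin_ip[OF v e] lin_closed[OF f ve]])
  fix i assume i: "i \<in> I"
  show "lin V E (\<lambda>x. itprod K I (\<lambda>_. V) ((v(i := x))(e := f ((v(i := x)) e))))"
  proof (cases "i = e")
    case True then show ?thesis using lin_comp[OF lin_ip[OF v e] f] by simp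
  next
    case False
    then show ?thesis
      using lin_ip[OF PiE_upd[OF v e lin_closed[OF f ve]] i] by (simp add: fun_upd_twist)
  qed
qed

lemma mlin_cosite:
  assumes g: "lin V (A \<boxtimes> V) g" and e: "e \<in> I"
  shows "mlin I (\<lambda>_. V) (A \<boxtimes> E) (\<lambda>v. tlf A V (A \<boxtimes> E) (\<lambda>b n. tp A E b (itprod K I (\<lambda>_. V) (v(e := n)))) (g (v e)))"
proof (rule mlinI)
  fix v assume v: "v \<in> (\<Pi>\<^sub>E i\<in>I. carrier V)"
  note ve = PiE_const[OF v e]
  note J = lin_intros vE lin_comp[OF lin_ip[OF v e]] lin_closed[OF lin_ip[OF v e]]
    lin_closed[OF g ve] lin_comp[OF g]
  show "tlf A V (A \<boxtimes> E) (\<lambda>b n. tp A E b (itprod K I (\<lambda>_. V) (v(e := n)))) (g (v e)) \<in> carrier (A \<boxtimes> E)"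
    by ((rule J | assumption)+)
  fix i assume i: "i \<in> I"
  show "lin V (A \<boxtimes> E) (\<lambda>x. tlf A V (A \<boxtimes> E) (\<lambda>b n. tp A E b (itprod K I (\<lambda>_. V) ((v(i := x))(e := n)))) (g ((v(i := x)) e)))"
  \<comment> \<open>If i = e, the variable is overwritten in the lifted map and enters only through
    g. Otherwise the value of g is constant and the lifted map depends on the variable.\<close>
  proof (cases "i = e")
    case True
    have "lin V (A \<boxtimes> E) (\<lambda>x. tlf A V (A \<boxtimes> E) (\<lambda>b n. tp A E b (itprod K I (\<lambda>_. V) (v(e := n)))) (g x))"
      by ((rule J | assumption)+)
    with True show ?thesis by simp
  next
    case False
    have l1: "lin V E (\<lambda>n. itprod K I (\<lambda>_. V) (v(e := n, i := x)))" if "x \<in> carrier V" for x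
      using lin_ip[OF PiE_upd[OF v i that] e] False by (simp add: fun_upd_twist)
    have l2: "lin V E (\<lambda>x. itprod K I (\<lambda>_. V) (v(e := n, i := x)))" if "n \<in> carrier V" for n
      by (rule lin_ip[OF PiE_upd[OF v e that] i])
    have "lin V (A \<boxtimes> E) (\<lambda>x. tlf A V (A \<boxtimes> E) (\<lambda>b n. tp A E b (itprod K I (\<lambda>_. V) (v(e := n, i := x)))) (g (v e)))"
      by ((rule J l1 lin_closed[OF l1] l2 | assumption)+)
    with False show ?thesis by (simp add: fun_upd_twist)
  qed
qed

lemma site_itprod:
  assumes v: "v \<in> (\<Pi>\<^sub>E i\<in>I. carrier V)" and e: "e \<in> I" and f: "lin V V f"
  shows "site I e f (itprod K I (\<lambda>_. V) v) = itprod K I (\<lambda>_. V) (v(e := f (v e)))"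
  unfolding site_def
  using itl_itprod[OF _ _ mlin_site[OF f e] v] vE by (simp add: E_def)

lemma site_ip:
  assumes v: "v \<in> (\<Pi>\<^sub>E i\<in>I. carrier V)" and e: "e \<in> I" and f: "lin V V f" and n: "n \<in> carrier V"
  shows "site I e f (itprod K I (\<lambda>_. V) (v(e := n))) = itprod K I (\<lambda>_. V) (v(e := f n))"
  using site_itprod[OF PiE_upd[OF v e n] e f] by simp

lemma cosite_itprod:
  assumes v: "v \<in> (\<Pi>\<^sub>E i\<in>I. carrier V)" and e: "e \<in> I" and g: "lin V (A \<boxtimes> V) g"
  shows "cosite I e g (itprod K I (\<lambda>_. V) v) =
    tlf A V (A \<boxtimes> E) (\<lambda>b n. tp A E b (itprod K I (\<lambda>_. V) (v(e := n)))) (g (v e))"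
  unfolding cosite_def
  using itl_itprod[OF _ _ mlin_cosite[OF g e] v] vE vsp_tensor[OF vA vE] by (simp add: E_def)

lemma cosite_ip:
  assumes v: "v \<in> (\<Pi>\<^sub>E i\<in>I. carrier V)" and e: "e \<in> I" and g: "lin V (A \<boxtimes> V) g" and n: "n \<in> carrier V"
  shows "cosite I e g (itprod K I (\<lambda>_. V) (v(e := n))) =
    tlf A V (A \<boxtimes> E) (\<lambda>b n. tp A E b (itprod K I (\<lambda>_. V) (v(e := n)))) (g n)"
  using cosite_itprod[OF PiE_upd[OF v e n] e g] by simp

lemma lin_site: "e \<in> I \<Longrightarrow> lin V V f \<Longrightarrow> lin U E h \<Longrightarrow> lin U E (\<lambda>x. site I e f (h x))"
  unfolding site_def using mlin_site[of f e] vE unfolding E_def by (intro lin_itl_arg) simp_all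

lemma lin_cosite: "e \<in> I \<Longrightarrow> lin V (A \<boxtimes> V) g \<Longrightarrow> lin U E h \<Longrightarrow> lin U (A \<boxtimes> E) (\<lambda>x. cosite I e g (h x))"
  unfolding cosite_def using mlin_cosite[of g e] vsp_tensor[OF vA vE] unfolding E_def by (intro lin_itl_arg) simp_all

lemma lin_site_act:
  assumes e: "e \<in> I" and w: "w \<in> carrier E" and h: "lin U A h"
  shows "lin U E (\<lambda>x. site I e (act s (h x)) w)"
proof -
  have "lin A E (\<lambda>a. site I e (act s a) w)"
    unfolding site_def E_def
  proof (rule lin_itl_fun)
    fix v assume v: "v \<in> (\<Pi>\<^sub>E i\<in>I. carrier V)"
    show "lin A (itensor K I (\<lambda>_. V)) (\<lambda>a. itprod K I (\<lambda>_. V) (v(e := act s a (v e))))"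
      by (rule lin_comp[OF lin_ip[OF v e, unfolded E_def] bilD(2)[OF bil_act PiE_const[OF v e]]])
  next
    fix a assume a: "a \<in> carrier A"
    show "mlin I (\<lambda>_. V) (itensor K I (\<lambda>_. V)) (\<lambda>v. itprod K I (\<lambda>_. V) (v(e := act s a (v e))))"
      by (rule mlin_site[OF lin_act[OF a] e, unfolded E_def])
  qed (use vE w in \<open>simp_all add: E_def\<close>)
  then show ?thesis by (rule lin_comp[OF _ h])
qed

context
begin

private lemmas lin_site_lin = lin_site[OF _ lin_act]
private lemmas lin_cosite_lin = lin_cosite[OF _ lin_coa]
private lemmas J = lin_intros vE lin_site_lin lin_cosite_lin lin_site_act
  lin_closed[OF lin_site_lin[OF _ _ lin_id]] lin_closed[OF lin_cosite_lin[OF _ lin_id]] lin_act lin_coa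
  vE[unfolded E_def]

text \<open>Transports a relation on M to one tensor factor. By linearity pure tensors suffice, and
  there only the coordinate e changes.\<close>

lemma cosite_site_edge:
  assumes \<mu>: "bil A A A (\<lambda>x c. \<mu> x c)" and d: "d \<in> carrier (A \<boxtimes> A)"
    and R: "\<And>m. m \<in> carrier V \<Longrightarrow> coa t (act s a m) =
      tlf A A (A \<boxtimes> V) (\<lambda>x y. tlf A V (A \<boxtimes> V) (\<lambda>c n. tp A V (\<mu> x c) (act s y n)) (coa t m)) d"
    and e: "e \<in> I" and a: "a \<in> carrier A" and w: "w \<in> carrier E"
  shows "cosite I e (coa t) (site I e (act s a) w) =
    tlf A A (A \<boxtimes> E) (\<lambda>x y. tlf A E (A \<boxtimes> E) (\<lambda>c n. tp A E (\<mu> x c) (site I e (act s y) n)) (cosite I e (coa t) w)) d"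
proof -
  let ?Z = "A \<boxtimes> E" and ?ZV = "A \<boxtimes> V"
  note J = J e a d bil_arg1[OF \<mu>] bil_arg2[OF \<mu>] bilD(3)[OF \<mu>]
  have "\<forall>w\<in>carrier E. cosite I e (coa t) (site I e (act s a) w) =
    tlf A A ?Z (\<lambda>x y. tlf A E ?Z (\<lambda>c n. tp A E (\<mu> x c) (site I e (act s y) n)) (cosite I e (coa t) w)) d"
  proof (unfold E_def, rule itens_ext, fold E_def)
    fix v assume v: "v \<in> (\<Pi>\<^sub>E i\<in>I. carrier V)"
    let ?i = "\<lambda>n. itprod K I (\<lambda>_. V) (v(e := n))"
    note J = J lin_comp[OF lin_ip[OF v e]] lin_closed[OF lin_ip[OF v e]] lin_ip[OF v e] v
    define m where "m = v e"
    have m: "m \<in> carrier V" using PiE_const[OF v e] by (simp add: m_def)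
    have vm: "itprod K I (\<lambda>_. V) v = ?i m" by (simp add: m_def)
    note s = site_ip[OF v e] cosite_ip[OF v e]
    have "cosite I e (coa t) (site I e (act s a) (?i m)) = tlf A V ?Z (\<lambda>b n. tp A E b (?i n)) (coa t (act s a m))"
      by (simp add: s lin_act a m lin_coa bilD(3)[OF bil_act])
    also have "\<dots> = tlf A V ?Z (\<lambda>b n. tp A E b (?i n))
        (tlf A A ?ZV (\<lambda>x y. tlf A V ?ZV (\<lambda>c n. tp A V (\<mu> x c) (act s y n)) (coa t m)) d)"
      by (simp add: R m)
    also have "\<dots> = tlf A A ?Z (\<lambda>x y. tlf A V ?Z (\<lambda>b n. tp A E b (?i n)) (tlf A V ?ZV (\<lambda>c n. tp A V (\<mu> x c) (act s y n)) (coa t m))) d"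
      by (rule tl_push) ((rule J m | assumption)+)
    also have "\<dots> = tlf A A ?Z (\<lambda>x y. tlf A V ?Z (\<lambda>c n. tp A E (\<mu> x c) (?i (act s y n))) (coa t m)) d"
    proof (rule tl_cong, (rule J m | assumption)+)
      fix x y assume xy: "x \<in> carrier A" "y \<in> carrier A"
      have "tlf A V ?Z (\<lambda>b n. tp A E b (?i n)) (tlf A V ?ZV (\<lambda>c n. tp A V (\<mu> x c) (act s y n)) (coa t m)) =
        tlf A V ?Z (\<lambda>c n. tlf A V ?Z (\<lambda>b n. tp A E b (?i n)) (tp A V (\<mu> x c) (act s y n))) (coa t m)"
        by (rule tl_push) ((rule J m xy | assumption)+)
      also have "\<dots> = tlf A V ?Z (\<lambda>c n. tp A E (\<mu> x c) (?i (act s y n))) (coa t m)"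
        by (rule tl_cong, (rule J m xy | assumption)+, rule tl_tp) ((rule J m xy | assumption)+)
      finally show "tlf A V ?Z (\<lambda>b n. tp A E b (?i n)) (tlf A V ?ZV (\<lambda>c n. tp A V (\<mu> x c) (act s y n)) (coa t m)) =
        tlf A V ?Z (\<lambda>c n. tp A E (\<mu> x c) (?i (act s y n))) (coa t m)" .
    qed
    also have "\<dots> = tlf A A ?Z (\<lambda>x y. tlf A E ?Z (\<lambda>c n. tp A E (\<mu> x c) (site I e (act s y) n)) (cosite I e (coa t) (?i m))) d"
    proof (rule tl_cong, (rule J m | assumption)+)
      fix x y assume xy: "x \<in> carrier A" "y \<in> carrier A"
      have "tlf A E ?Z (\<lambda>c n. tp A E (\<mu> x c) (site I e (act s y) n)) (tlf A V ?Z (\<lambda>b n. tp A E b (?i n)) (coa t m)) =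
        tlf A V ?Z (\<lambda>b n. tlf A E ?Z (\<lambda>c n. tp A E (\<mu> x c) (site I e (act s y) n)) (tp A E b (?i n))) (coa t m)"
        by (rule tl_push) ((rule J m xy | assumption)+)
      also have "\<dots> = tlf A V ?Z (\<lambda>c n. tp A E (\<mu> x c) (site I e (act s y) (?i n))) (coa t m)"
        by (rule tl_cong, (rule J m xy | assumption)+, rule tl_tp) ((rule J m xy | assumption)+)
      also have "\<dots> = tlf A V ?Z (\<lambda>c n. tp A E (\<mu> x c) (?i (act s y n))) (coa t m)"
        by (rule tl_cong, (rule J m xy | assumption)+) (simp add: s lin_act xy)
      finally show "tlf A V ?Z (\<lambda>c n. tp A E (\<mu> x c) (?i (act s y n))) (coa t m) =
        tlf A E ?Z (\<lambda>c n. tp A E (\<mu> x c) (site I e (act s y) n)) (cosite I e (coa t) (?i m))"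
        by (simp add: s lin_coa m)
    qed
    finally show "cosite I e (coa t) (site I e (act s a) (itprod K I (\<lambda>_. V) v)) =
      tlf A A ?Z (\<lambda>x y. tlf A E ?Z (\<lambda>c n. tp A E (\<mu> x c) (site I e (act s y) n)) (cosite I e (coa t) (itprod K I (\<lambda>_. V) v))) d"
      unfolding vm .
  qed ((rule J | assumption)+)
  with w show ?thesis by blast
qed

lemma cosite_site_opp:
  assumes e: "e \<in> I" and a: "a \<in> carrier A" and w: "w \<in> carrier E"
  shows "cosite I e (coa (\<not> s)) (site I e (act s a) w) =
    sw (A \<boxtimes> E) (\<lambda>x y. tlf A E (A \<boxtimes> E) (\<lambda>c n. tp A E (x \<star> c) (site I e (act s y) n)) (cosite I e (coa (\<not> s)) w)) a"
  by (rule cosite_site_edge[OF bil_opp lin_closed[OF lin_\<Delta> a] coa_act_opp[OF a] e a w])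

lemma cosite_site_same:
  assumes e: "e \<in> I" and a: "a \<in> carrier A" and w: "w \<in> carrier E"
  shows "cosite I e (coa s) (site I e (act s a) w) =
    sw (A \<boxtimes> E) (\<lambda>x y. tlf A E (A \<boxtimes> E) (\<lambda>c n. tp A E (c \<star> S y) (site I e (act s x) n)) (cosite I e (coa s) w)) a"
proof -
  have "cosite I e (coa s) (site I e (act s a) w) =
    tlf A A (A \<boxtimes> E) (\<lambda>x y. tlf A E (A \<boxtimes> E) (\<lambda>c n. tp A E (c \<star> S x) (site I e (act s y) n)) (cosite I e (coa s) w)) (cop a)"
    by (rule cosite_site_edge[OF bil_same cop_closed[OF a] coa_act_same[OF a] e a w])
  also have "\<dots> = sw (A \<boxtimes> E) (\<lambda>x y. tlf A E (A \<boxtimes> E) (\<lambda>c n. tp A E (c \<star> S y) (site I e (act s x) n)) (cosite I e (coa s) w)) a"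
    by (rule tl_cop) ((rule J e a w | assumption)+)
  finally show ?thesis .
qed

end

context
begin

private lemmas JS = lin_intros vE lin_site lin_cosite
  lin_closed[OF lin_site[OF _ _ lin_id]] lin_closed[OF lin_cosite[OF _ _ lin_id]] vE[unfolded E_def]

lemma site_site:
  assumes e: "e \<in> I" "e' \<in> I" and f: "lin V V f" "lin V V f'" and w: "w \<in> carrier E"
    and c: "\<And>m. e = e' \<Longrightarrow> m \<in> carrier V \<Longrightarrow> f (f' m) = f' (f m)"
  shows "site I e f (site I e' f' w) = site I e' f' (site I e f w)"
proof -
  have "\<forall>w\<in>carrier E. site I e f (site I e' f' w) = site I e' f' (site I e f w)"
  proof (unfold E_def, rule itens_ext, fold E_def)
    fix v assume v: "v \<in> (\<Pi>\<^sub>E i\<in>I. carrier V)"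
    note vc = lin_closed[OF f(1)] lin_closed[OF f(2)] PiE_const[OF v]
    show "site I e f (site I e' f' (itprod K I (\<lambda>_. V) v)) = site I e' f' (site I e f (itprod K I (\<lambda>_. V) v))"
      using site_itprod[OF v e(1) f(1)] site_itprod[OF v e(2) f(2)]
        site_itprod[OF PiE_upd[OF v e(2)] e(1) f(1)] site_itprod[OF PiE_upd[OF v e(1)] e(2) f(2)] c vc e
      by (cases "e = e'") (simp_all add: fun_upd_twist)
  qed ((rule JS e f | assumption)+)
  with w show ?thesis by blast
qed

lemma tl_cosite:
  assumes v: "v \<in> (\<Pi>\<^sub>E i\<in>I. carrier V)" and e: "e \<in> I" and g: "lin V (A \<boxtimes> V) g"
    and W: "vsp W" and \<phi>: "bil A E W (\<lambda>b n. \<phi> b n)"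
  shows "tlf A E W (\<lambda>b n. \<phi> b n) (cosite I e g (itprod K I (\<lambda>_. V) v)) =
    tlf A V W (\<lambda>b n. \<phi> b (itprod K I (\<lambda>_. V) (v(e := n)))) (g (v e))"
proof -
  note J = JS bil_arg1[OF \<phi>] bil_arg2[OF \<phi>] W lin_comp[OF lin_ip[OF v e]] lin_closed[OF lin_ip[OF v e]]
    lin_closed[OF g PiE_const[OF v e]]
  have "tlf A E W \<phi> (tlf A V (A \<boxtimes> E) (\<lambda>b n. tp A E b (itprod K I (\<lambda>_. V) (v(e := n)))) (g (v e))) =
    tlf A V W (\<lambda>b n. tlf A E W \<phi> (tp A E b (itprod K I (\<lambda>_. V) (v(e := n))))) (g (v e))"
    by (rule tl_push) ((rule J \<phi> lin_tl_self | assumption)+)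
  also have "\<dots> = tlf A V W (\<lambda>b n. \<phi> b (itprod K I (\<lambda>_. V) (v(e := n)))) (g (v e))"
    by (rule tl_cong, (rule J \<phi> lin_tl_self | assumption)+, rule tl_tp) ((rule J \<phi> | assumption)+)
  finally show ?thesis unfolding cosite_itprod[OF v e g, folded E_def] .
qed

lemma cosite_site_far:
  assumes e: "e \<in> I" "e' \<in> I" "e \<noteq> e'" and g: "lin V (A \<boxtimes> V) g" and f: "lin V V f" and w: "w \<in> carrier E"
  shows "cosite I e g (site I e' f w) = tm A E A E (\<lambda>x. x) (site I e' f) (cosite I e g w)"
proof -
  note sf = lin_site[OF e(2) f lin_id]
  have "\<forall>w\<in>carrier E. cosite I e g (site I e' f w) = tm A E A E (\<lambda>x. x) (site I e' f) (cosite I e g w)"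
  proof (unfold E_def, rule itens_ext, fold E_def)
    fix v assume v: "v \<in> (\<Pi>\<^sub>E i\<in>I. carrier V)"
    let ?Z = "A \<boxtimes> E"
    have fv: "f (v e') \<in> carrier V" by (rule lin_closed[OF f PiE_const[OF v e(2)]])
    note v' = PiE_upd[OF v e(2) fv]
    note J = JS lin_comp[OF lin_ip[OF v e(1)]] lin_closed[OF lin_ip[OF v e(1)]]
      lin_comp[OF lin_ip[OF v' e(1)]] lin_closed[OF lin_ip[OF v' e(1)]] lin_closed[OF g PiE_const[OF v e(1)]]
      e g f sf v'
    have "cosite I e g (site I e' f (itprod K I (\<lambda>_. V) v)) =
      tlf A V ?Z (\<lambda>b n. tp A E b (itprod K I (\<lambda>_. V) (v(e' := f (v e'), e := n)))) (g (v e))"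
      using site_itprod[OF v e(2) f] cosite_itprod[OF v' e(1) g] e(3) by (simp add: E_def)
    also have "\<dots> = tlf A V ?Z (\<lambda>b n. tp A E b (site I e' f (itprod K I (\<lambda>_. V) (v(e := n))))) (g (v e))"
      by (rule tl_cong, (rule J | assumption)+)
         (use site_itprod[OF PiE_upd[OF v e(1)] e(2) f] e(3) in \<open>simp add: fun_upd_twist\<close>)
    also have "\<dots> = tlf A E ?Z (\<lambda>b n. tp A E b (site I e' f n)) (cosite I e g (itprod K I (\<lambda>_. V) v))"
      by (rule tl_cosite[symmetric, OF v e(1) g]) ((rule J | assumption)+)
    finally show "cosite I e g (site I e' f (itprod K I (\<lambda>_. V) v)) =
      tm A E A E (\<lambda>x. x) (site I e' f) (cosite I e g (itprod K I (\<lambda>_. V) v))"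
      by (simp add: tensor_map_def)
  qed ((rule JS e f g sf | assumption)+)
  with w show ?thesis by blast
qed

text \<open>On different factors the two updates are independent and the sums can be interchanged;
  on one factor the commutation is the assumption.\<close>

lemma cosite_cosite:
  assumes e: "e \<in> I" "e' \<in> I" and g: "lin V (A \<boxtimes> V) g" "lin V (A \<boxtimes> V) g'" and w: "w \<in> carrier E"
    and c: "\<And>m. e = e' \<Longrightarrow> m \<in> carrier V \<Longrightarrow> cocomm A A V g g' m"
  shows "cocomm A A E (cosite I e g) (cosite I e' g') w"
proof -
  let ?Y = "A \<boxtimes> A \<boxtimes> E" and ?Z = "A \<boxtimes> E"
  note sg = lin_cosite[OF e(1) g(1) lin_id] lin_cosite[OF e(2) g(2) lin_id]
  have "\<forall>w\<in>carrier E.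
    tlf A E ?Y (\<lambda>b n. tlf A E ?Y (\<lambda>b' n'. tp A ?Z b (tp A E b' n')) (cosite I e' g' n)) (cosite I e g w) =
    tlf A E ?Y (\<lambda>b' n. tlf A E ?Y (\<lambda>b n'. tp A ?Z b (tp A E b' n')) (cosite I e g n)) (cosite I e' g' w)"
  proof (unfold E_def, rule itens_ext, fold E_def)
    fix v assume v: "v \<in> (\<Pi>\<^sub>E i\<in>I. carrier V)"
    let ?p = "itprod K I (\<lambda>_. V)"
    have ve: "v e \<in> carrier V" "v e' \<in> carrier V" using PiE_const[OF v] e by auto
    note J = JS lin_comp[OF lin_ip[OF v e(1)]] lin_closed[OF lin_ip[OF v e(1)]]
      lin_comp[OF lin_ip[OF v e(2)]] lin_closed[OF lin_ip[OF v e(2)]]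
      lin_closed[OF g(1)] lin_closed[OF g(2)] lin_comp[OF g(1)] lin_comp[OF g(2)] e g ve
    have 1: "tlf A E ?Y (\<lambda>b n. tlf A E ?Y (\<lambda>b' n'. tp A ?Z b (tp A E b' n')) (cosite I e' g' n)) (cosite I e g (?p v)) =
      tlf A V ?Y (\<lambda>b n. tlf A V ?Y (\<lambda>b' n'. tp A ?Z b (tp A E b' (?p (v(e := n, e' := n')))))
        (g' ((v(e := n)) e'))) (g (v e))"
    proof -
      have "tlf A E ?Y (\<lambda>b n. tlf A E ?Y (\<lambda>b' n'. tp A ?Z b (tp A E b' n')) (cosite I e' g' n)) (cosite I e g (?p v)) =
        tlf A V ?Y (\<lambda>b n. tlf A E ?Y (\<lambda>b' n'. tp A ?Z b (tp A E b' n')) (cosite I e' g' (?p (v(e := n))))) (g (v e))"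
        by (rule tl_cosite[OF v e(1) g(1)]) ((rule J | assumption)+)
      also have "\<dots> = tlf A V ?Y (\<lambda>b n. tlf A V ?Y (\<lambda>b' n'. tp A ?Z b (tp A E b' (?p (v(e := n, e' := n')))))
        (g' ((v(e := n)) e'))) (g (v e))"
        by (rule tl_cong, (rule J | assumption)+, rule tl_cosite[OF PiE_upd[OF v e(1)] e(2) g(2)])
           ((rule J | assumption)+)
      finally show ?thesis .
    qed
    have 2: "tlf A E ?Y (\<lambda>b' n. tlf A E ?Y (\<lambda>b n'. tp A ?Z b (tp A E b' n')) (cosite I e g n)) (cosite I e' g' (?p v)) =
      tlf A V ?Y (\<lambda>b' n. tlf A V ?Y (\<lambda>b n'. tp A ?Z b (tp A E b' (?p (v(e' := n, e := n')))))
        (g ((v(e' := n)) e))) (g' (v e'))"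
    proof -
      have "tlf A E ?Y (\<lambda>b' n. tlf A E ?Y (\<lambda>b n'. tp A ?Z b (tp A E b' n')) (cosite I e g n)) (cosite I e' g' (?p v)) =
        tlf A V ?Y (\<lambda>b' n. tlf A E ?Y (\<lambda>b n'. tp A ?Z b (tp A E b' n')) (cosite I e g (?p (v(e' := n))))) (g' (v e'))"
        by (rule tl_cosite[OF v e(2) g(2)]) ((rule J | assumption)+)
      also have "\<dots> = tlf A V ?Y (\<lambda>b' n. tlf A V ?Y (\<lambda>b n'. tp A ?Z b (tp A E b' (?p (v(e' := n, e := n')))))
        (g ((v(e' := n)) e))) (g' (v e'))"
        by (rule tl_cong, (rule J | assumption)+, rule tl_cosite[OF PiE_upd[OF v e(2)] e(1) g(1)])
           ((rule J | assumption)+)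
      finally show ?thesis .
    qed
    show "tlf A E ?Y (\<lambda>b n. tlf A E ?Y (\<lambda>b' n'. tp A ?Z b (tp A E b' n')) (cosite I e' g' n)) (cosite I e g (?p v)) =
      tlf A E ?Y (\<lambda>b' n. tlf A E ?Y (\<lambda>b n'. tp A ?Z b (tp A E b' n')) (cosite I e g n)) (cosite I e' g' (?p v))"
    proof (cases "e = e'")
      case True
      have "tlf A V ?Y (\<lambda>b n. tlf A V ?Y (\<lambda>b' n'. tp A ?Z b (tp A E b' (?p (v(e := n'))))) (g' n)) (g (v e)) =
        tlf A V ?Y (\<lambda>b' n. tlf A V ?Y (\<lambda>b n'. tp A ?Z b (tp A E b' (?p (v(e := n'))))) (g n)) (g' (v e))"
        by (rule cocomm_lift[OF vA vA vV _ g ve(1) c[OF True ve(1)]]) ((rule J | assumption)+)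
      with True 1 2 show ?thesis by simp
    next
      case False
      have l1: "lin V E (\<lambda>n. ?p (v(e := n, e' := n')))" if "n' \<in> carrier V" for n'
        using lin_ip[OF PiE_upd[OF v e(2) that] e(1)] False by (simp add: fun_upd_twist)
      have l2: "lin V E (\<lambda>n'. ?p (v(e := n, e' := n')))" if "n \<in> carrier V" for n
        by (rule lin_ip[OF PiE_upd[OF v e(1) that] e(2)])
      have "tlf A V ?Y (\<lambda>b n. tlf A V ?Y (\<lambda>b' n'. tp A ?Z b (tp A E b' (?p (v(e := n, e' := n'))))) (g' (v e'))) (g (v e)) =
        tlf A V ?Y (\<lambda>b' n'. tlf A V ?Y (\<lambda>b n. tp A ?Z b (tp A E b' (?p (v(e := n, e' := n'))))) (g (v e))) (g' (v e'))"
        by (rule tl_swap) ((rule J l1 l2 lin_closed[OF l1] | assumption)+)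
      with False 1 2 show ?thesis by (simp add: fun_upd_twist)
    qed
  qed ((rule JS e g sg | assumption)+)
  with w show ?thesis by (simp add: cocomm_def)
qed

end

end

end

section \<open>Half-edge operators of a graph and their exchange relations\<close>

section \<open>The extended space of a Kitaev graph\<close>

locale kitaev = bimod K H M for K :: "'k ring" and H :: "('k, 'h) hopf" and M :: "('k, 'h, 'm) hopf_bimod" +
  fixes G :: "nat kitaev"
  assumes G: "kitaev_graph G"
begin

abbreviation "D \<equiv> half G"
abbreviation "E \<equiv> ext_space K M G"
abbreviation "L \<equiv> half_act K H M G"
abbreviation "T \<equiv> half_coact K H M G"
abbreviation "Z \<equiv> A \<boxtimes> E"

lemma ribbon: "finite D" "flip G permutes D" "rho G permutes D"
    "h \<in> D \<Longrightarrow> flip G h \<noteq> h" "h \<in> D \<Longrightarrow> flip G (flip G h) = h"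
  using G by (auto simp: kitaev_graph_def ribbon_graph_def)

lemma flip_closed [simp]: "h \<in> D \<Longrightarrow> flip G h \<in> D"
  using permutes_in_image[OF ribbon(2)] by simp

lemma edge_of_eq: "h \<in> D \<Longrightarrow> edge_of G h = {h, flip G h}"
proof -
  assume h: "h \<in> D"
  have "k \<in> {h, flip G h}" if "k \<in> Orbits.orbit (flip G) h" for k
    using that by induct (auto simp: ribbon(5)[OF h])
  moreover have "flip G h \<in> Orbits.orbit (flip G) h" by (rule orbit.base)
  moreover then have "h \<in> Orbits.orbit (flip G) h"
    using orbit.step[of "flip G h" "flip G" h] ribbon(5)[OF h] by simp
  ultimately show ?thesis by (auto simp: edge_of_def)
qed

lemma edge_flip: "h \<in> D \<Longrightarrow> edge_of G (flip G h) = edge_of G h"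
  by (simp add: edge_of_eq ribbon(5) insert_commute)

lemma edge_of_in: "h \<in> D \<Longrightarrow> edge_of G h \<in> edges G"
  by (simp add: edges_def)

lemma edge_far: "h \<in> D \<Longrightarrow> k \<in> D \<Longrightarrow> k \<noteq> h \<Longrightarrow> k \<noteq> flip G h \<Longrightarrow> edge_of G k \<noteq> edge_of G h"
  by (auto simp: edge_of_eq doubleton_eq_iff)

text \<open>\<open>flip\<close> has no fixed points and the order is total and antisymmetric, so
  exactly one end of an edge precedes the other.\<close>

lemma is_source_flip: "h \<in> D \<Longrightarrow> is_source G (flip G h) \<longleftrightarrow> \<not> is_source G h"
proof -
  assume h: "h \<in> D"
  have "linear_order_on D (hord G)" using G by (simp add: kitaev_graph_def)
  then have "total_on D (hord G)" "antisym (hord G)"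
    by (simp_all add: linear_order_on_def partial_order_on_def)
  then show ?thesis
    using h ribbon(4)[OF h] ribbon(5)[OF h] flip_closed[OF h]
    unfolding is_source_def total_on_def antisym_def by metis
qed

lemma half_act_site: "L h a = site (edges G) (edge_of G h) (act (is_source G h) a)"
  by (simp add: half_act_def site_def act_def ext_space_def)

lemma half_coact_site: "T h = cosite (edges G) (edge_of G h) (coa (is_source G h))"
  by (simp add: half_coact_def cosite_def coa_def[abs_def] ext_space_def Let_def)

lemma vE [lin_intros, simp]: "vsp E"
  using vE[of "edges G"] by (simp add: ext_space_def)

lemma bil_L: "h \<in> D \<Longrightarrow> bil A E E (\<lambda>a w. L h a w)"
  unfolding half_act_site ext_space_def
  by (intro bilI lin_site lin_site_act lin_act lin_id edge_of_in)

lemma lin_T: "h \<in> D \<Longrightarrow> lin E Z (T h)"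
  unfolding half_coact_site ext_space_def by (intro lin_cosite lin_coa lin_id edge_of_in)

lemma L_one: "h \<in> D \<Longrightarrow> w \<in> carrier E \<Longrightarrow> L h uA w = w"
proof -
  assume h: "h \<in> D" and w: "w \<in> carrier E"
  have "\<forall>w\<in>carrier E. L h uA w = w"
    unfolding half_act_site ext_space_def
  proof (rule itens_ext)
    fix v assume v: "v \<in> (\<Pi>\<^sub>E i\<in>edges G. carrier V)"
    show "site (edges G) (edge_of G h) (act (is_source G h) uA) (itprod K (edges G) (\<lambda>_. V) v) = itprod K (edges G) (\<lambda>_. V) v"
      by (simp add: site_itprod[OF v edge_of_in[OF h] lin_act[OF uA_closed]] act_one PiE_const[OF v edge_of_in[OF h]])
  qed (use h vE in \<open>auto intro!: lin_site lin_act lin_id edge_of_in simp: ext_space_def\<close>)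
  with w show ?thesis by blast
qed

lemma T_opp:
  assumes h: "h \<in> D" and a: "a \<in> carrier A" and w: "w \<in> carrier E"
  shows "T (flip G h) (L h a w) = sw Z (\<lambda>x y. tlf A E Z (\<lambda>c n. tp A E (x \<star> c) (L h y n)) (T (flip G h) w)) a"
  using cosite_site_opp[OF edge_of_in[OF h] a, of w "is_source G h"] w
  unfolding half_act_site half_coact_site edge_flip[OF h] is_source_flip[OF h] by (simp add: ext_space_def)

lemma T_same:
  assumes h: "h \<in> D" and a: "a \<in> carrier A" and w: "w \<in> carrier E"
  shows "T h (L h a w) = sw Z (\<lambda>x y. tlf A E Z (\<lambda>c n. tp A E (c \<star> S y) (L h x n)) (T h w)) a"
  using cosite_site_same[OF edge_of_in[OF h] a, of w "is_source G h"] w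
  unfolding half_act_site half_coact_site by (simp add: ext_space_def)

lemma T_far:
  assumes h: "h \<in> D" "k \<in> D" "k \<noteq> h" "k \<noteq> flip G h" and a: "a \<in> carrier A" and w: "w \<in> carrier E"
  shows "T k (L h a w) = tm A E A E (\<lambda>x. x) (L h a) (T k w)"
  using cosite_site_far[OF edge_of_in[OF h(2)] edge_of_in[OF h(1)] edge_far[OF h] lin_coa lin_act[OF a], of w] w
  unfolding half_act_site half_coact_site by (simp add: ext_space_def)

text \<open>Distinct half-edges belong to different edges or are the two ends of one edge. In the
  latter case one of them acts from the left and the other from the right.\<close>

lemma L_L:
  assumes h: "h \<in> D" "k \<in> D" "k \<noteq> h" and a: "a \<in> carrier A" "b \<in> carrier A" and w: "w \<in> carrier E"
  shows "L h a (L k b w) = L k b (L h a w)"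
  unfolding half_act_site
proof (rule site_site[OF edge_of_in[OF h(1)] edge_of_in[OF h(2)] lin_act[OF a(1)] lin_act[OF a(2)]])
  show "w \<in> carrier (itensor K (edges G) (\<lambda>_. V))" using w by (simp add: ext_space_def)
  fix m assume e: "edge_of G h = edge_of G k" and m: "m \<in> carrier V"
  then have "k = flip G h" using edge_far[OF h] by metis
  then show "act (is_source G h) a (act (is_source G k) b m) = act (is_source G k) b (act (is_source G h) a m)"
    using act_act[OF a m] is_source_flip[OF h(1)] by simp
qed

text \<open>As for \<open>L_L\<close>: on a common edge one coaction comes from the left and the
  other from the right, and these commute by \<open>coa_coa\<close>. Either may come first, hence
  the symmetry of \<open>cocomm\<close>.\<close>

lemma T_T:
  assumes h: "h \<in> D" "k \<in> D" "k \<noteq> h" and w: "w \<in> carrier E"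
  shows "cocomm A A E (T h) (T k) w"
  unfolding half_coact_site ext_space_def
proof (rule cosite_cosite[OF edge_of_in[OF h(1)] edge_of_in[OF h(2)] lin_coa lin_coa])
  show "w \<in> carrier (itensor K (edges G) (\<lambda>_. V))" using w by (simp add: ext_space_def)
  fix m assume e: "edge_of G h = edge_of G k" and m: "m \<in> carrier V"
  then have k: "k = flip G h" using edge_far[OF h] by metis
  have 1: "cocomm A A V (coa True) (coa False) m" using coa_coa[OF m] by (simp add: cocomm_def)
  have 2: "cocomm A A V (coa False) (coa True) m"
    by (rule cocomm_sym[OF vA vA vV lin_coa lin_coa m 1])
  show "cocomm A A V (coa (is_source G h)) (coa (is_source G k)) m"
    using 1 2 is_source_flip[OF h(1)] k by (cases "is_source G h") simp_all
qed

end

section \<open>Words of half-edge operators\<close>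

context kitaev begin

abbreviation "wact \<equiv> word_act K H M G"
abbreviation "wco \<equiv> word_coact K H M G"

lemma vZ [lin_intros, simp]: "vsp Z"
  by (rule vsp_tensor[OF vA vE])

lemma lin_L: "h \<in> D \<Longrightarrow> a \<in> carrier A \<Longrightarrow> lin E E (L h a)"
  using bilD(1)[OF bil_L] .

lemmas LT = bil_arg1[OF bil_L] bil_arg2[OF bil_L] bilD(3)[OF bil_L] lin_comp[OF lin_T] lin_closed[OF lin_T] lin_L lin_T

lemma bil_wact: "set hs \<subseteq> D \<Longrightarrow> bil A E E (\<lambda>a w. wact hs a w)"
proof (induct hs)
  case Nil
  show ?case unfolding word_act.simps by ((rule lin_intros | assumption)+)
next
  case (Cons h hs)
  then have b: "bil A E E (\<lambda>a w. wact hs a w)" and h: "h \<in> D" by auto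
  show ?case unfolding word_act.simps
    by ((rule lin_intros LT h bil_arg1[OF b] bil_arg2[OF b] bilD(3)[OF b] | assumption)+)
qed

lemma lin_wco: "set ks \<subseteq> D \<Longrightarrow> lin E Z (wco ks)"
proof (induct ks)
  case Nil
  have "lin E Z (\<lambda>w. tp A E uA w)" by ((rule lin_intros | assumption)+)
  then show ?case by (simp add: lin_def)
next
  case (Cons k ks)
  then have l: "lin E Z (wco ks)" and k: "k \<in> D" by auto
  have "lin E Z (\<lambda>m. tlf A E Z (\<lambda>b n. tlf A E Z (\<lambda>b' n'. tp A E (b' \<star> b) n') (wco ks n)) (T k m))"
    by ((rule lin_intros LT k lin_comp[OF l] lin_closed[OF l] | assumption)+)
  then show ?case by (simp add: lin_def Let_def)
qed

lemma wact_one: "set hs \<subseteq> D \<Longrightarrow> w \<in> carrier E \<Longrightarrow> wact hs uA w = w"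
proof (induct hs arbitrary: w)
  case Nil then show ?case by (simp add: smult_one)
next
  case (Cons h hs)
  then have b: "bil A E E (\<lambda>a w. wact hs a w)" and h: "h \<in> D" using bil_wact by auto
  have "wact (h # hs) uA w = wact hs uA (L h uA w)"
    unfolding word_act.simps
    by (rule sw_one) ((rule lin_intros LT h Cons(3) bil_arg1[OF b] bil_arg2[OF b] bilD(3)[OF b] | assumption)+)
  then show ?case using Cons h by (simp add: L_one)
qed

text \<open>The operator f is arbitrary so that two words can be handled by using the lemma twice:
  with f the action of a whole word, and with f the action of one half-edge.\<close>

lemma wact_commute:
  assumes f: "lin E E f" and D: "set hs \<subseteq> D" and w: "w \<in> carrier E" and a: "a \<in> carrier A"
    and c: "\<And>h x w. h \<in> set hs \<Longrightarrow> x \<in> carrier A \<Longrightarrow> w \<in> carrier E \<Longrightarrow> f (L h x w) = L h x (f w)"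
  shows "f (wact hs a w) = wact hs a (f w)"
  using D w a c
proof (induct hs arbitrary: a w)
  case Nil then show ?case by (simp add: lin_smult[OF f])
next
  case (Cons h hs)
  then have b: "bil A E E (\<lambda>a w. wact hs a w)" and h: "h \<in> D" using bil_wact by auto
  note J = lin_intros LT h Cons(3,4) bil_arg1[OF b] bil_arg2[OF b] bilD(3)[OF b] lin_comp[OF f] lin_closed[OF f]
  have "f (wact (h # hs) a w) = sw E (\<lambda>x y. f (wact hs y (L h x w))) a"
    unfolding word_act.simps by (rule sw_push) ((rule J f | assumption)+)
  also have "\<dots> = sw E (\<lambda>x y. wact hs y (L h x (f w))) a"
  proof (rule sw_cong, (rule J | assumption)+)
    fix x y assume xy: "x \<in> carrier A" "y \<in> carrier A"
    have "f (wact hs y (L h x w)) = wact hs y (f (L h x w))"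
      by (rule Cons(1)) (use Cons xy LT h in auto)
    then show "f (wact hs y (L h x w)) = wact hs y (L h x (f w))"
      using Cons(5)[of h x w] Cons(3) xy by simp
  qed
  finally show ?case by simp
qed

lemma wact_wact:
  assumes D: "set hs \<subseteq> D" "set ks \<subseteq> D" "set hs \<inter> set ks = {}" and w: "w \<in> carrier E"
    and a: "a \<in> carrier A" and b: "b \<in> carrier A"
  shows "wact hs a (wact ks b w) = wact ks b (wact hs a w)"
proof (rule wact_commute[symmetric, OF bilD(1)[OF bil_wact[OF D(2)] b] D(1) w a])
  fix h x w assume h: "h \<in> set hs" and x: "x \<in> carrier A" and w: "w \<in> carrier E"
  have hD: "h \<in> D" using D h by auto
  show "wact ks b (L h x w) = L h x (wact ks b w)"
  proof (rule wact_commute[symmetric, OF bilD(1)[OF bil_L[OF hD] x] D(2) w b])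
    fix k y w assume k: "k \<in> set ks" and y: "y \<in> carrier A" and w: "w \<in> carrier E"
    show "L h x (L k y w) = L k y (L h x w)"
      using L_L[of h k x y w] hD D k h x y w by auto
  qed
qed

lemma tl_wco_Cons:
  assumes k: "k \<in> D" "set ks \<subseteq> D" and W: "vsp W" and \<phi>: "bil A E W (\<lambda>b n. \<phi> b n)" and w: "w \<in> carrier E"
  shows "tlf A E W (\<lambda>b n. \<phi> b n) (wco (k # ks) w) =
    tlf A E W (\<lambda>b n. tlf A E W (\<lambda>b' n'. \<phi> (b' \<star> b) n') (wco ks n)) (T k w)"
proof -
  note l = lin_wco[OF k(2)]
  note J = lin_intros LT k(1) lin_comp[OF l] lin_closed[OF l] bil_arg1[OF \<phi>] bil_arg2[OF \<phi>] W w
  have "tlf A E W (\<lambda>b n. \<phi> b n) (wco (k # ks) w) =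
    tlf A E W (\<lambda>b n. tlf A E W (\<lambda>b n. \<phi> b n) (tlf A E Z (\<lambda>b' n'. tp A E (b' \<star> b) n') (wco ks n))) (T k w)"
    unfolding word_coact.simps Let_def
    by (rule tl_push) ((rule J \<phi> lin_tl_self | assumption)+)
  also have "\<dots> = tlf A E W (\<lambda>b n. tlf A E W (\<lambda>b' n'. \<phi> (b' \<star> b) n') (wco ks n)) (T k w)"
  proof (rule tl_cong, (rule J \<phi> lin_tl_self | assumption)+)
    fix b n assume bn: "b \<in> carrier A" "n \<in> carrier E"
    have "tlf A E W (\<lambda>b n. \<phi> b n) (tlf A E Z (\<lambda>b' n'. tp A E (b' \<star> b) n') (wco ks n)) =
      tlf A E W (\<lambda>b' n'. tlf A E W (\<lambda>b n. \<phi> b n) (tp A E (b' \<star> b) n')) (wco ks n)"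
      by (rule tl_push) ((rule J bn \<phi> lin_tl_self | assumption)+)
    also have "\<dots> = tlf A E W (\<lambda>b' n'. \<phi> (b' \<star> b) n') (wco ks n)"
      by (rule tl_cong, (rule J bn \<phi> lin_tl_self | assumption)+, rule tl_tp) ((rule J bn \<phi> | assumption)+)
    finally show "tlf A E W (\<lambda>b n. \<phi> b n) (tlf A E Z (\<lambda>b' n'. tp A E (b' \<star> b) n') (wco ks n)) = \<dots>" .
  qed
  finally show ?thesis .
qed

text \<open>The second coaction is arbitrary for the same reason as in \<open>wact_commute\<close>:
  it will be that of a word and that of a single half-edge.\<close>

lemma wco_cocomm:
  assumes C: "vsp C" and t': "lin E (C \<boxtimes> E) t'" and ks: "set ks \<subseteq> D"
    and c: "\<And>k w. k \<in> set ks \<Longrightarrow> w \<in> carrier E \<Longrightarrow> cocomm A C E (T k) t' w" and w: "w \<in> carrier E"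
  shows "cocomm A C E (wco ks) t' w"
  using ks c w
proof (induct ks arbitrary: w)
  case Nil
  let ?Y = "A \<boxtimes> C \<boxtimes> E"
  note J = lin_intros C Nil(3) lin_comp[OF t'] lin_closed[OF t']
  have "tlf A E ?Y (\<lambda>b n. tlf C E ?Y (\<lambda>b' n'. tp A (C \<boxtimes> E) b (tp C E b' n')) (t' n)) (tp A E uA w) =
    tlf C E ?Y (\<lambda>b' n'. tp A (C \<boxtimes> E) uA (tp C E b' n')) (t' w)"
    by (rule tl_tp) ((rule J | assumption)+)
  also have "\<dots> = tlf C E ?Y (\<lambda>b' n. tlf A E ?Y (\<lambda>b n'. tp A (C \<boxtimes> E) b (tp C E b' n')) (tp A E uA n)) (t' w)"
    by (rule tl_cong, (rule J | assumption)+, rule tl_tp[symmetric]) ((rule J | assumption)+)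
  finally show ?case by (simp add: cocomm_def)
next
  case (Cons k ks)
  let ?Y = "A \<boxtimes> C \<boxtimes> E"
  have k: "k \<in> D" "set ks \<subseteq> D" and w: "w \<in> carrier E" using Cons by auto
  note l = lin_wco[OF k(2)]
  note J = lin_intros C lin_comp[OF t'] lin_closed[OF t'] LT k(1) lin_comp[OF l] lin_closed[OF l] w
  have IH: "cocomm A C E (wco ks) t' w" if "w \<in> carrier E" for w using Cons k that by auto
  have Tk: "cocomm A C E (T k) t' w" if "w \<in> carrier E" for w using Cons that by auto
  have "tlf A E ?Y (\<lambda>b n. tlf C E ?Y (\<lambda>b' n'. tp A (C \<boxtimes> E) b (tp C E b' n')) (t' n)) (wco (k # ks) w) =
    tlf A E ?Y (\<lambda>b n. tlf A E ?Y (\<lambda>b1 n. tlf C E ?Y (\<lambda>b' n'. tp A (C \<boxtimes> E) (b1 \<star> b) (tp C E b' n')) (t' n)) (wco ks n)) (T k w)"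
    by (rule tl_wco_Cons[OF k]) ((rule J | assumption)+)
  also have "\<dots> = tlf A E ?Y (\<lambda>b n. tlf C E ?Y (\<lambda>b' n. tlf A E ?Y (\<lambda>b1 n'. tp A (C \<boxtimes> E) (b1 \<star> b) (tp C E b' n')) (wco ks n)) (t' n)) (T k w)"
    by (rule tl_cong, (rule J | assumption)+, rule cocomm_lift[OF vA C vE _ l t' _ IH]) ((rule J | assumption)+)
  also have "\<dots> = tlf C E ?Y (\<lambda>b' n. tlf A E ?Y (\<lambda>b n. tlf A E ?Y (\<lambda>b1 n'. tp A (C \<boxtimes> E) (b1 \<star> b) (tp C E b' n')) (wco ks n)) (T k n)) (t' w)"
    by (rule cocomm_lift[OF vA C vE _ lin_T[OF k(1)] t' w Tk[OF w]]) ((rule J | assumption)+)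
  also have "\<dots> = tlf C E ?Y (\<lambda>b' n. tlf A E ?Y (\<lambda>b n'. tp A (C \<boxtimes> E) b (tp C E b' n')) (wco (k # ks) n)) (t' w)"
    by (rule tl_cong, (rule J | assumption)+, rule tl_wco_Cons[OF k, symmetric]) ((rule J | assumption)+)
  finally show ?case unfolding cocomm_def .
qed

lemma wco_wco:
  assumes D: "set ks \<subseteq> D" "set ls \<subseteq> D" "set ks \<inter> set ls = {}" and w: "w \<in> carrier E"
  shows "cocomm A A E (wco ks) (wco ls) w"
proof (rule wco_cocomm[OF vA lin_wco[OF D(2)] D(1) _ w])
  fix k w assume k: "k \<in> set ks" and w: "w \<in> carrier E"
  have kD: "k \<in> D" using k D by auto
  have "cocomm A A E (wco ls) (T k) w"
  proof (rule wco_cocomm[OF vA lin_T[OF kD] D(2) _ w])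
    fix l w assume "l \<in> set ls" "w \<in> carrier E"
    then show "cocomm A A E (T l) (T k) w" using T_T[of l k w] kD D k by auto
  qed
  then show "cocomm A A E (T k) (wco ls) w"
    by (rule cocomm_sym[OF vA vA vE lin_wco[OF D(2)] lin_T[OF kD] w])
qed

subsection \<open>Vertex actions and face coactions\<close>

text \<open>A map \<open>E \<rightarrow> H \<otimes> E\<close> is extended to \<open>H \<otimes> E\<close>, linearly with respect to right multiplication
  on \<open>H\<close>; the product of coactions then becomes composition of operators.\<close>

definition "hat k z = tlf A E Z (\<lambda>b m. tlf A E Z (\<lambda>c n. tp A E (c \<star> b) n) (T k m)) z"

text \<open>\<open>Lh\<close> acts on the second factor only, and \<open>ins\<close> multiplies the
  first from the left. As \<open>hat k\<close> also puts its coefficient on the left,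
  \<open>ins y\<close> between two such operators records a factor y at this position of the
  product.\<close>

definition "Lh h a z = tlf A E Z (\<lambda>b m. tp A E b (L h a m)) z"

definition "ins y z = tlf A E Z (\<lambda>b m. tp A E (y \<star> b) m) z"

lemma lin_hat: "k \<in> D \<Longrightarrow> lin Z Z (hat k)"
proof -
  assume k: "k \<in> D"
  have "lin Z Z (\<lambda>z. tlf A E Z (\<lambda>b m. tlf A E Z (\<lambda>c n. tp A E (c \<star> b) n) (T k m)) z)"
    by ((rule lin_intros LT k | assumption)+)
  then show ?thesis unfolding lin_def hat_def .
qed

lemma bil_Lh: "h \<in> D \<Longrightarrow> bil A Z Z (\<lambda>a z. Lh h a z)"
  unfolding Lh_def by ((rule lin_intros LT | assumption)+)

lemma bil_ins: "bil A Z Z (\<lambda>y z. ins y z)"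
  unfolding ins_def by ((rule lin_intros LT | assumption)+)

lemmas ZI = lin_intros LT lin_hat bil_arg1[OF bil_Lh] bil_arg2[OF bil_Lh] bilD(3)[OF bil_Lh]
  bil_arg1[OF bil_ins] bil_arg2[OF bil_ins] bilD(1)[OF bil_ins] bilD(3)[OF bil_ins] lin_comp[OF lin_hat] lin_closed[OF lin_hat]

lemma hat_tp: "k \<in> D \<Longrightarrow> b \<in> carrier A \<Longrightarrow> m \<in> carrier E \<Longrightarrow>
    hat k (tp A E b m) = tlf A E Z (\<lambda>c n. tp A E (c \<star> b) n) (T k m)"
  unfolding hat_def by (rule tl_tp) ((rule ZI | assumption)+)

lemma Lh_tp: "h \<in> D \<Longrightarrow> a \<in> carrier A \<Longrightarrow> b \<in> carrier A \<Longrightarrow> m \<in> carrier E \<Longrightarrow>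
    Lh h a (tp A E b m) = tp A E b (L h a m)"
  unfolding Lh_def by (rule tl_tp) ((rule ZI | assumption)+)

lemma ins_tp: "y \<in> carrier A \<Longrightarrow> b \<in> carrier A \<Longrightarrow> m \<in> carrier E \<Longrightarrow>
    ins y (tp A E b m) = tp A E (y \<star> b) m"
  unfolding ins_def by (rule tl_tp) ((rule ZI | assumption)+)

lemma Lh_tl:
  assumes h: "h \<in> D" and a: "a \<in> carrier A" and t: "t \<in> carrier Z" and \<phi>: "lin A A \<phi>" and f: "lin E E f"
  shows "Lh h a (tlf A E Z (\<lambda>c n. tp A E (\<phi> c) (f n)) t) = tlf A E Z (\<lambda>c n. tp A E (\<phi> c) (L h a (f n))) t"
proof -
  note J = ZI h a t \<phi> f lin_comp[OF \<phi>] lin_comp[OF f] lin_closed[OF \<phi>] lin_closed[OF f]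
  have "Lh h a (tlf A E Z (\<lambda>c n. tp A E (\<phi> c) (f n)) t) = tlf A E Z (\<lambda>c n. Lh h a (tp A E (\<phi> c) (f n))) t"
    by (rule tl_push) ((rule J | assumption)+)
  also have "\<dots> = tlf A E Z (\<lambda>c n. tp A E (\<phi> c) (L h a (f n))) t"
    by (rule tl_cong, (rule J | assumption)+, rule Lh_tp) ((rule J | assumption)+)
  finally show ?thesis .
qed

lemma ins_tl:
  assumes y: "y \<in> carrier A" and t: "t \<in> carrier Z" and \<phi>: "lin A A \<phi>" and f: "lin E E f"
  shows "ins y (tlf A E Z (\<lambda>c n. tp A E (\<phi> c) (f n)) t) = tlf A E Z (\<lambda>c n. tp A E (y \<star> \<phi> c) (f n)) t"
proof -
  note J = ZI y t \<phi> f lin_comp[OF \<phi>] lin_comp[OF f] lin_closed[OF \<phi>] lin_closed[OF f]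
  have "ins y (tlf A E Z (\<lambda>c n. tp A E (\<phi> c) (f n)) t) = tlf A E Z (\<lambda>c n. ins y (tp A E (\<phi> c) (f n))) t"
    by (rule tl_push) ((rule J | assumption)+)
  also have "\<dots> = tlf A E Z (\<lambda>c n. tp A E (y \<star> \<phi> c) (f n)) t"
    by (rule tl_cong, (rule J | assumption)+, rule ins_tp) ((rule J | assumption)+)
  finally show ?thesis .
qed

text \<open>By \<open>T_opp\<close> the action leaves its first leg to the left of the new
  coefficient, that is, immediately after the operator of the opposite half-edge.\<close>

lemma hat_opp:
  assumes h: "h \<in> D" and x: "x \<in> carrier A" and z: "z \<in> carrier Z"
  shows "hat (flip G h) (Lh h x z) = sw Z (\<lambda>u v. Lh h v (ins u (hat (flip G h) z))) x"
proof -
  note J = ZI h x flip_closed[OF h]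
  have "\<forall>z\<in>carrier Z. hat (flip G h) (Lh h x z) = sw Z (\<lambda>u v. Lh h v (ins u (hat (flip G h) z))) x"
  proof (rule tens_ext)
    fix b m assume bm: "b \<in> carrier A" "m \<in> carrier E"
    let ?T = "T (flip G h) m" and ?g = "tlf A E Z (\<lambda>c n. tp A E (c \<star> b) n)"
    have "hat (flip G h) (Lh h x (tp A E b m)) = ?g (T (flip G h) (L h x m))"
      using bm h x LT by (simp add: Lh_tp hat_tp)
    also have "\<dots> = ?g (sw Z (\<lambda>u v. tlf A E Z (\<lambda>c n. tp A E (u \<star> c) (L h v n)) ?T) x)"
      by (simp add: T_opp h x bm)
    also have "\<dots> = sw Z (\<lambda>u v. ?g (tlf A E Z (\<lambda>c n. tp A E (u \<star> c) (L h v n)) ?T)) x"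
      by (rule sw_push) ((rule J bm | assumption)+)
    also have "\<dots> = sw Z (\<lambda>u v. Lh h v (ins u (hat (flip G h) (tp A E b m)))) x"
    proof (rule sw_cong, (rule J bm | assumption)+)
      fix u v assume uv: "u \<in> carrier A" "v \<in> carrier A"
      have "?g (tlf A E Z (\<lambda>c n. tp A E (u \<star> c) (L h v n)) ?T) = tlf A E Z (\<lambda>c n. ?g (tp A E (u \<star> c) (L h v n))) ?T"
        by (rule tl_push) ((rule J bm uv | assumption)+)
      also have "\<dots> = tlf A E Z (\<lambda>c n. tp A E (u \<star> c \<star> b) (L h v n)) ?T"
        by (rule tl_cong, (rule J bm uv | assumption)+, rule tl_tp) ((rule J bm uv | assumption)+)
      also have "\<dots> = tlf A E Z (\<lambda>c n. tp A E (u \<star> (c \<star> b)) (L h v n)) ?T"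
        by (rule tl_cong, (rule J bm uv | assumption)+) (simp add: mul_assoc uv bm)
      also have "\<dots> = Lh h v (tlf A E Z (\<lambda>c n. tp A E (u \<star> (c \<star> b)) n) ?T)"
        by (rule Lh_tl[symmetric]) ((rule J bm uv | assumption)+)
      also have "tlf A E Z (\<lambda>c n. tp A E (u \<star> (c \<star> b)) n) ?T = ins u (?g ?T)"
        by (rule ins_tl[symmetric]) ((rule J bm uv | assumption)+)
      finally show "?g (tlf A E Z (\<lambda>c n. tp A E (u \<star> c) (L h v n)) ?T) = Lh h v (ins u (hat (flip G h) (tp A E b m)))"
        by (simp add: hat_tp h bm)
    qed
    finally show "hat (flip G h) (Lh h x (tp A E b m)) = sw Z (\<lambda>u v. Lh h v (ins u (hat (flip G h) (tp A E b m)))) x" .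
  qed ((rule J | assumption)+)
  with z show ?thesis by blast
qed

text \<open>By \<open>T_same\<close> the action at h creates S(x2) to the right of the new
  coefficient. A factor x3 inserted just before the operator stands next to it and cancels
  it.\<close>

lemma hat_same:
  assumes h: "h \<in> D" and x: "x \<in> carrier A" and z: "z \<in> carrier Z"
  shows "sw Z (\<lambda>u v. hat h (ins v (Lh h u z))) x = Lh h x (hat h z)"
proof -
  note J = ZI h x
  have "\<forall>z\<in>carrier Z. sw Z (\<lambda>u v. hat h (ins v (Lh h u z))) x = Lh h x (hat h z)"
  proof (rule tens_ext)
    fix b m assume bm: "b \<in> carrier A" "m \<in> carrier E"
    let ?g = "\<lambda>p w. tlf A E Z (\<lambda>c n. tp A E (c \<star> (w \<star> b)) (L h p n)) (T h m)"
    have "sw Z (\<lambda>u v. hat h (ins v (Lh h u (tp A E b m)))) x = sw Z (\<lambda>u v. sw Z (\<lambda>p q. ?g p (S q \<star> v)) u) x"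
    proof (rule sw_cong, (rule J bm | assumption)+)
      fix u v assume uv: "u \<in> carrier A" "v \<in> carrier A"
      let ?h = "tlf A E Z (\<lambda>c n. tp A E (c \<star> (v \<star> b)) n)"
      have "hat h (ins v (Lh h u (tp A E b m))) = ?h (T h (L h u m))"
        using bm h uv LT by (simp add: Lh_tp ins_tp hat_tp)
      also have "\<dots> = ?h (sw Z (\<lambda>p q. tlf A E Z (\<lambda>c n. tp A E (c \<star> S q) (L h p n)) (T h m)) u)"
        by (simp add: T_same h uv bm)
      also have "\<dots> = sw Z (\<lambda>p q. ?h (tlf A E Z (\<lambda>c n. tp A E (c \<star> S q) (L h p n)) (T h m))) u"
        by (rule sw_push) ((rule J bm uv | assumption)+)
      also have "\<dots> = sw Z (\<lambda>p q. ?g p (S q \<star> v)) u"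
      proof (rule sw_cong, (rule J bm uv | assumption)+)
        fix p q assume pq: "p \<in> carrier A" "q \<in> carrier A"
        have "?h (tlf A E Z (\<lambda>c n. tp A E (c \<star> S q) (L h p n)) (T h m)) =
          tlf A E Z (\<lambda>c n. ?h (tp A E (c \<star> S q) (L h p n))) (T h m)"
          by (rule tl_push) ((rule J bm uv pq | assumption)+)
        also have "\<dots> = tlf A E Z (\<lambda>c n. tp A E (c \<star> S q \<star> (v \<star> b)) (L h p n)) (T h m)"
          by (rule tl_cong, (rule J bm uv pq | assumption)+, rule tl_tp) ((rule J bm uv pq | assumption)+)
        also have "\<dots> = ?g p (S q \<star> v)"
          by (rule tl_cong, (rule J bm uv pq | assumption)+) (simp add: mul_assoc uv bm pq)
        finally show "?h (tlf A E Z (\<lambda>c n. tp A E (c \<star> S q) (L h p n)) (T h m)) = ?g p (S q \<star> v)" .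
      qed
      finally show "hat h (ins v (Lh h u (tp A E b m))) = sw Z (\<lambda>p q. ?g p (S q \<star> v)) u" .
    qed
    also have "\<dots> = sw Z (\<lambda>p r. sw Z (\<lambda>q v. ?g p (S q \<star> v)) r) x"
      by (rule coassoc) ((rule J bm | assumption)+)
    also have "\<dots> = sw Z (\<lambda>p r. \<epsilon> r \<odot>\<^bsub>Z\<^esub> ?g p uA) x"
      by (rule sw_cong, (rule J bm | assumption)+, rule antipode_l) ((rule J bm | assumption)+)
    also have "\<dots> = ?g x uA"
      by (rule counit_r) ((rule J bm | assumption)+)
    also have "\<dots> = Lh h x (tlf A E Z (\<lambda>c n. tp A E (c \<star> (uA \<star> b)) n) (T h m))"
      by (rule Lh_tl[symmetric]) ((rule J bm | assumption)+)
    finally show "sw Z (\<lambda>u v. hat h (ins v (Lh h u (tp A E b m)))) x = Lh h x (hat h (tp A E b m))"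
      using bm by (simp add: hat_tp h)
  qed ((rule J | assumption)+)
  with z show ?thesis by blast
qed

lemma hat_far:
  assumes h: "h \<in> D" "k \<in> D" "k \<noteq> h" "k \<noteq> flip G h" and x: "x \<in> carrier A" and z: "z \<in> carrier Z"
  shows "hat k (Lh h x z) = Lh h x (hat k z)"
proof -
  note J = ZI h(1,2) x
  have "\<forall>z\<in>carrier Z. hat k (Lh h x z) = Lh h x (hat k z)"
  proof (rule tens_ext)
    fix b m assume bm: "b \<in> carrier A" "m \<in> carrier E"
    have "hat k (Lh h x (tp A E b m)) = tlf A E Z (\<lambda>c n. tp A E (c \<star> b) n) (tm A E A E (\<lambda>x. x) (L h x) (T k m))"
      using bm h x LT by (simp add: Lh_tp hat_tp T_far)
    also have "\<dots> = tlf A E Z (\<lambda>c n. tp A E (c \<star> b) (L h x n)) (T k m)"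
      by (rule tl_tm) ((rule J bm | assumption)+)
    also have "\<dots> = Lh h x (tlf A E Z (\<lambda>c n. tp A E (c \<star> b) n) (T k m))"
      by (rule Lh_tl[symmetric]) ((rule J bm | assumption)+)
    finally show "hat k (Lh h x (tp A E b m)) = Lh h x (hat k (tp A E b m))" using bm h by (simp add: hat_tp)
  qed ((rule J | assumption)+)
  with z show ?thesis by blast
qed

text \<open>The head of the list is applied first, so its coefficient ends up as the rightmost
  one.\<close>

primrec cw where
  "cw [] z = z"
| "cw (k # ks) z = cw ks (hat k z)"

text \<open>Moving the action at a half-edge past a composite of operators \<open>hat k\<close> leaves an element of \<open>H\<close>
  immediately before or after one of the factors.\<close>

primrec cw_before where
  "cw_before h [] y z = \<epsilon> y \<odot>\<^bsub>Z\<^esub> z"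
| "cw_before h (k # ks) y z = (if k = h then cw ks (hat k (ins y z)) else cw_before h ks y (hat k z))"

primrec cw_after where
  "cw_after h [] y z = \<epsilon> y \<odot>\<^bsub>Z\<^esub> z"
| "cw_after h (k # ks) y z = (if k = h then cw ks (ins y (hat k z)) else cw_after h ks y (hat k z))"

lemma lin_cw: "set ks \<subseteq> D \<Longrightarrow> lin Z Z (cw ks)"
proof (induct ks)
  case Nil then show ?case by (simp add: lin_def)
next
  case (Cons k ks)
  then have k: "k \<in> D" and l: "lin Z Z (cw ks)" by auto
  have "lin Z Z (\<lambda>z. cw ks (hat k z))" by (rule lin_comp[OF l lin_hat[OF k]])
  then show ?case unfolding lin_def cw.simps .
qed

lemma bil_cw_before: "set ks \<subseteq> D \<Longrightarrow> bil A Z Z (\<lambda>y z. cw_before h ks y z)"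
proof (induct ks)
  case Nil show ?case unfolding cw_before.simps by (rule bil_\<epsilon>[OF vZ])
next
  case (Cons k ks)
  then have k: "k \<in> D" and l: "lin Z Z (cw ks)" and b: "bil A Z Z (\<lambda>y z. cw_before h ks y z)"
    using lin_cw by auto
  have 1: "bil A Z Z (\<lambda>y z. cw ks (hat k (ins y z)))" by ((rule ZI k lin_comp[OF l] | assumption)+)
  have 2: "bil A Z Z (\<lambda>y z. cw_before h ks y (hat k z))" by ((rule ZI k bil_arg1[OF b] bil_arg2[OF b] | assumption)+)
  show ?case using 1 2 by (cases "k = h") simp_all
qed

lemma bil_cw_after: "set ks \<subseteq> D \<Longrightarrow> bil A Z Z (\<lambda>y z. cw_after h ks y z)"
proof (induct ks)
  case Nil show ?case unfolding cw_after.simps by (rule bil_\<epsilon>[OF vZ])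
next
  case (Cons k ks)
  then have k: "k \<in> D" and l: "lin Z Z (cw ks)" and b: "bil A Z Z (\<lambda>y z. cw_after h ks y z)"
    using lin_cw by auto
  have 1: "bil A Z Z (\<lambda>y z. cw ks (ins y (hat k z)))" by ((rule ZI k lin_comp[OF l] | assumption)+)
  have 2: "bil A Z Z (\<lambda>y z. cw_after h ks y (hat k z))" by ((rule ZI k bil_arg1[OF b] bil_arg2[OF b] | assumption)+)
  show ?case using 1 2 by (cases "k = h") simp_all
qed

lemmas CI = ZI lin_cw lin_comp[OF lin_cw] lin_closed[OF lin_cw]
  bil_arg1[OF bil_cw_before] bil_arg2[OF bil_cw_before] bilD(3)[OF bil_cw_before] bilD(1)[OF bil_cw_before]
  bil_arg1[OF bil_cw_after] bil_arg2[OF bil_cw_after] bilD(3)[OF bil_cw_after]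

lemma cw_before_absent: "h \<notin> set ks \<Longrightarrow> set ks \<subseteq> D \<Longrightarrow> y \<in> carrier A \<Longrightarrow> z \<in> carrier Z \<Longrightarrow>
    cw_before h ks y z = \<epsilon> y \<odot>\<^bsub>Z\<^esub> cw ks z"
  by (induct ks arbitrary: z) (auto simp: lin_closed[OF lin_hat])

lemma cw_after_absent: "h \<notin> set ks \<Longrightarrow> set ks \<subseteq> D \<Longrightarrow> y \<in> carrier A \<Longrightarrow> z \<in> carrier Z \<Longrightarrow>
    cw_after h ks y z = \<epsilon> y \<odot>\<^bsub>Z\<^esub> cw ks z"
  by (induct ks arbitrary: z) (auto simp: lin_closed[OF lin_hat])

text \<open>Directly after g and directly before its successor are the same position.\<close>

lemma cw_before_after:
  "g \<notin> set F1 \<Longrightarrow> p \<notin> set F1 \<Longrightarrow> p \<noteq> g \<Longrightarrow> cw_after g (F1 @ g # p # F2) y z = cw_before p (F1 @ g # p # F2) y z"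
  by (induct F1 arbitrary: z) auto

lemma cw_Lh_far:
  "h \<in> D \<Longrightarrow> h \<notin> set ks \<Longrightarrow> flip G h \<notin> set ks \<Longrightarrow> set ks \<subseteq> D \<Longrightarrow> x \<in> carrier A \<Longrightarrow> z \<in> carrier Z \<Longrightarrow>
    cw ks (Lh h x z) = Lh h x (cw ks z)"
  by (induct ks arbitrary: z) (auto simp: hat_far lin_closed[OF lin_hat])

lemma Lh_counit:
  assumes h: "h \<in> D" and x: "x \<in> carrier A" and z: "z \<in> carrier Z"
  shows "sw Z (\<lambda>u v. Lh h v (\<epsilon> u \<odot>\<^bsub>Z\<^esub> z)) x = Lh h x z"
proof -
  note J = CI h x z
  have "sw Z (\<lambda>u v. Lh h v (\<epsilon> u \<odot>\<^bsub>Z\<^esub> z)) x = sw Z (\<lambda>u v. \<epsilon> u \<odot>\<^bsub>Z\<^esub> Lh h v z) x"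
    by (rule sw_cong, (rule J | assumption)+, rule lin_smult[OF bilD(1)[OF bil_Lh]]) ((rule J | assumption)+)
  also have "\<dots> = Lh h x z" by (rule counit_l) ((rule J | assumption)+)
  finally show ?thesis .
qed

text \<open>As h itself is absent, a factor can be left only at the other end of its edge; if that
  end is absent too, \<open>cw_after\<close> is the counit.\<close>

lemma cw_Lh:
  assumes h: "h \<in> D" and ks: "h \<notin> set ks" "distinct ks" "set ks \<subseteq> D" and x: "x \<in> carrier A" and z: "z \<in> carrier Z"
  shows "cw ks (Lh h x z) = sw Z (\<lambda>u v. Lh h v (cw_after (flip G h) ks u z)) x"
  using ks z
proof (induct ks arbitrary: z)
  case Nil then show ?case by (simp add: Lh_counit h x)
next
  case (Cons k ks)
  then have k: "k \<in> D" "k \<noteq> h" and ks: "set ks \<subseteq> D" "h \<notin> set ks" "distinct ks" "k \<notin> set ks" and z: "z \<in> carrier Z"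
    by auto
  have hz: "hat k z \<in> carrier Z" by (rule lin_closed[OF lin_hat[OF k(1)] z])
  note J = CI h x k(1) ks(1) z hz
  show ?case
  proof (cases "k = flip G h")
    case True
    have n: "flip G h \<notin> set ks" using True ks by simp
    have "cw ks (hat k (Lh h x z)) = cw ks (sw Z (\<lambda>u v. Lh h v (ins u (hat k z))) x)"
      unfolding True by (simp add: hat_opp h x z)
    also have "\<dots> = sw Z (\<lambda>u v. cw ks (Lh h v (ins u (hat k z)))) x"
      by (rule sw_push) ((rule J | assumption)+)
    also have "\<dots> = sw Z (\<lambda>u v. Lh h v (cw ks (ins u (hat k z)))) x"
      by (rule sw_cong, (rule J | assumption)+, rule cw_Lh_far) ((rule J ks n | assumption)+)
    finally show ?thesis using True by simp
  next
    case False
    have "cw ks (hat k (Lh h x z)) = cw ks (Lh h x (hat k z))" using False k by (simp add: hat_far h x z)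
    also have "\<dots> = sw Z (\<lambda>u v. Lh h v (cw_after (flip G h) ks u (hat k z))) x"
      by (rule Cons(1)[OF ks(2,3,1) hz])
    finally show ?thesis using False by simp
  qed
qed

text \<open>The exchange rule. A leg inserted before h cancels what the action creates at h
  (\<open>hat_same\<close>), and the passage of the opposite half-edge leaves a new leg after it
  (\<open>hat_opp\<close>). If one of the two half-edges is missing from the word, its leg is
  absorbed by the counit, which lets all cases have one form.\<close>

lemma cw_before_Lh:
  assumes h: "h \<in> D" and ks: "distinct ks" "set ks \<subseteq> D" and x: "x \<in> carrier A" and z: "z \<in> carrier Z"
  shows "sw Z (\<lambda>u v. cw_before h ks v (Lh h u z)) x = sw Z (\<lambda>u v. Lh h v (cw_after (flip G h) ks u z)) x"
  using ks x z
proof (induct ks arbitrary: x z)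
  case Nil
  note J = CI h Nil(3,4)
  have "sw Z (\<lambda>u v. \<epsilon> v \<odot>\<^bsub>Z\<^esub> Lh h u z) x = Lh h x z" by (rule counit_r) ((rule J | assumption)+)
  then show ?case using Nil by (simp add: Lh_counit h)
next
  case (Cons k ks)
  then have k: "k \<in> D" and ks: "set ks \<subseteq> D" "distinct ks" "k \<notin> set ks" and z: "z \<in> carrier Z"
    and x: "x \<in> carrier A" by auto
  have hz: "hat k z \<in> carrier Z" by (rule lin_closed[OF lin_hat[OF k(1)] z])
  have fh: "flip G h \<noteq> h" by (rule ribbon(4)[OF h])
  note J = CI h x k ks(1) z hz
  consider (same) "k = h" | (opp) "k = flip G h" "k \<noteq> h" | (far) "k \<noteq> h" "k \<noteq> flip G h" by blast
  then show ?case
  proof cases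
    case same
    have "sw Z (\<lambda>u v. cw ks (hat h (ins v (Lh h u z)))) x = cw ks (sw Z (\<lambda>u v. hat h (ins v (Lh h u z))) x)"
      by (rule sw_push[symmetric]) ((rule J | assumption)+)
    also have "\<dots> = cw ks (Lh h x (hat h z))" by (simp add: hat_same h x z)
    also have "\<dots> = sw Z (\<lambda>u v. Lh h v (cw_after (flip G h) ks u (hat h z))) x"
      by (rule cw_Lh[OF h _ ks(2,1) x]) (use same ks hz in simp_all)
    finally show ?thesis using same fh by simp
  next
    case opp
    have "sw Z (\<lambda>u v. cw_before h ks v (hat k (Lh h u z))) x =
      sw Z (\<lambda>u v. sw Z (\<lambda>p q. cw_before h ks v (Lh h q (ins p (hat k z)))) u) x"
    proof (rule sw_cong, (rule J | assumption)+)
      fix u v assume uv: "u \<in> carrier A" "v \<in> carrier A"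
      have "hat k (Lh h u z) = sw Z (\<lambda>p q. Lh h q (ins p (hat k z))) u"
        unfolding opp(1) by (rule hat_opp[OF h uv(1) z])
      then show "cw_before h ks v (hat k (Lh h u z)) = sw Z (\<lambda>p q. cw_before h ks v (Lh h q (ins p (hat k z)))) u"
        by (simp only:, intro sw_push) ((rule J uv | assumption)+)
    qed
    also have "\<dots> = sw Z (\<lambda>p r. sw Z (\<lambda>q v. cw_before h ks v (Lh h q (ins p (hat k z)))) r) x"
      by (rule coassoc) ((rule J | assumption)+)
    also have "\<dots> = sw Z (\<lambda>p r. Lh h r (cw ks (ins p (hat k z)))) x"
    proof (rule sw_cong, (rule J | assumption)+)
      fix p r assume pr: "p \<in> carrier A" "r \<in> carrier A"
      let ?y = "ins p (hat k z)"
      have y: "?y \<in> carrier Z" "cw ks ?y \<in> carrier Z" by ((rule J pr)+)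
      \<comment> \<open>The word is distinct, so \<open>flip G h\<close> does not recur and the
        induction hypothesis leaves only the counit.\<close>
      have "sw Z (\<lambda>q v. cw_before h ks v (Lh h q ?y)) r = sw Z (\<lambda>q v. Lh h v (cw_after (flip G h) ks q ?y)) r"
        by (rule Cons(1)[OF ks(2,1) pr(2) y(1)])
      also have "\<dots> = sw Z (\<lambda>q v. Lh h v (\<epsilon> q \<odot>\<^bsub>Z\<^esub> cw ks ?y)) r"
        by (rule sw_cong, (rule J pr y | assumption)+) (use opp ks y in \<open>simp add: cw_after_absent\<close>)
      also have "\<dots> = Lh h r (cw ks ?y)" by (rule Lh_counit[OF h pr(2) y(2)])
      finally show "sw Z (\<lambda>q v. cw_before h ks v (Lh h q ?y)) r = Lh h r (cw ks ?y)" .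
    qed
    finally show ?thesis using opp by simp
  next
    case far
    have "sw Z (\<lambda>u v. cw_before h ks v (hat k (Lh h u z))) x = sw Z (\<lambda>u v. cw_before h ks v (Lh h u (hat k z))) x"
      by (rule sw_cong, (rule J | assumption)+) (use far in \<open>simp add: hat_far h k z\<close>)
    also have "\<dots> = sw Z (\<lambda>u v. Lh h v (cw_after (flip G h) ks u (hat k z))) x"
      by (rule Cons(1)[OF ks(2,1) x hz])
    finally show ?thesis using far by simp
  qed
qed

text \<open>The operators \<open>hat k\<close> commute with right multiplication on H, so the
  initial coefficient b stays at the right end of the product.\<close>

lemma cw_tp:
  assumes "set ks \<subseteq> D" "b \<in> carrier A" "m \<in> carrier E"
  shows "cw ks (tp A E b m) = tlf A E Z (\<lambda>c n. tp A E (c \<star> b) n) (wco ks m)"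
  using assms
proof (induct ks arbitrary: b m)
  case Nil
  have "tlf A E Z (\<lambda>c n. tp A E (c \<star> b) n) (tp A E uA m) = tp A E (uA \<star> b) m"
    by (rule tl_tp) ((rule CI Nil | assumption)+)
  then show ?case using Nil by simp
next
  case (Cons k ks)
  then have k: "k \<in> D" and ks: "set ks \<subseteq> D" by auto
  note l = lin_wco[OF ks]
  note J = CI k ks Cons(3,4) lin_comp[OF l] lin_closed[OF l]
  have "cw (k # ks) (tp A E b m) = cw ks (tlf A E Z (\<lambda>c n. tp A E (c \<star> b) n) (T k m))"
    using Cons k by (simp add: hat_tp)
  also have "\<dots> = tlf A E Z (\<lambda>c n. cw ks (tp A E (c \<star> b) n)) (T k m)"
    by (rule tl_push) ((rule J | assumption)+)
  also have "\<dots> = tlf A E Z (\<lambda>c n. tlf A E Z (\<lambda>d l. tp A E (d \<star> c \<star> b) l) (wco ks n)) (T k m)"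
  proof (rule tl_cong, (rule J | assumption)+)
    fix c n assume cn: "c \<in> carrier A" "n \<in> carrier E"
    have "cw ks (tp A E (c \<star> b) n) = tlf A E Z (\<lambda>d l. tp A E (d \<star> (c \<star> b)) l) (wco ks n)"
      by (rule Cons(1)[OF ks]) ((rule J cn)+)
    also have "\<dots> = tlf A E Z (\<lambda>d l. tp A E (d \<star> c \<star> b) l) (wco ks n)"
      by (rule tl_cong, (rule J cn | assumption)+) (simp add: mul_assoc cn Cons)
    finally show "cw ks (tp A E (c \<star> b) n) = \<dots>" .
  qed
  also have "\<dots> = tlf A E Z (\<lambda>c n. tp A E (c \<star> b) n) (wco (k # ks) m)"
    by (rule tl_wco_Cons[symmetric, OF k ks]) ((rule J | assumption)+)
  finally show ?case .
qed

lemma wco_cw: "set ks \<subseteq> D \<Longrightarrow> m \<in> carrier E \<Longrightarrow> wco ks m = cw ks (tp A E uA m)"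
proof -
  assume ks: "set ks \<subseteq> D" and m: "m \<in> carrier E"
  note l = lin_closed[OF lin_wco[OF ks] m]
  have "tlf A E Z (\<lambda>c n. tp A E c n) (wco ks m) = tlf A E Z (\<lambda>c n. tp A E (c \<star> uA) n) (wco ks m)"
    by (rule tl_cong, (rule CI l | assumption)+) simp
  then show ?thesis using cw_tp[OF ks uA_closed m] tl_id[OF vA vE l] by simp
qed

text \<open>The word action on the second factor of H \<otimes> E, built from \<open>Lh\<close> so
  that half-edges can be exchanged with a face word one at a time.\<close>

primrec Wh where
  "Wh [] a z = \<epsilon> a \<odot>\<^bsub>Z\<^esub> z"
| "Wh (h # hs) a z = sw Z (\<lambda>x y. Wh hs y (Lh h x z)) a"

lemma bil_Wh: "set hs \<subseteq> D \<Longrightarrow> bil A Z Z (\<lambda>a z. Wh hs a z)"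
proof (induct hs)
  case Nil show ?case unfolding Wh.simps by (rule bil_\<epsilon>[OF vZ])
next
  case (Cons h hs)
  then have h: "h \<in> D" and b: "bil A Z Z (\<lambda>a z. Wh hs a z)" by auto
  show ?case unfolding Wh.simps
    by ((rule ZI h bil_arg1[OF b] bil_arg2[OF b] bilD(3)[OF b] | assumption)+)
qed

lemma Wh_tm:
  assumes "set hs \<subseteq> D" "a \<in> carrier A" "z \<in> carrier Z"
  shows "Wh hs a z = tm A E A E (\<lambda>x. x) (wact hs a) z"
proof -
  have "Wh hs a (tp A E b m) = tp A E b (wact hs a m)"
    if "set hs \<subseteq> D" "a \<in> carrier A" "b \<in> carrier A" "m \<in> carrier E" for a b m
    using that
  proof (induct hs arbitrary: a b m)
    case Nil then show ?case by (simp add: tp_linear[OF vA vE])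
  next
    case (Cons h hs)
    then have h: "h \<in> D" and hs: "set hs \<subseteq> D" by auto
    note b = bil_Wh[OF hs] and c = bil_wact[OF hs]
    note J = CI h Cons(3-5) bil_arg1[OF b] bil_arg2[OF b] bilD(3)[OF b] bil_arg1[OF c] bil_arg2[OF c] bilD(3)[OF c]
    have "Wh (h # hs) a (tp A E b m) = sw Z (\<lambda>x y. tp A E b (wact hs y (L h x m))) a"
      unfolding Wh.simps
    proof (rule sw_cong, (rule J | assumption)+)
      fix x y assume xy: "x \<in> carrier A" "y \<in> carrier A"
      show "Wh hs y (Lh h x (tp A E b m)) = tp A E b (wact hs y (L h x m))"
        using Cons(1)[OF hs xy(2) Cons(4), of "L h x m"] Cons(4,5) h xy LT by (simp add: Lh_tp)
    qed
    also have "\<dots> = tp A E b (sw E (\<lambda>x y. wact hs y (L h x m)) a)"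
      by (rule sw_push[symmetric]) ((rule J | assumption)+)
    finally show ?case by simp
  qed
  note e = this
  note w = bilD(1)[OF bil_wact[OF assms(1)] assms(2)]
  have "\<forall>z\<in>carrier Z. Wh hs a z = tm A E A E (\<lambda>x. x) (wact hs a) z"
    by (rule tens_ext)
       ((rule bilD(1)[OF bil_Wh] lin_tm w lin_id vA vE vZ assms | assumption | simp add: e assms tm_tp w lin_id)+)
  with assms show ?thesis by blast
qed

text \<open>The elements of \<open>H\<close> which are created when the action at \<open>h\<close> is moved past the coaction are
  cancelled by those which come from the half-edge following \<open>h\<close> in the cyclic order at the vertex.\<close>

primrec linked :: "nat list \<Rightarrow> nat \<Rightarrow> nat list \<Rightarrow> bool" where
  "linked F p [] \<longleftrightarrow> p \<notin> set F"
| "linked F p (h # hs) \<longleftrightarrow> (\<forall>y\<in>carrier A. \<forall>z\<in>carrier Z. cw_after (flip G h) F y z = cw_before p F y z) \<and> linked F h hs"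

text \<open>By induction the half-edges after h leave a leg before h. The exchange rule turns it
  into a leg after \<open>flip G h\<close>, and \<open>linked\<close> identifies this position with
  the one before p. The leftover thus moves one half-edge back along the vertex in each
  step.\<close>

lemma cw_Wh:
  assumes F: "distinct F" "set F \<subseteq> D" and hs: "set hs \<subseteq> D" and l: "linked F p hs"
    and a: "a \<in> carrier A" and z: "z \<in> carrier Z"
  shows "cw F (Wh hs a z) = sw Z (\<lambda>u v. Wh hs v (cw_before p F u z)) a"
  using hs l a z
proof (induct hs arbitrary: p a z)
  case Nil
  note J = CI F(2) Nil(3,4)
  have "sw Z (\<lambda>u v. \<epsilon> v \<odot>\<^bsub>Z\<^esub> cw_before p F u z) a = cw_before p F a z"
    by (rule counit_r) ((rule J | assumption)+)
  then show ?case using Nil F cw_before_absent[of p F a z] lin_smult[OF lin_cw[OF F(2)]] by simp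
next
  case (Cons h hs)
  then have h: "h \<in> D" and hs: "set hs \<subseteq> D" and lh: "linked F h hs" and a: "a \<in> carrier A" and z: "z \<in> carrier Z"
    and lk: "\<And>y z. y \<in> carrier A \<Longrightarrow> z \<in> carrier Z \<Longrightarrow> cw_after (flip G h) F y z = cw_before p F y z" by auto
  note b = bil_Wh[OF hs]
  note J = CI F(2) h a z bil_arg1[OF b] bil_arg2[OF b] bilD(1)[OF b] bilD(3)[OF b]
  have "cw F (Wh (h # hs) a z) = sw Z (\<lambda>x y. cw F (Wh hs y (Lh h x z))) a"
    unfolding Wh.simps by (rule sw_push) ((rule J | assumption)+)
  also have "\<dots> = sw Z (\<lambda>x y. sw Z (\<lambda>u v. Wh hs v (cw_before h F u (Lh h x z))) y) a"
    by (rule sw_cong, (rule J | assumption)+, rule Cons(1)[OF hs lh]) ((rule J | assumption)+)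
  also have "\<dots> = sw Z (\<lambda>y v. sw Z (\<lambda>x u. Wh hs v (cw_before h F u (Lh h x z))) y) a"
    by (rule coassoc[symmetric]) ((rule J | assumption)+)
  also have "\<dots> = sw Z (\<lambda>y v. sw Z (\<lambda>u x. Wh hs v (Lh h x (cw_before p F u z))) y) a"
  proof (rule sw_cong, (rule J | assumption)+)
    fix y v assume yv: "y \<in> carrier A" "v \<in> carrier A"
    have "sw Z (\<lambda>x u. Wh hs v (cw_before h F u (Lh h x z))) y = Wh hs v (sw Z (\<lambda>x u. cw_before h F u (Lh h x z)) y)"
      by (rule sw_push[symmetric]) ((rule J yv | assumption)+)
    also have "sw Z (\<lambda>x u. cw_before h F u (Lh h x z)) y = sw Z (\<lambda>u x. Lh h x (cw_after (flip G h) F u z)) y"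
      by (rule cw_before_Lh[OF h F yv(1) z])
    also have "\<dots> = sw Z (\<lambda>u x. Lh h x (cw_before p F u z)) y"
      by (rule sw_cong, (rule J yv | assumption)+) (simp add: lk z)
    also have "Wh hs v \<dots> = sw Z (\<lambda>u x. Wh hs v (Lh h x (cw_before p F u z))) y"
      by (rule sw_push) ((rule J yv | assumption)+)
    finally show "sw Z (\<lambda>x u. Wh hs v (cw_before h F u (Lh h x z))) y = \<dots>" .
  qed
  also have "\<dots> = sw Z (\<lambda>u v. sw Z (\<lambda>x y. Wh hs y (Lh h x (cw_before p F u z))) v) a"
    by (rule coassoc) ((rule J | assumption)+)
  finally show ?case by simp
qed

text \<open>The leftover arrives before p, which does not occur in F, and is absorbed by the
  counit.\<close>

lemma wco_wact:
  assumes F: "distinct F" "set F \<subseteq> D" and hs: "set hs \<subseteq> D" and l: "linked F p hs" and p: "p \<notin> set F"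
    and a: "a \<in> carrier A" and w: "w \<in> carrier E"
  shows "wco F (wact hs a w) = tm A E A E (\<lambda>x. x) (wact hs a) (wco F w)"
proof -
  note b = bil_Wh[OF hs]
  let ?z = "tp A E uA w"
  have z: "?z \<in> carrier Z" by ((rule CI w)+)
  have cz: "cw F ?z \<in> carrier Z" by (rule lin_closed[OF lin_cw[OF F(2)] z])
  note J = CI F(2) a z cz bil_arg1[OF b] bil_arg2[OF b] bilD(1)[OF b] bilD(3)[OF b]
  have wc: "wact hs a w \<in> carrier E" by (rule bilD(3)[OF bil_wact[OF hs] a w])
  have "Wh hs a ?z = tp A E uA (wact hs a w)"
    using bilD(1)[OF bil_wact[OF hs] a] w by (simp add: Wh_tm[OF hs a z] tm_tp lin_id)
  then have "wco F (wact hs a w) = cw F (Wh hs a ?z)" using wco_cw[OF F(2) wc] by simp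
  also have "\<dots> = sw Z (\<lambda>u v. Wh hs v (cw_before p F u ?z)) a" by (rule cw_Wh[OF F hs l a z])
  also have "\<dots> = sw Z (\<lambda>u v. \<epsilon> u \<odot>\<^bsub>Z\<^esub> Wh hs v (cw F ?z)) a"
    by (rule sw_cong, (rule J | assumption)+)
       (simp add: cw_before_absent[OF p F(2)] z lin_smult[OF bilD(1)[OF b]] cz)
  also have "\<dots> = Wh hs a (cw F ?z)" by (rule counit_l) ((rule J | assumption)+)
  also have "\<dots> = tm A E A E (\<lambda>x. x) (wact hs a) (wco F w)"
    using wco_cw[OF F(2) w] cz by (simp add: Wh_tm[OF hs a])
  finally show ?thesis .
qed

end

section \<open>Combinatorics of vertex and face words\<close>

section \<open>Commuting cilia\<close>

lemma set_support_orbit: "permutation p \<Longrightarrow> set (Cycles.support p x) = Orbits.orbit p x"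
  by (auto simp only: support_set orbit_altdef_permutation)

lemma orbit_eqI: "permutation p \<Longrightarrow> y \<in> Orbits.orbit p x \<Longrightarrow> Orbits.orbit p y = Orbits.orbit p x"
  using cyclic_on_orbit'[of p x] by (auto simp: cyclic_on_alldef)

lemma support_not_Nil: "permutation p \<Longrightarrow> Cycles.support p x \<noteq> []"
  using least_power_of_permutation(2)[of p x] by simp

text \<open>Consecutive elements of a cycle are adjacent in its list except where the list is cut,
  between its last element and x; the condition \<open>n\<close> excludes this.\<close>

lemma support_adjacent:
  assumes p: "permutation p" and y: "y \<in> set (Cycles.support p x)" and n: "p y \<noteq> x"
  shows "\<exists>F1 F2. Cycles.support p x = F1 @ y # p y # F2"
proof -
  let ?n = "least_power p x"
  obtain i where i: "i < ?n" "y = (p ^^ i) x" using y by auto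
  have "Suc i \<noteq> ?n"
  proof
    assume "Suc i = ?n"
    then have "(p ^^ Suc i) x = x" using least_power_of_permutation(1)[OF p] by metis
    then show False using i n by simp
  qed
  then have si: "Suc i < ?n" using i by simp
  have "[0..<?n] = [0..<i] @ [i..<?n]" using upt_add_eq_append[of 0 i "?n - i"] i by simp
  also have "[i..<?n] = i # Suc i # [Suc (Suc i)..<?n]" using si i by (simp only: upt_conv_Cons)
  finally have "Cycles.support p x = map (\<lambda>i. (p ^^ i) x) [0..<i] @ y # p y # map (\<lambda>i. (p ^^ i) x) [Suc (Suc i)..<?n]"
    unfolding i(2) by (simp only: map_append list.map funpow.simps o_apply)
  then show ?thesis by blast
qed

text \<open>With the predecessor of x put in front, each entry of the list is the image of the one
  before it, including the first. The list also ends with this predecessor, so the walk closes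
  up.\<close>

lemma support_chain:
  assumes p: "permutation p" and i: "i < length (Cycles.support p x)"
  shows "Cycles.support p x ! i = p ((Hilbert_Choice.inv p x # Cycles.support p x) ! i)"
    and "last (Cycles.support p x) = Hilbert_Choice.inv p x"
proof -
  have b: "bij p" by (rule permutation_bijective[OF p])
  show "Cycles.support p x ! i = p ((Hilbert_Choice.inv p x # Cycles.support p x) ! i)"
    using i b by (cases i) (simp_all add: surj_f_inv_f bij_is_surj)
  let ?n = "least_power p x"
  obtain n where n: "?n = Suc n" using least_power_of_permutation(2)[OF p, of x] gr0_implies_Suc by blast
  have "p ((p ^^ n) x) = x" using least_power_of_permutation(1)[OF p, of x] n by simp
  then show "last (Cycles.support p x) = Hilbert_Choice.inv p x"
    using n b by (simp add: last_map bij_is_inj inv_f_eq)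
qed

context kitaev begin

abbreviation "vertex_word \<equiv> Cycles.support (rho G)"
abbreviation "face_word c \<equiv> Cycles.support (face_perm G) (Hilbert_Choice.inv (rho G) c)"
abbreviation "NC \<equiv> cilium_lmc K H M G"

lemma perm_rho: "permutation (rho G)"
  using ribbon(1,3) by (auto simp: permutation_permutes)

lemma face_permutes: "face_perm G permutes D"
  unfolding face_perm_def by (rule permutes_compose[OF ribbon(2) permutes_inv[OF ribbon(3)]])

lemma perm_face: "permutation (face_perm G)"
  using ribbon(1) face_permutes by (auto simp: permutation_permutes)

lemma cilia_D: "c \<in> cilia G \<Longrightarrow> c \<in> D"
  using G by (auto simp: kitaev_graph_def)

lemma base_cilia: "base G \<in> cilia G"
  using G by (auto simp: kitaev_graph_def)

lemma finite_cilia: "finite (cilia G)"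
  using finite_subset[OF _ ribbon(1)] cilia_D by blast

lemma inv_rho_D: "h \<in> D \<Longrightarrow> Hilbert_Choice.inv (rho G) h \<in> D"
  using permutes_in_image[OF permutes_inv[OF ribbon(3)]] by simp

lemma vertex_word_D: "c \<in> cilia G \<Longrightarrow> set (vertex_word c) \<subseteq> D"
  unfolding set_support_orbit[OF perm_rho] by (rule permutes_orbit_subset[OF ribbon(3) cilia_D])

lemma face_word_D: "c \<in> cilia G \<Longrightarrow> set (face_word c) \<subseteq> D"
  unfolding set_support_orbit[OF perm_face] by (rule permutes_orbit_subset[OF face_permutes inv_rho_D[OF cilia_D]])

lemma vertex_word_disjoint:
  assumes c: "c \<in> cilia G" "d \<in> cilia G" "c \<noteq> d"
  shows "set (vertex_word c) \<inter> set (vertex_word d) = {}"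
proof -
  have "inj_on (vertex_of G) (cilia G)" using G by (auto simp: kitaev_graph_def bij_betw_def)
  then have "Orbits.orbit (rho G) c \<noteq> Orbits.orbit (rho G) d"
    using c by (auto simp: inj_on_def vertex_of_def)
  then show ?thesis unfolding set_support_orbit[OF perm_rho] using orbit_eqI[OF perm_rho] by blast
qed

lemma face_word_disjoint:
  assumes c: "c \<in> cilia G" "d \<in> cilia G" "c \<noteq> d"
  shows "set (face_word c) \<inter> set (face_word d) = {}"
proof -
  have "inj_on (\<lambda>c. face_of G (Hilbert_Choice.inv (rho G) c)) (cilia G)"
    using G by (auto simp: kitaev_graph_def bij_betw_def)
  then have "Orbits.orbit (face_perm G) (Hilbert_Choice.inv (rho G) c) \<noteq> Orbits.orbit (face_perm G) (Hilbert_Choice.inv (rho G) d)"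
    using c by (auto simp: inj_on_def face_of_def)
  then show ?thesis unfolding set_support_orbit[OF perm_face] using orbit_eqI[OF perm_face] by blast
qed

text \<open>Along a vertex word the parameter of \<open>linked\<close> is always \<rho>^-1 of the
  next half-edge; this removes the recursion.\<close>

lemma linkedI:
  assumes "\<And>i. i < length hs \<Longrightarrow> hs ! i = rho G ((p # hs) ! i)" and "last (p # hs) \<notin> set F"
    and "\<And>h y z. h \<in> set hs \<Longrightarrow> y \<in> carrier A \<Longrightarrow> z \<in> carrier Z \<Longrightarrow>
      cw_after (flip G h) F y z = cw_before (Hilbert_Choice.inv (rho G) h) F y z"
  shows "linked F p hs"
  using assms
proof (induct hs arbitrary: p)
  case Nil then show ?case by simp
next
  case (Cons h hs)
  have "h = rho G p" using Cons(2)[of 0] by simp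
  then have p: "Hilbert_Choice.inv (rho G) h = p" using permutation_bijective[OF perm_rho] by (simp add: bij_is_inj)
  have "linked F h hs"
  proof (rule Cons(1))
    fix i assume "i < length hs"
    then show "hs ! i = rho G ((h # hs) ! i)" using Cons(2)[of "Suc i"] by simp
  qed (use Cons(3,4) in auto)
  then show ?case using Cons(4)[of h] p by simp
qed

text \<open>In its face \<open>flip G h\<close> is followed by \<rho>^-1(h), so the two positions
  coincide unless the list of the face is cut between them. The list of the face of d starts at
  \<rho>^-1(d), so a cut there would force h = d; but h lies at the vertex of c and d does
  not.\<close>

lemma linked_words:
  assumes c: "c \<in> cilia G" "d \<in> cilia G" "c \<noteq> d"
  shows "linked (face_word d) (Hilbert_Choice.inv (rho G) c) (vertex_word c)"
    and "Hilbert_Choice.inv (rho G) c \<notin> set (face_word d)"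
proof -
  note b = permutation_bijective[OF perm_rho]
  let ?r = "Hilbert_Choice.inv (rho G)"
  have "?r c \<in> set (face_word c)"
    unfolding set_support_orbit[OF perm_face] by (rule permutation_self_in_orbit[OF perm_face])
  then show n: "?r c \<notin> set (face_word d)" using face_word_disjoint[OF c] by blast
  show "linked (face_word d) (?r c) (vertex_word c)"
  proof (rule linkedI)
    show "last (?r c # vertex_word c) \<notin> set (face_word d)"
      using n support_chain(2)[OF perm_rho] support_not_Nil[OF perm_rho, of c] by auto
  next
    fix h y z assume h: "h \<in> set (vertex_word c)" and y: "y \<in> carrier A" and z: "z \<in> carrier Z"
    have hD: "h \<in> D" using h vertex_word_D[OF c(1)] by blast
    have f: "face_perm G (flip G h) = ?r h" by (simp add: face_perm_def ribbon(5)[OF hD])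
    show "cw_after (flip G h) (face_word d) y z = cw_before (?r h) (face_word d) y z"
    proof (cases "flip G h \<in> set (face_word d)")
      case True
      have "?r h \<noteq> ?r d"
      proof
        assume "?r h = ?r d"
        then have "h = d" using b by (metis bij_inv_eq_iff)
        moreover have "d \<in> set (vertex_word d)"
          unfolding set_support_orbit[OF perm_rho] by (rule permutation_self_in_orbit[OF perm_rho])
        ultimately show False using h vertex_word_disjoint[OF c] by blast
      qed
      then obtain F1 F2 where e: "face_word d = F1 @ flip G h # ?r h # F2"
        using support_adjacent[OF perm_face True] unfolding f by blast
      have "distinct (F1 @ flip G h # ?r h # F2)" using cycle_of_permutation[OF perm_face] e by metis
      then show ?thesis unfolding e by (intro cw_before_after) auto
    next
      case False
      \<comment> \<open>\<open>flip G h\<close> and \<open>?r h\<close> lie on one face, so both are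
        absent here and both sides are the counit times the whole word.\<close>
      have "Orbits.orbit (face_perm G) (?r h) = Orbits.orbit (face_perm G) (flip G h)"
        using permutation_orbit_step[OF perm_face, of "flip G h"] f by simp
      then have "?r h \<notin> set (face_word d)"
        using False unfolding set_support_orbit[OF perm_face]
        by (metis orbit_eqI[OF perm_face] permutation_self_in_orbit[OF perm_face])
      with False show ?thesis using face_word_D[OF c(2)] y z by (simp add: cw_after_absent cw_before_absent)
    qed
  qed (rule support_chain(1)[OF perm_rho])
qed

lemma cilium_simps [simp]:
  "lvs (NC c) = E" "lact (NC c) = wact (vertex_word c)" "lcoact (NC c) = wco (face_word c)"
  by (simp_all add: cilium_lmc_def)

end

text \<open>What remains of the graph. All relations are between different cilia, which suffices
  because the distinguished cilium is compared only with the other ones.\<close>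

locale commuting_family = hopf K H for K :: "'k ring" and H :: "('k, 'h) hopf" +
  fixes E :: "('k, 'e) module" and C :: "nat set" and N :: "nat \<Rightarrow> ('k, 'h, 'h, 'e) lmc"
  assumes E: "vsp E" and finite_C: "finite C"
    and bil_N: "c \<in> C \<Longrightarrow> bil A E E (\<lambda>a w. lact (N c) a w)"
    and lin_N: "c \<in> C \<Longrightarrow> lin E (A \<boxtimes> E) (lcoact (N c))"
    and N_one: "c \<in> C \<Longrightarrow> w \<in> carrier E \<Longrightarrow> lact (N c) uA w = w"
    and N_act_act: "c \<in> C \<Longrightarrow> d \<in> C \<Longrightarrow> c \<noteq> d \<Longrightarrow> a \<in> carrier A \<Longrightarrow> b \<in> carrier A \<Longrightarrow> w \<in> carrier E \<Longrightarrow>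
      lact (N c) a (lact (N d) b w) = lact (N d) b (lact (N c) a w)"
    and N_coact_act: "c \<in> C \<Longrightarrow> d \<in> C \<Longrightarrow> c \<noteq> d \<Longrightarrow> a \<in> carrier A \<Longrightarrow> w \<in> carrier E \<Longrightarrow>
      lcoact (N d) (lact (N c) a w) = tm A E A E (\<lambda>x. x) (lact (N c) a) (lcoact (N d) w)"
    and N_coact_coact: "c \<in> C \<Longrightarrow> d \<in> C \<Longrightarrow> c \<noteq> d \<Longrightarrow> w \<in> carrier E \<Longrightarrow>
      cocomm A A E (lcoact (N c)) (lcoact (N d)) w"

lemma (in kitaev) cilia_family: "commuting_family K H E (cilia G) NC"
proof (intro commuting_family.intro commuting_family_axioms.intro)
  fix c d a w assume c: "c \<in> cilia G" "d \<in> cilia G" "c \<noteq> d" and a: "a \<in> carrier A" and w: "w \<in> carrier E"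
  have "wco (face_word d) (wact (vertex_word c) a w) =
    tm A E A E (\<lambda>x. x) (wact (vertex_word c) a) (wco (face_word d) w)"
    by (rule wco_wact[OF cycle_of_permutation[OF perm_face] face_word_D[OF c(2)] vertex_word_D[OF c(1)]
        linked_words[OF c] a w])
  then show "lcoact (NC d) (lact (NC c) a w) = tm A E A E (\<lambda>x. x) (lact (NC c) a) (lcoact (NC d) w)"
    unfolding cilium_simps .
next
  fix c d a b w assume c: "c \<in> cilia G" "d \<in> cilia G" "c \<noteq> d" and a: "a \<in> carrier A" "b \<in> carrier A" and w: "w \<in> carrier E"
  show "lact (NC c) a (lact (NC d) b w) = lact (NC d) b (lact (NC c) a w)"
    unfolding cilium_simps
    by (rule wact_wact[OF vertex_word_D[OF c(1)] vertex_word_D[OF c(2)] vertex_word_disjoint[OF c] w a])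
next
  fix c d w assume c: "c \<in> cilia G" "d \<in> cilia G" "c \<noteq> d" and w: "w \<in> carrier E"
  show "cocomm A A E (lcoact (NC c)) (lcoact (NC d)) w"
    unfolding cilium_simps
    by (rule wco_wco[OF face_word_D[OF c(1)] face_word_D[OF c(2)] face_word_disjoint[OF c] w])
next
  fix c assume c: "c \<in> cilia G"
  show "bil A E E (\<lambda>a w. lact (NC c) a w)" unfolding cilium_simps by (rule bil_wact[OF vertex_word_D[OF c]])
  show "lin E (A \<boxtimes> E) (lcoact (NC c))" unfolding cilium_simps by (rule lin_wco[OF face_word_D[OF c]])
  fix w assume w: "w \<in> carrier E"
  show "lact (NC c) uA w = w" unfolding cilium_simps by (rule wact_one[OF vertex_word_D[OF c] w])
qed (rule vE finite_cilia hopf_axioms)+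

section \<open>Bitensor products and the structures they inherit\<close>

section \<open>Bitensor products\<close>

text \<open>The operators and the coefficients come from arbitrary spaces, since the same facts are
  needed over H, over H \<otimes> H with coefficients in H, and over the tensor product of the
  algebras at several cilia.\<close>

locale bitensor = base_field K for K :: "'k ring" +
  fixes R :: "('k, 'a) module" and C :: "('k, 'c) module"
    and X :: "('k, 'a, 'c, 'x) rmc" and N :: "('k, 'a, 'c, 'n) lmc"
  assumes vX: "vsp (rvs X)" and vN: "vsp (lvs N)" and vC: "vsp C"
    and lin_rcoact: "lin (rvs X) (rvs X \<boxtimes> C) (rcoact X)"
    and lin_lcoact: "lin (lvs N) (C \<boxtimes> lvs N) (lcoact N)"
    and ract_closed: "x \<in> carrier (rvs X) \<Longrightarrow> a \<in> carrier R \<Longrightarrow> ract X x a \<in> carrier (rvs X)"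
    and lact_closed: "n \<in> carrier (lvs N) \<Longrightarrow> a \<in> carrier R \<Longrightarrow> lact N a n \<in> carrier (lvs N)"
begin

abbreviation "V \<equiv> rvs X"
abbreviation "U \<equiv> lvs N"
abbreviation "T \<equiv> V \<boxtimes> U"
abbreviation "CU \<equiv> C \<boxtimes> U"
abbreviation "W \<equiv> V \<boxtimes> CU"
abbreviation "rel \<equiv> balanced_rel K R X N"
abbreviation "Q \<equiv> tensor_over K R X N"
abbreviation "\<pi> \<equiv> proj_over K R X N"
abbreviation "B \<equiv> Bit K R C X N"
abbreviation "cot \<equiv> cotensor K C X N"

lemmas BI = lin_intros vX vN vC lin_comp[OF lin_rcoact] lin_comp[OF lin_lcoact]
  lin_closed[OF lin_rcoact] lin_closed[OF lin_lcoact] lin_rcoact lin_lcoact ract_closed lact_closed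

lemma vT: "vsp T" and vW: "vsp W"
  by ((rule BI)+)

definition "gens = {tp V U (ract X x a) n \<ominus>\<^bsub>T\<^esub> tp V U x (lact N a n) | x a n.
    x \<in> carrier V \<and> a \<in> carrier R \<and> n \<in> carrier U}"

lemma rel_span: "rel = LinearCombinations.module.span K T gens"
  by (simp add: balanced_rel_def gens_def Let_def)

lemma gens_closed: "gens \<subseteq> carrier T"
  using vs_closed(3)[OF vT] tp_closed[OF vX vN] ract_closed lact_closed unfolding gens_def by blast

lemma rel_sub: "submodule K rel T"
  unfolding rel_span by (rule submodule_span[OF vT gens_closed])

lemma \<pi>_coset: "\<pi> z = rel +>\<^bsub>T\<^esub> z"
  by (simp add: proj_over_def)

lemma vQ: "vsp Q" and lin_\<pi>: "lin T Q \<pi>"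
  unfolding tensor_over_def proj_over_def
  by (rule vs_quot[OF vT rel_sub], rule lin_quot[OF vT rel_sub])

lemma \<pi>_closed: "z \<in> carrier T \<Longrightarrow> \<pi> z \<in> carrier Q"
  by (rule lin_closed[OF lin_\<pi>])

definition "balanced Y f \<longleftrightarrow> (\<forall>x\<in>carrier V. \<forall>a\<in>carrier R. \<forall>n\<in>carrier U.
    f (tp V U (ract X x a) n) = f (tp V U x (lact N a n)))"

lemma balanced_rel:
  assumes Y: "vsp Y" and f: "lin T Y f" and b: "balanced Y f" and u: "u \<in> rel"
  shows "f u = \<zero>\<^bsub>Y\<^esub>"
proof (rule span_kernel[OF vT Y f gens_closed])
  fix g assume "g \<in> gens"
  then obtain x a n where g: "g = tp V U (ract X x a) n \<ominus>\<^bsub>T\<^esub> tp V U x (lact N a n)"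
    and m: "x \<in> carrier V" "a \<in> carrier R" "n \<in> carrier U" unfolding gens_def by blast
  have c: "tp V U (ract X x a) n \<in> carrier T" "tp V U x (lact N a n) \<in> carrier T" by ((rule BI m)+)
  show "f g = \<zero>\<^bsub>Y\<^esub>"
    unfolding g lin_minus[OF vT Y f c] using b m vs_minus_zero_iff[OF Y lin_closed[OF f c(1)] lin_closed[OF f c(2)]]
    by (simp add: balanced_def)
qed (use u in \<open>simp add: rel_span\<close>)

lemma \<pi>_balanced: "balanced Q \<pi>"
proof -
  have "tp V U (ract X x a) n \<ominus>\<^bsub>T\<^esub> tp V U x (lact N a n) \<in> rel"
    if "x \<in> carrier V" "a \<in> carrier R" "n \<in> carrier U" for x a n
    unfolding rel_span by (rule span_base[OF vT gens_closed]) (use that in \<open>auto simp: gens_def\<close>)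
  then show ?thesis
    unfolding balanced_def \<pi>_coset by (intro ballI coset_eqI[OF rel_sub] tp_closed vX vN ract_closed lact_closed)
qed

lemma the_elem_\<pi>:
  assumes "vsp Y" "lin T Y f" "balanced Y f" "z \<in> carrier T"
  shows "the_elem (f ` \<pi> z) = f z"
  unfolding \<pi>_coset using balanced_rel[OF assms(1-3)] by (rule the_elem_coset[OF vT assms(1) rel_sub assms(2) _ assms(4)])

lemma lin_from_Q:
  assumes "vsp Y" "lin T Y f" "\<And>z. z \<in> carrier T \<Longrightarrow> F (\<pi> z) = f z"
  shows "lin Q Y F"
  unfolding tensor_over_def by (rule lin_quotI[OF vT rel_sub assms(1,2)]) (use assms(3) in \<open>simp add: \<pi>_coset\<close>)

abbreviation "\<theta>1 z \<equiv> assoc K V C U (tm V U (V \<boxtimes> C) U (rcoact X) id z)"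
abbreviation "\<theta>2 z \<equiv> tm V U V CU id (lcoact N) z"

lemma lin_\<theta>: "lin T W (\<lambda>z. \<theta>1 z)" "lin T W (\<lambda>z. \<theta>2 z)"
  by ((rule BI)+)

lemma \<theta>_tp:
  assumes x: "x \<in> carrier V" and n: "n \<in> carrier U"
  shows "\<theta>1 (tp V U x n) = tlf V C W (\<lambda>x c. tp V CU x (tp C U c n)) (rcoact X x)"
    and "\<theta>2 (tp V U x n) = tp V CU x (lcoact N n)"
proof -
  have "tm V U (V \<boxtimes> C) U (rcoact X) id (tp V U x n) = tp (V \<boxtimes> C) U (rcoact X x) (id n)"
    by (rule tm_tp) ((rule BI x n)+)
  then show "\<theta>1 (tp V U x n) = tlf V C W (\<lambda>x c. tp V CU x (tp C U c n)) (rcoact X x)"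
    using assoc_tp'[OF vX vC vN lin_closed[OF lin_rcoact x] n] by simp
  have "\<theta>2 (tp V U x n) = tp V CU (id x) (lcoact N n)" by (rule tm_tp) ((rule BI x n)+)
  then show "\<theta>2 (tp V U x n) = tp V CU x (lcoact N n)" by simp
qed

lemma cot_iff: "z \<in> cot \<longleftrightarrow> z \<in> carrier T \<and> \<theta>1 z = \<theta>2 z"
  by (simp add: cotensor_def)

text \<open>Presents the cotensor product as the kernel of one linear map, the form in which
  \<open>tensor_kernel\<close> can be applied.\<close>

definition "\<theta> z = \<theta>1 z \<ominus>\<^bsub>W\<^esub> \<theta>2 z"

lemma lin_\<theta>d: "lin T W (\<lambda>z. \<theta> z)"
  unfolding \<theta>_def by (rule lin_diff[OF vT vW lin_\<theta>])

lemma cot_kernel: "cot = {z \<in> carrier T. \<theta> z = \<zero>\<^bsub>W\<^esub>}"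
proof (rule Set.set_eqI)
  fix z
  have "\<theta> z = \<zero>\<^bsub>W\<^esub> \<longleftrightarrow> \<theta>1 z = \<theta>2 z" if "z \<in> carrier T"
    unfolding \<theta>_def by (rule vs_minus_zero_iff[OF vW lin_closed[OF lin_\<theta>(1)] lin_closed[OF lin_\<theta>(2)]]) (rule that)+
  then show "z \<in> cot \<longleftrightarrow> z \<in> {z \<in> carrier T. \<theta> z = \<zero>\<^bsub>W\<^esub>}" by (simp add: cot_iff cong: conj_cong)
qed

lemma cot_sub: "submodule K cot T"
  unfolding cot_kernel by (rule submodule_kernel[OF vT vW lin_\<theta>d])

lemma cot_closed: "z \<in> cot \<Longrightarrow> z \<in> carrier T"
  by (simp add: cot_iff)

lemma Bit_sub: "submodule K (\<pi> ` cot) Q"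
  by (rule submodule_image[OF vT vQ lin_\<pi> cot_sub])

lemma carrier_Bit: "carrier B = \<pi> ` cot"
  by (simp add: Bit_def)

lemma vB: "vsp B" and lin_incl: "lin B Q (\<lambda>p. p)"
  unfolding Bit_def by (rule vs_sub[OF vQ Bit_sub], rule lin_sub[OF vQ Bit_sub])

lemma lin_from_B: "lin Q Y F \<Longrightarrow> lin B Y (\<lambda>p. F p)"
  by (rule lin_comp[OF _ lin_incl])

lemma Bit_ops: "x \<oplus>\<^bsub>B\<^esub> y = x \<oplus>\<^bsub>Q\<^esub> y" "r \<odot>\<^bsub>B\<^esub> x = r \<odot>\<^bsub>Q\<^esub> x"
  by (simp_all add: Bit_def)

lemma lin_to_B: "lin Y Q F \<Longrightarrow> (\<And>y. y \<in> carrier Y \<Longrightarrow> F y \<in> carrier B) \<Longrightarrow> lin Y B F"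
  by (auto simp: lin_def Bit_ops)

end

locale bit_inherit = bitensor K R C X N + hopf K H
  for K :: "'k ring" and R :: "('k, 'a) module" and C :: "('k, 'c) module"
    and X :: "('k, 'a, 'c, 'x) rmc" and N :: "('k, 'a, 'c, 'n) lmc" and H :: "('k, 'h) hopf" +
  fixes N0 :: "('k, 'h, 'h, 'n) lmc"
  assumes bil_N0: "bil A U U (\<lambda>a n. lact N0 a n)" and lin_N0: "lin U (A \<boxtimes> U) (lcoact N0)"
    and N0_one: "n \<in> carrier U \<Longrightarrow> lact N0 uA n = n"
    and lin_lact: "a \<in> carrier R \<Longrightarrow> lin U U (lact N a)"
    and act_act: "h \<in> carrier A \<Longrightarrow> a \<in> carrier R \<Longrightarrow> n \<in> carrier U \<Longrightarrow>
      lact N0 h (lact N a n) = lact N a (lact N0 h n)"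
    and coact_act0: "h \<in> carrier A \<Longrightarrow> n \<in> carrier U \<Longrightarrow>
      lcoact N (lact N0 h n) = tm C U C U (\<lambda>x. x) (lact N0 h) (lcoact N n)"
    and coact0_act: "a \<in> carrier R \<Longrightarrow> n \<in> carrier U \<Longrightarrow>
      lcoact N0 (lact N a n) = tm A U A U (\<lambda>x. x) (lact N a) (lcoact N0 n)"
    and coact_coact: "n \<in> carrier U \<Longrightarrow> cocomm A C U (lcoact N0) (lcoact N) n"
begin

lemmas II = BI bil_arg1[OF bil_N0] bil_arg2[OF bil_N0] bilD(1)[OF bil_N0] bilD(3)[OF bil_N0]
  lin_comp[OF lin_N0] lin_closed[OF lin_N0] lin_N0 lin_lact lin_closed[OF lin_lact] vT vW vA

definition "actT h z = tm V U V U id (lact N0 h) z"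
definition "coT = tlf V U (A \<boxtimes> T) (\<lambda>x n. tlf A U (A \<boxtimes> T) (\<lambda>h n'. tp A T h (tp V U x n')) (lcoact N0 n))"
abbreviation "BH \<equiv> Bit_inherit K H R C X N N0"

lemma BH_simps:
  "lvs BH = B" "lact BH h p = the_elem ((\<lambda>z. \<pi> (actT h z)) ` p)"
  "lcoact BH p = the_inv_into (carrier (A \<boxtimes> B)) (tm A B A Q id id)
     (the_elem ((\<lambda>z. tm A T A Q id \<pi> (coT z)) ` p))"
  by (simp_all add: Bit_inherit_def Let_def coT_def actT_def)

lemma bil_actT: "bil A T T (\<lambda>h z. actT h z)"
proof (rule bilI)
  fix h assume h: "h \<in> carrier A"
  show "lin T T (\<lambda>z. actT h z)" unfolding actT_def by ((rule II h)+)
next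
  fix z assume z: "z \<in> carrier T"
  show "lin A T (\<lambda>h. actT h z)" unfolding actT_def tensor_map_def id_apply by ((rule II z | assumption)+)
qed

lemma actT_tp: "h \<in> carrier A \<Longrightarrow> x \<in> carrier V \<Longrightarrow> n \<in> carrier U \<Longrightarrow> actT h (tp V U x n) = tp V U x (lact N0 h n)"
  using tm_tp[OF vX vN vX vN lin_id' bilD(1)[OF bil_N0], of h x n] by (simp add: actT_def)

lemma lin_coT: "lin T (A \<boxtimes> T) (\<lambda>z. coT z)"
  unfolding coT_def by ((rule II | assumption)+)

lemma coT_tp: "x \<in> carrier V \<Longrightarrow> n \<in> carrier U \<Longrightarrow>
    coT (tp V U x n) = tlf A U (A \<boxtimes> T) (\<lambda>h n'. tp A T h (tp V U x n')) (lcoact N0 n)"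
  unfolding coT_def by (rule tl_tp) ((rule II | assumption)+)

lemma balanced_actT: "h \<in> carrier A \<Longrightarrow> balanced Q (\<lambda>z. \<pi> (actT h z))"
  using \<pi>_balanced unfolding balanced_def by (simp add: actT_tp act_act ract_closed lact_closed bilD(3)[OF bil_N0])

lemma balanced_coT: "balanced (A \<boxtimes> Q) (\<lambda>z. tm A T A Q id \<pi> (coT z))"
  unfolding balanced_def
proof (intro ballI)
  fix x a n assume m: "x \<in> carrier V" "a \<in> carrier R" "n \<in> carrier U"
  note J = II vQ lin_\<pi> m lin_comp[OF lin_\<pi>] lin_closed[OF lin_\<pi>] lin_comp[OF lin_lact[OF m(2)]]
  have e: "tm A T A Q id \<pi> (coT (tp V U x n)) = tlf A U (A \<boxtimes> Q) (\<lambda>h n'. tp A Q h (\<pi> (tp V U x n'))) (lcoact N0 n)"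
    if x: "x \<in> carrier V" and n: "n \<in> carrier U" for x n
  proof -
    have "tm A T A Q id \<pi> (coT (tp V U x n)) =
      tlf A U (A \<boxtimes> Q) (\<lambda>h n'. tm A T A Q id \<pi> (tp A T h (tp V U x n'))) (lcoact N0 n)"
      unfolding coT_tp[OF x n] by (rule tl_push) ((rule J x n | assumption)+)
    also have "\<dots> = tlf A U (A \<boxtimes> Q) (\<lambda>h n'. tp A Q h (\<pi> (tp V U x n'))) (lcoact N0 n)"
    proof (rule tl_cong, (rule J x n | assumption)+)
      fix h n' assume h: "h \<in> carrier A" "n' \<in> carrier U"
      have "tm A T A Q id \<pi> (tp A T h (tp V U x n')) = tp A Q (id h) (\<pi> (tp V U x n'))"
        by (rule tm_tp) ((rule J x h)+)
      then show "tm A T A Q id \<pi> (tp A T h (tp V U x n')) = tp A Q h (\<pi> (tp V U x n'))" by simp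
    qed
    finally show ?thesis .
  qed
  have "tm A T A Q id \<pi> (coT (tp V U x (lact N a n))) =
    tlf A U (A \<boxtimes> Q) (\<lambda>h n'. tp A Q h (\<pi> (tp V U x n'))) (tm A U A U (\<lambda>x. x) (lact N a) (lcoact N0 n))"
    by (simp add: e m lact_closed coact0_act)
  also have "\<dots> = tlf A U (A \<boxtimes> Q) (\<lambda>h n'. tp A Q h (\<pi> (tp V U x (lact N a n')))) (lcoact N0 n)"
    by (rule tl_tm) ((rule J | assumption)+)
  also have "\<dots> = tlf A U (A \<boxtimes> Q) (\<lambda>h n'. tp A Q h (\<pi> (tp V U (ract X x a) n'))) (lcoact N0 n)"
    by (rule tl_cong, (rule J | assumption)+) (use \<pi>_balanced m in \<open>simp add: balanced_def\<close>)
  also have "\<dots> = tm A T A Q id \<pi> (coT (tp V U (ract X x a) n))"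
    by (rule e[symmetric]) ((rule J)+)
  finally show "tm A T A Q id \<pi> (coT (tp V U (ract X x a) n)) = tm A T A Q id \<pi> (coT (tp V U x (lact N a n)))" ..
qed

text \<open>Both maps that define the cotensor product intertwine the action of h with its action on
  the last factor of V \<otimes> (C \<otimes> U); for the second map this is
  \<open>coact_act0\<close>.\<close>

lemma actT_cot: "h \<in> carrier A \<Longrightarrow> z \<in> cot \<Longrightarrow> actT h z \<in> cot"
proof -
  assume h: "h \<in> carrier A" and z: "z \<in> cot"
  let ?\<Phi> = "\<lambda>w. tm V CU V CU id (tm C U C U (\<lambda>x. x) (lact N0 h)) w"
  note J = II h lin_comp[OF bilD(1)[OF bil_actT h]]
  have lt: "lin CU CU (tm C U C U (\<lambda>x. x) (lact N0 h))"
    using lin_tm[OF vC vN vC vN lin_id bilD(1)[OF bil_N0 h] lin_id] .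
  have t: "?\<Phi> (tp V CU x w) = tp V CU x (tm C U C U (\<lambda>x. x) (lact N0 h) w)" if "x \<in> carrier V" "w \<in> carrier CU" for x w
    using tm_tp[OF vX _ vX _ lin_id' lt that] vC vN by (simp add: vsp_tensor)
  have l\<Phi>: "lin W W ?\<Phi>" by ((rule J lt)+)
  have 1: "\<forall>z\<in>carrier T. \<theta>1 (actT h z) = ?\<Phi> (\<theta>1 z)"
  proof (rule tens_ext)
    fix x n assume m: "x \<in> carrier V" "n \<in> carrier U"
    have "?\<Phi> (\<theta>1 (tp V U x n)) = tlf V C W (\<lambda>x c. ?\<Phi> (tp V CU x (tp C U c n))) (rcoact X x)"
      unfolding \<theta>_tp[OF m] by (rule tl_push) ((rule J m l\<Phi> | assumption)+)
    also have "\<dots> = tlf V C W (\<lambda>x c. tp V CU x (tp C U c (lact N0 h n))) (rcoact X x)"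
    proof (rule tl_cong, (rule J m lt l\<Phi> | assumption)+)
      fix x c assume xc: "x \<in> carrier V" "c \<in> carrier C"
      have "tm C U C U (\<lambda>x. x) (lact N0 h) (tp C U c n) = tp C U c (lact N0 h n)"
        by (rule tm_tp) ((rule J m xc)+)
      then show "?\<Phi> (tp V CU x (tp C U c n)) = tp V CU x (tp C U c (lact N0 h n))"
        using t[OF xc(1)] tp_closed[OF vC vN xc(2) m(2)] by simp
    qed
    also have "\<dots> = \<theta>1 (actT h (tp V U x n))"
      using \<theta>_tp(1)[OF m(1) bilD(3)[OF bil_N0 h m(2)]] by (simp add: actT_tp h m)
    finally show "\<theta>1 (actT h (tp V U x n)) = ?\<Phi> (\<theta>1 (tp V U x n))" ..
  qed ((rule J lin_comp[OF l\<Phi>] lt lin_\<theta>)+)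
  have 2: "\<forall>z\<in>carrier T. \<theta>2 (actT h z) = ?\<Phi> (\<theta>2 z)"
  proof (rule tens_ext)
    fix x n assume m: "x \<in> carrier V" "n \<in> carrier U"
    show "\<theta>2 (actT h (tp V U x n)) = ?\<Phi> (\<theta>2 (tp V U x n))"
      using t[OF m(1) lin_closed[OF lin_lcoact m(2)]]
      by (simp add: actT_tp h m \<theta>_tp(2) bilD(3)[OF bil_N0] coact_act0)
  qed ((rule J lin_comp[OF l\<Phi>] lt lin_\<theta>)+)
  show ?thesis using 1 2 z bilD(3)[OF bil_actT h] unfolding cot_iff by simp
qed

text \<open>\<open>?K\<close> is the coaction on the last factor of V \<otimes> (C \<otimes> U),
  with the new coefficient moved to the front. Both maps that define the cotensor product intertwine
  \<open>coT\<close> with \<open>?K\<close>, the second because the two coactions on U commute, so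
  they agree on \<open>coT z\<close> if they agree on z.\<close>

lemma coT_\<theta>:
  assumes z: "z \<in> cot"
  shows "tm A T A W (\<lambda>x. x) (\<lambda>z. \<theta> z) (coT z) = \<zero>\<^bsub>A \<boxtimes> W\<^esub>"
proof -
  let ?Y = "A \<boxtimes> W"
  let ?\<phi> = "\<lambda>x c h n. tp A W h (tp V CU x (tp C U c n))"
  let ?K = "\<lambda>w. tlf V CU ?Y (\<lambda>x t. tlf C U ?Y (\<lambda>c n. tlf A U ?Y (\<lambda>h n'. ?\<phi> x c h n') (lcoact N0 n)) t) w"
  note J = II lin_comp[OF lin_coT]
  have bK: "bil V CU ?Y (\<lambda>x t. tlf C U ?Y (\<lambda>c n. tlf A U ?Y (\<lambda>h n'. ?\<phi> x c h n') (lcoact N0 n)) t)"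
    by ((rule J | assumption)+)
  have lK: "lin W ?Y ?K" by ((rule J bK)+)
  have K: "?K (tp V CU x t) = tlf C U ?Y (\<lambda>c n. tlf A U ?Y (\<lambda>h n'. ?\<phi> x c h n') (lcoact N0 n)) t"
    if "x \<in> carrier V" "t \<in> carrier CU" for x t
    by (rule tl_tp) ((rule J bK that)+)
  have p: "tm A T A W (\<lambda>x. x) f (coT (tp V U x n)) = tlf A U ?Y (\<lambda>h n'. tp A W h (f (tp V U x n'))) (lcoact N0 n)"
    if f: "lin T W f" and m: "x \<in> carrier V" "n \<in> carrier U" for f x n
  proof -
    note J = J f lin_comp[OF f] lin_closed[OF f] m
    have "tm A T A W (\<lambda>x. x) f (coT (tp V U x n)) =
      tlf A U ?Y (\<lambda>h n'. tm A T A W (\<lambda>x. x) f (tp A T h (tp V U x n'))) (lcoact N0 n)"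
      unfolding coT_tp[OF m] by (rule tl_push) ((rule J | assumption)+)
    also have "\<dots> = tlf A U ?Y (\<lambda>h n'. tp A W h (f (tp V U x n'))) (lcoact N0 n)"
      by (rule tl_cong, (rule J | assumption)+, rule tm_tp) ((rule J | assumption)+)
    finally show ?thesis .
  qed
  have 1: "\<forall>z\<in>carrier T. tm A T A W (\<lambda>x. x) (\<lambda>z. \<theta>1 z) (coT z) = ?K (\<theta>1 z)"
  proof (rule tens_ext)
    fix x n assume m: "x \<in> carrier V" "n \<in> carrier U"
    have "tm A T A W (\<lambda>x. x) (\<lambda>z. \<theta>1 z) (coT (tp V U x n)) =
      tlf A U ?Y (\<lambda>h n'. tp A W h (\<theta>1 (tp V U x n'))) (lcoact N0 n)"
      by (rule p[OF lin_\<theta>(1) m])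
    also have "\<dots> = tlf A U ?Y (\<lambda>h n'. tlf V C ?Y (\<lambda>x c. ?\<phi> x c h n') (rcoact X x)) (lcoact N0 n)"
    proof (rule tl_cong, (rule J m lin_comp[OF lin_\<theta>(1)] lin_closed[OF lin_\<theta>(1)] | assumption)+)
      fix h n' assume h: "h \<in> carrier A" "n' \<in> carrier U"
      show "tp A W h (\<theta>1 (tp V U x n')) = tlf V C ?Y (\<lambda>x c. ?\<phi> x c h n') (rcoact X x)"
        unfolding \<theta>_tp(1)[OF m(1) h(2)] by (rule tl_push) ((rule J m h | assumption)+)
    qed
    also have "\<dots> = tlf V C ?Y (\<lambda>x c. tlf A U ?Y (\<lambda>h n'. ?\<phi> x c h n') (lcoact N0 n)) (rcoact X x)"
      by (rule tl_swap) ((rule J m | assumption)+)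
    also have "\<dots> = tlf V C ?Y (\<lambda>x c. ?K (tp V CU x (tp C U c n))) (rcoact X x)"
    proof (rule tl_cong, (rule J m | assumption)+)
      fix x c assume xc: "x \<in> carrier V" "c \<in> carrier C"
      have "?K (tp V CU x (tp C U c n)) = tlf C U ?Y (\<lambda>c n. tlf A U ?Y (\<lambda>h n'. ?\<phi> x c h n') (lcoact N0 n)) (tp C U c n)"
        by (rule K) ((rule J m xc)+)
      also have "\<dots> = tlf A U ?Y (\<lambda>h n'. ?\<phi> x c h n') (lcoact N0 n)"
        by (rule tl_tp) ((rule J m xc | assumption)+)
      finally show "tlf A U ?Y (\<lambda>h n'. ?\<phi> x c h n') (lcoact N0 n) = ?K (tp V CU x (tp C U c n))" ..
    qed
    also have "\<dots> = ?K (\<theta>1 (tp V U x n))"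
      unfolding \<theta>_tp(1)[OF m] by (rule tl_push[symmetric]) ((rule J m lK bK | assumption)+)
    finally show "tm A T A W (\<lambda>x. x) (\<lambda>z. \<theta>1 z) (coT (tp V U x n)) = ?K (\<theta>1 (tp V U x n))" .
  qed ((rule J lin_coT lin_\<theta> lin_comp[OF lK])+)
  have 2: "\<forall>z\<in>carrier T. tm A T A W (\<lambda>x. x) (\<lambda>z. \<theta>2 z) (coT z) = ?K (\<theta>2 z)"
  proof (rule tens_ext)
    fix x n assume m: "x \<in> carrier V" "n \<in> carrier U"
    have "tm A T A W (\<lambda>x. x) (\<lambda>z. \<theta>2 z) (coT (tp V U x n)) =
      tlf A U ?Y (\<lambda>h n'. tp A W h (\<theta>2 (tp V U x n'))) (lcoact N0 n)"
      by (rule p[OF lin_\<theta>(2) m])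
    also have "\<dots> = tlf A U ?Y (\<lambda>h n'. tlf C U ?Y (\<lambda>c n'. ?\<phi> x c h n') (lcoact N n')) (lcoact N0 n)"
    proof (rule tl_cong, (rule J m lin_comp[OF lin_\<theta>(2)] lin_closed[OF lin_\<theta>(2)] | assumption)+)
      fix h n' assume h: "h \<in> carrier A" "n' \<in> carrier U"
      have "tp A W h (tp V CU x (lcoact N n')) = tp A W h (tp V CU x (tlf C U CU (\<lambda>c n. tp C U c n) (lcoact N n')))"
        using tl_id[OF vC vN lin_closed[OF lin_lcoact h(2)]] by simp
      also have "\<dots> = tlf C U ?Y (\<lambda>c n. ?\<phi> x c h n) (lcoact N n')"
        by (rule tl_push) ((rule J m h | assumption)+)
      finally show "tp A W h (\<theta>2 (tp V U x n')) = tlf C U ?Y (\<lambda>c n'. ?\<phi> x c h n') (lcoact N n')"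
        unfolding \<theta>_tp(2)[OF m(1) h(2)] .
    qed
    also have "\<dots> = tlf C U ?Y (\<lambda>c n. tlf A U ?Y (\<lambda>h n'. ?\<phi> x c h n') (lcoact N0 n)) (lcoact N n)"
      by (rule cocomm_lift[OF vA vC vN _ lin_N0 lin_lcoact m(2) coact_coact[OF m(2)]]) ((rule J m | assumption)+)
    also have "\<dots> = ?K (\<theta>2 (tp V U x n))"
      unfolding \<theta>_tp(2)[OF m] by (rule K[symmetric]) ((rule J m)+)
    finally show "tm A T A W (\<lambda>x. x) (\<lambda>z. \<theta>2 z) (coT (tp V U x n)) = ?K (\<theta>2 (tp V U x n))" .
  qed ((rule J lin_coT lin_\<theta> lin_comp[OF lK])+)
  have zT: "z \<in> carrier T" using z cot_closed by blast
  have c: "coT z \<in> carrier (A \<boxtimes> T)" by (rule lin_closed[OF lin_coT zT])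
  have d: "\<forall>t\<in>carrier (A \<boxtimes> T). tm A T A W (\<lambda>x. x) (\<lambda>z. \<theta> z) t =
    tm A T A W (\<lambda>x. x) (\<lambda>z. \<theta>1 z) t \<ominus>\<^bsub>?Y\<^esub> tm A T A W (\<lambda>x. x) (\<lambda>z. \<theta>2 z) t"
  proof (rule tens_ext)
    fix a t assume m: "a \<in> carrier A" "t \<in> carrier T"
    have "tp A W a (\<theta>1 t \<ominus>\<^bsub>W\<^esub> \<theta>2 t) = tp A W a (\<theta>1 t) \<ominus>\<^bsub>?Y\<^esub> tp A W a (\<theta>2 t)"
      by (rule lin_minus[of W]) ((rule J m lin_closed[OF lin_\<theta>(1)] lin_closed[OF lin_\<theta>(2)])+)
    then show "tm A T A W (\<lambda>x. x) (\<lambda>z. \<theta> z) (tp A T a t) =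
      tm A T A W (\<lambda>x. x) (\<lambda>z. \<theta>1 z) (tp A T a t) \<ominus>\<^bsub>?Y\<^esub> tm A T A W (\<lambda>x. x) (\<lambda>z. \<theta>2 z) (tp A T a t)"
      using tm_tp[OF vA vT vA vW lin_id lin_\<theta>(1) m] tm_tp[OF vA vT vA vW lin_id lin_\<theta>(2) m]
        tm_tp[OF vA vT vA vW lin_id lin_\<theta>d m] by (simp only: \<theta>_def)
  qed ((rule J lin_diff lin_\<theta> lin_\<theta>d)+)
  have e: "tm A T A W (\<lambda>x. x) (\<lambda>z. \<theta>1 z) (coT z) = tm A T A W (\<lambda>x. x) (\<lambda>z. \<theta>2 z) (coT z)"
    using 1 2 zT z by (simp add: cot_iff)
  have cl: "tm A T A W (\<lambda>x. x) (\<lambda>z. \<theta>2 z) (coT z) \<in> carrier ?Y" by ((rule J c lin_\<theta>)+)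
  have vY: "vsp ?Y" by ((rule J)+)
  show ?thesis using bspec[OF d c] e vs_minus_zero_iff[OF vY cl cl] by simp
qed

lemma lact_BH: "h \<in> carrier A \<Longrightarrow> z \<in> carrier T \<Longrightarrow> lact BH h (\<pi> z) = \<pi> (actT h z)"
  unfolding BH_simps(2)
  by (rule the_elem_\<pi>[OF vQ _ balanced_actT]) ((rule lin_comp[OF lin_\<pi>] bilD(1)[OF bil_actT] | assumption)+)

lemma bil_BH: "bil A B B (\<lambda>h p. lact BH h p)"
proof -
  have c: "lact BH h p \<in> carrier B" if "h \<in> carrier A" "p \<in> carrier B" for h p
  proof -
    obtain z where z: "p = \<pi> z" "z \<in> cot" using \<open>p \<in> carrier B\<close> unfolding carrier_Bit by blast
    then show ?thesis using lact_BH[OF that(1) cot_closed[OF z(2)]] actT_cot[OF that(1) z(2)]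
      unfolding carrier_Bit by simp
  qed
  show ?thesis
  proof (rule bilI)
    fix h assume h: "h \<in> carrier A"
    have "lin Q Q (\<lambda>p. lact BH h p)"
      by (rule lin_from_Q[OF vQ lin_comp[OF lin_\<pi> bilD(1)[OF bil_actT h]]]) (rule lact_BH[OF h])
    then show "lin B B (\<lambda>p. lact BH h p)" by (rule lin_to_B[OF lin_from_B]) (rule c[OF h])
  next
    fix p assume p: "p \<in> carrier B"
    then obtain z where z: "p = \<pi> z" "z \<in> cot" unfolding carrier_Bit by blast
    have "lin A Q (\<lambda>h. lact BH h p)"
      by (rule lin_cong[OF vA lin_comp[OF lin_\<pi> bilD(2)[OF bil_actT cot_closed[OF z(2)]]]])
         (simp add: z(1) lact_BH cot_closed[OF z(2)])
    then show "lin A B (\<lambda>h. lact BH h p)" by (rule lin_to_B) (rule c[OF _ p])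
  qed
qed

lemma BH_one: "p \<in> carrier B \<Longrightarrow> lact BH uA p = p"
proof -
  assume "p \<in> carrier B"
  then obtain z where z: "p = \<pi> z" "z \<in> cot" unfolding carrier_Bit by blast
  have "actT uA z = z" unfolding actT_def
    by (rule tm_id[OF vX vN cot_closed[OF z(2)]]) (simp_all add: N0_one)
  then show ?thesis using lact_BH[OF uA_closed cot_closed[OF z(2)]] z(1) by simp
qed

text \<open>The coaction is defined by inverting \<open>?j\<close>, which is injective by
  \<open>tm_inj\<close>. That all values to be inverted are in its range follows from
  \<open>coT_\<theta>\<close> and \<open>tensor_kernel\<close>: \<open>coT z\<close> comes from H
  tensored with the cotensor product.\<close>

lemma lin_BH: "lin B (A \<boxtimes> B) (lcoact BH)"
proof -
  let ?j = "tm A B A Q id id" and ?g = "\<lambda>z. tm A T A Q id \<pi> (coT z)"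
  let ?\<rho> = "\<lambda>p. the_elem (?g ` p)"
  have vAB: "vsp (A \<boxtimes> B)" and vAQ: "vsp (A \<boxtimes> Q)" by (rule vsp_tensor[OF vA vB], rule vsp_tensor[OF vA vQ])
  have ii: "lin B Q id" using lin_incl by (simp add: id_def)
  have lj: "lin (A \<boxtimes> B) (A \<boxtimes> Q) ?j" using lin_tm[OF vA vB vA vQ lin_id' ii lin_id] .
  have ij: "inj_on ?j (carrier (A \<boxtimes> B))" by (rule tm_inj[OF vA vB vA vQ lin_id' ii]) simp_all
  have lg: "lin T (A \<boxtimes> Q) ?g" by ((rule II vQ lin_\<pi> lin_coT)+)
  have r: "?\<rho> (\<pi> z) = ?g z" if "z \<in> carrier T" for z by (rule the_elem_\<pi>[OF vAQ lg balanced_coT that])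
  have l\<rho>: "lin B (A \<boxtimes> Q) ?\<rho>" by (rule lin_from_B[OF lin_from_Q[OF vAQ lg r]])
  have im: "?\<rho> p \<in> ?j ` carrier (A \<boxtimes> B)" if "p \<in> carrier B" for p
  proof -
    obtain z where z: "p = \<pi> z" "z \<in> cot" using \<open>p \<in> carrier B\<close> unfolding carrier_Bit by blast
    \<comment> \<open>The cotensor product as a space of its own, so that the projection can be
      regarded as a linear map from it to the bitensor product.\<close>
    let ?Z = "T\<lparr>carrier := {z \<in> carrier T. \<theta> z = \<zero>\<^bsub>W\<^esub>}\<rparr>"
    have vZ: "vsp ?Z" by (rule vs_sub[OF vT cot_sub[unfolded cot_kernel]])
    have lZ: "lin ?Z T (\<lambda>x. x)" by (rule lin_sub[OF vT cot_sub[unfolded cot_kernel]])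
    have lZB: "lin ?Z B \<pi>"
    proof (rule lin_to_B)
      show "lin ?Z Q \<pi>" using lin_comp[OF lin_\<pi> lZ] .
      show "\<pi> y \<in> carrier B" if "y \<in> carrier ?Z" for y using that unfolding carrier_Bit cot_kernel by auto
    qed
    obtain s where s: "s \<in> carrier (A \<boxtimes> ?Z)" "coT z = tm A ?Z A T (\<lambda>x. x) (\<lambda>x. x) s"
      using tensor_kernel[OF vA vT vW lin_\<theta>d lin_closed[OF lin_coT cot_closed[OF z(2)]] coT_\<theta>[OF z(2)]] by blast
    have "?\<rho> p = tm A T A Q id \<pi> (tm A ?Z A T (\<lambda>x. x) (\<lambda>x. x) s)"
      using r[OF cot_closed[OF z(2)]] z(1) s(2) by simp
    also have "\<dots> = tm A ?Z A Q (\<lambda>x. id x) (\<lambda>x. \<pi> x) s"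
      by (rule tm_tm[OF vA vZ vA vT vA vQ lin_id lZ lin_id' lin_\<pi> s(1)])
    also have "\<dots> = ?j (tm A ?Z A B (\<lambda>x. x) \<pi> s)"
      using tm_tm[OF vA vZ vA vB vA vQ lin_id lZB lin_id' ii s(1)] by (simp only: id_apply)
    finally show ?thesis using tm_closed[OF vA vZ vA vB lin_id lZB s(1)] by blast
  qed
  have e: "?j (lcoact BH p) = ?\<rho> p" "lcoact BH p \<in> carrier (A \<boxtimes> B)" if "p \<in> carrier B" for p
    unfolding BH_simps(3) using f_the_inv_into_f[OF ij im[OF that]] the_inv_into_into[OF ij im[OF that]] by simp_all
  show ?thesis
  proof (rule linI)
    fix p q assume pq: "p \<in> carrier B" "q \<in> carrier B"
    show "lcoact BH (p \<oplus>\<^bsub>B\<^esub> q) = lcoact BH p \<oplus>\<^bsub>A \<boxtimes> B\<^esub> lcoact BH q"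
      by (rule inj_onD[OF ij]) (simp_all add: e lin_add[OF lj] lin_add[OF l\<rho>] pq vAB vB)
  next
    fix r p assume rp: "r \<in> carrier K" "p \<in> carrier B"
    show "lcoact BH (r \<odot>\<^bsub>B\<^esub> p) = r \<odot>\<^bsub>A \<boxtimes> B\<^esub> lcoact BH p"
      by (rule inj_onD[OF ij]) (simp_all add: e lin_smult[OF lj] lin_smult[OF l\<rho>] rp vAB vB)
  qed (rule e)
qed

end

section \<open>Joint actions and coactions of several cilia\<close>

lemma PiE_insert_upd: "b \<in> (\<Pi>\<^sub>E i\<in>I - {c}. F i) \<Longrightarrow> c \<in> I \<Longrightarrow> x \<in> F c \<Longrightarrow> b(c := x) \<in> (\<Pi>\<^sub>E i\<in>I. F i)"
  by (auto simp: PiE_def Pi_def extensional_def)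

lemma PiE_Diff_Cons: "b \<in> (\<Pi>\<^sub>E i\<in>S - set (c # cs). F i) \<Longrightarrow> b \<in> (\<Pi>\<^sub>E i\<in>(S - set cs) - {c}. F i)"
  by (simp add: Diff_insert[symmetric])

text \<open>b lacks the coordinate c. It is filled with 1 only to have an element of the full
  product, to which multilinearity applies.\<close>

lemma (in hopf) lin_itprod_HS: "b \<in> (\<Pi>\<^sub>E i\<in>I - {c}. carrier A) \<Longrightarrow> c \<in> I \<Longrightarrow> lin A (cilia_hopf K H I) (\<lambda>x. itprod K I (\<lambda>_. A) (b(c := x)))"
proof -
  assume b: "b \<in> (\<Pi>\<^sub>E i\<in>I - {c}. carrier A)" and c: "c \<in> I"
  have "lin A (itensor K I (\<lambda>_. A)) (\<lambda>x. itprod K I (\<lambda>_. A) ((b(c := uA))(c := x)))"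
    by (rule mlinD(2)[OF mlin_itprod[of I "\<lambda>_. A"] _ c]) (use PiE_insert_upd[OF b c uA_closed] vA in auto)
  then show ?thesis by (simp add: cilia_hopf_def)
qed

context commuting_family begin

abbreviation "actw a \<equiv> fold (\<lambda>c. lact (N c) (a c))"

lemmas NI = lin_intros E vA bil_arg1[OF bil_N] bil_arg2[OF bil_N] bilD(1)[OF bil_N] bilD(3)[OF bil_N]
  lin_comp[OF lin_N] lin_closed[OF lin_N] lin_N

lemma lin_fold: "set cs \<subseteq> C \<Longrightarrow> (\<And>c. c \<in> set cs \<Longrightarrow> a c \<in> carrier A) \<Longrightarrow> lin E E (\<lambda>m. actw a cs m)"
proof (induct cs)
  case Nil then show ?case by (simp add: lin_id)
next
  case (Cons c cs)
  then have l: "lin E E (\<lambda>m. actw a cs m)" and c: "c \<in> C" "a c \<in> carrier A" by auto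
  show ?case using lin_comp[OF l bilD(1)[OF bil_N[OF c(1)] c(2)]] by simp
qed

lemma lin_fold_coeff:
  assumes "set cs \<subseteq> C" "distinct cs" "\<And>c. c \<in> set cs \<Longrightarrow> a c \<in> carrier A" "i \<in> set cs" "w \<in> carrier E"
  shows "lin A E (\<lambda>x. actw (a(i := x)) cs w)"
  using assms
proof (induct cs arbitrary: w)
  case Nil then show ?case by simp
next
  case (Cons c cs)
  then have cs: "set cs \<subseteq> C" "distinct cs" "c \<notin> set cs" and c: "c \<in> C" "a c \<in> carrier A"
    and a: "\<And>c. c \<in> set cs \<Longrightarrow> a c \<in> carrier A" and w: "w \<in> carrier E" by auto
  show ?case
  proof (cases "i = c")
    case True
    have "lin A E (\<lambda>x. actw a cs (lact (N c) x w))" by (rule lin_comp[OF lin_fold[OF cs(1) a] bilD(2)[OF bil_N[OF c(1)] w]])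
    moreover have "actw (a(i := x)) cs m = actw a cs m" for x m by (rule List.fold_cong) (use True cs in auto)
    ultimately show ?thesis using True by simp
  next
    case False
    then have "lin A E (\<lambda>x. actw (a(i := x)) cs (lact (N c) (a c) w))"
      by (intro Cons(1)[OF cs(1,2) a]) (use Cons(5) bilD(3)[OF bil_N[OF c(1)] c(2) w] in auto)
    then show ?thesis using False by simp
  qed
qed

lemma fold_act:
  assumes "set cs \<subseteq> C" "\<And>c. c \<in> set cs \<Longrightarrow> a c \<in> carrier A" "d \<in> C" "d \<notin> set cs" "h \<in> carrier A" "w \<in> carrier E"
  shows "lact (N d) h (actw a cs w) = actw a cs (lact (N d) h w)"
  using assms
proof (induct cs arbitrary: w)
  case Nil then show ?case by simp
next
  case (Cons c cs)
  then have c: "c \<in> C" "a c \<in> carrier A" "c \<noteq> d" by auto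
  have w: "lact (N c) (a c) w \<in> carrier E" by (rule bilD(3)[OF bil_N[OF c(1)] c(2) Cons(7)])
  show ?case using Cons(1)[of "lact (N c) (a c) w"] Cons(2-) N_act_act[of d c h "a c" w] c w by simp
qed

lemma fold_coact:
  assumes "set cs \<subseteq> C" "\<And>c. c \<in> set cs \<Longrightarrow> a c \<in> carrier A" "d \<in> C" "d \<notin> set cs" "w \<in> carrier E"
  shows "lcoact (N d) (actw a cs w) = tm A E A E (\<lambda>x. x) (\<lambda>m. actw a cs m) (lcoact (N d) w)"
  using assms
proof (induct cs arbitrary: w)
  case Nil
  have "tm A E A E (\<lambda>x. x) (\<lambda>m. m) (lcoact (N d) w) = lcoact (N d) w"
    by (rule tm_id[OF vA E lin_closed[OF lin_N[OF Nil(3)] Nil(5)]]) simp_all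
  then show ?case by simp
next
  case (Cons c cs)
  then have c: "c \<in> C" "a c \<in> carrier A" "c \<noteq> d" and cs: "set cs \<subseteq> C" "d \<notin> set cs"
    and a: "\<And>c. c \<in> set cs \<Longrightarrow> a c \<in> carrier A" by auto
  have w: "lact (N c) (a c) w \<in> carrier E" by (rule bilD(3)[OF bil_N[OF c(1)] c(2) Cons(6)])
  have "lcoact (N d) (actw a (c # cs) w) = tm A E A E (\<lambda>x. x) (\<lambda>m. actw a cs m) (lcoact (N d) (lact (N c) (a c) w))"
    using Cons(1)[OF cs(1) a Cons(4) cs(2) w] by simp
  also have "\<dots> = tm A E A E (\<lambda>x. x) (\<lambda>m. actw a cs m) (tm A E A E (\<lambda>x. x) (lact (N c) (a c)) (lcoact (N d) w))"
    using N_coact_act[OF c(1) Cons(4) c(3,2) Cons(6)] by simp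
  also have "\<dots> = tm A E A E (\<lambda>x. x) (\<lambda>m. actw a cs (lact (N c) (a c) m)) (lcoact (N d) w)"
    by (rule tm_tm[OF vA E vA E vA E lin_id bilD(1)[OF bil_N[OF c(1)] c(2)] lin_id lin_fold[OF cs(1) a]
        lin_closed[OF lin_N[OF Cons(4)] Cons(6)]])
  finally show ?case by simp
qed

context
  fixes S assumes S: "S \<subseteq> C"
begin

abbreviation "cs \<equiv> sorted_list_of_set S"
abbreviation "HS \<equiv> cilia_hopf K H S"
abbreviation "mc \<equiv> multi_coact K H S N E"
definition "gact t m = itensor_lift K S (\<lambda>_. A) E (\<lambda>a. actw a cs m) t"

lemma cs: "set cs = S" "distinct cs" "set cs \<subseteq> C"
  using finite_subset[OF S finite_C] S by simp_all

lemma vHS: "vsp HS"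
  by (simp add: cilia_hopf_def vsp_itensor)

lemma mlin_actw: "m \<in> carrier E \<Longrightarrow> mlin S (\<lambda>_. A) E (\<lambda>a. actw a cs m)"
proof (rule mlinI)
  fix v assume m: "m \<in> carrier E" and v: "v \<in> (\<Pi>\<^sub>E i\<in>S. carrier A)"
  then have a: "v c \<in> carrier A" if "c \<in> set cs" for c using that cs(1) by auto
  show "actw v cs m \<in> carrier E" by (rule lin_closed[OF lin_fold[OF cs(3) a] m])
  fix i assume i: "i \<in> S"
  show "lin A E (\<lambda>x. actw (v(i := x)) cs m)" by (rule lin_fold_coeff[OF cs(3,2) a _ m]) (simp_all add: i cs(1))
qed

lemma gact_itprod: "v \<in> (\<Pi>\<^sub>E i\<in>S. carrier A) \<Longrightarrow> m \<in> carrier E \<Longrightarrow> gact (itprod K S (\<lambda>_. A) v) m = actw v cs m"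
  unfolding gact_def by (rule itl_itprod[OF vA E mlin_actw])

lemma bil_gact: "bil HS E E (\<lambda>t m. gact t m)"
  unfolding gact_def cilia_hopf_def
proof (rule bilI)
  fix t assume t: "t \<in> carrier (itensor K S (\<lambda>_. A))"
  show "lin E E (\<lambda>m. itensor_lift K S (\<lambda>_. A) E (\<lambda>a. actw a cs m) t)"
    by (rule lin_itl_fun[OF vA E E _ mlin_actw t], rule lin_fold[OF cs(3)]) (use cs(1) in auto)
next
  fix m assume m: "m \<in> carrier E"
  show "lin (itensor K S (\<lambda>_. A)) E (\<lambda>t. itensor_lift K S (\<lambda>_. A) E (\<lambda>a. actw a cs m) t)"
    by (rule lin_itl_arg[OF vA E mlin_actw[OF m] lin_id])
qed

lemma HS_ext:
  assumes "vsp Y" "lin HS Y f" "lin HS Y g"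
    "\<And>v. v \<in> (\<Pi>\<^sub>E i\<in>S. carrier A) \<Longrightarrow> f (itprod K S (\<lambda>_. A) v) = g (itprod K S (\<lambda>_. A) v)"
  shows "\<forall>t\<in>carrier HS. f t = g t"
  using assms unfolding cilia_hopf_def by (intro itens_ext vA)

lemma gact_act:
  assumes d: "d \<in> C - S" and h: "h \<in> carrier A" and t: "t \<in> carrier HS" and w: "w \<in> carrier E"
  shows "lact (N d) h (gact t w) = gact t (lact (N d) h w)"
proof -
  have d': "d \<in> C" "d \<notin> set cs" using d cs by auto
  have hw: "lact (N d) h w \<in> carrier E" by (rule bilD(3)[OF bil_N[OF d'(1)] h w])
  have "\<forall>t\<in>carrier HS. lact (N d) h (gact t w) = gact t (lact (N d) h w)"
  proof (rule HS_ext)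
    fix v assume v: "v \<in> (\<Pi>\<^sub>E i\<in>S. carrier A)"
    then have a: "v c \<in> carrier A" if "c \<in> set cs" for c using that cs(1) by auto
    show "lact (N d) h (gact (itprod K S (\<lambda>_. A) v) w) = gact (itprod K S (\<lambda>_. A) v) (lact (N d) h w)"
      using fold_act[OF cs(3) a d' h w] by (simp add: gact_itprod v w hw)
  qed (rule E lin_comp[OF bilD(1)[OF bil_N[OF d'(1)] h]] bilD(2)[OF bil_gact] w hw)+
  with t show ?thesis by blast
qed

lemma coact_gact:
  assumes d: "d \<in> C - S" and t: "t \<in> carrier HS" and w: "w \<in> carrier E"
  shows "lcoact (N d) (gact t w) = tm A E A E (\<lambda>x. x) (gact t) (lcoact (N d) w)"
proof -
  have d': "d \<in> C" "d \<notin> set cs" using d cs by auto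
  note dw = lin_closed[OF lin_N[OF d'(1)] w]
  have "\<forall>t\<in>carrier HS. lcoact (N d) (gact t w) = tm A E A E (\<lambda>x. x) (\<lambda>m. gact t m) (lcoact (N d) w)"
  proof (rule HS_ext)
    fix v assume v: "v \<in> (\<Pi>\<^sub>E i\<in>S. carrier A)"
    then have a: "v c \<in> carrier A" if "c \<in> set cs" for c using that cs(1) by auto
    have "tm A E A E (\<lambda>x. x) (\<lambda>m. actw v cs m) (lcoact (N d) w) =
      tm A E A E (\<lambda>x. x) (\<lambda>m. gact (itprod K S (\<lambda>_. A) v) m) (lcoact (N d) w)"
      by (rule tm_cong[OF vA E vA E lin_id lin_fold[OF cs(3) a] dw]) (simp_all add: gact_itprod v)
    then show "lcoact (N d) (gact (itprod K S (\<lambda>_. A) v) w) =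
      tm A E A E (\<lambda>x. x) (\<lambda>m. gact (itprod K S (\<lambda>_. A) v) m) (lcoact (N d) w)"
      using fold_coact[OF cs(3) a d' w] by (simp add: gact_itprod v w)
  next
    show "lin HS (A \<boxtimes> E) (\<lambda>t. tm A E A E (\<lambda>x. x) (\<lambda>m. gact t m) (lcoact (N d) w))"
      unfolding tensor_map_def
      by ((rule NI vHS d'(1) w bilD(1)[OF bil_gact] bilD(2)[OF bil_gact] bilD(3)[OF bil_gact] | assumption)+)
    show "lin HS (A \<boxtimes> E) (\<lambda>t. lcoact (N d) (gact t w))"
      by (rule lin_comp[OF lin_N[OF d'(1)] bilD(2)[OF bil_gact w]])
  qed (rule vsp_tensor[OF vA E])
  with t show ?thesis by simp
qed

text \<open>The recursion fills in the coordinates of b along the list, so b is extensional on those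
  filled so far; the initial constant \<open>undefined\<close> is the one element of the empty
  product. Linearity in a filled coordinate is proved simultaneously, since each step lifts over the
  coordinate it fills.\<close>

lemma lin_mc:
  assumes "set ks \<subseteq> S" "distinct ks"
  shows "\<And>b. b \<in> (\<Pi>\<^sub>E i\<in>S - set ks. carrier A) \<Longrightarrow> lin E (HS \<boxtimes> E) (\<lambda>n. mc ks b n)"
    and "\<And>b i n. i \<in> S - set ks \<Longrightarrow> b \<in> (\<Pi>\<^sub>E i\<in>S - set ks - {i}. carrier A) \<Longrightarrow> n \<in> carrier E \<Longrightarrow>
      lin A (HS \<boxtimes> E) (\<lambda>x. mc ks (b(i := x)) n)"
  using assms
proof (induct ks)
  case Nil
  have c: "itprod K S (\<lambda>_. A) b \<in> carrier HS" if "b \<in> (\<Pi>\<^sub>E i\<in>S. carrier A)" for b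
    unfolding cilia_hopf_def by (rule itprod_closed) (use vA that in simp_all)
  {
    case 1 then show ?case using lin_tpr[OF vHS E lin_id c] by (simp only: multi_coact.simps list.set Diff_empty)
  next
    case 2 then show ?case using lin_tpl[OF vHS E lin_itprod_HS] by (simp only: multi_coact.simps list.set Diff_empty)
  }
next
  case (Cons c ks)
  {
    case (1 b)
    then have c: "c \<in> S - set ks" "c \<in> C" and ks: "set ks \<subseteq> S" "distinct ks" using S by auto
    note b = PiE_Diff_Cons[OF 1(1)]
    have "lin E (HS \<boxtimes> E) (\<lambda>n. tlf A E (HS \<boxtimes> E) (\<lambda>h n'. mc ks (b(c := h)) n') (lcoact (N c) n))"
      by ((rule NI c vHS Cons(1)[OF _ ks] Cons(2)[OF c(1) b _ ks] PiE_insert_upd[OF b c(1)] | assumption)+)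
    then show ?case by simp
  next
    case (2 b i n)
    then have c: "c \<in> S - set ks" "c \<in> C" and ks: "set ks \<subseteq> S" "distinct ks" and i: "i \<in> S - set ks" "i \<noteq> c"
      and n: "n \<in> carrier E" using S by auto
    have e: "S - set (c # ks) - {i} = S - set ks - {i} - {c}" "S - set (c # ks) - {i} = S - set ks - {c} - {i}" by auto
    note b = 2(2)[unfolded e(1)] 2(2)[unfolded e(2)]
    have bh: "b(c := h) \<in> (\<Pi>\<^sub>E i\<in>S - set ks - {i}. carrier A)" if "h \<in> carrier A" for h
      by (rule PiE_insert_upd[OF b(1) _ that]) (use c i in auto)
    have bx: "b(i := x) \<in> (\<Pi>\<^sub>E i\<in>S - set ks - {c}. carrier A)" if "x \<in> carrier A" for x
      by (rule PiE_insert_upd[OF b(2) _ that]) (use c i in auto)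
    have l: "lin A (HS \<boxtimes> E) (\<lambda>x. mc ks (b(i := x, c := h)) n')" if "h \<in> carrier A" "n' \<in> carrier E" for h n'
      using Cons(2)[OF i(1) bh[OF that(1)] that(2) ks] by (simp only: fun_upd_twist[OF i(2)])
    have "lin A (HS \<boxtimes> E) (\<lambda>x. tlf A E (HS \<boxtimes> E) (\<lambda>h n'. mc ks (b(i := x, c := h)) n') (lcoact (N c) n))"
      by ((rule NI c vHS n l Cons(1)[OF _ ks] Cons(2)[OF c(1) _ _ ks] bx PiE_insert_upd[OF bx c(1)] | assumption)+)
    then show ?case by (simp only: multi_coact.simps)
  }
qed

lemma mc_act:
  assumes "set ks \<subseteq> S" "distinct ks" "b \<in> (\<Pi>\<^sub>E i\<in>S - set ks. carrier A)" "d \<in> C - S" "h \<in> carrier A" "n \<in> carrier E"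
  shows "mc ks b (lact (N d) h n) = tm HS E HS E (\<lambda>x. x) (lact (N d) h) (mc ks b n)"
  using assms
proof (induct ks arbitrary: b n)
  case Nil
  have "itprod K S (\<lambda>_. A) b \<in> carrier HS" unfolding cilia_hopf_def by (rule itprod_closed) (use Nil vA in simp_all)
  then show ?case
    using tm_tp[OF vHS E vHS E lin_id bilD(1)[OF bil_N Nil(5)] _ Nil(6)] Nil(4) by simp
next
  case (Cons c ks)
  then have c: "c \<in> S - set ks" "c \<in> C" "d \<in> C" "c \<noteq> d" and ks: "set ks \<subseteq> S" "distinct ks" using S by auto
  note b = PiE_Diff_Cons[OF Cons(4)]
  note bl = bilD(1)[OF bil_N[OF c(3)] Cons(6)]
  note J = NI c vHS lin_mc(1)[OF ks] lin_mc(2)[OF ks c(1) b] lin_closed[OF lin_mc(1)[OF ks]]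
    lin_comp[OF lin_mc(1)[OF ks]] PiE_insert_upd[OF b c(1)] Cons(6,7) bl
  let ?Y = "HS \<boxtimes> E" and ?f = "tm HS E HS E (\<lambda>x. x) (lact (N d) h)"
  have "mc (c # ks) b (lact (N d) h n) =
    tlf A E ?Y (\<lambda>h' n'. mc ks (b(c := h')) n') (tm A E A E (\<lambda>x. x) (lact (N d) h) (lcoact (N c) n))"
    using N_coact_act[OF c(3,2) c(4)[symmetric] Cons(6,7)] by simp
  also have "\<dots> = tlf A E ?Y (\<lambda>h' n'. mc ks (b(c := h')) (lact (N d) h n')) (lcoact (N c) n)"
    by (rule tl_tm) ((rule J | assumption)+)
  also have "\<dots> = tlf A E ?Y (\<lambda>h' n'. ?f (mc ks (b(c := h')) n')) (lcoact (N c) n)"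
    by (rule tl_cong, (rule J | assumption)+, rule Cons(1)[OF ks _ Cons(5,6)]) ((rule J | assumption)+)
  also have "\<dots> = ?f (mc (c # ks) b n)"
    unfolding multi_coact.simps by (rule tl_push[symmetric]) ((rule J | assumption)+)
  finally show ?case .
qed

text \<open>The coaction at d passes the head of the list by commutation of two cilia, and the rest
  by induction.\<close>

lemma mc_cocomm:
  assumes "set ks \<subseteq> S" "distinct ks" "b \<in> (\<Pi>\<^sub>E i\<in>S - set ks. carrier A)" "d \<in> C - S" "n \<in> carrier E"
  shows "cocomm A HS E (lcoact (N d)) (\<lambda>n. mc ks b n) n"
  using assms
proof (induct ks arbitrary: b n)
  case Nil
  let ?Y = "A \<boxtimes> HS \<boxtimes> E" and ?i = "itprod K S (\<lambda>_. A) b"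
  have d: "d \<in> C" using Nil by auto
  have i: "?i \<in> carrier HS" unfolding cilia_hopf_def by (rule itprod_closed) (use Nil vA in simp_all)
  note J = NI d vHS i Nil(5)
  have "tlf A E ?Y (\<lambda>x n. tlf HS E ?Y (\<lambda>t n'. tp A (HS \<boxtimes> E) x (tp HS E t n')) (tp HS E ?i n)) (lcoact (N d) n) =
    tlf A E ?Y (\<lambda>x n. tp A (HS \<boxtimes> E) x (tp HS E ?i n)) (lcoact (N d) n)"
    by (rule tl_cong, (rule J | assumption)+, rule tl_tp) ((rule J | assumption)+)
  also have "\<dots> = tlf HS E ?Y (\<lambda>t n. tlf A E ?Y (\<lambda>x n'. tp A (HS \<boxtimes> E) x (tp HS E t n')) (lcoact (N d) n)) (tp HS E ?i n)"
    by (rule tl_tp[symmetric]) ((rule J | assumption)+)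
  finally show ?case by (simp add: cocomm_def)
next
  case (Cons c ks)
  then have c: "c \<in> S - set ks" "c \<in> C" "d \<in> C" "c \<noteq> d" and ks: "set ks \<subseteq> S" "distinct ks" using S by auto
  note b = PiE_Diff_Cons[OF Cons(4)]
  note J = NI c vHS lin_mc(1)[OF ks] lin_mc(2)[OF ks c(1) b] lin_closed[OF lin_mc(1)[OF ks]]
    lin_comp[OF lin_mc(1)[OF ks]] PiE_insert_upd[OF b c(1)] Cons(6)
  let ?Y = "A \<boxtimes> HS \<boxtimes> E"
  let ?t = "\<lambda>x t n. tp A (HS \<boxtimes> E) x (tp HS E t n)"
  have p: "tlf HS E ?Y (\<lambda>t n. \<phi> t n) (mc (c # ks) b n) =
    tlf A E ?Y (\<lambda>h n'. tlf HS E ?Y (\<lambda>t n. \<phi> t n) (mc ks (b(c := h)) n')) (lcoact (N c) n)"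
    if \<phi>: "bil HS E ?Y (\<lambda>t n. \<phi> t n)" and n: "n \<in> carrier E" for \<phi> n
  proof -
    have vY: "vsp ?Y" by ((rule J)+)
    show ?thesis unfolding multi_coact.simps
      by (rule tl_push) ((rule J n lin_tl_self[OF vHS E vY \<phi>] | assumption)+)
  qed
  have "tlf A E ?Y (\<lambda>x n. tlf HS E ?Y (\<lambda>t n'. ?t x t n') (mc (c # ks) b n)) (lcoact (N d) n) =
    tlf A E ?Y (\<lambda>x n. tlf A E ?Y (\<lambda>h n'. tlf HS E ?Y (\<lambda>t n'. ?t x t n') (mc ks (b(c := h)) n')) (lcoact (N c) n)) (lcoact (N d) n)"
    by (rule tl_cong[symmetric], (rule J | assumption)+, rule p[symmetric]) ((rule J | assumption)+)
  also have "\<dots> = tlf A E ?Y (\<lambda>h n. tlf A E ?Y (\<lambda>x n'. tlf HS E ?Y (\<lambda>t n'. ?t x t n') (mc ks (b(c := h)) n')) (lcoact (N d) n)) (lcoact (N c) n)"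
    by (rule cocomm_lift[OF vA vA E _ lin_N[OF c(3)] lin_N[OF c(2)] Cons(6) N_coact_coact[OF c(3,2) c(4)[symmetric] Cons(6)]])
       ((rule J | assumption)+)
  also have "\<dots> = tlf A E ?Y (\<lambda>h n. tlf HS E ?Y (\<lambda>t n. tlf A E ?Y (\<lambda>x n'. ?t x t n') (lcoact (N d) n)) (mc ks (b(c := h)) n)) (lcoact (N c) n)"
    by (rule tl_cong, (rule J | assumption)+, rule Cons(1)[OF ks _ Cons(5), unfolded cocomm_def]) ((rule J | assumption)+)
  also have "\<dots> = tlf HS E ?Y (\<lambda>t n. tlf A E ?Y (\<lambda>x n'. ?t x t n') (lcoact (N d) n)) (mc (c # ks) b n)"
    by (rule p[symmetric]) ((rule J | assumption)+)
  finally show ?case unfolding cocomm_def .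
qed

end

end

lemma (in hopf) right_modcomodD:
  assumes "right_modcomod K H X"
  shows "vsp (rvs X)" "bil (rvs X) A (rvs X) (\<lambda>x a. ract X x a)" "lin (rvs X) (rvs X \<boxtimes> A) (rcoact X)"
    "x \<in> carrier (rvs X) \<Longrightarrow> ract X x uA = x"
  using assms by (auto simp: right_modcomod_def right_module_def right_comodule_def linear_map_iff Let_def intro!: bilI)

section \<open>Tensor products of coefficient modules over a set of cilia\<close>

locale coefficients = hopf K H for K :: "'k ring" and H :: "('k, 'h) hopf" +
  fixes S :: "nat set" and X :: "nat \<Rightarrow> ('k, 'h, 'h, 'x) rmc"
  assumes finite_S: "finite S" and modcomod: "c \<in> S \<Longrightarrow> right_modcomod K H (X c)"
begin

abbreviation "V \<equiv> \<lambda>c. rvs (X c)"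
abbreviation "VS \<equiv> itensor K S V"
abbreviation "HS \<equiv> cilia_hopf K H S"
abbreviation "fc \<equiv> factor_coact K H S X"

lemmas XD = right_modcomodD[OF modcomod]

lemma vVS: "vsp VS" and vHS: "vsp HS"
  by (simp_all add: cilia_hopf_def vsp_itensor XD(1))

lemma itprod_VS: "v \<in> (\<Pi>\<^sub>E i\<in>S. carrier (V i)) \<Longrightarrow> itprod K S V v \<in> carrier VS"
  by (rule itprod_closed) (rule XD(1))

lemma lin_itprod_VS: "v \<in> (\<Pi>\<^sub>E i\<in>S - {i}. carrier (V i)) \<Longrightarrow> i \<in> S \<Longrightarrow> lin (V i) VS (\<lambda>x. itprod K S V (v(i := x)))"
proof -
  assume v: "v \<in> (\<Pi>\<^sub>E i\<in>S - {i}. carrier (V i))" and i: "i \<in> S"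
  have "lin (V i) VS (\<lambda>x. itprod K S V ((v(i := \<zero>\<^bsub>V i\<^esub>))(i := x)))"
    by (rule mlinD(2)[OF mlin_itprod _ i])
       (use PiE_insert_upd[OF v i, of "\<zero>\<^bsub>V i\<^esub>"] XD(1) i in auto)
  then show ?thesis by simp
qed

lemma itprod_HS: "b \<in> (\<Pi>\<^sub>E i\<in>S. carrier A) \<Longrightarrow> itprod K S (\<lambda>_. A) b \<in> carrier HS"
  unfolding cilia_hopf_def by (rule itprod_closed) (rule vA)

lemma ract_coeff_closed:
  assumes x: "x \<in> carrier VS" and t: "t \<in> carrier HS"
  shows "ract (coeff_rmc K H S X) x t \<in> carrier VS"
proof -
  let ?f = "\<lambda>v a. \<lambda>c\<in>S. ract (X c) (v c) (a c)"
  have f: "?f v a \<in> (\<Pi>\<^sub>E i\<in>S. carrier (V i))" if "v \<in> (\<Pi>\<^sub>E i\<in>S. carrier (V i))" "a \<in> (\<Pi>\<^sub>E i\<in>S. carrier A)" for v a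
    using that bilD(3)[OF XD(2)] by (auto simp: PiE_def Pi_def)
  have 1: "mlin S (\<lambda>_. A) VS (\<lambda>a. itprod K S V (?f v a))" if v: "v \<in> (\<Pi>\<^sub>E i\<in>S. carrier (V i))" for v
  proof (rule mlinI)
    fix a assume a: "a \<in> (\<Pi>\<^sub>E i\<in>S. carrier A)"
    show "itprod K S V (?f v a) \<in> carrier VS" by (rule itprod_VS[OF f[OF v a]])
    fix i assume i: "i \<in> S"
    have e: "?f v (a(i := x)) = (?f v a)(i := ract (X i) (v i) x)" for x using i by auto
    have "v i \<in> carrier (V i)" using v i by auto
    note l = bilD(1)[OF XD(2)[OF i] this]
    show "lin A VS (\<lambda>x. itprod K S V (?f v (a(i := x))))"
      unfolding e by (rule lin_comp[OF mlinD(2)[OF mlin_itprod f[OF v a] i] l]) (rule XD(1))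
  qed
  have 2: "mlin S V VS (\<lambda>v. itensor_lift K S (\<lambda>_. A) VS (\<lambda>a. itprod K S V (?f v a)) t)"
  proof (rule mlinI)
    fix v assume v: "v \<in> (\<Pi>\<^sub>E i\<in>S. carrier (V i))"
    note t = t[unfolded cilia_hopf_def]
    show "itensor_lift K S (\<lambda>_. A) VS (\<lambda>a. itprod K S V (?f v a)) t \<in> carrier VS"
      by (rule itl_closed[OF vA vVS 1[OF v] t])
    fix i assume i: "i \<in> S"
    show "lin (V i) VS (\<lambda>x. itensor_lift K S (\<lambda>_. A) VS (\<lambda>a. itprod K S V (?f (v(i := x)) a)) t)"
    proof (rule lin_itl_fun[OF vA vVS XD(1)[OF i] _ 1[OF PiE_upd[OF v i]] t])
      fix a assume a: "a \<in> (\<Pi>\<^sub>E i\<in>S. carrier A)"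
      have e: "?f (v(i := x)) a = (?f v a)(i := ract (X i) x (a i))" for x using i by auto
      have "a i \<in> carrier A" using a i by auto
      note l = bilD(2)[OF XD(2)[OF i] this]
      show "lin (V i) VS (\<lambda>x. itprod K S V (?f (v(i := x)) a))"
        unfolding e by (rule lin_comp[OF mlinD(2)[OF mlin_itprod f[OF v a] i] l]) (rule XD(1))
    qed
  qed
  show ?thesis unfolding coeff_rmc_def Let_def rmc.simps by (rule itl_closed[OF XD(1) vVS 2 x])
qed

text \<open>Coordinates of v outside the list are not read. Once the head c has been processed, v at
  c therefore enters only through its coaction, which settles the case i = c in the last part of
  \<open>lin_fc\<close>.\<close>

lemma fc_cong: "(\<And>i. i \<in> set cs \<Longrightarrow> v i = v' i) \<Longrightarrow> fc v cs u b = fc v' cs u b"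
  by (induct cs arbitrary: u b) simp_all

text \<open>The four claims need one induction: a step lifts over the new coordinates of u and b,
  for which the second and third claims are used, while the fourth varies a coordinate of v still to
  be read.\<close>

lemma lin_fc:
  assumes "set cs \<subseteq> S" "distinct cs"
  shows "\<And>v u b. v \<in> (\<Pi>\<^sub>E i\<in>S. carrier (V i)) \<Longrightarrow> u \<in> (\<Pi>\<^sub>E i\<in>S - set cs. carrier (V i)) \<Longrightarrow> b \<in> (\<Pi>\<^sub>E i\<in>S - set cs. carrier A) \<Longrightarrow>
      fc v cs u b \<in> carrier (VS \<boxtimes> HS)"
    and "\<And>v i u b. v \<in> (\<Pi>\<^sub>E i\<in>S. carrier (V i)) \<Longrightarrow> i \<in> S - set cs \<Longrightarrow> u \<in> (\<Pi>\<^sub>E i\<in>S - set cs - {i}. carrier (V i)) \<Longrightarrow>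
      b \<in> (\<Pi>\<^sub>E i\<in>S - set cs. carrier A) \<Longrightarrow> lin (V i) (VS \<boxtimes> HS) (\<lambda>x. fc v cs (u(i := x)) b)"
    and "\<And>v i u b. v \<in> (\<Pi>\<^sub>E i\<in>S. carrier (V i)) \<Longrightarrow> i \<in> S - set cs \<Longrightarrow> u \<in> (\<Pi>\<^sub>E i\<in>S - set cs. carrier (V i)) \<Longrightarrow>
      b \<in> (\<Pi>\<^sub>E i\<in>S - set cs - {i}. carrier A) \<Longrightarrow> lin A (VS \<boxtimes> HS) (\<lambda>h. fc v cs u (b(i := h)))"
    and "\<And>v i u b. v \<in> (\<Pi>\<^sub>E i\<in>S. carrier (V i)) \<Longrightarrow> i \<in> set cs \<Longrightarrow> u \<in> (\<Pi>\<^sub>E i\<in>S - set cs. carrier (V i)) \<Longrightarrow>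
      b \<in> (\<Pi>\<^sub>E i\<in>S - set cs. carrier A) \<Longrightarrow> lin (V i) (VS \<boxtimes> HS) (\<lambda>x. fc (v(i := x)) cs u b)"
  using assms
proof (induct cs)
  case Nil
  {
    case 1 then show ?case by (simp add: tp_closed vVS vHS itprod_VS itprod_HS)
  next
    case 2 then show ?case using lin_tpl[OF vVS vHS lin_itprod_VS itprod_HS] by (simp only: factor_coact.simps list.set Diff_empty)
  next
    case 3 then show ?case using lin_tpr[OF vVS vHS lin_itprod_HS itprod_VS] by (simp only: factor_coact.simps list.set Diff_empty)
  next
    case 4 then show ?case by simp
  }
next
  case (Cons c cs)
  let ?Y = "VS \<boxtimes> HS"
  have vY: "vsp ?Y" by (rule vsp_tensor[OF vVS vHS])
  have 0: "set cs \<subseteq> S" "distinct cs" "c \<in> S - set cs" "c \<in> S" if "set (c # cs) \<subseteq> S" "distinct (c # cs)" using that by auto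
  have b: "bil (V c) A ?Y (\<lambda>x h. fc v cs (u(c := x)) (b(c := h)))"
    if d: "set (c # cs) \<subseteq> S" "distinct (c # cs)" and v: "v \<in> (\<Pi>\<^sub>E i\<in>S. carrier (V i))"
      and u: "u \<in> (\<Pi>\<^sub>E i\<in>S - set cs - {c}. carrier (V i))" and b: "b \<in> (\<Pi>\<^sub>E i\<in>S - set cs - {c}. carrier A)" for v u b
    by (rule bilI, rule Cons(3)[OF v 0(3)[OF d] PiE_insert_upd[OF u 0(3)[OF d]] b 0(1,2)[OF d]], assumption,
        rule Cons(2)[OF v 0(3)[OF d] u PiE_insert_upd[OF b 0(3)[OF d]] 0(1,2)[OF d]])
  have r: "rcoact (X c) (v c) \<in> carrier (V c \<boxtimes> A)" if "c \<in> S" "v \<in> (\<Pi>\<^sub>E i\<in>S. carrier (V i))" for v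
    by (rule lin_closed[OF XD(3)]) (use that in auto)
  have e: "S - set (c # cs) - {i} = S - set cs - {i} - {c}" "S - set (c # cs) - {i} = S - set cs - {c} - {i}" for i by auto
  {
    case (1 v u b)
    note d = 1(4,5)
    show ?case unfolding factor_coact.simps
      by (rule tl_closed[OF XD(1)[OF 0(4)[OF d]] vA vY b[OF d 1(1) PiE_Diff_Cons[OF 1(2)] PiE_Diff_Cons[OF 1(3)]] r[OF 0(4)[OF d] 1(1)]])
  next
    case (2 v i u b')
    note d = 2(5,6)
    note 0 = 0[OF d]
    have i: "i \<in> S - set cs" "i \<noteq> c" "i \<in> S" "i \<in> S - set cs - {c}" "c \<in> S - set cs - {i}" using 2(2) 0 by auto
    note u = 2(3)[unfolded e(1)] 2(3)[unfolded e(2)]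
    note b' = PiE_Diff_Cons[OF 2(4)]
    have l: "lin (V i) ?Y (\<lambda>x. fc v cs (u(i := x, c := y)) (b'(c := h)))" if "y \<in> carrier (V c)" "h \<in> carrier A" for y h
      using Cons(2)[OF 2(1) i(1) PiE_insert_upd[OF u(1) i(5) that(1)] PiE_insert_upd[OF b' 0(3) that(2)] 0(1,2)]
      by (simp only: fun_upd_twist[OF i(2)])
    show ?case unfolding factor_coact.simps
      by (rule lin_tl_fun[OF XD(1)[OF 0(4)] vA vY XD(1)[OF i(3)] l b[OF d 2(1) PiE_insert_upd[OF u(2) i(4)] b'] r[OF 0(4) 2(1)]])
  next
    case (3 v i u b')
    note d = 3(5,6)
    note 0 = 0[OF d]
    have i: "i \<in> S - set cs" "i \<noteq> c" "i \<in> S" "i \<in> S - set cs - {c}" "c \<in> S - set cs - {i}" using 3(2) 0 by auto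
    note b' = 3(4)[unfolded e(1)] 3(4)[unfolded e(2)]
    note u = PiE_Diff_Cons[OF 3(3)]
    have l: "lin A ?Y (\<lambda>x. fc v cs (u(c := y)) (b'(i := x, c := h)))" if "y \<in> carrier (V c)" "h \<in> carrier A" for y h
      using Cons(3)[OF 3(1) i(1) PiE_insert_upd[OF u 0(3) that(1)] PiE_insert_upd[OF b'(1) i(5) that(2)] 0(1,2)]
      by (simp only: fun_upd_twist[OF i(2)])
    show ?case unfolding factor_coact.simps
      by (rule lin_tl_fun[OF XD(1)[OF 0(4)] vA vY vA l b[OF d 3(1) u PiE_insert_upd[OF b'(2) i(4)]] r[OF 0(4) 3(1)]])
  next
    case (4 v i u b')
    note d = 4(5,6)
    note 0 = 0[OF d]
    note u = PiE_Diff_Cons[OF 4(3)] and b' = PiE_Diff_Cons[OF 4(4)]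
    show ?case
    proof (cases "i = c")
      case True
      have f: "fc (v(c := x)) cs u' b'' = fc v cs u' b''" for x u' b'' by (rule fc_cong) (use d in auto)
      have "lin (V c) ?Y (\<lambda>x. tlf (V c) A ?Y (\<lambda>x h. fc v cs (u(c := x)) (b'(c := h))) (rcoact (X c) x))"
        by (rule lin_tl_arg[OF XD(1)[OF 0(4)] vA vY b[OF d 4(1) u b'] XD(3)[OF 0(4)]])
      then show ?thesis unfolding True by (simp only: factor_coact.simps fun_upd_same f)
    next
      case False
      then have i: "i \<in> set cs" "i \<in> S" using 4(2) 0(1) by auto
      have l: "lin (V i) ?Y (\<lambda>x. fc (v(i := x)) cs (u(c := y)) (b'(c := h)))" if "y \<in> carrier (V c)" "h \<in> carrier A" for y h
        by (rule Cons(4)[OF 4(1) i(1) PiE_insert_upd[OF u 0(3) that(1)] PiE_insert_upd[OF b' 0(3) that(2)] 0(1,2)])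
      have "lin (V i) ?Y (\<lambda>x. tlf (V c) A ?Y (\<lambda>y h. fc (v(i := x)) cs (u(c := y)) (b'(c := h))) (rcoact (X c) (v c)))"
        by (rule lin_tl_fun[OF XD(1)[OF 0(4)] vA vY XD(1)[OF i(2)] l b[OF d PiE_upd[OF 4(1) i(2)] u b'] r[OF 0(4) 4(1)]])
      then show ?thesis by (simp only: factor_coact.simps fun_upd_other[OF False[symmetric]])
    qed
  }
qed

lemma lin_rcoact_coeff: "lin VS (VS \<boxtimes> HS) (rcoact (coeff_rmc K H S X))"
proof -
  let ?cs = "sorted_list_of_set S" and ?u = "\<lambda>_. undefined"
  have cs: "set ?cs = S" "distinct ?cs" "set ?cs \<subseteq> S" using finite_S by simp_all
  have u: "?u \<in> (\<Pi>\<^sub>E i\<in>S - set ?cs. F i)" for F by (simp add: cs(1) PiE_def extensional_def)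
  have "mlin S V (VS \<boxtimes> HS) (\<lambda>v. fc v ?cs ?u ?u)"
    by (rule mlinI, rule lin_fc(1)[OF cs(3,2) _ u u], assumption, rule lin_fc(4)[OF cs(3,2) _ _ u u], assumption)
       (simp add: cs(1))
  from lin_itl_self[OF XD(1) vsp_tensor[OF vVS vHS] this] show ?thesis
    by (simp add: coeff_rmc_def Let_def)
qed

lemma rvs_coeff: "rvs (coeff_rmc K H S X) = VS"
  by (simp add: coeff_rmc_def Let_def)

end

section \<open>The structure at the distinguished cilium\<close>

context kitaev begin

lemma graph_lmc_simps:
  assumes "R \<subseteq> cilia G"
  shows "lvs (graph_lmc K H M G R) = E"
  "lact (graph_lmc K H M G R) t m = commuting_family.gact K H E NC R t m"
  "lcoact (graph_lmc K H M G R) = multi_coact K H R NC E (sorted_list_of_set R) (\<lambda>_. undefined)"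
  unfolding graph_lmc_def Let_def commuting_family.gact_def[OF cilia_family assms] by simp_all

text \<open>The joint structure is formed over the cilia other than the distinguished one, so every
  commutation required is one between different cilia.\<close>

lemma base_inherit:
  assumes X: "\<And>c. c \<in> cilia G \<Longrightarrow> right_modcomod K H (X c)"
  shows "bit_inherit K (cilia_hopf K H (rest G)) (cilia_hopf K H (rest G))
    (coeff_rmc K H (rest G) X) (graph_lmc K H M G (rest G)) H (NC (base G))"
proof -
  let ?R = "rest G" and ?u = "\<lambda>_. undefined"
  have R: "?R \<subseteq> cilia G" and b: "base G \<in> cilia G - ?R" "base G \<in> cilia G" using base_cilia by auto
  interpret F: commuting_family K H E "cilia G" NC by (rule cilia_family)
  interpret Y: coefficients K H ?R X
    by (intro coefficients.intro coefficients_axioms.intro hopf_axioms) (use finite_cilia X in auto)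
  note gs = graph_lmc_simps[OF R] and cs = F.cs[OF R]
  have u: "?u \<in> (\<Pi>\<^sub>E i\<in>?R - set (sorted_list_of_set ?R). carrier A)"
    using finite_cilia by (simp add: PiE_def extensional_def)
  note sub = cs(1)[THEN equalityD1]
  show ?thesis
  proof (intro bit_inherit.intro bitensor.intro bitensor_axioms.intro bit_inherit_axioms.intro base_field_axioms hopf_axioms,
      unfold gs Y.rvs_coeff)
    show "vsp Y.VS" by (rule Y.vVS)
    show "vsp E" by (rule vE)
    show "vsp Y.HS" by (rule Y.vHS)
    show "lin Y.VS (Y.VS \<boxtimes> Y.HS) (rcoact (coeff_rmc K H ?R X))" by (rule Y.lin_rcoact_coeff)
    show "lin E (Y.HS \<boxtimes> E) (multi_coact K H ?R NC E (sorted_list_of_set ?R) ?u)"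
      by (rule F.lin_mc(1)[OF R sub cs(2) u])
    show "ract (coeff_rmc K H ?R X) x a \<in> carrier Y.VS" if "x \<in> carrier Y.VS" "a \<in> carrier Y.HS" for x a
      by (rule Y.ract_coeff_closed[OF that])
    show "F.gact ?R a n \<in> carrier E" if "n \<in> carrier E" "a \<in> carrier Y.HS" for n a
      by (rule bilD(3)[OF F.bil_gact[OF R] that(2,1)])
    show "bil A E E (\<lambda>a n. lact (NC (base G)) a n)" by (rule F.bil_N[OF b(2)])
    show "lin E (A \<boxtimes> E) (lcoact (NC (base G)))" by (rule F.lin_N[OF b(2)])
    show "lact (NC (base G)) uA n = n" if "n \<in> carrier E" for n by (rule F.N_one[OF b(2) that])
    show "lin E E (F.gact ?R a)" if "a \<in> carrier Y.HS" for a
      by (rule bilD(1)[OF F.bil_gact[OF R] that])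
    show "lact (NC (base G)) h (F.gact ?R a n) = F.gact ?R a (lact (NC (base G)) h n)"
      if "h \<in> carrier A" "a \<in> carrier Y.HS" "n \<in> carrier E" for h a n
      by (rule F.gact_act[OF R b(1) that])
    show "multi_coact K H ?R NC E (sorted_list_of_set ?R) ?u (lact (NC (base G)) h n) =
      tm Y.HS E Y.HS E (\<lambda>x. x) (lact (NC (base G)) h) (multi_coact K H ?R NC E (sorted_list_of_set ?R) ?u n)"
      if "h \<in> carrier A" "n \<in> carrier E" for h n
      by (rule F.mc_act[OF R sub cs(2) u b(1) that])
    show "lcoact (NC (base G)) (F.gact ?R a n) =
      tm A E A E (\<lambda>x. x) (F.gact ?R a) (lcoact (NC (base G)) n)"
      if "a \<in> carrier Y.HS" "n \<in> carrier E" for a n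
      by (rule F.coact_gact[OF R b(1) that])
    show "cocomm A Y.HS E (lcoact (NC (base G))) (multi_coact K H ?R NC E (sorted_list_of_set ?R) ?u) n"
      if "n \<in> carrier E" for n
      by (rule F.mc_cocomm[OF R sub cs(2) u b(1) that])
  qed
qed

end

section \<open>The embedding \<kappa> and the projection \<nu>\<close>

section \<open>The canonical maps\<close>

lemma (in bitensor) \<pi>_const:
  assumes "vsp Y" "lin T Y f" "balanced Y f" "z \<in> carrier T" "y \<in> \<pi> z"
  shows "f y = f z"
  by (rule coset_const[OF vT assms(1) rel_sub assms(2) _ assms(4)], rule balanced_rel[OF assms(1-3)])
     (use assms(5) in \<open>simp_all add: \<pi>_coset\<close>)

lemma (in bitensor) \<pi>_subset: "z \<in> carrier T \<Longrightarrow> \<pi> z \<subseteq> carrier T" and \<pi>_self: "z \<in> carrier T \<Longrightarrow> z \<in> \<pi> z"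
  unfolding \<pi>_coset by (rule coset_subset[OF rel_sub], assumption, rule coset_self[OF rel_sub])

locale module_pair = hopf K H for K :: "'k ring" and H :: "('k, 'h) hopf" +
  fixes X :: "('k, 'h, 'h, 'x) rmc" and Y :: "('k, 'h, 'h, 'y) rmc"
    and P :: "('k, 'h, 'h, 'p) lmc" and Q :: "('k, 'h, 'h, 'q) lmc"
  assumes X: "right_modcomod K H X" and Y: "right_modcomod K H Y"
    and vP: "vsp (lvs P)" and vQ: "vsp (lvs Q)"
    and bil_P: "bil A (lvs P) (lvs P) (\<lambda>a p. lact P a p)" and bil_Q: "bil A (lvs Q) (lvs Q) (\<lambda>a p. lact Q a p)"
    and P_one: "p \<in> carrier (lvs P) \<Longrightarrow> lact P uA p = p" and Q_one: "q \<in> carrier (lvs Q) \<Longrightarrow> lact Q uA q = q"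
    and lin_P: "lin (lvs P) (A \<boxtimes> lvs P) (lcoact P)" and lin_Q: "lin (lvs Q) (A \<boxtimes> lvs Q) (lcoact Q)"
begin

lemmas XM = right_modcomodD[OF X] and YM = right_modcomodD[OF Y]

abbreviation "VX \<equiv> rvs X"
abbreviation "VY \<equiv> rvs Y"
abbreviation "UP \<equiv> lvs P"
abbreviation "UQ \<equiv> lvs Q"
abbreviation "XY \<equiv> VX \<boxtimes> VY"
abbreviation "PQ \<equiv> UP \<boxtimes> UQ"
abbreviation "TT \<equiv> XY \<boxtimes> PQ"
abbreviation "AA \<equiv> A \<boxtimes> A"
abbreviation "WW \<equiv> XY \<boxtimes> A \<boxtimes> PQ"

lemmas PI = lin_intros vA XM(1) YM(1) vP vQ
  bil_arg1[OF XM(2)] bil_arg2[OF XM(2)] bilD[OF XM(2)] bil_arg1[OF YM(2)] bil_arg2[OF YM(2)] bilD[OF YM(2)]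
  bil_arg1[OF bil_P] bil_arg2[OF bil_P] bilD[OF bil_P] bil_arg1[OF bil_Q] bil_arg2[OF bil_Q] bilD[OF bil_Q]
  lin_comp[OF XM(3)] lin_closed[OF XM(3)] XM(3) lin_comp[OF YM(3)] lin_closed[OF YM(3)] YM(3)
  lin_comp[OF lin_P] lin_closed[OF lin_P] lin_P lin_comp[OF lin_Q] lin_closed[OF lin_Q] lin_Q

lemma bil_rtensor: "bil XY AA XY (\<lambda>z t. rtensor_act K H X Y z t)"
proof (rule bilI)
  fix z assume z: "z \<in> carrier XY"
  show "lin AA XY (\<lambda>t. rtensor_act K H X Y z t)"
    unfolding rtensor_act_def tensor_map_def by ((rule PI z | assumption)+)
next
  fix t assume t: "t \<in> carrier AA"
  show "lin XY XY (\<lambda>z. rtensor_act K H X Y z t)"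
    unfolding rtensor_act_def tensor_map_def by ((rule PI t | assumption)+)
qed

lemma bil_ltensor: "bil AA PQ PQ (\<lambda>t z. ltensor_act K H P Q t z)"
proof (rule bilI)
  fix z assume z: "z \<in> carrier PQ"
  show "lin AA PQ (\<lambda>t. ltensor_act K H P Q t z)"
    unfolding ltensor_act_def tensor_map_def by ((rule PI z | assumption)+)
next
  fix t assume t: "t \<in> carrier AA"
  show "lin PQ PQ (\<lambda>z. ltensor_act K H P Q t z)"
    unfolding ltensor_act_def tensor_map_def by ((rule PI t | assumption)+)
qed

lemma rtensor_tp:
  assumes m: "x \<in> carrier VX" "y \<in> carrier VY" "a \<in> carrier A" "b \<in> carrier A"
  shows "rtensor_act K H X Y (tp VX VY x y) (tp A A a b) = tp VX VY (ract X x a) (ract Y y b)"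
proof -
  have "rtensor_act K H X Y (tp VX VY x y) (tp A A a b) =
    tm VX VY VX VY (\<lambda>x. ract X x a) (\<lambda>y. ract Y y b) (tp VX VY x y)"
    unfolding rtensor_act_def by (rule tl_tp) (unfold tensor_map_def, (rule PI m | assumption)+)
  also have "\<dots> = tp VX VY (ract X x a) (ract Y y b)" by (rule tm_tp) ((rule PI m)+)
  finally show ?thesis .
qed

lemma ltensor_tp:
  assumes m: "p \<in> carrier UP" "q \<in> carrier UQ" "a \<in> carrier A" "b \<in> carrier A"
  shows "ltensor_act K H P Q (tp A A a b) (tp UP UQ p q) = tp UP UQ (lact P a p) (lact Q b q)"
proof -
  have "ltensor_act K H P Q (tp A A a b) (tp UP UQ p q) =
    tm UP UQ UP UQ (\<lambda>p. lact P a p) (\<lambda>q. lact Q b q) (tp UP UQ p q)"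
    unfolding ltensor_act_def by (rule tl_tp) (unfold tensor_map_def, (rule PI m | assumption)+)
  also have "\<dots> = tp UP UQ (lact P a p) (lact Q b q)" by (rule tm_tp) ((rule PI m)+)
  finally show ?thesis .
qed

lemma lin_rtensor_coact: "lin XY (XY \<boxtimes> A) (\<lambda>z. rtensor_coact K H X Y z)"
  unfolding rtensor_coact_def Let_def by ((rule PI | assumption)+)

lemma lin_ltensor_coact: "lin PQ (A \<boxtimes> PQ) (\<lambda>z. ltensor_coact K H P Q z)"
  unfolding ltensor_coact_def Let_def by ((rule PI | assumption)+)

lemma rtensor_coact_tp:
  assumes m: "x \<in> carrier VX" "y \<in> carrier VY"
  shows "rtensor_coact K H X Y (tp VX VY x y) = tlf VX A (XY \<boxtimes> A) (\<lambda>x a.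
    tlf VY A (XY \<boxtimes> A) (\<lambda>y b. tp XY A (tp VX VY x y) (a \<star> b)) (rcoact Y y)) (rcoact X x)"
  unfolding rtensor_coact_def Let_def by (rule tl_tp) ((rule PI m | assumption)+)

lemma ltensor_coact_tp:
  assumes m: "p \<in> carrier UP" "q \<in> carrier UQ"
  shows "ltensor_coact K H P Q (tp UP UQ p q) = tlf A UP (A \<boxtimes> PQ) (\<lambda>a p.
    tlf A UQ (A \<boxtimes> PQ) (\<lambda>b q. tp A PQ (a \<star> b) (tp UP UQ p q)) (lcoact Q q)) (lcoact P p)"
  unfolding ltensor_coact_def Let_def by (rule tl_tp) ((rule PI m | assumption)+)

text \<open>Four bitensor products enter: \<open>bX\<close> and \<open>bY\<close> for the two
  sources of \<kappa>, \<open>fa\<close> for the common target and \<open>dg\<close> for the source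
  of \<nu>. The last two have the same spaces and coactions and differ in their operators.\<close>

sublocale bX: bitensor K A A X P
  by (intro bitensor.intro bitensor_axioms.intro base_field_axioms) ((rule PI | assumption)+)

sublocale bY: bitensor K A A Y Q
  by (intro bitensor.intro bitensor_axioms.intro base_field_axioms) ((rule PI | assumption)+)

lemma factor_simps:
  "rvs (rfactor K H X Y) = XY" "ract (rfactor K H X Y) = rtensor_act K H X Y" "rcoact (rfactor K H X Y) = rtensor_coact K H X Y"
  "lvs (lfactor K H P Q) = PQ" "lact (lfactor K H P Q) = ltensor_act K H P Q" "lcoact (lfactor K H P Q) = ltensor_coact K H P Q"
  "rvs (rdiag K H X Y) = XY" "ract (rdiag K H X Y) z a = rtensor_act K H X Y z (\<Delta> a)" "rcoact (rdiag K H X Y) = rtensor_coact K H X Y"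
  "lvs (ldiag K H P Q) = PQ" "lact (ldiag K H P Q) a w = ltensor_act K H P Q (\<Delta> a) w" "lcoact (ldiag K H P Q) = ltensor_coact K H P Q"
  by (simp_all add: rfactor_def lfactor_def rdiag_def ldiag_def)

sublocale fa: bitensor K "A \<boxtimes> A" A "rfactor K H X Y" "lfactor K H P Q"
  by (intro bitensor.intro bitensor_axioms.intro base_field_axioms, unfold factor_simps)
     (assumption | rule vsp_tensor XM(1) YM(1) vP vQ vA bilD(3)[OF bil_rtensor] bilD(3)[OF bil_ltensor]
      lin_rtensor_coact[unfolded lin_def, folded lin_def] lin_ltensor_coact)+

sublocale dg: bitensor K A A "rdiag K H X Y" "ldiag K H P Q"
  by (intro bitensor.intro bitensor_axioms.intro base_field_axioms, unfold factor_simps)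
     (assumption | rule vsp_tensor XM(1) YM(1) vP vQ vA bilD(3)[OF bil_rtensor] bilD(3)[OF bil_ltensor]
      lin_rtensor_coact lin_ltensor_coact lin_closed[OF lin_\<Delta>])+

lemma Aux_eq: "Aux K H X Y P Q = fa.B" and Aux_proj_eq: "Aux_proj K H X Y P Q = fa.\<pi>"
  by (simp_all add: Aux_def Aux_proj_def)

abbreviation "sh \<equiv> shuffle K VX UP VY UQ"

lemma sh_def: "sh s t = tlf VX UP TT (\<lambda>x p. tlf VY UQ TT (\<lambda>y q. tp XY PQ (tp VX VY x y) (tp UP UQ p q)) t) s"
  by (simp add: shuffle_def Let_def)

lemma bil_sh: "bil bX.T bY.T TT (\<lambda>s t. sh s t)"
  unfolding sh_def by ((rule PI | assumption)+)

lemma sh_tp: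
  assumes m: "x \<in> carrier VX" "p \<in> carrier UP" "y \<in> carrier VY" "q \<in> carrier UQ"
  shows "sh (tp VX UP x p) (tp VY UQ y q) = tp XY PQ (tp VX VY x y) (tp UP UQ p q)"
proof -
  have "sh (tp VX UP x p) (tp VY UQ y q) =
    tlf VY UQ TT (\<lambda>y q. tp XY PQ (tp VX VY x y) (tp UP UQ p q)) (tp VY UQ y q)"
    unfolding sh_def by (rule tl_tp) ((rule PI m | assumption)+)
  also have "\<dots> = tp XY PQ (tp VX VY x y) (tp UP UQ p q)"
    by (rule tl_tp) ((rule PI m | assumption)+)
  finally show ?thesis .
qed

text \<open>The relations over \<open>H\<close> hold over \<open>H \<otimes> H\<close>, because \<open>a\<close> can be replaced by \<open>a \<otimes> 1\<close>, respectively \<open>1 \<otimes> a\<close>.\<close>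

lemma fa_move:
  assumes m: "x \<in> carrier VX" "p \<in> carrier UP" "y \<in> carrier VY" "q \<in> carrier UQ" "a \<in> carrier A" "b \<in> carrier A"
  shows "fa.\<pi> (tp XY PQ (tp VX VY (ract X x a) (ract Y y b)) (tp UP UQ p q)) =
    fa.\<pi> (tp XY PQ (tp VX VY x y) (tp UP UQ (lact P a p) (lact Q b q)))"
proof -
  have "fa.\<pi> (tp XY PQ (rtensor_act K H X Y (tp VX VY x y) (tp A A a b)) (tp UP UQ p q)) =
    fa.\<pi> (tp XY PQ (tp VX VY x y) (ltensor_act K H P Q (tp A A a b) (tp UP UQ p q)))"
    using fa.\<pi>_balanced unfolding fa.balanced_def factor_simps
    by (auto simp: m tp_closed vA XM(1) YM(1) vP vQ)
  then show ?thesis by (simp add: rtensor_tp ltensor_tp m)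
qed

lemma lin_fa\<pi>: "lin TT fa.Q fa.\<pi>"
  using fa.lin_\<pi> by (simp add: factor_simps)

text \<open>Independence of representatives, one argument at a time. Fixing the other argument means
  that the operator on that side is 1, which is where unitality of the actions enters.\<close>

lemma sh_\<pi>:
  assumes u: "u \<in> bX.\<pi> u0" "u0 \<in> carrier bX.T" and v: "v \<in> bY.\<pi> v0" "v0 \<in> carrier bY.T"
  shows "fa.\<pi> (sh u v) = fa.\<pi> (sh u0 v0)"
proof -
  have v': "v \<in> carrier bY.T" using bY.\<pi>_subset v by blast
  note J = PI lin_comp[OF lin_fa\<pi>] lin_fa\<pi> fa.vQ bil_arg1[OF bil_sh] bil_arg2[OF bil_sh] bilD[OF bil_sh]
  have "bX.balanced fa.Q (\<lambda>u. fa.\<pi> (sh u v))"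
    unfolding bX.balanced_def
  proof (intro ballI)
    fix x a p assume m: "x \<in> carrier VX" "a \<in> carrier A" "p \<in> carrier UP"
    have "\<forall>v\<in>carrier bY.T. fa.\<pi> (sh (tp VX UP (ract X x a) p) v) = fa.\<pi> (sh (tp VX UP x (lact P a p)) v)"
    proof (rule tens_ext)
      fix y q assume n: "y \<in> carrier VY" "q \<in> carrier UQ"
      show "fa.\<pi> (sh (tp VX UP (ract X x a) p) (tp VY UQ y q)) = fa.\<pi> (sh (tp VX UP x (lact P a p)) (tp VY UQ y q))"
        using fa_move[OF m(1,3) n m(2) uA_closed] by (simp add: sh_tp m n XM(4) YM(4) Q_one bX.ract_closed bX.lact_closed)
    qed ((rule J m)+)
    with v' show "fa.\<pi> (sh (tp VX UP (ract X x a) p) v) = fa.\<pi> (sh (tp VX UP x (lact P a p)) v)" by blast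
  qed
  then have 1: "fa.\<pi> (sh u v) = fa.\<pi> (sh u0 v)"
    by (rule bX.\<pi>_const[OF fa.vQ lin_comp[OF lin_fa\<pi> bilD(2)[OF bil_sh v']] _ u(2,1)])
  have "bY.balanced fa.Q (\<lambda>v. fa.\<pi> (sh u0 v))"
    unfolding bY.balanced_def
  proof (intro ballI)
    fix y a q assume m: "y \<in> carrier VY" "a \<in> carrier A" "q \<in> carrier UQ"
    have "\<forall>u\<in>carrier bX.T. fa.\<pi> (sh u (tp VY UQ (ract Y y a) q)) = fa.\<pi> (sh u (tp VY UQ y (lact Q a q)))"
    proof (rule tens_ext)
      fix x p assume n: "x \<in> carrier VX" "p \<in> carrier UP"
      show "fa.\<pi> (sh (tp VX UP x p) (tp VY UQ (ract Y y a) q)) = fa.\<pi> (sh (tp VX UP x p) (tp VY UQ y (lact Q a q)))"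
        using fa_move[OF n m(1,3) uA_closed m(2)] by (simp add: sh_tp m n XM(4) YM(4) P_one bY.ract_closed bY.lact_closed)
    qed ((rule J m)+)
    with u(2) show "fa.\<pi> (sh u0 (tp VY UQ (ract Y y a) q)) = fa.\<pi> (sh u0 (tp VY UQ y (lact Q a q)))" by blast
  qed
  then have "fa.\<pi> (sh u0 v) = fa.\<pi> (sh u0 v0)"
    by (rule bY.\<pi>_const[OF fa.vQ lin_comp[OF lin_fa\<pi> bilD(1)[OF bil_sh u(2)]] _ v(2,1)])
  with 1 show ?thesis by simp
qed

definition "k0 b c = the_elem ((\<lambda>(u, v). fa.\<pi> (sh u v)) ` (b \<times> c))"

lemma k0_\<pi>:
  assumes "u \<in> carrier bX.T" "v \<in> carrier bY.T"
  shows "k0 (bX.\<pi> u) (bY.\<pi> v) = fa.\<pi> (sh u v)"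
proof -
  have "the_elem ((\<lambda>(u, v). fa.\<pi> (sh u v)) ` (bX.\<pi> u \<times> bY.\<pi> v)) = (\<lambda>(u, v). fa.\<pi> (sh u v)) (u, v)"
  proof (rule the_elem_image_unique)
    show "bX.\<pi> u \<times> bY.\<pi> v \<noteq> {}" using bX.\<pi>_self[OF assms(1)] bY.\<pi>_self[OF assms(2)] by blast
    fix y assume "y \<in> bX.\<pi> u \<times> bY.\<pi> v"
    then obtain u' v' where y: "y = (u', v')" "u' \<in> bX.\<pi> u" "v' \<in> bY.\<pi> v" by blast
    show "(\<lambda>(u, v). fa.\<pi> (sh u v)) y = (\<lambda>(u, v). fa.\<pi> (sh u v)) (u, v)"
      unfolding y(1) prod.case by (rule sh_\<pi>[OF y(2) assms(1) y(3) assms(2)])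
  qed
  then show ?thesis unfolding k0_def prod.case .
qed

text \<open>\<open>?\<Psi>\<close> multiplies the coefficients of the two factors and shuffles the
  rest. Because the coactions are codiagonal, each of the two maps defining the cotensor product of
  the tensor products is \<open>?\<Psi>\<close> of the corresponding maps of the factors; if these
  agree on u and on v, so do the former on the shuffle.\<close>

lemma sh_cot:
  assumes u: "u \<in> bX.cot" and v: "v \<in> bY.cot"
  shows "sh u v \<in> fa.cot"
proof -
  let ?\<Psi> = "\<lambda>s t. tlf VX (A \<boxtimes> UP) WW (\<lambda>x s. tlf A UP WW (\<lambda>c p. tlf VY (A \<boxtimes> UQ) WW (\<lambda>y t. tlf A UQ WW (\<lambda>d q.
    tp XY (A \<boxtimes> PQ) (tp VX VY x y) (tp A PQ (c \<star> d) (tp UP UQ p q))) t) t) s) s"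
  note J = PI bil_arg1[OF bil_sh] bil_arg2[OF bil_sh] bilD[OF bil_sh]
  have bb: "bil bX.W bY.W WW (\<lambda>s t. ?\<Psi> s t)" by ((rule J | assumption)+)
  have p1: "?\<Psi> (tp VX (A \<boxtimes> UP) x s) t = tlf A UP WW (\<lambda>c p. tlf VY (A \<boxtimes> UQ) WW (\<lambda>y t. tlf A UQ WW (\<lambda>d q.
    tp XY (A \<boxtimes> PQ) (tp VX VY x y) (tp A PQ (c \<star> d) (tp UP UQ p q))) t) t) s"
    if "x \<in> carrier VX" "s \<in> carrier (A \<boxtimes> UP)" "t \<in> carrier bY.W" for x s t
    by (rule tl_tp) ((rule J that | assumption)+)
  have p2: "tlf VY (A \<boxtimes> UQ) WW (\<lambda>y t. tlf A UQ WW (\<lambda>d q.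
      tp XY (A \<boxtimes> PQ) (tp VX VY x y) (tp A PQ (c \<star> d) (tp UP UQ p q))) t) (tp VY (A \<boxtimes> UQ) y t) =
    tlf A UQ WW (\<lambda>d q. tp XY (A \<boxtimes> PQ) (tp VX VY x y) (tp A PQ (c \<star> d) (tp UP UQ p q))) t"
    if "x \<in> carrier VX" "c \<in> carrier A" "p \<in> carrier UP" "y \<in> carrier VY" "t \<in> carrier (A \<boxtimes> UQ)" for x c p y t
    by (rule tl_tp) ((rule J that | assumption)+)
  have p3: "?\<Psi> (tp VX (A \<boxtimes> UP) x (tp A UP c p)) (tp VY (A \<boxtimes> UQ) y (tp A UQ d q)) =
    tp XY (A \<boxtimes> PQ) (tp VX VY x y) (tp A PQ (c \<star> d) (tp UP UQ p q))"
    if m: "x \<in> carrier VX" "c \<in> carrier A" "p \<in> carrier UP" "y \<in> carrier VY" "d \<in> carrier A" "q \<in> carrier UQ" for x c p y d q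
  proof -
    have "?\<Psi> (tp VX (A \<boxtimes> UP) x (tp A UP c p)) (tp VY (A \<boxtimes> UQ) y (tp A UQ d q)) =
      tlf A UP WW (\<lambda>c p. tlf VY (A \<boxtimes> UQ) WW (\<lambda>y t. tlf A UQ WW (\<lambda>d q.
      tp XY (A \<boxtimes> PQ) (tp VX VY x y) (tp A PQ (c \<star> d) (tp UP UQ p q))) t) (tp VY (A \<boxtimes> UQ) y (tp A UQ d q))) (tp A UP c p)"
      by (rule p1) ((rule J m)+)
    also have "\<dots> = tlf VY (A \<boxtimes> UQ) WW (\<lambda>y t. tlf A UQ WW (\<lambda>d q.
      tp XY (A \<boxtimes> PQ) (tp VX VY x y) (tp A PQ (c \<star> d) (tp UP UQ p q))) t) (tp VY (A \<boxtimes> UQ) y (tp A UQ d q))"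
      by (rule tl_tp) ((rule J m | assumption)+)
    also have "\<dots> = tlf A UQ WW (\<lambda>d q. tp XY (A \<boxtimes> PQ) (tp VX VY x y) (tp A PQ (c \<star> d) (tp UP UQ p q))) (tp A UQ d q)"
      by (rule p2) ((rule J m)+)
    also have "\<dots> = tp XY (A \<boxtimes> PQ) (tp VX VY x y) (tp A PQ (c \<star> d) (tp UP UQ p q))"
      by (rule tl_tp) ((rule J m | assumption)+)
    finally show ?thesis .
  qed
  have l1: "lin bX.W WW (\<lambda>s. ?\<Psi> s t)" if "t \<in> carrier bY.W" for t using bilD(2)[OF bb that] .
  have l2: "lin bY.W WW (\<lambda>t. ?\<Psi> s t)" if "s \<in> carrier bX.W" for s using bilD(1)[OF bb that] .
  note t1 = fa.lin_\<theta>(1)[unfolded factor_simps] and t2 = fa.lin_\<theta>(2)[unfolded factor_simps]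
  note K = J bil_arg1[OF bb] bil_arg2[OF bb] lin_closed[OF bX.lin_\<theta>(1)] lin_closed[OF bX.lin_\<theta>(2)]
    lin_closed[OF bY.lin_\<theta>(1)] lin_closed[OF bY.lin_\<theta>(2)] bX.lin_\<theta> bY.lin_\<theta> lin_comp[OF t1] lin_comp[OF t2]
  have 1: "fa.\<theta>1 (sh (tp VX UP x p) (tp VY UQ y q)) = ?\<Psi> (bX.\<theta>1 (tp VX UP x p)) (bY.\<theta>1 (tp VY UQ y q))"
    if m: "x \<in> carrier VX" "p \<in> carrier UP" "y \<in> carrier VY" "q \<in> carrier UQ" for x p y q
  proof -
    have xy: "tp VX VY x y \<in> carrier XY" "tp UP UQ p q \<in> carrier PQ" by ((rule J m)+)
    have c1: "bY.\<theta>1 (tp VY UQ y q) \<in> carrier bY.W" by ((rule K m)+)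
    have "fa.\<theta>1 (sh (tp VX UP x p) (tp VY UQ y q)) =
      tlf XY A WW (\<lambda>z c. tp XY (A \<boxtimes> PQ) z (tp A PQ c (tp UP UQ p q))) (rtensor_coact K H X Y (tp VX VY x y))"
      using fa.\<theta>_tp(1)[unfolded factor_simps, OF xy] by (simp only: sh_tp[OF m] factor_simps)
    also have "\<dots> = tlf VX A WW (\<lambda>x c. tlf XY A WW (\<lambda>z c. tp XY (A \<boxtimes> PQ) z (tp A PQ c (tp UP UQ p q)))
      (tlf VY A (XY \<boxtimes> A) (\<lambda>y d. tp XY A (tp VX VY x y) (c \<star> d)) (rcoact Y y))) (rcoact X x)"
      unfolding rtensor_coact_tp[OF m(1,3)] by (rule tl_push) ((rule J m xy | assumption)+)
    also have "\<dots> = tlf VX A WW (\<lambda>x c. tlf VY A WW (\<lambda>y d.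
      tp XY (A \<boxtimes> PQ) (tp VX VY x y) (tp A PQ (c \<star> d) (tp UP UQ p q))) (rcoact Y y)) (rcoact X x)"
    proof (rule tl_cong, (rule J m xy | assumption)+)
      fix x' c assume n: "x' \<in> carrier VX" "c \<in> carrier A"
      have "tlf XY A WW (\<lambda>z c. tp XY (A \<boxtimes> PQ) z (tp A PQ c (tp UP UQ p q)))
          (tlf VY A (XY \<boxtimes> A) (\<lambda>y d. tp XY A (tp VX VY x' y) (c \<star> d)) (rcoact Y y)) =
        tlf VY A WW (\<lambda>y d. tlf XY A WW (\<lambda>z c. tp XY (A \<boxtimes> PQ) z (tp A PQ c (tp UP UQ p q)))
          (tp XY A (tp VX VY x' y) (c \<star> d))) (rcoact Y y)"
        by (rule tl_push) ((rule J m xy n | assumption)+)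
      also have "\<dots> = tlf VY A WW (\<lambda>y d. tp XY (A \<boxtimes> PQ) (tp VX VY x' y) (tp A PQ (c \<star> d) (tp UP UQ p q))) (rcoact Y y)"
        by (rule tl_cong, (rule J m xy n | assumption)+, rule tl_tp) ((rule J m xy n | assumption)+)
      finally show "tlf XY A WW (\<lambda>z c. tp XY (A \<boxtimes> PQ) z (tp A PQ c (tp UP UQ p q)))
          (tlf VY A (XY \<boxtimes> A) (\<lambda>y d. tp XY A (tp VX VY x' y) (c \<star> d)) (rcoact Y y)) = \<dots>" .
    qed
    also have "\<dots> = tlf VX A WW (\<lambda>x c. ?\<Psi> (tp VX (A \<boxtimes> UP) x (tp A UP c p)) (bY.\<theta>1 (tp VY UQ y q))) (rcoact X x)"
    proof (rule tl_cong, (rule J m xy | assumption)+)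
      fix x' c assume n: "x' \<in> carrier VX" "c \<in> carrier A"
      have s: "tp VX (A \<boxtimes> UP) x' (tp A UP c p) \<in> carrier bX.W" by ((rule J m n)+)
      have "?\<Psi> (tp VX (A \<boxtimes> UP) x' (tp A UP c p)) (bY.\<theta>1 (tp VY UQ y q)) =
        tlf VY A WW (\<lambda>y d. ?\<Psi> (tp VX (A \<boxtimes> UP) x' (tp A UP c p)) (tp VY (A \<boxtimes> UQ) y (tp A UQ d q))) (rcoact Y y)"
        unfolding bY.\<theta>_tp(1)[OF m(3,4)] by (rule tl_push[OF YM(1) vA _ _ l2[OF s]]) ((rule J m n s | assumption)+)
      also have "\<dots> = tlf VY A WW (\<lambda>y d. tp XY (A \<boxtimes> PQ) (tp VX VY x' y) (tp A PQ (c \<star> d) (tp UP UQ p q))) (rcoact Y y)"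
        by (rule tl_cong, (rule K m n s | assumption)+, rule p3) ((rule J m n | assumption)+)
      finally show "tlf VY A WW (\<lambda>y d. tp XY (A \<boxtimes> PQ) (tp VX VY x' y) (tp A PQ (c \<star> d) (tp UP UQ p q))) (rcoact Y y) =
        ?\<Psi> (tp VX (A \<boxtimes> UP) x' (tp A UP c p)) (bY.\<theta>1 (tp VY UQ y q))" ..
    qed
    also have "\<dots> = ?\<Psi> (bX.\<theta>1 (tp VX UP x p)) (bY.\<theta>1 (tp VY UQ y q))"
      unfolding bX.\<theta>_tp(1)[OF m(1,2)] by (rule tl_push[symmetric, OF XM(1) vA _ _ l1[OF c1]]) ((rule J m | assumption)+)
    finally show ?thesis .
  qed
  have 2: "fa.\<theta>2 (sh (tp VX UP x p) (tp VY UQ y q)) = ?\<Psi> (bX.\<theta>2 (tp VX UP x p)) (bY.\<theta>2 (tp VY UQ y q))"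
    if m: "x \<in> carrier VX" "p \<in> carrier UP" "y \<in> carrier VY" "q \<in> carrier UQ" for x p y q
  proof -
    have xy: "tp VX VY x y \<in> carrier XY" "tp UP UQ p q \<in> carrier PQ" by ((rule J m)+)
    have "fa.\<theta>2 (sh (tp VX UP x p) (tp VY UQ y q)) = tp XY (A \<boxtimes> PQ) (tp VX VY x y) (ltensor_coact K H P Q (tp UP UQ p q))"
      using fa.\<theta>_tp(2)[unfolded factor_simps, OF xy] by (simp only: sh_tp[OF m] factor_simps)
    also have "\<dots> = tlf A UP WW (\<lambda>c p. tp XY (A \<boxtimes> PQ) (tp VX VY x y)
      (tlf A UQ (A \<boxtimes> PQ) (\<lambda>d q. tp A PQ (c \<star> d) (tp UP UQ p q)) (lcoact Q q))) (lcoact P p)"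
      unfolding ltensor_coact_tp[OF m(2,4)] by (rule tl_push) ((rule J m xy | assumption)+)
    also have "\<dots> = tlf A UP WW (\<lambda>c p. tlf A UQ WW (\<lambda>d q. tp XY (A \<boxtimes> PQ) (tp VX VY x y)
      (tp A PQ (c \<star> d) (tp UP UQ p q))) (lcoact Q q)) (lcoact P p)"
      by (rule tl_cong, (rule J m xy | assumption)+, rule tl_push) ((rule J m xy | assumption)+)
    also have "\<dots> = tlf A UP WW (\<lambda>c p. tlf VY (A \<boxtimes> UQ) WW (\<lambda>y t. tlf A UQ WW (\<lambda>d q.
      tp XY (A \<boxtimes> PQ) (tp VX VY x y) (tp A PQ (c \<star> d) (tp UP UQ p q))) t) (tp VY (A \<boxtimes> UQ) y (lcoact Q q))) (lcoact P p)"
      by (rule tl_cong, (rule J m xy | assumption)+, rule p2[symmetric]) ((rule J m | assumption)+)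
    also have "\<dots> = ?\<Psi> (bX.\<theta>2 (tp VX UP x p)) (bY.\<theta>2 (tp VY UQ y q))"
      unfolding bX.\<theta>_tp(2)[OF m(1,2)] bY.\<theta>_tp(2)[OF m(3,4)] by (rule p1[symmetric]) ((rule J m)+)
    finally show ?thesis .
  qed
  \<comment> \<open>Extensionality in two variables, stated once for both pairs of maps.\<close>
  have e: "f (sh u v) = g u v"
    if f: "lin TT WW f" and g: "bil bX.T bY.T WW g" and u: "u \<in> carrier bX.T" and v: "v \<in> carrier bY.T"
      and fg: "\<And>x p y q. x \<in> carrier VX \<Longrightarrow> p \<in> carrier UP \<Longrightarrow> y \<in> carrier VY \<Longrightarrow> q \<in> carrier UQ \<Longrightarrow>
        f (sh (tp VX UP x p) (tp VY UQ y q)) = g (tp VX UP x p) (tp VY UQ y q)" for f g u v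
  proof -
    have "\<forall>u\<in>carrier bX.T. f (sh u v) = g u v"
    proof (rule tens_ext)
      fix x p assume m: "x \<in> carrier VX" "p \<in> carrier UP"
      have xp: "tp VX UP x p \<in> carrier bX.T" by ((rule J m)+)
      have "\<forall>v\<in>carrier bY.T. f (sh (tp VX UP x p) v) = g (tp VX UP x p) v"
        by (rule tens_ext) ((rule J lin_comp[OF f] bilD(1)[OF g] xp fg m | assumption)+)
      with v show "f (sh (tp VX UP x p) v) = g (tp VX UP x p) v" by blast
    qed ((rule J lin_comp[OF f] bilD(2)[OF g] v)+)
    with u show ?thesis by blast
  qed
  have uv: "u \<in> carrier bX.T" "v \<in> carrier bY.T" using u v bX.cot_closed bY.cot_closed by auto
  have b1: "bil bX.T bY.T WW (\<lambda>u v. ?\<Psi> (bX.\<theta>1 u) (bY.\<theta>1 v))" by ((rule bilI K | assumption)+)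
  have b2: "bil bX.T bY.T WW (\<lambda>u v. ?\<Psi> (bX.\<theta>2 u) (bY.\<theta>2 v))" by ((rule bilI K | assumption)+)
  have "fa.\<theta>1 (sh u v) = ?\<Psi> (bX.\<theta>1 u) (bY.\<theta>1 v)" unfolding factor_simps by (rule e[OF t1 b1 uv]) (rule 1[unfolded factor_simps])
  also have "\<dots> = ?\<Psi> (bX.\<theta>2 u) (bY.\<theta>2 v)" using u v by (simp add: bX.cot_iff bY.cot_iff)
  also have "\<dots> = fa.\<theta>2 (sh u v)" unfolding factor_simps by (rule e[symmetric, OF t2 b2 uv]) (rule 2[unfolded factor_simps])
  finally show ?thesis using bilD(3)[OF bil_sh uv] by (simp add: fa.cot_iff factor_simps)
qed

lemma bil_k0: "bil bX.B bY.B fa.B (\<lambda>b c. k0 b c)"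
proof -
  have c: "k0 b c \<in> carrier fa.B" if bc: "b \<in> carrier bX.B" "c \<in> carrier bY.B" for b c
  proof -
    obtain u v where u: "b = bX.\<pi> u" "u \<in> bX.cot" and v: "c = bY.\<pi> v" "v \<in> bY.cot"
      using bc unfolding bX.carrier_Bit bY.carrier_Bit by blast
    then have "k0 b c = fa.\<pi> (sh u v)" using k0_\<pi> bX.cot_closed bY.cot_closed by simp
    then show ?thesis using sh_cot[OF u(2) v(2)] by (simp add: fa.carrier_Bit)
  qed
  show ?thesis
  proof (rule bilI)
    fix b assume b: "b \<in> carrier bX.B"
    then obtain u where u: "b = bX.\<pi> u" "u \<in> carrier bX.T"
      unfolding bX.carrier_Bit using bX.cot_closed by blast
    have "lin bY.Q fa.Q (\<lambda>c. k0 b c)"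
      by (rule bY.lin_from_Q[OF fa.vQ lin_comp[OF lin_fa\<pi> bilD(1)[OF bil_sh u(2)]]]) (simp add: u k0_\<pi>)
    then show "lin bY.B fa.B (\<lambda>c. k0 b c)" by (rule fa.lin_to_B[OF bY.lin_from_B]) (rule c[OF b])
  next
    fix b assume b: "b \<in> carrier bY.B"
    then obtain v where v: "b = bY.\<pi> v" "v \<in> carrier bY.T"
      unfolding bY.carrier_Bit using bY.cot_closed by blast
    have "lin bX.Q fa.Q (\<lambda>a. k0 a b)"
      by (rule bX.lin_from_Q[OF fa.vQ lin_comp[OF lin_fa\<pi> bilD(2)[OF bil_sh v(2)]]]) (simp add: v k0_\<pi>)
    then show "lin bX.B fa.B (\<lambda>a. k0 a b)" by (rule fa.lin_to_B[OF bX.lin_from_B]) (rule c[OF _ b])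
  qed
qed

lemma kappa_eq: "kappa K H X Y P Q = tlf bX.B bY.B fa.B (\<lambda>b c. k0 b c)"
  by (simp add: kappa_def k0_def Aux_eq Aux_proj_eq)

lemma lin_kappa: "lin (bX.B \<boxtimes> bY.B) fa.B (kappa K H X Y P Q)"
  unfolding kappa_eq by (rule lin_tl_self[OF bX.vB bY.vB fa.vB bil_k0])

lemma inj_kappa: "inj_on (kappa K H X Y P Q) (carrier (bX.B \<boxtimes> bY.B))"
proof -
  \<comment> \<open>The target is the tensor product of the full quotients and not of the bitensor
    products, because \<open>?l\<close> is defined on all of \<open>TT\<close>, without any cotensor
    condition.\<close>
  let ?QQ = "bX.Q \<boxtimes> bY.Q"
  let ?l = "\<lambda>t. tlf XY PQ ?QQ (\<lambda>z w. tlf VX VY ?QQ (\<lambda>x y. tlf UP UQ ?QQ (\<lambda>p q.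
    tp bX.Q bY.Q (bX.\<pi> (tp VX UP x p)) (bY.\<pi> (tp VY UQ y q))) w) z) t"
  note J = PI bX.vQ bY.vQ lin_comp[OF bX.lin_\<pi>] lin_comp[OF bY.lin_\<pi>] bX.\<pi>_closed bY.\<pi>_closed
    bil_arg1[OF bil_sh] bil_arg2[OF bil_sh] bilD[OF bil_sh]
    bil_arg1[OF bil_rtensor] bil_arg2[OF bil_rtensor] bilD[OF bil_rtensor]
    bil_arg1[OF bil_ltensor] bil_arg2[OF bil_ltensor] bilD[OF bil_ltensor]
  have b1: "bil XY PQ ?QQ (\<lambda>z w. tlf VX VY ?QQ (\<lambda>x y. tlf UP UQ ?QQ (\<lambda>p q.
    tp bX.Q bY.Q (bX.\<pi> (tp VX UP x p)) (bY.\<pi> (tp VY UQ y q))) w) z)" by ((rule J | assumption)+)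
  have vQQ: "vsp ?QQ" by ((rule J)+)
  have vTT: "vsp XY" "vsp PQ" by ((rule J)+)
  have ll: "lin TT ?QQ ?l" by (rule lin_tl_self[OF vTT vQQ b1])
  have l_tp: "?l (tp XY PQ (tp VX VY x y) (tp UP UQ p q)) = tp bX.Q bY.Q (bX.\<pi> (tp VX UP x p)) (bY.\<pi> (tp VY UQ y q))"
    if m: "x \<in> carrier VX" "p \<in> carrier UP" "y \<in> carrier VY" "q \<in> carrier UQ" for x p y q
  proof -
    have "?l (tp XY PQ (tp VX VY x y) (tp UP UQ p q)) = tlf VX VY ?QQ (\<lambda>x y. tlf UP UQ ?QQ (\<lambda>p q.
      tp bX.Q bY.Q (bX.\<pi> (tp VX UP x p)) (bY.\<pi> (tp VY UQ y q))) (tp UP UQ p q)) (tp VX VY x y)"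
      by (rule tl_tp[OF vTT vQQ b1]) ((rule J m)+)
    also have "\<dots> = tlf UP UQ ?QQ (\<lambda>p q.
      tp bX.Q bY.Q (bX.\<pi> (tp VX UP x p)) (bY.\<pi> (tp VY UQ y q))) (tp UP UQ p q)"
      by (rule tl_tp) ((rule J m | assumption)+)
    also have "\<dots> = tp bX.Q bY.Q (bX.\<pi> (tp VX UP x p)) (bY.\<pi> (tp VY UQ y q))"
      by (rule tl_tp) ((rule J m | assumption)+)
    finally show ?thesis .
  qed
  note J = J lin_comp[OF ll]
  \<comment> \<open>It suffices to take pure tensors in all three arguments. There the operator a
    \<otimes> b crosses each of the two factors separately.\<close>
  have "fa.balanced ?QQ ?l"
    unfolding fa.balanced_def factor_simps
  proof (intro ballI)
    fix z t w assume z: "z \<in> carrier XY" and t: "t \<in> carrier AA" and w: "w \<in> carrier PQ"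
    have "\<forall>z\<in>carrier XY. ?l (tp XY PQ (rtensor_act K H X Y z t) w) = ?l (tp XY PQ z (ltensor_act K H P Q t w))"
    proof (rule tens_ext)
      fix x y assume m: "x \<in> carrier VX" "y \<in> carrier VY"
      let ?z = "tp VX VY x y"
      have z: "?z \<in> carrier XY" by ((rule J m)+)
      have "\<forall>t\<in>carrier AA. ?l (tp XY PQ (rtensor_act K H X Y ?z t) w) = ?l (tp XY PQ ?z (ltensor_act K H P Q t w))"
      proof (rule tens_ext)
        fix a b assume ab: "a \<in> carrier A" "b \<in> carrier A"
        have tc: "tp A A a b \<in> carrier AA" by ((rule J ab)+)
        have "\<forall>w\<in>carrier PQ. ?l (tp XY PQ (rtensor_act K H X Y ?z (tp A A a b)) w) = ?l (tp XY PQ ?z (ltensor_act K H P Q (tp A A a b) w))"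
        proof (rule tens_ext)
          fix p q assume n: "p \<in> carrier UP" "q \<in> carrier UQ"
          show "?l (tp XY PQ (rtensor_act K H X Y ?z (tp A A a b)) (tp UP UQ p q)) =
            ?l (tp XY PQ ?z (ltensor_act K H P Q (tp A A a b) (tp UP UQ p q)))"
            unfolding rtensor_tp[OF m ab] ltensor_tp[OF n ab]
              l_tp[OF bX.ract_closed[OF m(1) ab(1)] n(1) bY.ract_closed[OF m(2) ab(2)] n(2)]
              l_tp[OF m(1) bX.lact_closed[OF n(1) ab(1)] m(2) bY.lact_closed[OF n(2) ab(2)]]
            using bX.\<pi>_balanced bY.\<pi>_balanced m n ab by (simp add: bX.balanced_def bY.balanced_def)
        qed ((rule J z tc | assumption)+)
        with w show "?l (tp XY PQ (rtensor_act K H X Y ?z (tp A A a b)) w) =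
          ?l (tp XY PQ ?z (ltensor_act K H P Q (tp A A a b) w))" by blast
      qed ((rule J z w | assumption)+)
      with t show "?l (tp XY PQ (rtensor_act K H X Y ?z t) w) = ?l (tp XY PQ ?z (ltensor_act K H P Q t w))" by blast
    qed ((rule J t w | assumption)+)
    with z show "?l (tp XY PQ (rtensor_act K H X Y z t) w) = ?l (tp XY PQ z (ltensor_act K H P Q t w))" by blast
  qed
  note lq = fa.the_elem_\<pi>[OF vQQ _ this, unfolded factor_simps, OF ll]
  let ?L = "\<lambda>c. the_elem (?l ` c)"
  have lL: "lin fa.B ?QQ ?L"
    by (rule fa.lin_from_B[OF fa.lin_from_Q[OF vQQ, unfolded factor_simps, OF ll]]) (rule lq)
  have l_sh: "?l (sh u v) = tp bX.Q bY.Q (bX.\<pi> u) (bY.\<pi> v)" if u: "u \<in> carrier bX.T" and v: "v \<in> carrier bY.T" for u v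
  proof -
    have "\<forall>u\<in>carrier bX.T. ?l (sh u v) = tp bX.Q bY.Q (bX.\<pi> u) (bY.\<pi> v)"
    proof (rule tens_ext)
      fix x p assume m: "x \<in> carrier VX" "p \<in> carrier UP"
      have xp: "tp VX UP x p \<in> carrier bX.T" by ((rule J m)+)
      have "\<forall>v\<in>carrier bY.T. ?l (sh (tp VX UP x p) v) = tp bX.Q bY.Q (bX.\<pi> (tp VX UP x p)) (bY.\<pi> v)"
      proof (rule tens_ext)
        fix y q assume n: "y \<in> carrier VY" "q \<in> carrier UQ"
        show "?l (sh (tp VX UP x p) (tp VY UQ y q)) = tp bX.Q bY.Q (bX.\<pi> (tp VX UP x p)) (bY.\<pi> (tp VY UQ y q))"
          unfolding sh_tp[OF m n] by (rule l_tp[OF m n])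
      qed ((rule J xp bY.lin_\<pi> | assumption)+)
      with v show "?l (sh (tp VX UP x p) v) = tp bX.Q bY.Q (bX.\<pi> (tp VX UP x p)) (bY.\<pi> v)" by blast
    qed ((rule J v bX.lin_\<pi> | assumption)+)
    with u show ?thesis by blast
  qed
  have e: "\<forall>w\<in>carrier (bX.B \<boxtimes> bY.B). ?L (kappa K H X Y P Q w) = tm bX.B bY.B bX.Q bY.Q (\<lambda>x. x) (\<lambda>x. x) w"
  proof (rule tens_ext[OF bX.vB bY.vB vQQ])
    show "lin (bX.B \<boxtimes> bY.B) ?QQ (\<lambda>w. ?L (kappa K H X Y P Q w))" by (rule lin_comp[OF lL lin_kappa])
    show "lin (bX.B \<boxtimes> bY.B) ?QQ (\<lambda>w. tm bX.B bY.B bX.Q bY.Q (\<lambda>x. x) (\<lambda>x. x) w)"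
      by (rule lin_tm[OF bX.vB bY.vB bX.vQ bY.vQ bX.lin_incl bY.lin_incl lin_id])
    fix b c assume bc: "b \<in> carrier bX.B" "c \<in> carrier bY.B"
    obtain u v where u: "b = bX.\<pi> u" "u \<in> carrier bX.T" and v: "c = bY.\<pi> v" "v \<in> carrier bY.T"
      using bc bX.cot_closed bY.cot_closed unfolding bX.carrier_Bit bY.carrier_Bit by blast
    have "kappa K H X Y P Q (tp bX.B bY.B b c) = fa.\<pi> (sh u v)"
      unfolding kappa_eq using tl_tp[OF bX.vB bY.vB fa.vB bil_k0 bc] k0_\<pi>[OF u(2) v(2)] u v by simp
    then have "?L (kappa K H X Y P Q (tp bX.B bY.B b c)) = tp bX.Q bY.Q b c"
      using lq[OF bilD(3)[OF bil_sh u(2) v(2)]] l_sh[OF u(2) v(2)] u v by simp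
    then show "?L (kappa K H X Y P Q (tp bX.B bY.B b c)) = tm bX.B bY.B bX.Q bY.Q (\<lambda>x. x) (\<lambda>x. x) (tp bX.B bY.B b c)"
      using tm_tp[OF bX.vB bY.vB bX.vQ bY.vQ bX.lin_incl bY.lin_incl bc] by simp
  qed
  have i: "inj_on (tm bX.B bY.B bX.Q bY.Q (\<lambda>x. x) (\<lambda>x. x)) (carrier (bX.B \<boxtimes> bY.B))"
    by (rule tm_inj[OF bX.vB bY.vB bX.vQ bY.vQ bX.lin_incl bY.lin_incl]) simp_all
  show ?thesis
  proof (rule inj_onI)
    fix s t assume s: "s \<in> carrier (bX.B \<boxtimes> bY.B)" and t: "t \<in> carrier (bX.B \<boxtimes> bY.B)"
      and k: "kappa K H X Y P Q s = kappa K H X Y P Q t"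
    have "tm bX.B bY.B bX.Q bY.Q (\<lambda>x. x) (\<lambda>x. x) s = tm bX.B bY.B bX.Q bY.Q (\<lambda>x. x) (\<lambda>x. x) t"
      unfolding bspec[OF e s, symmetric] bspec[OF e t, symmetric] k ..
    then show "s = t" by (rule inj_onD[OF i _ s t])
  qed
qed

theorem kappa_embedding: "linear_embedding K (bX.B \<boxtimes> bY.B) (Aux K H X Y P Q) (kappa K H X Y P Q)"
  unfolding linear_embedding_def linear_map_iff Aux_eq
  using vsp_tensor[OF bX.vB bY.vB] fa.vB lin_kappa inj_kappa by blast

lemma cot_diag: "dg.cot = fa.cot"
  unfolding cotensor_def by (simp only: factor_simps)

text \<open>A relation for a in the diagonal structure is the relation for the element \<Delta>(a)
  of H \<otimes> H in the factorwise structure.\<close>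

lemma nu_\<pi>: "z \<in> carrier TT \<Longrightarrow> nu K H X Y P Q (dg.\<pi> z) = fa.\<pi> z"
proof -
  assume z: "z \<in> carrier TT"
  have b: "dg.balanced fa.Q fa.\<pi>"
    unfolding dg.balanced_def factor_simps
    using fa.\<pi>_balanced lin_closed[OF lin_\<Delta>] unfolding fa.balanced_def factor_simps by blast
  show ?thesis unfolding nu_def Aux_proj_eq
    by (rule dg.the_elem_\<pi>[OF fa.vQ _ b, unfolded factor_simps, OF lin_fa\<pi> z])
qed

theorem nu_projection:
  "linear_projection K dg.B (Aux K H X Y P Q) (nu K H X Y P Q)"
proof -
  have T: "z \<in> carrier TT" if "z \<in> fa.cot" for z using fa.cot_closed[OF that] by (simp add: factor_simps)
  have im: "nu K H X Y P Q ` carrier dg.B = carrier fa.B"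
    unfolding dg.carrier_Bit fa.carrier_Bit cot_diag image_image
    by (rule image_cong[OF refl]) (rule nu_\<pi>[OF T])
  have "lin dg.Q fa.Q (nu K H X Y P Q)"
    by (rule dg.lin_from_Q[OF fa.vQ, unfolded factor_simps, OF lin_fa\<pi> nu_\<pi>])
  then have "lin dg.B fa.B (nu K H X Y P Q)"
    by (rule fa.lin_to_B[OF dg.lin_from_B]) (use im in blast)
  then show ?thesis
    unfolding linear_projection_def linear_map_iff Aux_eq using dg.vB fa.vB im by blast
qed

end

section \<open>Splitting\<close>

lemma (in kitaev) base_lmc_structure:
  assumes X: "\<And>c. c \<in> cilia G \<Longrightarrow> right_modcomod K H (X c)"
  defines "P \<equiv> base_lmc K H M G X"
  shows "vsp (lvs P)" "bil A (lvs P) (lvs P) (\<lambda>a p. lact P a p)"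
    "p \<in> carrier (lvs P) \<Longrightarrow> lact P uA p = p" "lin (lvs P) (A \<boxtimes> lvs P) (lcoact P)"
proof -
  interpret I: bit_inherit K "cilia_hopf K H (rest G)" "cilia_hopf K H (rest G)"
    "coeff_rmc K H (rest G) X" "graph_lmc K H M G (rest G)" H "NC (base G)"
    by (rule base_inherit[OF X])
  show "vsp (lvs P)" "bil A (lvs P) (lvs P) (\<lambda>a p. lact P a p)"
    "p \<in> carrier (lvs P) \<Longrightarrow> lact P uA p = p" "lin (lvs P) (A \<boxtimes> lvs P) (lcoact P)"
    unfolding P_def base_lmc_def I.BH_simps(1) by (rule I.vB I.bil_BH I.BH_one I.lin_BH, assumption?)+
qed

section \<open>Splitting of exact sequences of vector spaces\<close>

context base_field begin

lemma vs_add_diff: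
  assumes "vsp V" "x \<in> carrier V" "y \<in> carrier V"
  shows "x \<oplus>\<^bsub>V\<^esub> (y \<ominus>\<^bsub>V\<^esub> x) = y" "(x \<oplus>\<^bsub>V\<^esub> y) \<ominus>\<^bsub>V\<^esub> x = y"
proof -
  interpret V: vectorspace K V by fact
  show "x \<oplus>\<^bsub>V\<^esub> (y \<ominus>\<^bsub>V\<^esub> x) = y" "(x \<oplus>\<^bsub>V\<^esub> y) \<ominus>\<^bsub>V\<^esub> x = y"
    using assms by (simp_all add: a_minus_def V.a_comm[of y] V.a_comm[of "x \<oplus>\<^bsub>V\<^esub> y"] V.r_neg2 V.r_neg1)
qed

lemma lin_injI:
  assumes V: "vsp V" and W: "vsp W" and f: "lin V W f"
    and z: "\<And>v. v \<in> carrier V \<Longrightarrow> f v = \<zero>\<^bsub>W\<^esub> \<Longrightarrow> v = \<zero>\<^bsub>V\<^esub>"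
  shows "inj_on f (carrier V)"
proof (rule inj_onI)
  fix x y assume xy: "x \<in> carrier V" "y \<in> carrier V" "f x = f y"
  have "f (x \<ominus>\<^bsub>V\<^esub> y) = \<zero>\<^bsub>W\<^esub>"
    using lin_minus[OF V W f xy(1,2)] vs_minus_zero_iff[OF W lin_closed[OF f xy(1)] lin_closed[OF f xy(2)]] xy(3) by simp
  then show "x = y" using z[of "x \<ominus>\<^bsub>V\<^esub> y"] vs_minus_zero_iff[OF V xy(1,2)] V xy by simp
qed

lemma direct_sum_simps:
  "carrier (direct_sum X Y) = carrier X \<times> carrier Y" "\<zero>\<^bsub>direct_sum X Y\<^esub> = (\<zero>\<^bsub>X\<^esub>, \<zero>\<^bsub>Y\<^esub>)"
  by (simp_all add: direct_sum_def)

lemma lin_pair: "lin V X f \<Longrightarrow> lin V Y g \<Longrightarrow> lin V (direct_sum X Y) (\<lambda>v. (f v, g v))"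
  by (auto simp: lin_def direct_sum_def)

context
  fixes U :: "('k, 'u) module" and V :: "('k, 'v) module" and W :: "('k, 'w) module"
    and k :: "'u \<Rightarrow> 'w" and n :: "'v \<Rightarrow> 'w"
  assumes k: "linear_embedding K U W k" and n: "linear_projection K V W n"
begin

private lemma kn: "vsp U" "vsp V" "vsp W" "lin U W k" "inj_on k (carrier U)" "lin V W n" "n ` carrier V = carrier W"
  using k n by (auto simp: linear_embedding_def linear_projection_def linear_map_iff)

private abbreviation "I \<equiv> k ` carrier U"
private abbreviation "cls a \<equiv> I +>\<^bsub>W\<^esub> a"
private abbreviation "CK \<equiv> coker_space U W k"
private abbreviation "KN \<equiv> ker_space V W n"
private abbreviation "CB \<equiv> direct_sum KN CK"

private lemma I: "submodule K I W"
  by (rule submodule_image[OF kn(1,3,4) submodule_carrier[OF kn(1)]])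

private lemma vCK: "vsp CK" and lin_cls: "lin W CK (\<lambda>a. cls a)" and carrier_CK: "carrier CK = (\<lambda>a. cls a) ` carrier W"
    and zero_CK: "\<zero>\<^bsub>CK\<^esub> = I"
  unfolding coker_space_def
  by (rule vs_quot[OF kn(3) I], rule lin_quot[OF kn(3) I], rule carrier_quot, rule zero_quot)

private lemma vKN: "vsp KN" and carrier_KN: "carrier KN = {v \<in> carrier V. n v = \<zero>\<^bsub>W\<^esub>}" and zero_KN: "\<zero>\<^bsub>KN\<^esub> = \<zero>\<^bsub>V\<^esub>"
  unfolding ker_space_def by (rule vs_sub[OF kn(2) submodule_kernel[OF kn(2,3,6)]]) simp_all

private lemma vCB: "vsp CB"
  by (rule direct_sum_is_vs[OF vKN vCK])

private lemma lin_to_KN: "lin Y V f \<Longrightarrow> (\<And>y. y \<in> carrier Y \<Longrightarrow> n (f y) = \<zero>\<^bsub>W\<^esub>) \<Longrightarrow> lin Y KN f"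
  by (auto simp: lin_def ker_space_def)

context
  fixes s assumes s: "linear_section K V W n s"
begin

private lemma sd: "lin W V s" "w \<in> carrier W \<Longrightarrow> n (s w) = w"
  using s by (auto simp: linear_section_def linear_map_iff)

private abbreviation "g \<equiv> \<lambda>w. (w \<ominus>\<^bsub>V\<^esub> s (n w), cls (n w))"

private lemma closed: "w \<in> carrier V \<Longrightarrow> n w \<in> carrier W" "w \<in> carrier V \<Longrightarrow> s (n w) \<in> carrier V" "a \<in> carrier W \<Longrightarrow> s a \<in> carrier V"
  using lin_closed[OF kn(6)] lin_closed[OF sd(1)] by auto

private lemma lin_g: "lin V CB g"
proof (rule lin_pair)
  show "lin V KN (\<lambda>w. w \<ominus>\<^bsub>V\<^esub> s (n w))"
  proof (rule lin_to_KN)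
    show "lin V V (\<lambda>w. w \<ominus>\<^bsub>V\<^esub> s (n w))" by (rule lin_diff[OF kn(2,2) lin_id lin_comp[OF sd(1) kn(6)]])
    fix w assume w: "w \<in> carrier V"
    show "n (w \<ominus>\<^bsub>V\<^esub> s (n w)) = \<zero>\<^bsub>W\<^esub>"
      unfolding lin_minus[OF kn(2,3,6) w closed(2)[OF w]] sd(2)[OF closed(1)[OF w]]
      using vs_minus_zero_iff[OF kn(3) closed(1)[OF w] closed(1)[OF w]] by simp
  qed
  show "lin V CK (\<lambda>w. cls (n w))" by (rule lin_comp[OF lin_cls kn(6)])
qed

text \<open>The section contributes the value under n, and v the part in the kernel. This supplies
  the preimages for the surjectivity of g and of the isomorphism in
  \<open>split_iso\<close>.\<close>

private lemma g_lift:
  assumes v: "v \<in> carrier KN" and a: "a \<in> carrier W"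
  shows "n (s a \<oplus>\<^bsub>V\<^esub> v) = a" "g (s a \<oplus>\<^bsub>V\<^esub> v) = (v, cls a)"
proof -
  have vV: "v \<in> carrier V" "n v = \<zero>\<^bsub>W\<^esub>" using v by (simp_all add: carrier_KN)
  interpret W: vectorspace K W by (rule kn(3))
  show 1: "n (s a \<oplus>\<^bsub>V\<^esub> v) = a" using lin_add[OF kn(6) closed(3)[OF a] vV(1)] sd(2)[OF a] vV(2) a by simp
  show "g (s a \<oplus>\<^bsub>V\<^esub> v) = (v, cls a)" unfolding 1 vs_add_diff(2)[OF kn(2) closed(3)[OF a] vV(1)] ..
qed

private lemma g_zero: "w \<in> carrier V \<Longrightarrow> g w = \<zero>\<^bsub>CB\<^esub> \<longleftrightarrow> w = s (n w) \<and> n w \<in> I"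
  using vs_minus_zero_iff[OF kn(2) _ closed(2), of w w] coset_eq_U[OF kn(3) I closed(1), of w]
  by (simp add: direct_sum_simps zero_KN zero_CK)

text \<open>By \<open>g_zero\<close> the kernel of g consists of the w with w = s (n w) and n w in
  the image of k, which is the image of s k. Injectivity of s k follows from n s = id and that of
  k.\<close>

lemma short_exact_section:
  "short_exact K U V CB (s \<circ> k) g"
  "t \<in> carrier U \<Longrightarrow> n ((s \<circ> k) t) = k t"
  "w \<in> carrier KN \<Longrightarrow> g w = (w, \<zero>\<^bsub>CK\<^esub>)"
proof -
  show nf: "n ((s \<circ> k) t) = k t" if "t \<in> carrier U" for t using sd(2)[OF lin_closed[OF kn(4) that]] by simp
  have f: "lin U V (s \<circ> k)" using lin_comp[OF sd(1) kn(4)] by (simp only: comp_def)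
  have "inj_on (s \<circ> k) (carrier U)"
  proof (rule inj_onI)
    fix x y assume xy: "x \<in> carrier U" "y \<in> carrier U" "(s \<circ> k) x = (s \<circ> k) y"
    then have "k x = k y" using nf[OF xy(1)] nf[OF xy(2)] by simp
    then show "x = y" using inj_onD[OF kn(5)] xy by blast
  qed
  then have 1: "linear_embedding K U V (s \<circ> k)" using f kn by (simp add: linear_embedding_def linear_map_iff)
  have "g ` carrier V = carrier CB"
  proof
    show "g ` carrier V \<subseteq> carrier CB" using lin_closed[OF lin_g] by blast
    show "carrier CB \<subseteq> g ` carrier V"
    proof
      fix p assume "p \<in> carrier CB"
      then obtain v a where p: "p = (v, cls a)" "v \<in> carrier KN" "a \<in> carrier W"
        by (auto simp: direct_sum_simps carrier_CK)
      have "s a \<oplus>\<^bsub>V\<^esub> v \<in> carrier V" using closed(3)[OF p(3)] p(2) kn(2) by (simp add: carrier_KN)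
      then show "p \<in> g ` carrier V" using g_lift(2)[OF p(2,3)] p(1) by (metis (no_types, lifting) image_eqI)
    qed
  qed
  then have 2: "linear_projection K V CB g" using lin_g kn(2) vCB by (simp add: linear_projection_def linear_map_iff)
  have "(s \<circ> k) ` carrier U = {v \<in> carrier V. g v = \<zero>\<^bsub>CB\<^esub>}"
  proof
    show "(s \<circ> k) ` carrier U \<subseteq> {v \<in> carrier V. g v = \<zero>\<^bsub>CB\<^esub>}"
    proof
      fix v assume "v \<in> (s \<circ> k) ` carrier U"
      then obtain t where t: "t \<in> carrier U" "v = (s \<circ> k) t" by blast
      then have v: "v \<in> carrier V" "n v = k t" using lin_closed[OF f] nf by auto
      then show "v \<in> {v \<in> carrier V. g v = \<zero>\<^bsub>CB\<^esub>}" unfolding mem_Collect_eq g_zero[OF v(1)] using t by simp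
    qed
    show "{v \<in> carrier V. g v = \<zero>\<^bsub>CB\<^esub>} \<subseteq> (s \<circ> k) ` carrier U"
    proof
      fix v assume "v \<in> {v \<in> carrier V. g v = \<zero>\<^bsub>CB\<^esub>}"
      then have "v \<in> carrier V" "g v = \<zero>\<^bsub>CB\<^esub>" by blast+
      then have "v = s (n v)" "n v \<in> I" using g_zero by blast+
      then obtain t where "t \<in> carrier U" "v = s (k t)" by force
      then show "v \<in> (s \<circ> k) ` carrier U" by simp
    qed
  qed
  with 1 2 show "short_exact K U V CB (s \<circ> k) g" by (simp only: short_exact_def)
  show "g w = (w, \<zero>\<^bsub>CK\<^esub>)" if "w \<in> carrier KN" for w
  proof -
    have w: "w \<in> carrier V" "n w = \<zero>\<^bsub>W\<^esub>" using that by (simp_all add: carrier_KN)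
    show ?thesis unfolding w(2) lin_zero[OF kn(3,2) sd(1)] vs_minus_zero[OF kn(2) w(1)] coset_zero[OF I] zero_CK ..
  qed
qed

text \<open>The section s splits V into the kernel of n and a copy of W; a retraction r of k splits
  W into a copy of U and the cokernel. The isomorphism combines the two, its first component being r
  n.\<close>

lemma split_iso:
  shows "\<exists>\<phi>. linear_iso K V (direct_sum U CB) \<phi>"
proof -
  obtain r where r: "lin W U r" and kr: "\<And>v. v \<in> carrier U \<Longrightarrow> k (r (k v)) = k v"
    by (rule generalised_inverse[OF kn(1,3,4)]) (rule that)
  have rk: "r (k v) = v" if v: "v \<in> carrier U" for v
    by (rule inj_onD[OF kn(5) kr[OF v] lin_closed[OF r lin_closed[OF kn(4) v]] v])
  let ?\<phi> = "\<lambda>w. (r (n w), g w)"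
  note vS = direct_sum_is_vs[OF kn(1) vCB]
  have l: "lin V (direct_sum U CB) ?\<phi>" by (rule lin_pair[OF lin_comp[OF r kn(6)] lin_g])
  have "inj_on ?\<phi> (carrier V)"
  proof (rule lin_injI[OF kn(2) vS l])
    fix w assume w: "w \<in> carrier V" "?\<phi> w = \<zero>\<^bsub>direct_sum U CB\<^esub>"
    then have "r (n w) = \<zero>\<^bsub>U\<^esub>" "g w = \<zero>\<^bsub>CB\<^esub>" by (simp_all only: direct_sum_simps prod.inject)
    then have e: "r (n w) = \<zero>\<^bsub>U\<^esub>" "w = s (n w)" "n w \<in> I" using g_zero[OF w(1)] by blast+
    then have "n w = k \<zero>\<^bsub>U\<^esub>" using rk by force
    then have "n w = \<zero>\<^bsub>W\<^esub>" using lin_zero[OF kn(1,3,4)] by simp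
    then show "w = \<zero>\<^bsub>V\<^esub>" using e(2) lin_zero[OF kn(3,2) sd(1)] by metis
  qed
  moreover have "?\<phi> ` carrier V = carrier (direct_sum U CB)"
  proof
    show "?\<phi> ` carrier V \<subseteq> carrier (direct_sum U CB)" using lin_closed[OF l] by blast
    show "carrier (direct_sum U CB) \<subseteq> ?\<phi> ` carrier V"
    proof
      fix p assume "p \<in> carrier (direct_sum U CB)"
      then obtain u v a where p: "p = (u, v, cls a)" "u \<in> carrier U" "v \<in> carrier KN" "a \<in> carrier W"
        by (auto simp: direct_sum_simps carrier_CK)
      \<comment> \<open>Adding \<open>k ?c\<close> to a does not change the class of a and corrects
        the value of r from \<open>r a\<close> to u.\<close>
      let ?c = "u \<ominus>\<^bsub>U\<^esub> r a"
      have c: "r a \<in> carrier U" "?c \<in> carrier U" using lin_closed[OF r p(4)] p(2) kn(1) by auto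
      note kc = lin_closed[OF kn(4) c(2)]
      let ?a = "a \<oplus>\<^bsub>W\<^esub> k ?c"
      have a: "?a \<in> carrier W" using p(4) kc kn(3) by simp
      have ra: "r ?a = u" using lin_add[OF r p(4) kc] rk[OF c(2)] vs_add_diff(1)[OF kn(1) c(1) p(2)] by simp
      have ca: "cls ?a = cls a"
        by (rule coset_eqI[OF I a p(4)]) (use vs_add_diff(2)[OF kn(3) p(4) kc] c(2) in simp)
      have "s ?a \<oplus>\<^bsub>V\<^esub> v \<in> carrier V" using closed(3)[OF a] p(3) kn(2) by (simp add: carrier_KN)
      moreover have "?\<phi> (s ?a \<oplus>\<^bsub>V\<^esub> v) = p"
        unfolding g_lift(2)[OF p(3) a] unfolding g_lift(1)[OF p(3) a] ra ca p(1) ..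
      ultimately show "p \<in> ?\<phi> ` carrier V" by (metis (no_types, lifting) image_eqI)
    qed
  qed
  ultimately have "linear_iso K V (direct_sum U CB) ?\<phi>"
    using l kn(2) vS by (simp add: linear_iso_def linear_map_iff bij_betw_def)
  then show ?thesis by blast
qed

end

text \<open>For a surjective map a generalised inverse is a section. It is needed because the
  isomorphism is claimed without reference to a given section.\<close>

lemma section_exists: "\<exists>s. linear_section K V W n s"
proof -
  obtain s where s: "lin W V s" and ns: "\<And>v. v \<in> carrier V \<Longrightarrow> n (s (n v)) = n v"
    by (rule generalised_inverse[OF kn(2,3,6)]) (rule that)
  have "n (s w) = w" if w: "w \<in> carrier W" for w
  proof -
    have "w \<in> n ` carrier V" unfolding kn(7) by (rule w)
    then obtain v where v: "v \<in> carrier V" "w = n v" by blast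
    show ?thesis unfolding v(2) by (rule ns[OF v(1)])
  qed
  with s kn(2,3) show ?thesis by (auto simp: linear_section_def linear_map_iff)
qed

lemma exact_split:
  "(\<forall>s. linear_section K V W n s \<longrightarrow>
     short_exact K U V CB (s \<circ> k) (\<lambda>w. (w \<ominus>\<^bsub>V\<^esub> s (n w), cls (n w))) \<and>
     (\<forall>t\<in>carrier U. n ((s \<circ> k) t) = k t) \<and>
     (\<forall>w\<in>carrier KN. (w \<ominus>\<^bsub>V\<^esub> s (n w), cls (n w)) = (w, \<zero>\<^bsub>CK\<^esub>)) \<and>
     (\<forall>w\<in>carrier V. snd (w \<ominus>\<^bsub>V\<^esub> s (n w), cls (n w)) = cls (n w))) \<and>
   (\<exists>\<phi>. linear_iso K V (direct_sum U CB) \<phi>)"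
proof (intro conjI allI impI ballI)
  fix s assume s: "linear_section K V W n s"
  note e = short_exact_section[OF s]
  show "short_exact K U V CB (s \<circ> k) (\<lambda>w. (w \<ominus>\<^bsub>V\<^esub> s (n w), cls (n w)))" by (rule e)
  show "n ((s \<circ> k) t) = k t" if "t \<in> carrier U" for t by (rule e(2)[OF that])
  show "(w \<ominus>\<^bsub>V\<^esub> s (n w), cls (n w)) = (w, \<zero>\<^bsub>CK\<^esub>)" if "w \<in> carrier KN" for w by (rule e(3)[OF that])
  show "snd (w \<ominus>\<^bsub>V\<^esub> s (n w), cls (n w)) = cls (n w)" for w by simp
next
  obtain s where "linear_section K V W n s" using section_exists by blast
  then show "\<exists>\<phi>. linear_iso K V (direct_sum U CB) \<phi>" by (rule split_iso)
qed

end

lemma linear_embedding_tensor_iso: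
  assumes k: "linear_embedding K (C \<boxtimes> D) W k" and f: "linear_iso K A C f" and g: "linear_iso K B D g"
  shows "linear_embedding K (A \<boxtimes> B) W (k \<circ> tm A B C D f g)"
proof -
  have v: "vsp A" "vsp B" "vsp C" "vsp D" "vsp W" and l: "lin A C f" "lin B D g" "lin (C \<boxtimes> D) W k"
    and i: "inj_on f (carrier A)" "inj_on g (carrier B)" "inj_on k (carrier (C \<boxtimes> D))"
    using assms by (auto simp: linear_embedding_def linear_iso_def linear_map_iff bij_betw_def)
  note t = lin_tm[OF v(1-4) l(1,2) lin_id]
  have "tm A B C D f g ` carrier (A \<boxtimes> B) \<subseteq> carrier (C \<boxtimes> D)" using lin_closed[OF t] by blast
  then have "inj_on (k \<circ> tm A B C D f g) (carrier (A \<boxtimes> B))"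
    by (intro comp_inj_on tm_inj[OF v(1-4) l(1,2) i(1,2)] inj_on_subset[OF i(3)])
  moreover have "lin (A \<boxtimes> B) W (k \<circ> tm A B C D f g)" using lin_comp[OF l(3) t] by (simp only: comp_def)
  ultimately show ?thesis
    using v vsp_tensor[OF v(1,2)] by (simp add: linear_embedding_def linear_map_iff)
qed

lemma linear_projection_iso:
  assumes n: "linear_projection K V W n" and f: "linear_iso K U V f"
  shows "linear_projection K U W (n \<circ> f)"
proof -
  have "lin U W (n \<circ> f)" using n f lin_comp[of V W n U f]
    by (simp add: linear_projection_def linear_iso_def linear_map_iff comp_def)
  moreover have "(n \<circ> f) ` carrier U = n ` (f ` carrier U)" by (simp only: image_comp)
  ultimately show ?thesis using n f
    unfolding linear_projection_def linear_iso_def linear_map_iff bij_betw_def by metis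
qed

end

theorem theorem7p20:
  fixes K :: "'k ring"
    and H :: "('k, 'h) hopf"
    and M :: "('k, 'h, 'm) hopf_bimod"
    and \<Gamma> \<Delta> :: "nat kitaev"
    and X :: "nat \<Rightarrow> ('k, 'h, 'h, 'x) rmc"
    and Y :: "nat \<Rightarrow> ('k, 'h, 'h, 'y) rmc"
  assumes "field K"
    and "hopf_algebra K H"
    and "vectorspace.fin_dim K (halg H)"
    and "involutive_hopf_bimodule K H M"
    and "\<Gamma> \<in> RK" and "\<Delta> \<in> RK"
    and "\<forall>c\<in>cilia \<Gamma>. right_modcomod K H (X c)"
    and "\<forall>d\<in>cilia \<Delta>. right_modcomod K H (Y d)"
  shows
    "let A = halg H; Xb = X (base \<Gamma>); Yb = Y (base \<Delta>);
         P = base_lmc K H M \<Gamma> X; Q = base_lmc K H M \<Delta> Y;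
         BP = Bit K A A Xb P; BQ = Bit K A A Yb Q;
         BPQ = Bit K A A (rdiag K H Xb Yb) (ldiag K H P Q);
         AUX = Aux K H Xb Yb P Q;
         B\<Gamma> = graph_Bit K H M \<Gamma> X; B\<Delta> = graph_Bit K H M \<Delta> Y;
         BB = tensor K B\<Gamma> B\<Delta>; B = sum_Bit K H M \<Gamma> \<Delta> X Y;
         \<kappa> = kappa K H Xb Yb P Q; \<nu> = nu K H Xb Yb P Q
     in linear_embedding K (tensor K BP BQ) AUX \<kappa> \<and>
        linear_projection K BPQ AUX \<nu> \<and>
        (\<forall>\<theta>\<Gamma> \<theta>\<Delta> \<theta>.
           graph_identification K H M \<Gamma> X \<theta>\<Gamma> \<and> graph_identification K H M \<Delta> Y \<theta>\<Delta> \<and>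
           sum_identification K H M \<Gamma> \<Delta> X Y \<theta> \<longrightarrow>
           (let \<kappa>t = \<kappa> \<circ> tensor_map K B\<Gamma> B\<Delta> BP BQ \<theta>\<Gamma> \<theta>\<Delta>;
                \<nu>t = \<nu> \<circ> \<theta>;
                CK = coker_space BB AUX \<kappa>t;
                cls = (\<lambda>a. (\<kappa>t ` carrier BB) +>\<^bsub>AUX\<^esub> a);
                CBit = direct_sum (ker_space B AUX \<nu>t) CK
            in linear_embedding K BB AUX \<kappa>t \<and>
               linear_projection K B AUX \<nu>t \<and>
               (\<forall>s. linear_section K B AUX \<nu>t s \<longrightarrow>
                  (let f = s \<circ> \<kappa>t; g = (\<lambda>w. (w \<ominus>\<^bsub>B\<^esub> s (\<nu>t w), cls (\<nu>t w)))
                   in short_exact K BB B CBit f g \<and>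
                      (\<forall>t\<in>carrier BB. \<nu>t (f t) = \<kappa>t t) \<and>
                      (\<forall>w\<in>carrier (ker_space B AUX \<nu>t). g w = (w, \<zero>\<^bsub>CK\<^esub>)) \<and>
                      (\<forall>w\<in>carrier B. snd (g w) = cls (\<nu>t w)))) \<and>
               (\<exists>\<phi>. linear_iso K B (direct_sum BB CBit) \<phi>)))"
proof -
  interpret bimod K H M
    by (intro bimod.intro hopf.intro base_field.intro hopf_axioms.intro bimod_axioms.intro assms)
  have kg: "kitaev_graph \<Gamma>" "kitaev_graph \<Delta>" using assms(5,6) by (simp_all add: RK_def)
  interpret \<Gamma>: kitaev K H M \<Gamma> by (intro kitaev.intro kitaev_axioms.intro bimod_axioms kg)
  interpret \<Delta>: kitaev K H M \<Delta> by (intro kitaev.intro kitaev_axioms.intro bimod_axioms kg)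
  have X: "\<And>c. c \<in> cilia \<Gamma> \<Longrightarrow> right_modcomod K H (X c)" and Y: "\<And>c. c \<in> cilia \<Delta> \<Longrightarrow> right_modcomod K H (Y c)"
    using assms(7,8) by auto
  let ?P = "base_lmc K H M \<Gamma> X" and ?Q = "base_lmc K H M \<Delta> Y"
  interpret p: module_pair K H "X (base \<Gamma>)" "Y (base \<Delta>)" ?P ?Q
    by (intro module_pair.intro module_pair_axioms.intro hopf_axioms X Y \<Gamma>.base_cilia \<Delta>.base_cilia
        \<Gamma>.base_lmc_structure \<Delta>.base_lmc_structure)
  note k = p.kappa_embedding and n = p.nu_projection
  show ?thesis
    unfolding Let_def
  proof (rule conjI[OF k], rule conjI[OF n], intro allI impI, goal_cases)
    case (1 \<theta>\<Gamma> \<theta>\<Delta> \<theta>)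
    then have i1: "linear_iso K (graph_Bit K H M \<Gamma> X) p.bX.B \<theta>\<Gamma>" and i2: "linear_iso K (graph_Bit K H M \<Delta> Y) p.bY.B \<theta>\<Delta>"
      and i3: "linear_iso K (sum_Bit K H M \<Gamma> \<Delta> X Y) p.dg.B \<theta>"
      unfolding graph_identification_def sum_identification_def Let_def by blast+
    \<comment> \<open>The permutation isomorphisms turn \<kappa> and \<nu> into maps between the
      spaces attached to the graphs. An embedding and a projection stay such under composition with
      isomorphisms, so the splitting applies to the composites directly.\<close>
    note kt = linear_embedding_tensor_iso[OF k i1 i2] and nt = linear_projection_iso[OF n i3]
    show ?case by (rule conjI[OF kt conjI[OF nt exact_split[OF kt nt]]])
  qed
qed

end
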